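(* Let $\mathcal T$ be a nondegenerate Grothendieck topos with terminal object $1$ and its epi--mono factorization system. Equip $\mathbf{Set}$ with the surjection--injection system. Define the constant-object functor $\Delta:\mathbf{Set}\to\mathcal T$ by $\Delta(X)=\coprod_{x\in X}1$ and $\Delta(f)i_x=i_{f(x)}$ for a function $f:X\to Y$, where the $i_x$ are coproduct injections. Then $\Delta$ is a transfer functor, and $\mathcal T$ is a universal target.
   Context: Nondegenerate means $0\not\cong1$ in $\mathcal T$. "Universal target": a category $\mathcal D$ with a specified proper factorization system $(\mathcal E_{\mathcal D},\mathcal M_{\mathcal D})$, pullbacks of two $\mathcal M_{\mathcal D}$-morphisms and pushouts of two $\mathcal E_{\mathcal D}$-morphisms, such that for every category $\mathcal C$ with a proper factorization system $(\mathcal E,\mathcal M)$, pullbacks of two $\mathcal M$-morphisms with common codomain and pushouts of two $\mathcal E$-morphisms with common domain, $\mathcal C$ has a noetherian form inducing $(\mathcal E,\mathcal M)$ if and only if there is a transfer functor $\mathcal C\to\mathcal D$. Conventions: categories are locally small; "set" is relative to a fixed universe. A conservative functor is one that reflects isomorphisms. A proper factorization system $(\mathcal E,\mathcal M)$ is an orthogonal factorization system with every morphism in $\mathcal E$ an epimorphism and every morphism in $\mathcal M$ a monomorphism. Transfer functors. Let $\mathcal C,\mathcal D$ have specified proper factorization systems $(\mathcal E_{\mathcal C},\mathcal M_{\mathcal C})$, $(\mathcal E_{\mathcal D},\mathcal M_{\mathcal D})$, and suppose both have pullbacks of two right-class morphisms with common codomain and pushouts of two left-class morphisms with common domain. A transfer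 functor $T:\mathcal C\to\mathcal D$ is a conservative functor with $T(\mathcal E_{\mathcal C})\subseteq\mathcal E_{\mathcal D}$, $T(\mathcal M_{\mathcal C})\subseteq\mathcal M_{\mathcal D}$, preserving pullbacks of two $\mathcal M_{\mathcal C}$-morphisms and pushouts of two $\mathcal E_{\mathcal C}$-morphisms. Forms. An (orean) form $\mathsf F$ on a category $\mathcal C$ assigns to each object $X$ a set-sized bounded lattice $\mathsf F(X)$ (the fibre over $X$; its elements are called clusters) and to each morphism $f:X\to Y$ monotone maps $f_!:\mathsf F(X)\to\mathsf F(Y)$ and $f^*:\mathsf F(Y)\to\mathsf F(X)$ with $f_!S\le T\iff S\le f^*T$, such that $(gf)_!=g_!f_!$, $(gf)^*=f^*g^*$, and identities act as identities. Put $\operatorname{Im}f=f_!\top_X$ and $\operatorname{Ker}f=f^*\bot_Y$. A cluster in $\mathsf F(X)$ is conormal if it is the image of some morphism of $\mathcal C$ with codomain $X$, and normal if it is the kernel of some morphism of $\mathcal C$ with domain $X$. An embedding of a conormal $S\in\mathsf F(X)$ is a morphism $\iota$ into $X$ with $\operatorname{Im}\iota=S$ such that every morphism $f$ into $X$ with $\operatorname{Im}f\le S$ factors as $f=\iota h$ for a unique $h$. A quotient of a normal $K\in\mathsf F(X)$ is a morphism $\pi$ out of $X$ with $\operatorname{Ker}\pi=K$ such that every morphism $g$ out of $X$ with $K\le\operatorname{Ker}g$ factors as $g=h\pi$ for a unique $h$. The form is noetherian if: (N1) $f^*f_!S=S\vee\operatorname{Ker}f$ and $f_!f^*T=T\wedge\operatorname{Im}f$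 for all $f,S,T$; (N2) every morphism $f$ factors as $f=me$ with $e$ a quotient of $\operatorname{Ker}f$ and $m$ an embedding of $\operatorname{Im}f$; (N3) the join of two normal clusters (in the same fibre) is normal, and the meet of two conormal clusters is conormal. For a noetherian form, the class $\mathcal E$ of all quotients (of normal clusters) and the class $\mathcal M$ of all embeddings (of conormal clusters) form a proper factorization system, the one induced by the form. *)

theory Defs
  imports "HOL-Library.FuncSet" "HOL-Library.Equipollence" "HOL-Algebra.Lattice"
begin

section \<open>The universe of small sets\<close>

text \<open>
  The fixed universe is a type \<open>'u\<close>, every element \<open>a\<close> of which codes the small set
  \<open>U a :: 'u set\<close> of its elements. The closure conditions are those of a Grothendieck
  universe containing an infinite set.
\<close>

definition grothendieck_universe :: "('u \<Rightarrow> 'u set) \<Rightarrow> bool" where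
  "grothendieck_universe U \<longleftrightarrow>
     inj U \<and>
     wf {(x, y). x \<in> U y} \<and>
     (\<forall>x y. {x, y} \<in> range U) \<and>
     (\<forall>a. (\<Union>x\<in>U a. U x) \<in> range U) \<and>
     (\<forall>a. {x. U x \<subseteq> U a} \<in> range U) \<and>
     (\<forall>a (f :: 'u \<Rightarrow> 'u). f ` U a \<in> range U) \<and>
     (\<exists>a. infinite (U a))"

definition small :: "('u \<Rightarrow> 'u set) \<Rightarrow> 'a set \<Rightarrow> bool" where
  "small U A \<longleftrightarrow> (\<exists>a. A \<approx> U a)"


section \<open>Categories\<close>

record ('o, 'm) cat =
  ob :: "'o set"
  ar :: "'m set"
  src :: "'m \<Rightarrow> 'o"
  tgt :: "'m \<Rightarrow> 'o"
  ide :: "'o \<Rightarrow> 'm"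
  cmp :: "'m \<Rightarrow> 'm \<Rightarrow> 'm"  (infixl \<open>\<cdot>\<index>\<close> 70)

definition hom :: "('o, 'm) cat \<Rightarrow> 'o \<Rightarrow> 'o \<Rightarrow> 'm set" where
  "hom C X Y = {f \<in> ar C. src C f = X \<and> tgt C f = Y}"

definition category :: "('o, 'm) cat \<Rightarrow> bool" where
  "category C \<longleftrightarrow>
     (\<forall>f\<in>ar C. src C f \<in> ob C \<and> tgt C f \<in> ob C) \<and>
     (\<forall>X\<in>ob C. ide C X \<in> hom C X X) \<and>
     (\<forall>f\<in>ar C. \<forall>g\<in>ar C. src C g = tgt C f \<longrightarrow> g \<cdot>\<^bsub>C\<^esub> f \<in> hom C (src C f) (tgt C g)) \<and>
     (\<forall>f\<in>ar C. f \<cdot>\<^bsub>C\<^esub> ide C (src C f) = f \<and> ide C (tgt C f) \<cdot>\<^bsub>C\<^esub> f = f) \<and>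
     (\<forall>f\<in>ar C. \<forall>g\<in>ar C. \<forall>h\<in>ar C. src C g = tgt C f \<longrightarrow> src C h = tgt C g \<longrightarrow>
        h \<cdot>\<^bsub>C\<^esub> (g \<cdot>\<^bsub>C\<^esub> f) = (h \<cdot>\<^bsub>C\<^esub> g) \<cdot>\<^bsub>C\<^esub> f)"

definition locally_small :: "('u \<Rightarrow> 'u set) \<Rightarrow> ('o, 'm) cat \<Rightarrow> bool" where
  "locally_small U C \<longleftrightarrow> (\<forall>X\<in>ob C. \<forall>Y\<in>ob C. small U (hom C X Y))"

definition op_cat :: "('o, 'm) cat \<Rightarrow> ('o, 'm) cat" where
  "op_cat C = \<lparr>ob = ob C, ar = ar C, src = tgt C, tgt = src C, ide = ide C,
               cmp = (\<lambda>f g. g \<cdot>\<^bsub>C\<^esub> f)\<rparr>"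

definition iso :: "('o, 'm) cat \<Rightarrow> 'm \<Rightarrow> bool" where
  "iso C f \<longleftrightarrow> f \<in> ar C \<and>
     (\<exists>g\<in>hom C (tgt C f) (src C f).
        g \<cdot>\<^bsub>C\<^esub> f = ide C (src C f) \<and> f \<cdot>\<^bsub>C\<^esub> g = ide C (tgt C f))"

definition isomorphic :: "('o, 'm) cat \<Rightarrow> 'o \<Rightarrow> 'o \<Rightarrow> bool" where
  "isomorphic C X Y \<longleftrightarrow> (\<exists>f\<in>hom C X Y. iso C f)"

definition mono_arrows :: "('o, 'm) cat \<Rightarrow> 'm set" where
  "mono_arrows C = {m \<in> ar C. \<forall>f\<in>ar C. \<forall>g\<in>ar C.
     src C f = src C g \<longrightarrow> tgt C f = src C m \<longrightarrow> tgt C g = src C m \<longrightarrow>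
     m \<cdot>\<^bsub>C\<^esub> f = m \<cdot>\<^bsub>C\<^esub> g \<longrightarrow> f = g}"

definition epi_arrows :: "('o, 'm) cat \<Rightarrow> 'm set" where
  "epi_arrows C = {e \<in> ar C. \<forall>f\<in>ar C. \<forall>g\<in>ar C.
     tgt C f = tgt C g \<longrightarrow> src C f = tgt C e \<longrightarrow> src C g = tgt C e \<longrightarrow>
     f \<cdot>\<^bsub>C\<^esub> e = g \<cdot>\<^bsub>C\<^esub> e \<longrightarrow> f = g}"

definition initial :: "('o, 'm) cat \<Rightarrow> 'o \<Rightarrow> bool" where
  "initial C z \<longleftrightarrow> z \<in> ob C \<and> (\<forall>X\<in>ob C. \<exists>!f. f \<in> hom C z X)"

definition terminal :: "('o, 'm) cat \<Rightarrow> 'o \<Rightarrow> bool" where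
  "terminal C t \<longleftrightarrow> t \<in> ob C \<and> (\<forall>X\<in>ob C. \<exists>!f. f \<in> hom C X t)"

definition is_coproduct ::
  "('o, 'm) cat \<Rightarrow> 'i set \<Rightarrow> ('i \<Rightarrow> 'o) \<Rightarrow> 'o \<Rightarrow> ('i \<Rightarrow> 'm) \<Rightarrow> bool" where
  "is_coproduct C I A S \<iota> \<longleftrightarrow>
     S \<in> ob C \<and> (\<forall>x\<in>I. \<iota> x \<in> hom C (A x) S) \<and>
     (\<forall>Y\<in>ob C. \<forall>j. (\<forall>x\<in>I. j x \<in> hom C (A x) Y) \<longrightarrow>
        (\<exists>!h. h \<in> hom C S Y \<and> (\<forall>x\<in>I. h \<cdot>\<^bsub>C\<^esub> \<iota> x = j x)))"

definition is_pullback :: "('o, 'm) cat \<Rightarrow> 'm \<Rightarrow> 'm \<Rightarrow> 'm \<Rightarrow> 'm \<Rightarrow> bool" where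
  "is_pullback C m n p q \<longleftrightarrow>
     m \<in> ar C \<and> n \<in> ar C \<and> p \<in> ar C \<and> q \<in> ar C \<and>
     tgt C m = tgt C n \<and> src C p = src C q \<and> tgt C p = src C m \<and> tgt C q = src C n \<and>
     m \<cdot>\<^bsub>C\<^esub> p = n \<cdot>\<^bsub>C\<^esub> q \<and>
     (\<forall>f\<in>ar C. \<forall>g\<in>ar C.
        src C f = src C g \<longrightarrow> tgt C f = src C m \<longrightarrow> tgt C g = src C n \<longrightarrow>
        m \<cdot>\<^bsub>C\<^esub> f = n \<cdot>\<^bsub>C\<^esub> g \<longrightarrow>
        (\<exists>!h. h \<in> hom C (src C f) (src C p) \<and> p \<cdot>\<^bsub>C\<^esub> h = f \<and> q \<cdot>\<^bsub>C\<^esub> h = g))"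

definition is_pushout :: "('o, 'm) cat \<Rightarrow> 'm \<Rightarrow> 'm \<Rightarrow> 'm \<Rightarrow> 'm \<Rightarrow> bool" where
  "is_pushout C d e p q \<longleftrightarrow>
     d \<in> ar C \<and> e \<in> ar C \<and> p \<in> ar C \<and> q \<in> ar C \<and>
     src C d = src C e \<and> tgt C p = tgt C q \<and> src C p = tgt C d \<and> src C q = tgt C e \<and>
     p \<cdot>\<^bsub>C\<^esub> d = q \<cdot>\<^bsub>C\<^esub> e \<and>
     (\<forall>f\<in>ar C. \<forall>g\<in>ar C.
        tgt C f = tgt C g \<longrightarrow> src C f = tgt C d \<longrightarrow> src C g = tgt C e \<longrightarrow>
        f \<cdot>\<^bsub>C\<^esub> d = g \<cdot>\<^bsub>C\<^esub> e \<longrightarrow>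
        (\<exists>!h. h \<in> hom C (tgt C p) (tgt C f) \<and> h \<cdot>\<^bsub>C\<^esub> p = f \<and> h \<cdot>\<^bsub>C\<^esub> q = g))"


section \<open>Functors and equivalences\<close>

text \<open>Values of functors outside the objects and arrows of the source category are irrelevant.\<close>

record ('o, 'm, 'p, 'n) ftr =
  on_ob :: "'o \<Rightarrow> 'p"
  on_ar :: "'m \<Rightarrow> 'n"

definition is_functor :: "('o, 'm) cat \<Rightarrow> ('p, 'n) cat \<Rightarrow> ('o, 'm, 'p, 'n) ftr \<Rightarrow> bool" where
  "is_functor C D F \<longleftrightarrow>
     (\<forall>X\<in>ob C. on_ob F X \<in> ob D) \<and>
     (\<forall>f\<in>ar C. on_ar F f \<in> hom D (on_ob F (src C f)) (on_ob F (tgt C f))) \<and>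
     (\<forall>X\<in>ob C. on_ar F (ide C X) = ide D (on_ob F X)) \<and>
     (\<forall>f\<in>ar C. \<forall>g\<in>ar C. src C g = tgt C f \<longrightarrow>
        on_ar F (g \<cdot>\<^bsub>C\<^esub> f) = on_ar F g \<cdot>\<^bsub>D\<^esub> on_ar F f)"

definition id_ftr :: "('o, 'm, 'o, 'm) ftr" where
  "id_ftr = \<lparr>on_ob = id, on_ar = id\<rparr>"

definition comp_ftr ::
  "('p, 'n, 'q, 'k) ftr \<Rightarrow> ('o, 'm, 'p, 'n) ftr \<Rightarrow> ('o, 'm, 'q, 'k) ftr" where
  "comp_ftr G F = \<lparr>on_ob = on_ob G \<circ> on_ob F, on_ar = on_ar G \<circ> on_ar F\<rparr>"

definition nat_trans :: "('o, 'm) cat \<Rightarrow> ('p, 'n) cat \<Rightarrow> ('o, 'm, 'p, 'n) ftr \<Rightarrow>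
    ('o, 'm, 'p, 'n) ftr \<Rightarrow> ('o \<Rightarrow> 'n) \<Rightarrow> bool" where
  "nat_trans C D F G \<eta> \<longleftrightarrow>
     (\<forall>X\<in>ob C. \<eta> X \<in> hom D (on_ob F X) (on_ob G X)) \<and>
     (\<forall>f\<in>ar C. \<eta> (tgt C f) \<cdot>\<^bsub>D\<^esub> on_ar F f = on_ar G f \<cdot>\<^bsub>D\<^esub> \<eta> (src C f))"

definition nat_iso :: "('o, 'm) cat \<Rightarrow> ('p, 'n) cat \<Rightarrow> ('o, 'm, 'p, 'n) ftr \<Rightarrow>
    ('o, 'm, 'p, 'n) ftr \<Rightarrow> ('o \<Rightarrow> 'n) \<Rightarrow> bool" where
  "nat_iso C D F G \<eta> \<longleftrightarrow> nat_trans C D F G \<eta> \<and> (\<forall>X\<in>ob C. iso D (\<eta> X))"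

definition equivalent_cats :: "('o, 'm) cat \<Rightarrow> ('p, 'n) cat \<Rightarrow> bool" where
  "equivalent_cats C D \<longleftrightarrow>
     (\<exists>F G \<eta> \<epsilon>. is_functor C D F \<and> is_functor D C G \<and>
        nat_iso C C id_ftr (comp_ftr G F) \<eta> \<and> nat_iso D D (comp_ftr F G) id_ftr \<epsilon>)"

definition conservative :: "('o, 'm) cat \<Rightarrow> ('p, 'n) cat \<Rightarrow> ('o, 'm, 'p, 'n) ftr \<Rightarrow> bool" where
  "conservative C D F \<longleftrightarrow> (\<forall>f\<in>ar C. iso D (on_ar F f) \<longrightarrow> iso C f)"

text \<open>
  Natural transformations are made undefined outside \<open>ob C\<close>, so that arrows of the functor
  category are equal when their components are.
\<close>

definition functor_cat :: "('o, 'm) cat \<Rightarrow> ('p, 'n) cat \<Rightarrow>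
    (('o, 'm, 'p, 'n) ftr,
     ('o, 'm, 'p, 'n) ftr \<times> ('o \<Rightarrow> 'n) \<times> ('o, 'm, 'p, 'n) ftr) cat" where
  "functor_cat C D =
    \<lparr>ob = {F. is_functor C D F},
     ar = {(F, \<eta>, G). is_functor C D F \<and> is_functor C D G \<and> nat_trans C D F G \<eta> \<and>
             \<eta> \<in> extensional (ob C)},
     src = (\<lambda>(F, \<eta>, G). F),
     tgt = (\<lambda>(F, \<eta>, G). G),
     ide = (\<lambda>F. (F, restrict (\<lambda>X. ide D (on_ob F X)) (ob C), F)),
     cmp = (\<lambda>(G, \<theta>, H) (F, \<eta>, G'). (F, restrict (\<lambda>X. \<theta> X \<cdot>\<^bsub>D\<^esub> \<eta> X) (ob C), H))\<rparr>"

definition full_subcat :: "('o, 'm) cat \<Rightarrow> 'o set \<Rightarrow> ('o, 'm) cat" where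
  "full_subcat C A =
     C\<lparr>ob := ob C \<inter> A, ar := {f \<in> ar C. src C f \<in> A \<and> tgt C f \<in> A}\<rparr>"


section \<open>The category of small sets\<close>

text \<open>An arrow is a triple of domain, function (undefined off the domain) and codomain.\<close>

type_synonym 'u fn = "'u \<times> ('u \<Rightarrow> 'u) \<times> 'u"

definition app :: "'u fn \<Rightarrow> 'u \<Rightarrow> 'u" where
  "app = (\<lambda>(X, f, Y). f)"

definition set_cat :: "('u \<Rightarrow> 'u set) \<Rightarrow> ('u, 'u fn) cat" where
  "set_cat U =
    \<lparr>ob = UNIV,
     ar = {(X, f, Y). f \<in> U X \<rightarrow>\<^sub>E U Y},
     src = (\<lambda>(X, f, Y). X),
     tgt = (\<lambda>(X, f, Y). Y),
     ide = (\<lambda>X. (X, restrict (\<lambda>x. x) (U X), X)),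
     cmp = (\<lambda>(Y, g, Z) (X, f, Y'). (X, compose (U X) g f, Z))\<rparr>"

definition surjections :: "('u \<Rightarrow> 'u set) \<Rightarrow> 'u fn set" where
  "surjections U = {f \<in> ar (set_cat U). app f ` U (src (set_cat U) f) = U (tgt (set_cat U) f)}"

definition injections :: "('u \<Rightarrow> 'u set) \<Rightarrow> 'u fn set" where
  "injections U = {f \<in> ar (set_cat U). inj_on (app f) (U (src (set_cat U) f))}"


section \<open>Grothendieck toposes\<close>

definition sieve :: "('o, 'm) cat \<Rightarrow> 'o \<Rightarrow> 'm set \<Rightarrow> bool" where
  "sieve C c R \<longleftrightarrow> R \<subseteq> {f \<in> ar C. tgt C f = c} \<and>
     (\<forall>f\<in>R. \<forall>g\<in>ar C. tgt C g = src C f \<longrightarrow> f \<cdot>\<^bsub>C\<^esub> g \<in> R)"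

definition pull_sieve :: "('o, 'm) cat \<Rightarrow> 'm \<Rightarrow> 'm set \<Rightarrow> 'm set" where
  "pull_sieve C h R = {g \<in> ar C. tgt C g = src C h \<and> h \<cdot>\<^bsub>C\<^esub> g \<in> R}"

definition grothendieck_topology :: "('o, 'm) cat \<Rightarrow> ('o \<Rightarrow> 'm set set) \<Rightarrow> bool" where
  "grothendieck_topology C J \<longleftrightarrow>
     (\<forall>c\<in>ob C. \<forall>R\<in>J c. sieve C c R) \<and>
     (\<forall>c\<in>ob C. {f \<in> ar C. tgt C f = c} \<in> J c) \<and>
     (\<forall>h\<in>ar C. \<forall>R\<in>J (tgt C h). pull_sieve C h R \<in> J (src C h)) \<and>
     (\<forall>c\<in>ob C. \<forall>R\<in>J c. \<forall>Q. sieve C c Q \<longrightarrow>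
        (\<forall>h\<in>R. pull_sieve C h Q \<in> J (src C h)) \<longrightarrow> Q \<in> J c)"

definition is_sheaf :: "('u \<Rightarrow> 'u set) \<Rightarrow> ('o, 'm) cat \<Rightarrow> ('o \<Rightarrow> 'm set set) \<Rightarrow>
    ('o, 'm, 'u, 'u fn) ftr \<Rightarrow> bool" where
  "is_sheaf U C J P \<longleftrightarrow>
     is_functor (op_cat C) (set_cat U) P \<and>
     (\<forall>c\<in>ob C. \<forall>R\<in>J c. \<forall>x.
        (\<forall>f\<in>R. x f \<in> U (on_ob P (src C f))) \<longrightarrow>
        (\<forall>f\<in>R. \<forall>g\<in>ar C. tgt C g = src C f \<longrightarrow> app (on_ar P g) (x f) = x (f \<cdot>\<^bsub>C\<^esub> g)) \<longrightarrow>
        (\<exists>!y. y \<in> U (on_ob P c) \<and> (\<forall>f\<in>R. app (on_ar P f) y = x f)))"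

definition sheaf_cat :: "('u \<Rightarrow> 'u set) \<Rightarrow> ('o, 'm) cat \<Rightarrow> ('o \<Rightarrow> 'm set set) \<Rightarrow>
    (('o, 'm, 'u, 'u fn) ftr,
     ('o, 'm, 'u, 'u fn) ftr \<times> ('o \<Rightarrow> 'u fn) \<times> ('o, 'm, 'u, 'u fn) ftr) cat" where
  "sheaf_cat U C J =
     full_subcat (functor_cat (op_cat C) (set_cat U)) {P. is_sheaf U C J P}"

text \<open>
  Every small category is isomorphic to one whose objects and arrows are elements of \<open>'u\<close>, so
  sites may be taken on that type.
\<close>

definition grothendieck_topos :: "('u \<Rightarrow> 'u set) \<Rightarrow> ('o, 'm) cat \<Rightarrow> bool" where
  "grothendieck_topos U T \<longleftrightarrow> category T \<and>
     (\<exists>(S :: ('u, 'u) cat) J. category S \<and> small U (ob S) \<and> small U (ar S) \<and>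
        grothendieck_topology S J \<and> equivalent_cats T (sheaf_cat U S J))"

definition nondegenerate :: "('o, 'm) cat \<Rightarrow> bool" where
  "nondegenerate T \<longleftrightarrow> (\<forall>z t. initial T z \<longrightarrow> terminal T t \<longrightarrow> \<not> isomorphic T z t)"

definition constant_object_functor :: "('u \<Rightarrow> 'u set) \<Rightarrow> ('o, 'm) cat \<Rightarrow> 'o \<Rightarrow>
    ('u, 'u fn, 'o, 'm) ftr \<Rightarrow> ('u \<Rightarrow> 'u \<Rightarrow> 'm) \<Rightarrow> bool" where
  "constant_object_functor U T one \<Delta> \<iota> \<longleftrightarrow>
     (\<forall>X. is_coproduct T (U X) (\<lambda>x. one) (on_ob \<Delta> X) (\<iota> X)) \<and>
     (\<forall>X Y f. f \<in> hom (set_cat U) X Y \<longrightarrow>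
        on_ar \<Delta> f \<in> hom T (on_ob \<Delta> X) (on_ob \<Delta> Y) \<and>
        (\<forall>x\<in>U X. on_ar \<Delta> f \<cdot>\<^bsub>T\<^esub> \<iota> X x = \<iota> Y (app f x)))"


section \<open>Factorization systems and transfer functors\<close>

definition orthogonal_factorization_system ::
  "('o, 'm) cat \<Rightarrow> 'm set \<Rightarrow> 'm set \<Rightarrow> bool" where
  "orthogonal_factorization_system C E M \<longleftrightarrow>
     E \<subseteq> ar C \<and> M \<subseteq> ar C \<and>
     {f. iso C f} \<subseteq> E \<and> {f. iso C f} \<subseteq> M \<and>
     (\<forall>f\<in>E. \<forall>g\<in>E. src C g = tgt C f \<longrightarrow> g \<cdot>\<^bsub>C\<^esub> f \<in> E) \<and>
     (\<forall>f\<in>M. \<forall>g\<in>M. src C g = tgt C f \<longrightarrow> g \<cdot>\<^bsub>C\<^esub> f \<in> M) \<and>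
     (\<forall>f\<in>ar C. \<exists>e\<in>E. \<exists>m\<in>M. src C m = tgt C e \<and> f = m \<cdot>\<^bsub>C\<^esub> e) \<and>
     (\<forall>e\<in>E. \<forall>m\<in>M. \<forall>u\<in>hom C (src C e) (src C m). \<forall>v\<in>hom C (tgt C e) (tgt C m).
        m \<cdot>\<^bsub>C\<^esub> u = v \<cdot>\<^bsub>C\<^esub> e \<longrightarrow>
        (\<exists>!d. d \<in> hom C (tgt C e) (src C m) \<and> d \<cdot>\<^bsub>C\<^esub> e = u \<and> m \<cdot>\<^bsub>C\<^esub> d = v))"

definition proper_factorization_system ::
  "('o, 'm) cat \<Rightarrow> 'm set \<Rightarrow> 'm set \<Rightarrow> bool" where
  "proper_factorization_system C E M \<longleftrightarrow>
     orthogonal_factorization_system C E M \<and> E \<subseteq> epi_arrows C \<and> M \<subseteq> mono_arrows C"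

definition transfer_setting ::
  "('u \<Rightarrow> 'u set) \<Rightarrow> ('o, 'm) cat \<Rightarrow> 'm set \<Rightarrow> 'm set \<Rightarrow> bool" where
  "transfer_setting U C E M \<longleftrightarrow>
     category C \<and> locally_small U C \<and> proper_factorization_system C E M \<and>
     (\<forall>m\<in>M. \<forall>n\<in>M. tgt C m = tgt C n \<longrightarrow> (\<exists>p q. is_pullback C m n p q)) \<and>
     (\<forall>d\<in>E. \<forall>e\<in>E. src C d = src C e \<longrightarrow> (\<exists>p q. is_pushout C d e p q))"

definition transfer_functor ::
  "('u \<Rightarrow> 'u set) \<Rightarrow> ('o, 'm) cat \<Rightarrow> 'm set \<Rightarrow> 'm set \<Rightarrow>
   ('p, 'n) cat \<Rightarrow> 'n set \<Rightarrow> 'n set \<Rightarrow> ('o, 'm, 'p, 'n) ftr \<Rightarrow> bool" where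
  "transfer_functor U C E M D E' M' F \<longleftrightarrow>
     transfer_setting U C E M \<and> transfer_setting U D E' M' \<and>
     is_functor C D F \<and> conservative C D F \<and>
     on_ar F ` E \<subseteq> E' \<and> on_ar F ` M \<subseteq> M' \<and>
     (\<forall>m\<in>M. \<forall>n\<in>M. \<forall>p q. is_pullback C m n p q \<longrightarrow>
        is_pullback D (on_ar F m) (on_ar F n) (on_ar F p) (on_ar F q)) \<and>
     (\<forall>d\<in>E. \<forall>e\<in>E. \<forall>p q. is_pushout C d e p q \<longrightarrow>
        is_pushout D (on_ar F d) (on_ar F e) (on_ar F p) (on_ar F q))"


section \<open>Noetherian forms\<close>

text \<open>\<open>push F f\<close> and \<open>pull F f\<close> are the direct and inverse image maps of \<open>f\<close>.\<close>

record ('o, 'm, 'k) form =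
  fib :: "'o \<Rightarrow> 'k gorder"
  push :: "'m \<Rightarrow> 'k \<Rightarrow> 'k"
  pull :: "'m \<Rightarrow> 'k \<Rightarrow> 'k"

abbreviation clusters :: "('o, 'm, 'k) form \<Rightarrow> 'o \<Rightarrow> 'k set" where
  "clusters F X \<equiv> carrier (fib F X)"

definition is_form :: "('u \<Rightarrow> 'u set) \<Rightarrow> ('o, 'm) cat \<Rightarrow> ('o, 'm, 'k) form \<Rightarrow> bool" where
  "is_form U C F \<longleftrightarrow>
     (\<forall>X\<in>ob C. Lattice.bounded_lattice (fib F X) \<and> small U (clusters F X)) \<and>
     (\<forall>f\<in>ar C.
        push F f \<in> clusters F (src C f) \<rightarrow> clusters F (tgt C f) \<and>
        pull F f \<in> clusters F (tgt C f) \<rightarrow> clusters F (src C f) \<and>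
        isotone (fib F (src C f)) (fib F (tgt C f)) (push F f) \<and>
        isotone (fib F (tgt C f)) (fib F (src C f)) (pull F f) \<and>
        (\<forall>S\<in>clusters F (src C f). \<forall>T\<in>clusters F (tgt C f).
           push F f S \<sqsubseteq>\<^bsub>fib F (tgt C f)\<^esub> T \<longleftrightarrow> S \<sqsubseteq>\<^bsub>fib F (src C f)\<^esub> pull F f T)) \<and>
     (\<forall>f\<in>ar C. \<forall>g\<in>ar C. src C g = tgt C f \<longrightarrow>
        (\<forall>S\<in>clusters F (src C f). push F (g \<cdot>\<^bsub>C\<^esub> f) S = push F g (push F f S)) \<and>
        (\<forall>T\<in>clusters F (tgt C g). pull F (g \<cdot>\<^bsub>C\<^esub> f) T = pull F f (pull F g T))) \<and>
     (\<forall>X\<in>ob C. \<forall>S\<in>clusters F X. push F (ide C X) S = S \<and> pull F (ide C X) S = S)"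

definition Im :: "('o, 'm) cat \<Rightarrow> ('o, 'm, 'k) form \<Rightarrow> 'm \<Rightarrow> 'k" where
  "Im C F f = push F f \<top>\<^bsub>fib F (src C f)\<^esub>"

definition Ker :: "('o, 'm) cat \<Rightarrow> ('o, 'm, 'k) form \<Rightarrow> 'm \<Rightarrow> 'k" where
  "Ker C F f = pull F f \<bottom>\<^bsub>fib F (tgt C f)\<^esub>"

definition conormal :: "('o, 'm) cat \<Rightarrow> ('o, 'm, 'k) form \<Rightarrow> 'o \<Rightarrow> 'k \<Rightarrow> bool" where
  "conormal C F X S \<longleftrightarrow> (\<exists>f\<in>ar C. tgt C f = X \<and> S = Im C F f)"

definition normal :: "('o, 'm) cat \<Rightarrow> ('o, 'm, 'k) form \<Rightarrow> 'o \<Rightarrow> 'k \<Rightarrow> bool" where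
  "normal C F X K \<longleftrightarrow> (\<exists>f\<in>ar C. src C f = X \<and> K = Ker C F f)"

definition is_embedding ::
  "('o, 'm) cat \<Rightarrow> ('o, 'm, 'k) form \<Rightarrow> 'o \<Rightarrow> 'k \<Rightarrow> 'm \<Rightarrow> bool" where
  "is_embedding C F X S m \<longleftrightarrow>
     conormal C F X S \<and> m \<in> ar C \<and> tgt C m = X \<and> Im C F m = S \<and>
     (\<forall>f\<in>ar C. tgt C f = X \<longrightarrow> Im C F f \<sqsubseteq>\<^bsub>fib F X\<^esub> S \<longrightarrow>
        (\<exists>!h. h \<in> hom C (src C f) (src C m) \<and> f = m \<cdot>\<^bsub>C\<^esub> h))"

definition is_quotient ::
  "('o, 'm) cat \<Rightarrow> ('o, 'm, 'k) form \<Rightarrow> 'o \<Rightarrow> 'k \<Rightarrow> 'm \<Rightarrow> bool" where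
  "is_quotient C F X K e \<longleftrightarrow>
     normal C F X K \<and> e \<in> ar C \<and> src C e = X \<and> Ker C F e = K \<and>
     (\<forall>g\<in>ar C. src C g = X \<longrightarrow> K \<sqsubseteq>\<^bsub>fib F X\<^esub> Ker C F g \<longrightarrow>
        (\<exists>!h. h \<in> hom C (tgt C e) (tgt C g) \<and> g = h \<cdot>\<^bsub>C\<^esub> e))"

definition noetherian_form ::
  "('u \<Rightarrow> 'u set) \<Rightarrow> ('o, 'm) cat \<Rightarrow> ('o, 'm, 'k) form \<Rightarrow> bool" where
  "noetherian_form U C F \<longleftrightarrow>
     is_form U C F \<and>
     (\<forall>f\<in>ar C.
        (\<forall>S\<in>clusters F (src C f). pull F f (push F f S) = S \<squnion>\<^bsub>fib F (src C f)\<^esub> Ker C F f) \<and>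
        (\<forall>T\<in>clusters F (tgt C f). push F f (pull F f T) = T \<sqinter>\<^bsub>fib F (tgt C f)\<^esub> Im C F f)) \<and>
     (\<forall>f\<in>ar C. \<exists>e m. is_quotient C F (src C f) (Ker C F f) e \<and>
        is_embedding C F (tgt C f) (Im C F f) m \<and> src C m = tgt C e \<and> f = m \<cdot>\<^bsub>C\<^esub> e) \<and>
     (\<forall>X\<in>ob C.
        (\<forall>K L. normal C F X K \<longrightarrow> normal C F X L \<longrightarrow> normal C F X (K \<squnion>\<^bsub>fib F X\<^esub> L)) \<and>
        (\<forall>S T. conormal C F X S \<longrightarrow> conormal C F X T \<longrightarrow> conormal C F X (S \<sqinter>\<^bsub>fib F X\<^esub> T)))"

definition quotients :: "('o, 'm) cat \<Rightarrow> ('o, 'm, 'k) form \<Rightarrow> 'm set" where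
  "quotients C F = {e. \<exists>X K. is_quotient C F X K e}"

definition embeddings :: "('o, 'm) cat \<Rightarrow> ('o, 'm, 'k) form \<Rightarrow> 'm set" where
  "embeddings C F = {m. \<exists>X S. is_embedding C F X S m}"

text \<open>
  Fibres are set-sized, so clusters may be taken in the universe type \<open>'u\<close> without loss of
  generality.
\<close>

definition has_noetherian_form_inducing ::
  "('u \<Rightarrow> 'u set) \<Rightarrow> ('o, 'm) cat \<Rightarrow> 'm set \<Rightarrow> 'm set \<Rightarrow> bool" where
  "has_noetherian_form_inducing U C E M \<longleftrightarrow>
     (\<exists>F :: ('o, 'm, 'u) form. noetherian_form U C F \<and> quotients C F = E \<and> embeddings C F = M)"


section \<open>Universal targets\<close>

text \<open>
  The last argument names the types of objects and arrows of the test categories; quantification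
  over all categories is obtained by leaving these types arbitrary.
\<close>

definition universal_target ::
  "('u \<Rightarrow> 'u set) \<Rightarrow> ('p, 'n) cat \<Rightarrow> 'n set \<Rightarrow> 'n set \<Rightarrow> ('o, 'm) cat itself \<Rightarrow> bool" where
  "universal_target U D E' M' (_ :: ('o, 'm) cat itself) \<longleftrightarrow>
     transfer_setting U D E' M' \<and>
     (\<forall>(C :: ('o, 'm) cat) E M. transfer_setting U C E M \<longrightarrow>
        (has_noetherian_form_inducing U C E M \<longleftrightarrow>
         (\<exists>F. transfer_functor U C E M D E' M' F)))"

end

theory Submission
  imports Defs
begin

text \<open>
  A noetherian form on \<open>C\<close> gives a transfer functor from \<open>C\<close> to sets: send an object to its set of
  clusters and an arrow to its direct image map. The identities for \<open>f\<^sup>* f\<^sub>!\<close> and \<open>f\<^sub>! f\<^sup>*\<close>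
  make quotients act surjectively and embeddings injectively, and the kernel of a pushout of
  quotients is the join of the kernels. Composing with \<open>\<Delta>\<close> yields a transfer functor to \<open>T\<close>.

  Conversely, a transfer functor \<open>G\<close> from \<open>C\<close> to \<open>T\<close> gives a noetherian form whose clusters over \<open>X\<close> are
  the internal equivalence relations on \<open>G X + 1\<close>. To factor an arrow through a quotient with
  smaller kernel, one forms the pushout of the two quotients; its image in \<open>T\<close> has an invertible
  leg, and \<open>G\<close> reflects isomorphisms. Embeddings are dual.

  On the side of \<open>T\<close> everything reduces to one construction, the quotient sheaf of a presheaf by a
  closed congruence: images, pullbacks of monomorphisms, pushouts of epimorphisms and constant
  objects are all instances of it, and sets are the case of the one-point site.
\<close>

section \<open>Small sets\<close>

text \<open>Clusters on X alone would not do: among equivalence relations on X, the images of the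
  empty subobject and of a one-element subobject are both the diagonal. The added point marks the
  class that is the image, so subobjects and quotients sit in one lattice. In general a direct image
  of an equivalence relation needs a transitive closure; it becomes explicit once the relation
  contains the kernel, and both identities of a noetherian form are reduced to that case.

  In a topos all of this holds only locally. The recurrent exception is an object of the site
  covered by the empty sieve: there every sheaf has a single section, distinct constants coincide,
  and the added point falls together with the rest. Nondegeneracy supplies an object where this does
  not happen, which lets \<open>\<Delta>\<close> reflect isomorphisms. That \<open>\<Delta>\<close>
  preserves pushouts is an adjunction with the functor of points.

  In \<open>C\<close>, pushouts and pullbacks are available only inside the two classes, hence
  arbitrary arrows are factorized before they are compared.\<close>

locale small_universe =
  fixes U :: "'u \<Rightarrow> 'u set"
  assumes grothendieck: "grothendieck_universe U"
begin

abbreviation sm :: "'a set \<Rightarrow> bool" where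
  "sm \<equiv> small U"

lemma U_inj: "U a = U b \<longleftrightarrow> a = b"
  using grothendieck by (auto simp: grothendieck_universe_def inj_eq)

lemma U_pair: "\<exists>a. U a = {x, y}"
proof -
  have "{x, y} \<in> range U"
    using grothendieck by (auto simp: grothendieck_universe_def)
  then show ?thesis by (metis imageE)
qed

lemma U_Union: "\<exists>b. U b = (\<Union>x\<in>U a. U x)"
proof -
  have "(\<Union>x\<in>U a. U x) \<in> range U"
    using grothendieck by (auto simp: grothendieck_universe_def)
  then show ?thesis by (metis imageE)
qed

lemma U_Pow: "\<exists>b. U b = {x. U x \<subseteq> U a}"
proof -
  have "{x. U x \<subseteq> U a} \<in> range U"
    using grothendieck by (auto simp: grothendieck_universe_def)
  then show ?thesis by (metis imageE)
qed

lemma U_image: "\<exists>b. U b = f ` U a"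
proof -
  have "f ` U a \<in> range U"
    using grothendieck by (auto simp: grothendieck_universe_def)
  then show ?thesis by (metis imageE)
qed

text \<open>A code that is minimal for membership, which well-foundedness provides, has no
  elements.\<close>

lemma U_empty: "\<exists>a. U a = {}"
proof -
  have "wf {(x, y). x \<in> U y}"
    using grothendieck by (auto simp: grothendieck_universe_def)
  from wfE_min[OF this, of undefined UNIV] show ?thesis by (metis (mono_tags) UNIV_I case_prodI equals0I mem_Collect_eq)
qed

text \<open>Separation comes from replacement: the elements outside \<open>A\<close> are sent to a
  fixed member of \<open>A\<close>. This needs \<open>A\<close> to be nonempty, whence the case
  distinction.\<close>

lemma U_subset: "A \<subseteq> U a \<Longrightarrow> \<exists>b. U b = A"
proof (cases "A = {}")
  case True then show ?thesis using U_empty by blast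
next
  case False
  assume "A \<subseteq> U a"
  from False obtain z where "z \<in> A" by blast
  then have "(\<lambda>x. if x \<in> A then x else z) ` U a = A"
    using \<open>A \<subseteq> U a\<close> by auto
  then show ?thesis using U_image by metis
qed

lemma small_iff_inj: "sm A \<longleftrightarrow> (\<exists>f a. inj_on f A \<and> f ` A \<subseteq> U a)"
  unfolding small_def eqpoll_def bij_betw_def
  by (metis U_subset subset_refl)

lemma small_U [simp]: "sm (U a)"
  unfolding small_def by blast

lemma small_code: "sm (A :: 'u set) \<Longrightarrow> \<exists>a. U a = A"
proof -
  assume "sm A"
  then obtain a where "A \<approx> U a" by (auto simp: small_def)
  then obtain f where "bij_betw f (U a) A" by (meson eqpoll_def eqpoll_sym)
  then show ?thesis using U_image[of f a] by (auto simp: bij_betw_def)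
qed

lemma small_bij: "sm A \<Longrightarrow> \<exists>f a. bij_betw f A (U a)"
  by (auto simp: small_def eqpoll_def)

lemma small_subset: "sm A \<Longrightarrow> B \<subseteq> A \<Longrightarrow> sm B"
  unfolding small_iff_inj by (meson image_mono inj_on_subset order_trans)

lemma small_image: "sm A \<Longrightarrow> sm (f ` A)"
proof -
  assume "sm A"
  moreover have "inj_on (inv_into A f) (f ` A)" by (simp add: inj_on_inv_into)
  moreover have "inv_into A f ` f ` A \<subseteq> A" by (auto intro: inv_into_into)
  ultimately show ?thesis
    unfolding small_iff_inj by (metis comp_inj_on_iff image_comp image_mono inj_on_subset order_trans)
qed

lemma small_inj: "inj_on f A \<Longrightarrow> f ` A \<subseteq> B \<Longrightarrow> sm B \<Longrightarrow> sm A"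
  by (metis inv_into_image_cancel inj_on_def small_image small_subset subset_refl)

text \<open>The power set of the universe collects codes rather than sets, so a subset is
  represented by a code of its image under an injection into some \<open>U a\<close>.\<close>

lemma small_Pow: "sm A \<Longrightarrow> sm (Pow A)"
proof -
  assume "sm A"
  then obtain f a where f: "inj_on f A" "f ` A \<subseteq> U a" by (auto simp: small_iff_inj)
  obtain b where b: "U b = {x. U x \<subseteq> U a}" using U_Pow by blast
  define g where "g B = (SOME x. U x = f ` B)" for B
  have g: "U (g B) = f ` B" if "B \<subseteq> A" for B
    unfolding g_def using U_subset[of "f ` B" a] that f(2) by (metis (mono_tags, lifting) image_mono order_trans someI_ex)
  have "inj_on g (Pow A)"
    using g f(1) by (metis PowD inj_on_def inj_on_image_eq_iff)
  moreover have "g ` Pow A \<subseteq> U b"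
    using g f(2) unfolding b by (fastforce simp: image_subset_iff)
  ultimately show ?thesis unfolding small_iff_inj by blast
qed

lemma small_Sigma: assumes "sm I" "\<And>i. i \<in> I \<Longrightarrow> sm (A i)" shows "sm (Sigma I A)"
proof -
  obtain e a where e: "inj_on e I" "e ` I \<subseteq> U a" using assms(1) by (auto simp: small_iff_inj)
  have "\<forall>i\<in>I. \<exists>f b. inj_on f (A i) \<and> f ` A i \<subseteq> U b"
    using assms(2) by (simp add: small_iff_inj)
  then obtain f b where f: "\<And>i. i \<in> I \<Longrightarrow> inj_on (f i) (A i)" "\<And>i. i \<in> I \<Longrightarrow> f i ` A i \<subseteq> U (b i)"
    by metis
  define s where "s x y = (SOME z. U z = {x, y})" for x y
  have s: "U (s x y) = {x, y}" for x y unfolding s_def using U_pair by (metis (mono_tags, lifting) someI_ex)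
  \<comment> \<open>\<open>s\<close> codes unordered pairs, so \<open>p\<close> is the Kuratowski
    pair.\<close>
  define p where "p x y = s (s x x) (s x y)" for x y
  have p: "p x y = p x' y' \<longleftrightarrow> x = x' \<and> y = y'" for x y x' y'
  proof -
    have sx: "s x y = s x' y' \<longleftrightarrow> {x, y} = {x', y'}" for x y x' y' by (metis U_inj s)
    show ?thesis unfolding p_def sx by (auto simp: doubleton_eq_iff sx)
  qed
  \<comment> \<open>The fibre over \<open>x\<close> as a set of pairs. Replacement collects these
    fibres in \<open>w\<close>, and \<open>v\<close> is their union.\<close>
  define d where "d x = (SOME z. U z = p x ` U (b (inv_into I e x)))" for x
  have d: "U (d x) = p x ` U (b (inv_into I e x))" for x
    unfolding d_def using U_image by (metis (mono_tags, lifting) someI_ex)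
  obtain w where w: "U w = d ` U a" using U_image by blast
  obtain v where v: "U v = (\<Union>x\<in>U w. U x)" using U_Union by blast
  have "inj_on (\<lambda>(i, x). p (e i) (f i x)) (Sigma I A)"
    using e(1) f(1) by (auto simp: inj_on_def p)
  moreover have "(\<lambda>(i, x). p (e i) (f i x)) ` Sigma I A \<subseteq> U v"
  proof clarify
    fix i x assume i: "i \<in> I" "x \<in> A i"
    then have "p (e i) (f i x) \<in> U (d (e i))"
      unfolding d using f(2) e(1) by (auto simp: image_subset_iff)
    then show "p (e i) (f i x) \<in> U v"
      unfolding v w using e(2) i by auto
  qed
  ultimately show ?thesis unfolding small_iff_inj by blast
qed

lemma small_Times: "sm A \<Longrightarrow> sm B \<Longrightarrow> sm (A \<times> B)"
  by (simp add: small_Sigma)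

lemma small_UN: assumes "sm I" "\<And>i. i \<in> I \<Longrightarrow> sm (A i)" shows "sm (\<Union>i\<in>I. A i)"
proof -
  have "(\<Union>i\<in>I. A i) = snd ` Sigma I A" by force
  then show ?thesis using small_image small_Sigma assms by metis
qed

lemma small_bool: "sm (UNIV :: bool set)"
proof -
  \<comment> \<open>The empty set and its singleton serve as the two truth values.\<close>
  obtain e where e: "U e = {}" using U_empty by blast
  obtain a where a: "U a = {e, e}" using U_pair by blast
  obtain b where b: "U b = {e, a}" using U_pair by blast
  have "e \<noteq> a" using e a by auto
  then have "inj_on (\<lambda>x. if x then e else a) UNIV" by (auto simp: inj_on_def)
  moreover have "range (\<lambda>x. if x then e else a) \<subseteq> U b" using b by auto
  ultimately show ?thesis unfolding small_iff_inj by blast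
qed

lemma small_Un: "sm A \<Longrightarrow> sm B \<Longrightarrow> sm (A \<union> B)"
proof -
  assume "sm A" "sm B"
  then have "sm (\<Union>i\<in>UNIV. if i then A else B)" by (intro small_UN small_bool) auto
  then show ?thesis by (simp add: UNIV_bool Un_commute)
qed

lemma small_singleton [simp]: "sm {x}"
  by (rule small_inj[of "\<lambda>_. undefined" _ "U (SOME a. U a = {undefined})"])
    (auto intro: someI2_ex U_pair[of undefined undefined, simplified])

end

section \<open>Sheaves on a site\<close>

locale site = small_universe U for U :: "'u \<Rightarrow> 'u set" +
  fixes S :: "('u, 'u) cat" and J :: "'u \<Rightarrow> 'u set set"
  assumes category_S: "category S"
    and small_ob: "sm (ob S)"
    and small_ar: "sm (ar S)"
    and topology: "grothendieck_topology S J"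
begin

section \<open>Arrows into an object and covering sieves\<close>

abbreviation cmpS (infixl \<open>\<odot>\<close> 70) where "f \<odot> g \<equiv> f \<cdot>\<^bsub>S\<^esub> g"

definition into :: "'u \<Rightarrow> 'u set" where
  "into c = {f \<in> ar S. tgt S f = c}"

lemma intoD: "f \<in> into c \<Longrightarrow> f \<in> ar S \<and> tgt S f = c \<and> c \<in> ob S \<and> src S f \<in> ob S"
  using category_S by (auto simp: into_def category_def)

lemma src_ob: "f \<in> into c \<Longrightarrow> src S f \<in> ob S" and into_ob: "f \<in> into c \<Longrightarrow> c \<in> ob S"
  using intoD by auto

lemma cmp_into [intro]: "f \<in> into c \<Longrightarrow> g \<in> into (src S f) \<Longrightarrow> f \<odot> g \<in> into c"
  and src_cmp [simp]: "f \<in> into c \<Longrightarrow> g \<in> into (src S f) \<Longrightarrow> src S (f \<odot> g) = src S g"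
  using category_S by (auto simp: into_def category_def hom_def)

lemma ide_into [intro]: "c \<in> ob S \<Longrightarrow> ide S c \<in> into c"
  and src_ide [simp]: "c \<in> ob S \<Longrightarrow> src S (ide S c) = c"
  using category_S by (auto simp: into_def category_def hom_def)

lemma cmp_ide [simp]: "f \<in> into c \<Longrightarrow> ide S c \<odot> f = f"
  and cmp_ide_src [simp]: "f \<in> into c \<Longrightarrow> f \<odot> ide S (src S f) = f"
  using category_S by (auto simp: into_def category_def)

lemma cmp_assoc: "f \<in> into c \<Longrightarrow> g \<in> into (src S f) \<Longrightarrow> h \<in> into (src S g) \<Longrightarrow> f \<odot> g \<odot> h = f \<odot> (g \<odot> h)"
  using category_S by (auto simp: into_def category_def)

lemma sieve_J: "c \<in> ob S \<Longrightarrow> R \<in> J c \<Longrightarrow> sieve S c R"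
  using topology by (auto simp: grothendieck_topology_def)

lemma J_into: "c \<in> ob S \<Longrightarrow> R \<in> J c \<Longrightarrow> f \<in> R \<Longrightarrow> f \<in> into c"
  using sieve_J by (fastforce simp: sieve_def into_def)

lemma J_cmp: "c \<in> ob S \<Longrightarrow> R \<in> J c \<Longrightarrow> f \<in> R \<Longrightarrow> g \<in> into (src S f) \<Longrightarrow> f \<odot> g \<in> R"
  using sieve_J by (fastforce simp: sieve_def into_def)

lemma J_trans: "c \<in> ob S \<Longrightarrow> R \<in> J c \<Longrightarrow> sieve S c Q \<Longrightarrow> (\<And>h. h \<in> R \<Longrightarrow> pull_sieve S h Q \<in> J (src S h)) \<Longrightarrow> Q \<in> J c"
  using topology unfolding grothendieck_topology_def by blast

lemma J_pull: "h \<in> into c \<Longrightarrow> R \<in> J c \<Longrightarrow> pull_sieve S h R \<in> J (src S h)"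
  using topology unfolding grothendieck_topology_def into_def by blast

lemma J_top: "c \<in> ob S \<Longrightarrow> into c \<in> J c"
  using topology unfolding grothendieck_topology_def into_def by blast

lemma pull_sieve_into: "pull_sieve S h R = {g \<in> into (src S h). h \<odot> g \<in> R}"
  by (auto simp: pull_sieve_def into_def)

lemma sieveI: "(\<And>f. f \<in> R \<Longrightarrow> f \<in> into c) \<Longrightarrow> (\<And>f g. f \<in> R \<Longrightarrow> g \<in> into (src S f) \<Longrightarrow> f \<odot> g \<in> R) \<Longrightarrow> sieve S c R"
  by (fastforce simp: sieve_def into_def)

text \<open>Along every arrow of \<open>R\<close> the larger sieve pulls back to the maximal one, so
  the transitivity axiom applies.\<close>

lemma J_mono:
  assumes c: "c \<in> ob S" and R: "R \<in> J c" and Q: "sieve S c Q" "R \<subseteq> Q" shows "Q \<in> J c"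
proof (rule J_trans[OF c R Q(1)])
  fix h assume h: "h \<in> R"
  then have hi: "h \<in> into c" using J_into c R by auto
  have "pull_sieve S h Q = into (src S h)"
    unfolding pull_sieve_into using J_cmp[OF c R h] Q(2) by blast
  then show "pull_sieve S h Q \<in> J (src S h)" using J_top src_ob[OF hi] by simp
qed

text \<open>The modality of local truth. \<open>P\<close> is an arbitrary predicate on arrows, not a
  sieve; arguments about sheaves are phrased with it so that covers need not be named and refined
  each time.\<close>

definition lcov :: "'u \<Rightarrow> ('u \<Rightarrow> bool) \<Rightarrow> bool" where
  "lcov c P \<longleftrightarrow> (\<exists>R\<in>J c. \<forall>h\<in>R. P h)"

lemma lcov_top: "c \<in> ob S \<Longrightarrow> (\<And>h. h \<in> into c \<Longrightarrow> P h) \<Longrightarrow> lcov c P"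
  unfolding lcov_def using J_top by blast

lemma lcov_mono: "c \<in> ob S \<Longrightarrow> lcov c P \<Longrightarrow> (\<And>h. h \<in> into c \<Longrightarrow> P h \<Longrightarrow> Q h) \<Longrightarrow> lcov c Q"
  unfolding lcov_def using J_into by blast

lemma lcov_pull: "h \<in> into c \<Longrightarrow> lcov c P \<Longrightarrow> lcov (src S h) (\<lambda>g. P (h \<odot> g))"
  unfolding lcov_def by (metis (no_types, lifting) J_pull mem_Collect_eq pull_sieve_into)

lemma lcov_trans:
  assumes c: "c \<in> ob S" and P: "lcov c (\<lambda>h. lcov (src S h) (\<lambda>g. P (h \<odot> g)))"
  shows "lcov c P"
proof -
  obtain R where R: "R \<in> J c" "\<And>h. h \<in> R \<Longrightarrow> lcov (src S h) (\<lambda>g. P (h \<odot> g))"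
    using P by (auto simp: lcov_def)
  \<comment> \<open>The largest sieve on which \<open>P\<close> holds. Since \<open>P\<close> need
    not be stable under composition, the arrows satisfying it may fail to form a sieve.\<close>
  define Q where "Q = {f \<in> into c. \<forall>g\<in>into (src S f). P (f \<odot> g)}"
  have sQ: "sieve S c Q"
  proof (rule sieveI)
    fix f g assume f: "f \<in> Q" and g: "g \<in> into (src S f)"
    then have "P (f \<odot> g \<odot> k)" if "k \<in> into (src S g)" for k
      using that cmp_into[OF g that] cmp_assoc[of f c g k] by (simp add: Q_def)
    then show "f \<odot> g \<in> Q" using f g by (auto simp: Q_def)
  qed (auto simp: Q_def)
  have "Q \<in> J c"
  proof (rule J_trans[OF c R(1) sQ])
    fix h assume h: "h \<in> R"
    then have hi: "h \<in> into c" using J_into c R by auto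
    obtain R' where R': "R' \<in> J (src S h)" "\<And>g. g \<in> R' \<Longrightarrow> P (h \<odot> g)" using R(2)[OF h] by (auto simp: lcov_def)
    show "pull_sieve S h Q \<in> J (src S h)"
    proof (rule J_mono[OF src_ob[OF hi] R'(1)])
      show "sieve S (src S h) (pull_sieve S h Q)"
      proof (rule sieveI)
        fix f g assume f: "f \<in> pull_sieve S h Q" and g: "g \<in> into (src S f)"
        then have fi: "f \<in> into (src S h)" and hf: "h \<odot> f \<in> Q" by (auto simp: pull_sieve_into)
        have "h \<odot> f \<odot> g \<in> Q" using sQ hf g fi hi by (fastforce simp: sieve_def into_def)
        then show "f \<odot> g \<in> pull_sieve S h Q" using fi g hi by (auto simp: pull_sieve_into cmp_assoc)
      qed (auto simp: pull_sieve_into)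
      show "R' \<subseteq> pull_sieve S h Q"
      proof
        fix g assume g: "g \<in> R'"
        then have gi: "g \<in> into (src S h)" using J_into R' src_ob[OF hi] by auto
        show "g \<in> pull_sieve S h Q"
          using gi hi R'(2)[OF J_cmp[OF src_ob[OF hi] R'(1) g]] by (auto simp: pull_sieve_into Q_def cmp_assoc)
      qed
    qed
  qed
  moreover have "P h" if "h \<in> Q" for h
    using that ide_into[OF src_ob] unfolding Q_def by (metis (mono_tags, lifting) cmp_ide_src mem_Collect_eq)
  ultimately show ?thesis unfolding lcov_def by blast
qed

text \<open>The cover for \<open>Q\<close> is pulled back along each arrow of the cover for
  \<open>P\<close>; there \<open>P\<close> persists because \<open>R\<close> is a sieve, and
  \<open>lcov_trans\<close> composes the two covers.\<close>

lemma lcov_conj: 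
  assumes c: "c \<in> ob S" and P: "lcov c P" and Q: "lcov c Q"
  shows "lcov c (\<lambda>h. P h \<and> Q h)"
proof -
  obtain R where R: "R \<in> J c" "\<And>h. h \<in> R \<Longrightarrow> P h" using P by (auto simp: lcov_def)
  have "lcov c (\<lambda>h. lcov (src S h) (\<lambda>g. P (h \<odot> g) \<and> Q (h \<odot> g)))"
    unfolding lcov_def[of c]
  proof (intro bexI[OF _ R(1)] ballI)
    fix h assume h: "h \<in> R"
    then have hi: "h \<in> into c" using J_into c R by auto
    show "lcov (src S h) (\<lambda>g. P (h \<odot> g) \<and> Q (h \<odot> g))"
      by (rule lcov_mono[OF src_ob[OF hi] lcov_pull[OF hi Q]]) (use J_cmp[OF c R(1) h] R(2) in auto)
  qed
  then show ?thesis by (rule lcov_trans[OF c])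
qed

lemma lcov_mp:
  assumes "c \<in> ob S" "lcov c P" "lcov c Q" "\<And>h. h \<in> into c \<Longrightarrow> P h \<Longrightarrow> Q h \<Longrightarrow> T h"
  shows "lcov c T"
  using lcov_mono[OF assms(1) lcov_conj[OF assms(1-3)]] assms(4) by blast


section \<open>Presheaves and sheaves as families of sets with restrictions\<close>

definition presheaf :: "('u \<Rightarrow> 'a set) \<Rightarrow> ('u \<Rightarrow> 'a \<Rightarrow> 'a) \<Rightarrow> bool" where
  "presheaf Q r \<longleftrightarrow>
     (\<forall>c. \<forall>f\<in>into c. \<forall>x\<in>Q c. r f x \<in> Q (src S f)) \<and>
     (\<forall>c\<in>ob S. \<forall>x\<in>Q c. r (ide S c) x = x) \<and>
     (\<forall>c. \<forall>f\<in>into c. \<forall>g\<in>into (src S f). \<forall>x\<in>Q c. r (f \<odot> g) x = r g (r f x))"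

lemma presheaf_mem: "presheaf Q r \<Longrightarrow> f \<in> into c \<Longrightarrow> x \<in> Q c \<Longrightarrow> r f x \<in> Q (src S f)"
  and presheaf_ide: "presheaf Q r \<Longrightarrow> c \<in> ob S \<Longrightarrow> x \<in> Q c \<Longrightarrow> r (ide S c) x = x"
  and presheaf_cmp: "presheaf Q r \<Longrightarrow> f \<in> into c \<Longrightarrow> g \<in> into (src S f) \<Longrightarrow> x \<in> Q c \<Longrightarrow> r (f \<odot> g) x = r g (r f x)"
  unfolding presheaf_def by blast+

definition sheaf :: "('u \<Rightarrow> 'a set) \<Rightarrow> ('u \<Rightarrow> 'a \<Rightarrow> 'a) \<Rightarrow> bool" where
  "sheaf Q r \<longleftrightarrow> presheaf Q r \<and>
     (\<forall>c\<in>ob S. \<forall>R\<in>J c. \<forall>x. (\<forall>f\<in>R. x f \<in> Q (src S f)) \<longrightarrow>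
        (\<forall>f\<in>R. \<forall>g\<in>into (src S f). r g (x f) = x (f \<odot> g)) \<longrightarrow>
        (\<exists>!y. y \<in> Q c \<and> (\<forall>f\<in>R. r f y = x f)))"

lemma sheaf_presheaf: "sheaf Q r \<Longrightarrow> presheaf Q r"
  by (simp add: sheaf_def)

lemma sheaf_sep:
  assumes Q: "sheaf Q r" and c: "c \<in> ob S" and xy: "x \<in> Q c" "y \<in> Q c"
    and l: "lcov c (\<lambda>h. r h x = r h y)"
  shows "x = y"
proof -
  obtain R where R: "R \<in> J c" "\<And>h. h \<in> R \<Longrightarrow> r h x = r h y" using l by (auto simp: lcov_def)
  note p = sheaf_presheaf[OF Q]
  have "\<exists>!z. z \<in> Q c \<and> (\<forall>f\<in>R. r f z = r f x)"
  proof (rule Q[unfolded sheaf_def, THEN conjunct2, rule_format, OF c R(1)])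
    show "r f x \<in> Q (src S f)" if "f \<in> R" for f
      using presheaf_mem[OF p] J_into[OF c R(1)] xy that by auto
    show "r g (r f x) = r (f \<odot> g) x" if "f \<in> R" "g \<in> into (src S f)" for f g
      using presheaf_cmp[OF p] J_into[OF c R(1)] xy that by metis
  qed
  then show ?thesis using R xy by metis
qed

text \<open>Gluing for a section that is described by a relation instead of being chosen. Stability
  makes the arrows on which \<open>P\<close> is solvable a sieve, and uniqueness of solutions makes
  any choice of them a matching family.\<close>

lemma sheaf_glue:
  assumes Q: "sheaf Q r" and c: "c \<in> ob S"
    and st: "\<And>h g y. h \<in> into c \<Longrightarrow> g \<in> into (src S h) \<Longrightarrow> y \<in> Q (src S h) \<Longrightarrow> P h y \<Longrightarrow> P (h \<odot> g) (r g y)"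
    and fn: "\<And>h y y'. h \<in> into c \<Longrightarrow> y \<in> Q (src S h) \<Longrightarrow> y' \<in> Q (src S h) \<Longrightarrow> P h y \<Longrightarrow> P h y' \<Longrightarrow> y = y'"
    and ex: "lcov c (\<lambda>h. \<exists>y\<in>Q (src S h). P h y)"
  obtains z where "z \<in> Q c" "\<And>h y. h \<in> into c \<Longrightarrow> y \<in> Q (src S h) \<Longrightarrow> P h y \<Longrightarrow> r h z = y"
proof -
  note p = sheaf_presheaf[OF Q]
  define R where "R = {h \<in> into c. \<exists>y\<in>Q (src S h). P h y}"
  have sR: "sieve S c R"
  proof (rule sieveI)
    fix f g assume f: "f \<in> R" and g: "g \<in> into (src S f)"
    then obtain y where "f \<in> into c" "y \<in> Q (src S f)" "P f y" by (auto simp: R_def)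
    then show "f \<odot> g \<in> R" using g st[of f g y] presheaf_mem[OF p g] by (auto simp: R_def intro!: bexI[of _ "r g y"])
  qed (auto simp: R_def)
  obtain R0 where R0: "R0 \<in> J c" "\<And>h. h \<in> R0 \<Longrightarrow> \<exists>y\<in>Q (src S h). P h y" using ex by (auto simp: lcov_def)
  have RJ: "R \<in> J c"
    by (rule J_mono[OF c R0(1) sR]) (use R0 J_into[OF c R0(1)] in \<open>auto simp: R_def\<close>)
  define x where "x h = (SOME y. y \<in> Q (src S h) \<and> P h y)" for h
  have x: "x h \<in> Q (src S h)" "P h (x h)" if "h \<in> R" for h
  proof -
    have "\<exists>y. y \<in> Q (src S h) \<and> P h y" using that by (auto simp: R_def)
    from someI_ex[OF this] show "x h \<in> Q (src S h)" "P h (x h)" by (auto simp: x_def)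
  qed
  have Ri: "h \<in> into c" if "h \<in> R" for h using that by (auto simp: R_def)
  have "\<exists>!z. z \<in> Q c \<and> (\<forall>f\<in>R. r f z = x f)"
  proof (rule Q[unfolded sheaf_def, THEN conjunct2, rule_format, OF c RJ])
    show "x f \<in> Q (src S f)" if "f \<in> R" for f using x that by auto
    fix f g assume f: "f \<in> R" and g: "g \<in> into (src S f)"
    have fg: "f \<odot> g \<in> R" using J_cmp[OF c RJ f g] .
    show "r g (x f) = x (f \<odot> g)"
      using fn[of "f \<odot> g" "r g (x f)" "x (f \<odot> g)"] st[OF Ri[OF f] g x[OF f]] x[OF fg] Ri[OF fg] Ri[OF f]
        presheaf_mem[OF p g x(1)[OF f]] g by simp
  qed
  then obtain z where z: "z \<in> Q c" "\<And>f. f \<in> R \<Longrightarrow> r f z = x f" by blast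
  show ?thesis
  proof (rule that[OF z(1)])
    fix h y assume "h \<in> into c" "y \<in> Q (src S h)" "P h y"
    moreover from this have "h \<in> R" by (auto simp: R_def)
    ultimately show "r h z = y" using z(2) fn x by metis
  qed
qed

text \<open>Presheaves and maps between them live on arbitrary types rather than on codes. Pairs of
  sections, tagged sections and sections with an added element can then be used directly, and are
  coded only when an object of the topos is wanted.\<close>

definition nmap :: "('u \<Rightarrow> 'a set) \<Rightarrow> ('u \<Rightarrow> 'a \<Rightarrow> 'a) \<Rightarrow> ('u \<Rightarrow> 'b set) \<Rightarrow> ('u \<Rightarrow> 'b \<Rightarrow> 'b) \<Rightarrow>
    ('u \<Rightarrow> 'a \<Rightarrow> 'b) \<Rightarrow> bool" where
  "nmap Q r Q' r' \<phi> \<longleftrightarrow> (\<forall>c\<in>ob S. \<forall>x\<in>Q c. \<phi> c x \<in> Q' c) \<and>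
     (\<forall>c. \<forall>f\<in>into c. \<forall>x\<in>Q c. \<phi> (src S f) (r f x) = r' f (\<phi> c x))"

lemma nmap_mem: "nmap Q r Q' r' \<phi> \<Longrightarrow> c \<in> ob S \<Longrightarrow> x \<in> Q c \<Longrightarrow> \<phi> c x \<in> Q' c"
  and nmap_nat: "nmap Q r Q' r' \<phi> \<Longrightarrow> f \<in> into c \<Longrightarrow> x \<in> Q c \<Longrightarrow> \<phi> (src S f) (r f x) = r' f (\<phi> c x)"
  unfolding nmap_def by blast+

lemma nmap_comp: "nmap Q r Q' r' \<phi> \<Longrightarrow> nmap Q' r' Q'' r'' \<psi> \<Longrightarrow> nmap Q r Q'' r'' (\<lambda>c x. \<psi> c (\<phi> c x))"
  unfolding nmap_def by (metis into_ob)

text \<open>Between sheaves this is the condition of being an epimorphism. The domain may be any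
  presheaf, so that the map from a presheaf to its quotient sheaf is covered as well.\<close>

definition lsurj :: "('u \<Rightarrow> 'a set) \<Rightarrow> ('u \<Rightarrow> 'b set) \<Rightarrow> ('u \<Rightarrow> 'b \<Rightarrow> 'b) \<Rightarrow> ('u \<Rightarrow> 'a \<Rightarrow> 'b) \<Rightarrow> bool" where
  "lsurj Q X s \<phi> \<longleftrightarrow> (\<forall>c\<in>ob S. \<forall>x\<in>X c. lcov c (\<lambda>h. \<exists>q\<in>Q (src S h). \<phi> (src S h) q = s h x))"

lemma lsurjD: "lsurj Q X s \<phi> \<Longrightarrow> c \<in> ob S \<Longrightarrow> x \<in> X c \<Longrightarrow> lcov c (\<lambda>h. \<exists>q\<in>Q (src S h). \<phi> (src S h) q = s h x)"
  by (auto simp: lsurj_def)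

text \<open>
  The universal property behind all constructions below: a locally surjective map onto any
  presheaf is a quotient map as far as maps into sheaves are concerned.
\<close>

lemma factor_through_lsurj:
  assumes Q: "presheaf Q r" and X: "presheaf X s" and Y: "sheaf Y t"
    and \<phi>: "nmap Q r X s \<phi>" and surj: "lsurj Q X s \<phi>" and \<psi>: "nmap Q r Y t \<psi>"
    and ker: "\<And>c q q'. c \<in> ob S \<Longrightarrow> q \<in> Q c \<Longrightarrow> q' \<in> Q c \<Longrightarrow> \<phi> c q = \<phi> c q' \<Longrightarrow> \<psi> c q = \<psi> c q'"
  obtains \<theta> where "nmap X s Y t \<theta>" "\<And>c q. c \<in> ob S \<Longrightarrow> q \<in> Q c \<Longrightarrow> \<theta> c (\<phi> c q) = \<psi> c q"
proof -
  note pY = sheaf_presheaf[OF Y]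
  \<comment> \<open>The value wanted at the restriction of \<open>x\<close> along \<open>h\<close>,
    computed from some preimage under \<open>\<phi>\<close>; by \<open>ker\<close> it does not
    depend on the preimage.\<close>
  define P where "P x h y \<longleftrightarrow> (\<exists>q\<in>Q (src S h). \<phi> (src S h) q = s h x \<and> y = \<psi> (src S h) q)" for x h y
  have ex: "\<exists>z\<in>Y c. \<forall>h y. h \<in> into c \<longrightarrow> P x h y \<longrightarrow> t h z = y" if c: "c \<in> ob S" and x: "x \<in> X c" for c x
  proof -
    have "\<exists>z. z \<in> Y c \<and> (\<forall>h y. h \<in> into c \<longrightarrow> y \<in> Y (src S h) \<longrightarrow> P x h y \<longrightarrow> t h z = y)"
    proof (rule sheaf_glue[OF Y c, of "P x"])
      fix h g y assume h: "h \<in> into c" and g: "g \<in> into (src S h)" and "y \<in> Y (src S h)" "P x h y"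
      then obtain q where q: "q \<in> Q (src S h)" "\<phi> (src S h) q = s h x" "y = \<psi> (src S h) q" by (auto simp: P_def)
      then show "P x (h \<odot> g) (t g y)"
        unfolding P_def using h g presheaf_mem[OF Q g] nmap_nat[OF \<phi> g] nmap_nat[OF \<psi> g] presheaf_cmp[OF X h g x]
        by (intro bexI[of _ "r g q"]) auto
    next
      fix h y y' assume "h \<in> into c" "P x h y" "P x h y'"
      then show "y = y'" unfolding P_def using ker src_ob by metis
    next
      show "lcov c (\<lambda>h. \<exists>y\<in>Y (src S h). P x h y)"
        by (rule lcov_mono[OF c lsurjD[OF surj c x]]) (metis P_def nmap_mem[OF \<psi>] src_ob)
    qed blast
    moreover have "y \<in> Y (src S h)" if "h \<in> into c" "P x h y" for h y
      using that nmap_mem[OF \<psi> src_ob[OF that(1)]] by (auto simp: P_def)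
    ultimately show ?thesis by blast
  qed
  define \<theta> where "\<theta> c x = (SOME z. z \<in> Y c \<and> (\<forall>h y. h \<in> into c \<longrightarrow> P x h y \<longrightarrow> t h z = y))" for c x
  have \<theta>: "\<theta> c x \<in> Y c" "\<And>h y. h \<in> into c \<Longrightarrow> P x h y \<Longrightarrow> t h (\<theta> c x) = y" if "c \<in> ob S" "x \<in> X c" for c x
    using someI_ex[of "\<lambda>z. z \<in> Y c \<and> (\<forall>h y. h \<in> into c \<longrightarrow> P x h y \<longrightarrow> t h z = y)"] ex[OF that]
    unfolding \<theta>_def[symmetric] by blast+
  show ?thesis
  proof
    show "nmap X s Y t \<theta>"
      unfolding nmap_def
    proof (intro conjI allI ballI)
      fix c f x assume f: "f \<in> into c" and x: "x \<in> X c"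
      let ?d = "src S f"
      have d: "?d \<in> ob S" and c: "c \<in> ob S" using f src_ob into_ob by auto
      have fx: "s f x \<in> X ?d" using presheaf_mem[OF X f x] .
      show "\<theta> ?d (s f x) = t f (\<theta> c x)"
      proof (rule sheaf_sep[OF Y d \<theta>(1)[OF d fx]])
        show "t f (\<theta> c x) \<in> Y ?d" using presheaf_mem[OF pY f \<theta>(1)[OF c x]] .
        show "lcov ?d (\<lambda>h. t h (\<theta> ?d (s f x)) = t h (t f (\<theta> c x)))"
        proof (rule lcov_mono[OF d lsurjD[OF surj d fx]])
          fix h assume h: "h \<in> into ?d" and "\<exists>q\<in>Q (src S h). \<phi> (src S h) q = s h (s f x)"
          then obtain q where q: "q \<in> Q (src S h)" "\<phi> (src S h) q = s h (s f x)" by blast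
          have "P (s f x) h (\<psi> (src S h) q)" using q by (auto simp: P_def)
          moreover have "P x (f \<odot> h) (\<psi> (src S h) q)"
            using q f h presheaf_cmp[OF X f h x] by (auto simp: P_def)
          ultimately show "t h (\<theta> ?d (s f x)) = t h (t f (\<theta> c x))"
            using \<theta>(2)[OF d fx h] \<theta>(2)[OF c x cmp_into[OF f h]] presheaf_cmp[OF pY f h \<theta>(1)[OF c x]] by metis
        qed
      qed
    qed (use \<theta> in auto)
    fix c q assume c: "c \<in> ob S" and q: "q \<in> Q c"
    have x: "\<phi> c q \<in> X c" using nmap_mem[OF \<phi> c q] .
    have "P (\<phi> c q) (ide S c) (\<psi> c q)"
      using c q presheaf_ide[OF X c x] by (auto simp: P_def)
    then show "\<theta> c (\<phi> c q) = \<psi> c q"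
      using \<theta>(2)[OF c x ide_into[OF c]] presheaf_ide[OF pY c \<theta>(1)[OF c x]] by metis
  qed
qed

text \<open>Every section of \<open>X\<close> is locally in the image of \<open>\<phi>\<close>, so
  the two maps agree on a cover, and sections of the sheaf \<open>Y\<close> are determined
  there.\<close>

lemma lsurj_unique:
  assumes Q: "presheaf Q r" and X: "presheaf X s" and Y: "sheaf Y t"
    and surj: "lsurj Q X s \<phi>" and \<theta>: "nmap X s Y t \<theta>" "nmap X s Y t \<theta>'"
    and eq: "\<And>c q. c \<in> ob S \<Longrightarrow> q \<in> Q c \<Longrightarrow> \<theta> c (\<phi> c q) = \<theta>' c (\<phi> c q)"
    and c: "c \<in> ob S" and x: "x \<in> X c"
  shows "\<theta> c x = \<theta>' c x"
proof (rule sheaf_sep[OF Y c])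
  show "\<theta> c x \<in> Y c" "\<theta>' c x \<in> Y c" using nmap_mem \<theta> c x by metis+
  show "lcov c (\<lambda>h. t h (\<theta> c x) = t h (\<theta>' c x))"
  proof (rule lcov_mono[OF c lsurjD[OF surj c x]])
    fix h assume h: "h \<in> into c" and "\<exists>q\<in>Q (src S h). \<phi> (src S h) q = s h x"
    then obtain q where "q \<in> Q (src S h)" "\<phi> (src S h) q = s h x" by blast
    then have "\<theta> (src S h) (s h x) = \<theta>' (src S h) (s h x)" using eq[OF src_ob[OF h]] by metis
    then show "t h (\<theta> c x) = t h (\<theta>' c x)" using nmap_nat[OF \<theta>(1) h x] nmap_nat[OF \<theta>(2) h x] by simp
  qed
qed

text \<open>The last clause makes being related a local property. Such relations are precisely the
  kernels of maps from \<open>Q\<close> into sheaves: kernels satisfy it because sections of a sheaf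
  are determined locally, and the map to the quotient sheaf realizes each of them. Coding the whole
  family as one set of triples turns order and meet into inclusion and intersection of sets.\<close>

definition closed_congruence :: "('u \<Rightarrow> 'a set) \<Rightarrow> ('u \<Rightarrow> 'a \<Rightarrow> 'a) \<Rightarrow> ('u \<times> 'a \<times> 'a) set \<Rightarrow> bool" where
  "closed_congruence Q r E \<longleftrightarrow>
     (\<forall>c x y. (c, x, y) \<in> E \<longrightarrow> c \<in> ob S \<and> x \<in> Q c \<and> y \<in> Q c) \<and>
     (\<forall>c\<in>ob S. \<forall>x\<in>Q c. (c, x, x) \<in> E) \<and>
     (\<forall>c x y. (c, x, y) \<in> E \<longrightarrow> (c, y, x) \<in> E) \<and>
     (\<forall>c x y z. (c, x, y) \<in> E \<longrightarrow> (c, y, z) \<in> E \<longrightarrow> (c, x, z) \<in> E) \<and>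
     (\<forall>c x y. \<forall>f\<in>into c. (c, x, y) \<in> E \<longrightarrow> (src S f, r f x, r f y) \<in> E) \<and>
     (\<forall>c\<in>ob S. \<forall>x\<in>Q c. \<forall>y\<in>Q c. lcov c (\<lambda>h. (src S h, r h x, r h y) \<in> E) \<longrightarrow> (c, x, y) \<in> E)"

lemma cc_mem: "closed_congruence Q r E \<Longrightarrow> (c, x, y) \<in> E \<Longrightarrow> c \<in> ob S \<and> x \<in> Q c \<and> y \<in> Q c"
  and cc_refl: "closed_congruence Q r E \<Longrightarrow> c \<in> ob S \<Longrightarrow> x \<in> Q c \<Longrightarrow> (c, x, x) \<in> E"
  and cc_sym: "closed_congruence Q r E \<Longrightarrow> (c, x, y) \<in> E \<Longrightarrow> (c, y, x) \<in> E"
  and cc_trans: "closed_congruence Q r E \<Longrightarrow> (c, x, y) \<in> E \<Longrightarrow> (c, y, z) \<in> E \<Longrightarrow> (c, x, z) \<in> E"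
  and cc_res: "closed_congruence Q r E \<Longrightarrow> f \<in> into c \<Longrightarrow> (c, x, y) \<in> E \<Longrightarrow> (src S f, r f x, r f y) \<in> E"
  and cc_local: "closed_congruence Q r E \<Longrightarrow> c \<in> ob S \<Longrightarrow> x \<in> Q c \<Longrightarrow> y \<in> Q c \<Longrightarrow>
     lcov c (\<lambda>h. (src S h, r h x, r h y) \<in> E) \<Longrightarrow> (c, x, y) \<in> E"
  unfolding closed_congruence_def by blast+

text \<open>
  The quotient sheaf of a presheaf by a closed congruence is built in one step: its sections are
  the congruence classes that are only locally inhabited.
\<close>

definition quo :: "('u \<Rightarrow> 'a set) \<Rightarrow> ('u \<Rightarrow> 'a \<Rightarrow> 'a) \<Rightarrow> ('u \<times> 'a \<times> 'a) set \<Rightarrow> 'u \<Rightarrow> ('u \<times> 'a) set set" where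
  "quo Q r E c = {A. A \<subseteq> (SIGMA h:into c. Q (src S h)) \<and>
     (\<forall>h q g. (h, q) \<in> A \<longrightarrow> g \<in> into (src S h) \<longrightarrow> (h \<odot> g, r g q) \<in> A) \<and>
     (\<forall>h q q'. (h, q) \<in> A \<longrightarrow> (h, q') \<in> A \<longrightarrow> (src S h, q, q') \<in> E) \<and>
     (\<forall>h q q'. (h, q) \<in> A \<longrightarrow> (src S h, q, q') \<in> E \<longrightarrow> (h, q') \<in> A) \<and>
     (\<forall>h\<in>into c. \<forall>q\<in>Q (src S h). lcov (src S h) (\<lambda>g. (h \<odot> g, r g q) \<in> A) \<longrightarrow> (h, q) \<in> A) \<and>
     lcov c (\<lambda>h. \<exists>q. (h, q) \<in> A)}"

definition quo_res :: "('u \<Rightarrow> 'a set) \<Rightarrow> 'u \<Rightarrow> ('u \<times> 'a) set \<Rightarrow> ('u \<times> 'a) set" where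
  "quo_res Q f A = {(g, q). g \<in> into (src S f) \<and> q \<in> Q (src S g) \<and> (f \<odot> g, q) \<in> A}"

definition quo_map :: "('u \<Rightarrow> 'a set) \<Rightarrow> ('u \<Rightarrow> 'a \<Rightarrow> 'a) \<Rightarrow> ('u \<times> 'a \<times> 'a) set \<Rightarrow> 'u \<Rightarrow> 'a \<Rightarrow> ('u \<times> 'a) set" where
  "quo_map Q r E c q = {(h, q'). h \<in> into c \<and> (src S h, r h q, q') \<in> E}"

context
  fixes Q :: "'u \<Rightarrow> 'a set" and r E
  assumes Q: "presheaf Q r" and E: "closed_congruence Q r E"
begin

lemma quoD:
  assumes "A \<in> quo Q r E c"
  shows "(h, q) \<in> A \<Longrightarrow> h \<in> into c \<and> q \<in> Q (src S h)"
    and "(h, q) \<in> A \<Longrightarrow> g \<in> into (src S h) \<Longrightarrow> (h \<odot> g, r g q) \<in> A"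
    and "(h, q) \<in> A \<Longrightarrow> (h, q') \<in> A \<Longrightarrow> (src S h, q, q') \<in> E"
    and "(h, q) \<in> A \<Longrightarrow> (src S h, q, q') \<in> E \<Longrightarrow> (h, q') \<in> A"
    and "h \<in> into c \<Longrightarrow> q \<in> Q (src S h) \<Longrightarrow> lcov (src S h) (\<lambda>g. (h \<odot> g, r g q) \<in> A) \<Longrightarrow> (h, q) \<in> A"
    and "lcov c (\<lambda>h. \<exists>q. (h, q) \<in> A)"
  using assms unfolding quo_def by blast+

lemma quoI:
  assumes "\<And>h q. (h, q) \<in> A \<Longrightarrow> h \<in> into c \<and> q \<in> Q (src S h)"
    and "\<And>h q g. (h, q) \<in> A \<Longrightarrow> g \<in> into (src S h) \<Longrightarrow> (h \<odot> g, r g q) \<in> A"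
    and "\<And>h q q'. (h, q) \<in> A \<Longrightarrow> (h, q') \<in> A \<Longrightarrow> (src S h, q, q') \<in> E"
    and "\<And>h q q'. (h, q) \<in> A \<Longrightarrow> (src S h, q, q') \<in> E \<Longrightarrow> (h, q') \<in> A"
    and "\<And>h q. h \<in> into c \<Longrightarrow> q \<in> Q (src S h) \<Longrightarrow> lcov (src S h) (\<lambda>g. (h \<odot> g, r g q) \<in> A) \<Longrightarrow> (h, q) \<in> A"
    and "lcov c (\<lambda>h. \<exists>q. (h, q) \<in> A)"
  shows "A \<in> quo Q r E c"
  unfolding quo_def
  apply (intro CollectI conjI allI impI ballI subsetI)
  subgoal for x using assms(1) by (cases x) auto
  subgoal by (rule assms(2))
  subgoal by (rule assms(3))
  subgoal by (rule assms(4))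
  subgoal by (rule assms(5))
  subgoal by (rule assms(6))
  done

lemma quo_map_mem:
  assumes c: "c \<in> ob S" and q: "q \<in> Q c" shows "quo_map Q r E c q \<in> quo Q r E c"
proof (rule quoI)
  fix h p g assume *: "(h, p) \<in> quo_map Q r E c q" and g: "g \<in> into (src S h)"
  then show "(h \<odot> g, r g p) \<in> quo_map Q r E c q"
    using cc_res[OF E g] presheaf_cmp[OF Q _ g q] by (auto simp: quo_map_def)
next
  fix h p assume h: "h \<in> into c" and p: "p \<in> Q (src S h)"
    and l: "lcov (src S h) (\<lambda>g. (h \<odot> g, r g p) \<in> quo_map Q r E c q)"
  have "(src S h, r h q, p) \<in> E"
    by (rule cc_local[OF E src_ob[OF h] presheaf_mem[OF Q h q] p], rule lcov_mono[OF src_ob[OF h] l])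
      (use h presheaf_cmp[OF Q h _ q] in \<open>auto simp: quo_map_def\<close>)
  then show "(h, p) \<in> quo_map Q r E c q" using h by (auto simp: quo_map_def)
next
  show "lcov c (\<lambda>h. \<exists>p. (h, p) \<in> quo_map Q r E c q)"
  proof (rule lcov_top[OF c])
    fix h assume h: "h \<in> into c"
    then have "(h, r h q) \<in> quo_map Q r E c q"
      using cc_refl[OF E src_ob[OF h] presheaf_mem[OF Q h q]] by (simp add: quo_map_def)
    then show "\<exists>p. (h, p) \<in> quo_map Q r E c q" ..
  qed
next
  fix h p assume "(h, p) \<in> quo_map Q r E c q"
  then show "h \<in> into c \<and> p \<in> Q (src S h)" using cc_mem[OF E] unfolding quo_map_def by blast
next
  fix h p p' assume "(h, p) \<in> quo_map Q r E c q" "(h, p') \<in> quo_map Q r E c q"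
  then show "(src S h, p, p') \<in> E" using cc_trans[OF E cc_sym[OF E]] unfolding quo_map_def by blast
next
  fix h p p' assume "(h, p) \<in> quo_map Q r E c q" "(src S h, p, p') \<in> E"
  then show "(h, p') \<in> quo_map Q r E c q" using cc_trans[OF E] unfolding quo_map_def by blast
qed

lemma quo_res_mem:
  assumes f: "f \<in> into c" and A: "A \<in> quo Q r E c"
  shows "quo_res Q f A \<in> quo Q r E (src S f)"
proof (rule quoI)
  fix h q g assume "(h, q) \<in> quo_res Q f A" and g: "g \<in> into (src S h)"
  then show "(h \<odot> g, r g q) \<in> quo_res Q f A"
    using f presheaf_mem[OF Q g] quoD(2)[OF A, of "f \<odot> h" q g] by (auto simp: quo_res_def cmp_assoc)
next
  fix h q q' assume "(h, q) \<in> quo_res Q f A" "(h, q') \<in> quo_res Q f A"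
  then show "(src S h, q, q') \<in> E" using f quoD(3)[OF A, of "f \<odot> h" q q'] by (auto simp: quo_res_def)
next
  fix h q q' assume "(h, q) \<in> quo_res Q f A" "(src S h, q, q') \<in> E"
  then show "(h, q') \<in> quo_res Q f A" using f cc_mem[OF E] quoD(4)[OF A, of "f \<odot> h" q q'] by (auto simp: quo_res_def)
next
  fix h q assume h: "h \<in> into (src S f)" and q: "q \<in> Q (src S h)"
    and l: "lcov (src S h) (\<lambda>g. (h \<odot> g, r g q) \<in> quo_res Q f A)"
  have "lcov (src S h) (\<lambda>g. (f \<odot> h \<odot> g, r g q) \<in> A)"
    by (rule lcov_mono[OF src_ob[OF h] l]) (use f h in \<open>auto simp: quo_res_def cmp_assoc\<close>)
  then show "(h, q) \<in> quo_res Q f A" using quoD(5)[OF A cmp_into[OF f h], of q] f h q by (auto simp: quo_res_def)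
next
  show "lcov (src S f) (\<lambda>h. \<exists>q. (h, q) \<in> quo_res Q f A)"
    by (rule lcov_mono[OF src_ob[OF f] lcov_pull[OF f quoD(6)[OF A]]])
      (use f quoD(1)[OF A] in \<open>fastforce simp: quo_res_def\<close>)
qed (auto simp: quo_res_def)

lemma presheaf_quo: "presheaf (quo Q r E) (quo_res Q)"
  unfolding presheaf_def
proof (intro conjI allI ballI)
  fix c f A assume "f \<in> into c" "A \<in> quo Q r E c"
  then show "quo_res Q f A \<in> quo Q r E (src S f)" by (rule quo_res_mem)
next
  fix c A assume "c \<in> ob S" and A: "A \<in> quo Q r E c"
  then show "quo_res Q (ide S c) A = A" using quoD(1)[OF A] by (auto simp: quo_res_def)
next
  fix c f g A assume "f \<in> into c" "g \<in> into (src S f)" "A \<in> quo Q r E c"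
  then show "quo_res Q (f \<odot> g) A = quo_res Q g (quo_res Q f A)" by (auto simp: quo_res_def cmp_assoc)
qed

lemma quo_res_iff:
  assumes A: "A \<in> quo Q r E c" and f: "f \<in> into c" and q: "q \<in> Q (src S f)"
  shows "(ide S (src S f), q) \<in> quo_res Q f A \<longleftrightarrow> (f, q) \<in> A"
  using assms src_ob[OF f] by (auto simp: quo_res_def)

text \<open>A pair in \<open>A\<close> lies in \<open>B\<close> after restriction to a cover, and
  \<open>B\<close> is closed under local membership. One inclusion is proved so that it can be used
  in both directions.\<close>

lemma quo_sep:
  assumes c: "c \<in> ob S" and A: "A \<in> quo Q r E c" and B: "B \<in> quo Q r E c"
    and R: "R \<in> J c" and eq: "\<And>f. f \<in> R \<Longrightarrow> quo_res Q f A = quo_res Q f B"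
  shows "A \<subseteq> B"
proof clarify
  fix f q assume fq: "(f, q) \<in> A"
  then have f: "f \<in> into c" and q: "q \<in> Q (src S f)" using quoD(1)[OF A] by auto
  have "lcov c (\<lambda>h. quo_res Q h A = quo_res Q h B)" using R eq by (auto simp: lcov_def)
  from lcov_pull[OF f this] have "lcov (src S f) (\<lambda>g. (f \<odot> g, r g q) \<in> B)"
  proof (rule lcov_mono[OF src_ob[OF f]])
    fix g assume g: "g \<in> into (src S f)" and eq: "quo_res Q (f \<odot> g) A = quo_res Q (f \<odot> g) B"
    show "(f \<odot> g, r g q) \<in> B"
      using quo_res_iff[OF A cmp_into[OF f g], of "r g q"] quo_res_iff[OF B cmp_into[OF f g], of "r g q"] eq
        quoD(2)[OF A fq g] presheaf_mem[OF Q g q] f g by simp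
  qed
  then show "(f, q) \<in> B" using quoD(5)[OF B f q] by blast
qed

text \<open>The union of the given classes need not contain a pair that belongs to it only locally.
  The glued class is therefore the local closure of that union.\<close>

lemma quo_glue:
  assumes c: "c \<in> ob S" and R: "R \<in> J c" and x: "\<And>f. f \<in> R \<Longrightarrow> x f \<in> quo Q r E (src S f)"
    and m: "\<And>f g. f \<in> R \<Longrightarrow> g \<in> into (src S f) \<Longrightarrow> quo_res Q g (x f) = x (f \<odot> g)"
  shows "\<exists>A\<in>quo Q r E c. \<forall>f\<in>R. quo_res Q f A = x f"
proof -
  \<comment> \<open>\<open>q\<close> represents the given section at \<open>h\<close>, read off at
    the identity arrow of the source of \<open>h\<close>. The matching condition makes this the same
    as membership at any arrow through which \<open>h\<close> is reached from
    \<open>R\<close>.\<close>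
  define I where "I h q \<longleftrightarrow> h \<in> R \<and> (ide S (src S h), q) \<in> x h" for h q
  define A where "A = {(h, q). h \<in> into c \<and> q \<in> Q (src S h) \<and> lcov (src S h) (\<lambda>g. I (h \<odot> g) (r g q))}"
  note Ri = J_into[OF c R]
  have I: "I (f \<odot> g) q \<longleftrightarrow> (g, q) \<in> x f" if f: "f \<in> R" and g: "g \<in> into (src S f)" and q: "q \<in> Q (src S g)" for f g q
    unfolding I_def using m[OF f g] quo_res_iff[OF x[OF f] g q] J_cmp[OF c R f g] src_cmp[OF Ri[OF f] g] by auto
  have I_src: "(src S h, q, q) \<in> E \<and> h \<in> R \<and> h \<in> into c \<and> q \<in> Q (src S h)" if "I h q" for h q
    using that quoD(1)[OF x[of h], of "ide S (src S h)" q] cc_refl[OF E] src_ob Ri[of h] unfolding I_def by auto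
  have I_st: "I (h \<odot> g) (r g q)" if i: "I h q" and g: "g \<in> into (src S h)" for h q g
  proof -
    have h: "h \<in> R" "h \<in> into c" "q \<in> Q (src S h)" using i I_src by auto
    then have "(g, r g q) \<in> x h" using i g quoD(2)[OF x[OF h(1)], of "ide S (src S h)" q g] src_ob[OF h(2)]
      by (auto simp: I_def)
    then show ?thesis using I h g presheaf_mem[OF Q g h(3)] by auto
  qed
  have I_E: "(src S h, q, q') \<in> E" if "I h q" "I h q'" for h q q'
  proof -
    have "h \<in> R" "h \<in> into c" using that I_src by auto
    with that show ?thesis using quoD(3)[OF x[of h], of "ide S (src S h)" q q'] src_ob[of h c] by (auto simp: I_def)
  qed
  have I_sat: "I h q'" if "I h q" "(src S h, q, q') \<in> E" for h q q'
  proof -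
    have "h \<in> R" "h \<in> into c" using that I_src by auto
    with that show ?thesis using quoD(4)[OF x[of h], of "ide S (src S h)" q q'] src_ob[of h c] by (auto simp: I_def)
  qed
  have A: "A \<in> quo Q r E c"
  proof (rule quoI)
    fix h q g assume "(h, q) \<in> A" and g: "g \<in> into (src S h)"
    then have h: "h \<in> into c" and q: "q \<in> Q (src S h)" and l: "lcov (src S h) (\<lambda>g. I (h \<odot> g) (r g q))" by (auto simp: A_def)
    have "lcov (src S g) (\<lambda>k. I (h \<odot> g \<odot> k) (r k (r g q)))"
      by (rule lcov_mono[OF src_ob[OF g] lcov_pull[OF g l]]) (use h g q in \<open>simp add: cmp_assoc presheaf_cmp[OF Q g]\<close>)
    then show "(h \<odot> g, r g q) \<in> A" using h g q presheaf_mem[OF Q g q] by (auto simp: A_def)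
  next
    fix h q q' assume "(h, q) \<in> A" "(h, q') \<in> A"
    then have h: "h \<in> into c" and q: "q \<in> Q (src S h)" "q' \<in> Q (src S h)"
      and l: "lcov (src S h) (\<lambda>g. I (h \<odot> g) (r g q))" "lcov (src S h) (\<lambda>g. I (h \<odot> g) (r g q'))" by (auto simp: A_def)
    show "(src S h, q, q') \<in> E"
      by (rule cc_local[OF E src_ob[OF h] q], rule lcov_mp[OF src_ob[OF h] l])
        (use I_E h in \<open>fastforce\<close>)
  next
    fix h q q' assume "(h, q) \<in> A" and e: "(src S h, q, q') \<in> E"
    then have h: "h \<in> into c" and q: "q \<in> Q (src S h)" "q' \<in> Q (src S h)"
      and l: "lcov (src S h) (\<lambda>g. I (h \<odot> g) (r g q))" using cc_mem[OF E e] by (auto simp: A_def)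
    have "lcov (src S h) (\<lambda>g. I (h \<odot> g) (r g q'))"
      by (rule lcov_mono[OF src_ob[OF h] l]) (use I_sat h cc_res[OF E _ e] in auto)
    then show "(h, q') \<in> A" using h q by (auto simp: A_def)
  next
    fix h q assume h: "h \<in> into c" and q: "q \<in> Q (src S h)" and l: "lcov (src S h) (\<lambda>g. (h \<odot> g, r g q) \<in> A)"
    have "lcov (src S h) (\<lambda>g. I (h \<odot> g) (r g q))"
    proof (rule lcov_trans[OF src_ob[OF h]], rule lcov_mono[OF src_ob[OF h] l])
      fix g assume g: "g \<in> into (src S h)" and "(h \<odot> g, r g q) \<in> A"
      then have l: "lcov (src S g) (\<lambda>k. I (h \<odot> g \<odot> k) (r k (r g q)))" using h by (auto simp: A_def)
      show "lcov (src S g) (\<lambda>k. I (h \<odot> (g \<odot> k)) (r (g \<odot> k) q))"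
        by (rule lcov_mono[OF src_ob[OF g] l]) (use h g q in \<open>simp add: cmp_assoc presheaf_cmp[OF Q g]\<close>)
    qed
    then show "(h, q) \<in> A" using h q by (auto simp: A_def)
  next
    show "lcov c (\<lambda>h. \<exists>q. (h, q) \<in> A)"
    proof (rule lcov_trans[OF c], unfold lcov_def[of c], intro bexI[OF _ R] ballI)
      fix f assume f: "f \<in> R"
      note fi = Ri[OF f]
      show "lcov (src S f) (\<lambda>g. \<exists>q. (f \<odot> g, q) \<in> A)"
      proof (rule lcov_mono[OF src_ob[OF fi] quoD(6)[OF x[OF f]]])
        fix g assume g: "g \<in> into (src S f)" and "\<exists>q. (g, q) \<in> x f"
        then obtain q where q: "(g, q) \<in> x f" by blast
        then have qm: "q \<in> Q (src S g)" using quoD(1)[OF x[OF f]] by blast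
        have i: "I (f \<odot> g) q" using I[OF f g qm] q by simp
        have "lcov (src S g) (\<lambda>k. I (f \<odot> g \<odot> k) (r k q))"
          by (rule lcov_top[OF src_ob[OF g]]) (use I_st[OF i] fi g in auto)
        then show "\<exists>q. (f \<odot> g, q) \<in> A" using fi g qm by (auto simp: A_def)
      qed
    qed
  qed (auto simp: A_def)
  moreover have "quo_res Q f A = x f" if f: "f \<in> R" for f
  proof -
    note fi = Ri[OF f]
    have "(g, q) \<in> quo_res Q f A \<longleftrightarrow> (g, q) \<in> x f" if g: "g \<in> into (src S f)" and q: "q \<in> Q (src S g)" for g q
    proof -
      have i: "I (f \<odot> g \<odot> k) (r k q) \<longleftrightarrow> (g \<odot> k, r k q) \<in> x f" if k: "k \<in> into (src S g)" for k
        using I[OF f cmp_into[OF g k], of "r k q"] g k q presheaf_mem[OF Q k q] fi by (simp add: cmp_assoc)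
      have "(g, q) \<in> quo_res Q f A \<longleftrightarrow> lcov (src S g) (\<lambda>k. I (f \<odot> g \<odot> k) (r k q))"
        using fi g q by (auto simp: quo_res_def A_def)
      also have "\<dots> \<longleftrightarrow> lcov (src S g) (\<lambda>k. (g \<odot> k, r k q) \<in> x f)"
        by (intro iffI; erule lcov_mono[OF src_ob[OF g]]) (use i in auto)
      also have "\<dots> \<longleftrightarrow> (g, q) \<in> x f"
        using quoD(5)[OF x[OF f] g q] lcov_top[OF src_ob[OF g], of "\<lambda>k. (g \<odot> k, r k q) \<in> x f"]
          quoD(2)[OF x[OF f], of g q] by iprover
      finally show ?thesis .
    qed
    then show ?thesis using quoD(1)[OF x[OF f]] unfolding quo_res_def by blast
  qed
  ultimately show ?thesis by blast
qed

lemma sheaf_quo: "sheaf (quo Q r E) (quo_res Q)"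
  unfolding sheaf_def
proof (intro conjI presheaf_quo ballI allI impI)
  fix c R x assume c: "c \<in> ob S" and R: "R \<in> J c"
    and x: "\<forall>f\<in>R. x f \<in> quo Q r E (src S f)" and m: "\<forall>f\<in>R. \<forall>g\<in>into (src S f). quo_res Q g (x f) = x (f \<odot> g)"
  obtain A where A: "A \<in> quo Q r E c" "\<forall>f\<in>R. quo_res Q f A = x f" using quo_glue[OF c R, of x] x m by blast
  show "\<exists>!y. y \<in> quo Q r E c \<and> (\<forall>f\<in>R. quo_res Q f y = x f)"
  proof (rule ex1I[of _ A])
    fix B assume "B \<in> quo Q r E c \<and> (\<forall>f\<in>R. quo_res Q f B = x f)"
    then have B: "B \<in> quo Q r E c" "\<And>f. f \<in> R \<Longrightarrow> quo_res Q f B = quo_res Q f A" using A by simp_all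
    show "B = A" using quo_sep[OF c A(1) B(1) R] quo_sep[OF c B(1) A(1) R] B(2) by auto
  qed (use A in auto)
qed

lemma nmap_quo: "nmap Q r (quo Q r E) (quo_res Q) (quo_map Q r E)"
  unfolding nmap_def
proof (intro conjI allI ballI)
  fix c f q assume "f \<in> into c" "q \<in> Q c"
  then show "quo_map Q r E (src S f) (r f q) = quo_res Q f (quo_map Q r E c q)"
    using presheaf_cmp[OF Q] cc_mem[OF E] by (fastforce simp: quo_map_def quo_res_def)
qed (rule quo_map_mem)

lemma quo_map_eq_iff:
  assumes c: "c \<in> ob S" and q: "q \<in> Q c" "q' \<in> Q c"
  shows "quo_map Q r E c q = quo_map Q r E c q' \<longleftrightarrow> (c, q, q') \<in> E"
proof
  assume "quo_map Q r E c q = quo_map Q r E c q'"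
  moreover have "(ide S c, q') \<in> quo_map Q r E c q'"
    using c q cc_refl[OF E] presheaf_ide[OF Q] by (auto simp: quo_map_def)
  ultimately have "(ide S c, q') \<in> quo_map Q r E c q" by simp
  then show "(c, q, q') \<in> E" using c q presheaf_ide[OF Q] by (auto simp: quo_map_def)
next
  assume "(c, q, q') \<in> E"
  then show "quo_map Q r E c q = quo_map Q r E c q'"
    unfolding quo_map_def using cc_res[OF E] cc_sym[OF E] cc_trans[OF E] by blast
qed

text \<open>Once a representative \<open>q\<close> of \<open>A\<close> exists at \<open>h\<close>,
  the restriction of \<open>A\<close> along \<open>h\<close> is the class of \<open>q\<close>; and a
  section of the quotient is locally inhabited by construction.\<close>

lemma lsurj_quo: "lsurj Q (quo Q r E) (quo_res Q) (quo_map Q r E)"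
  unfolding lsurj_def
proof (intro ballI)
  fix c A assume c: "c \<in> ob S" and A: "A \<in> quo Q r E c"
  show "lcov c (\<lambda>h. \<exists>q\<in>Q (src S h). quo_map Q r E (src S h) q = quo_res Q h A)"
  proof (rule lcov_mono[OF c quoD(6)[OF A]])
    fix h assume h: "h \<in> into c" and "\<exists>q. (h, q) \<in> A"
    then obtain q where q: "(h, q) \<in> A" by blast
    have "quo_map Q r E (src S h) q = quo_res Q h A"
    proof (intro Set.set_eqI, goal_cases)
      case (1 gp)
      obtain g p where gp: "gp = (g, p)" by fastforce
      have "(h \<odot> g, p) \<in> A \<longleftrightarrow> (src S g, r g q, p) \<in> E" if g: "g \<in> into (src S h)"
      proof -
        have m: "(h \<odot> g, r g q) \<in> A" using quoD(2)[OF A q g] .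
        show ?thesis
          using quoD(3)[OF A m, of p] quoD(4)[OF A m, of p] src_cmp[OF h g] by metis
      qed
      then show ?case unfolding gp
        using cc_mem[OF E] by (auto simp: quo_map_def quo_res_def)
    qed
    then show "\<exists>q\<in>Q (src S h). quo_map Q r E (src S h) q = quo_res Q h A" using quoD(1)[OF A q] by blast
  qed
qed

lemma small_quo:
  assumes "\<And>c. c \<in> ob S \<Longrightarrow> sm (Q c)" shows "sm (quo Q r E c)"
proof -
  have "sm (SIGMA h:into c. Q (src S h))"
    by (rule small_Sigma) (use small_subset[OF small_ar, of "into c"] assms src_ob in \<open>auto simp: into_def\<close>)
  then show ?thesis by (rule small_subset[OF small_Pow]) (auto simp: quo_def)
qed

end

end

section \<open>Arrows of a category\<close>

lemma ex1_eq: "P x \<Longrightarrow> P y \<Longrightarrow> \<exists>!x. P x \<Longrightarrow> x = y"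
  by blast

locale category_locale =
  fixes C :: "('o, 'm) cat"
  assumes category: "category C"
begin

abbreviation cmpC (infixl \<open>\<bullet>\<close> 70) where "f \<bullet> g \<equiv> f \<cdot>\<^bsub>C\<^esub> g"

lemma homD: "f \<in> hom C X Y \<Longrightarrow> f \<in> ar C \<and> src C f = X \<and> tgt C f = Y \<and> X \<in> ob C \<and> Y \<in> ob C"
  using category by (auto simp: category_def hom_def)

lemma ar_hom: "f \<in> ar C \<Longrightarrow> f \<in> hom C (src C f) (tgt C f)"
  by (simp add: hom_def)

lemma cmp_hom: "f \<in> hom C X Y \<Longrightarrow> g \<in> hom C Y Z \<Longrightarrow> g \<bullet> f \<in> hom C X Z"
  using category by (auto simp: category_def hom_def)

lemma ide_hom: "X \<in> ob C \<Longrightarrow> ide C X \<in> hom C X X"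
  using category by (auto simp: category_def hom_def)

lemma assoc: "f \<in> hom C X Y \<Longrightarrow> g \<in> hom C Y Z \<Longrightarrow> h \<in> hom C Z W \<Longrightarrow> h \<bullet> (g \<bullet> f) = (h \<bullet> g) \<bullet> f"
  using category by (auto simp: category_def hom_def)

lemma ide_left: "f \<in> hom C X Y \<Longrightarrow> ide C Y \<bullet> f = f"
  and ide_right: "f \<in> hom C X Y \<Longrightarrow> f \<bullet> ide C X = f"
  using category by (auto simp: category_def hom_def)

lemma monoD: "m \<in> mono_arrows C \<Longrightarrow> m \<in> hom C X Y \<Longrightarrow> f \<in> hom C W X \<Longrightarrow> g \<in> hom C W X \<Longrightarrow>
    m \<bullet> f = m \<bullet> g \<Longrightarrow> f = g"
  by (auto simp: mono_arrows_def hom_def)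

lemma monoI:
  assumes "m \<in> hom C X Y" "\<And>W f g. f \<in> hom C W X \<Longrightarrow> g \<in> hom C W X \<Longrightarrow> m \<bullet> f = m \<bullet> g \<Longrightarrow> f = g"
  shows "m \<in> mono_arrows C"
  using assms by (auto simp: mono_arrows_def hom_def)

lemma epiD: "e \<in> epi_arrows C \<Longrightarrow> e \<in> hom C X Y \<Longrightarrow> f \<in> hom C Y W \<Longrightarrow> g \<in> hom C Y W \<Longrightarrow>
    f \<bullet> e = g \<bullet> e \<Longrightarrow> f = g"
  by (auto simp: epi_arrows_def hom_def)

lemma epiI:
  assumes "e \<in> hom C X Y" "\<And>W f g. f \<in> hom C Y W \<Longrightarrow> g \<in> hom C Y W \<Longrightarrow> f \<bullet> e = g \<bullet> e \<Longrightarrow> f = g"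
  shows "e \<in> epi_arrows C"
  using assms by (auto simp: epi_arrows_def hom_def)

lemma isoI: "f \<in> hom C X Y \<Longrightarrow> g \<in> hom C Y X \<Longrightarrow> g \<bullet> f = ide C X \<Longrightarrow> f \<bullet> g = ide C Y \<Longrightarrow> iso C f"
  by (auto simp: iso_def hom_def)

lemma isoE:
  assumes "iso C f" "f \<in> hom C X Y"
  obtains g where "g \<in> hom C Y X" "g \<bullet> f = ide C X" "f \<bullet> g = ide C Y"
  using assms by (auto simp: iso_def hom_def)

lemma iso_ide: "X \<in> ob C \<Longrightarrow> iso C (ide C X)"
  using isoI[of "ide C X" X X "ide C X"] ide_hom ide_left by blast

lemma split_mono_mono:
  assumes f: "f \<in> hom C X Y" and g: "g \<in> hom C Y X" and gf: "g \<bullet> f = ide C X"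
  shows "f \<in> mono_arrows C"
proof (rule monoI[OF f])
  fix W u v assume u: "u \<in> hom C W X" and v: "v \<in> hom C W X" and e: "f \<bullet> u = f \<bullet> v"
  have "u = (g \<bullet> f) \<bullet> u" using gf ide_left u by simp
  also have "\<dots> = g \<bullet> (f \<bullet> v)" using assoc[OF u f g] e by simp
  also have "\<dots> = v" using assoc[OF v f g] gf ide_left v by simp
  finally show "u = v" .
qed

lemma split_epi_epi:
  assumes f: "f \<in> hom C X Y" and g: "g \<in> hom C Y X" and fg: "f \<bullet> g = ide C Y"
  shows "f \<in> epi_arrows C"
proof (rule epiI[OF f])
  fix W u v assume u: "u \<in> hom C Y W" and v: "v \<in> hom C Y W" and e: "u \<bullet> f = v \<bullet> f"
  have "u = u \<bullet> (f \<bullet> g)" using fg ide_right u by simp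
  also have "\<dots> = (v \<bullet> f) \<bullet> g" using assoc[OF g f u] e by simp
  also have "\<dots> = v" using assoc[OF g f v] fg ide_right v by simp
  finally show "u = v" .
qed

lemma iso_mono: "iso C f \<Longrightarrow> f \<in> mono_arrows C"
  using split_mono_mono unfolding iso_def hom_def by blast

lemma iso_epi: "iso C f \<Longrightarrow> f \<in> epi_arrows C"
  using split_epi_epi unfolding iso_def hom_def by blast

lemma mono_cmp:
  assumes f: "f \<in> mono_arrows C" "f \<in> hom C X Y" and g: "g \<in> mono_arrows C" "g \<in> hom C Y Z"
  shows "g \<bullet> f \<in> mono_arrows C"
proof (rule monoI[OF cmp_hom[OF f(2) g(2)]])
  fix W u v assume u: "u \<in> hom C W X" "v \<in> hom C W X" "(g \<bullet> f) \<bullet> u = (g \<bullet> f) \<bullet> v"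
  then have "g \<bullet> (f \<bullet> u) = g \<bullet> (f \<bullet> v)" using assoc[OF _ f(2) g(2)] by simp
  then show "u = v" using monoD[OF g] monoD[OF f] cmp_hom[OF _ f(2)] u by blast
qed

lemma epi_cmp:
  assumes f: "f \<in> epi_arrows C" "f \<in> hom C X Y" and g: "g \<in> epi_arrows C" "g \<in> hom C Y Z"
  shows "g \<bullet> f \<in> epi_arrows C"
proof (rule epiI[OF cmp_hom[OF f(2) g(2)]])
  fix W u v assume u: "u \<in> hom C Z W" "v \<in> hom C Z W" "u \<bullet> (g \<bullet> f) = v \<bullet> (g \<bullet> f)"
  then have "(u \<bullet> g) \<bullet> f = (v \<bullet> g) \<bullet> f" using assoc[OF f(2) g(2)] by simp
  then show "u = v" using epiD[OF g] epiD[OF f] cmp_hom[OF g(2)] u by blast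
qed

lemma iso_if_split_mono_epi:
  assumes f: "f \<in> hom C X Y" "f \<in> epi_arrows C" and g: "g \<in> hom C Y X" and gf: "g \<bullet> f = ide C X"
  shows "iso C f"
proof (rule isoI[OF f(1) g gf])
  have "(f \<bullet> g) \<bullet> f = ide C Y \<bullet> f"
    using assoc[OF f(1) g f(1)] gf ide_right[OF f(1)] ide_left[OF f(1)] by simp
  then show "f \<bullet> g = ide C Y"
    using epiD[OF f(2) f(1)] cmp_hom[OF g f(1)] ide_hom homD[OF f(1)] by blast
qed

lemma iso_if_split_epi_mono:
  assumes f: "f \<in> hom C X Y" "f \<in> mono_arrows C" and g: "g \<in> hom C Y X" and fg: "f \<bullet> g = ide C Y"
  shows "iso C f"
proof (rule isoI[OF f(1) g _ fg])
  have "f \<bullet> (g \<bullet> f) = f \<bullet> ide C X"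
    using assoc[OF f(1) g f(1)] fg ide_right[OF f(1)] ide_left[OF f(1)] by simp
  then show "g \<bullet> f = ide C X"
    using monoD[OF f(2) f(1)] cmp_hom[OF f(1) g] ide_hom homD[OF f(1)] by blast
qed

lemma pullbackI:
  assumes "m \<in> hom C A Z" "n \<in> hom C B Z" "p \<in> hom C P A" "q \<in> hom C P B" "m \<bullet> p = n \<bullet> q"
    and "\<And>W f g. f \<in> hom C W A \<Longrightarrow> g \<in> hom C W B \<Longrightarrow> m \<bullet> f = n \<bullet> g \<Longrightarrow> \<exists>!h. h \<in> hom C W P \<and> p \<bullet> h = f \<and> q \<bullet> h = g"
  shows "is_pullback C m n p q"
  unfolding is_pullback_def
proof (intro conjI ballI impI)
  fix f g assume "f \<in> ar C" "g \<in> ar C" "src C f = src C g" "tgt C f = src C m" "tgt C g = src C n" "m \<bullet> f = n \<bullet> g"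
  then show "\<exists>!h. h \<in> hom C (src C f) (src C p) \<and> p \<bullet> h = f \<and> q \<bullet> h = g"
    using assms(6)[of f "src C f" g] assms(1-5) by (simp add: hom_def)
qed (use assms(1-5) in \<open>simp_all add: hom_def\<close>)

lemma pullbackD:
  assumes "is_pullback C m n p q" "m \<in> hom C A Z"
  obtains B P where "n \<in> hom C B Z" "p \<in> hom C P A" "q \<in> hom C P B" "m \<bullet> p = n \<bullet> q"
    "\<And>W f g. f \<in> hom C W A \<Longrightarrow> g \<in> hom C W B \<Longrightarrow> m \<bullet> f = n \<bullet> g \<Longrightarrow> \<exists>!h. h \<in> hom C W P \<and> p \<bullet> h = f \<and> q \<bullet> h = g"
proof
  show "n \<in> hom C (src C n) Z" "p \<in> hom C (src C p) A" "q \<in> hom C (src C p) (src C n)" "m \<bullet> p = n \<bullet> q"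
    using assms unfolding is_pullback_def hom_def by auto
  have D: "\<forall>f\<in>ar C. \<forall>g\<in>ar C. src C f = src C g \<longrightarrow> tgt C f = src C m \<longrightarrow> tgt C g = src C n \<longrightarrow>
      m \<bullet> f = n \<bullet> g \<longrightarrow> (\<exists>!h. h \<in> hom C (src C f) (src C p) \<and> p \<bullet> h = f \<and> q \<bullet> h = g)"
    using assms(1) unfolding is_pullback_def by (elim conjE) assumption
  fix W f g assume "f \<in> hom C W A" "g \<in> hom C W (src C n)" "m \<bullet> f = n \<bullet> g"
  then show "\<exists>!h. h \<in> hom C W (src C p) \<and> p \<bullet> h = f \<and> q \<bullet> h = g"
    using D[rule_format, of f g] assms(2) by (simp add: hom_def)
qed

lemma pushoutI:
  assumes "d \<in> hom C X A" "e \<in> hom C X B" "p \<in> hom C A P" "q \<in> hom C B P" "p \<bullet> d = q \<bullet> e"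
    and "\<And>W f g. f \<in> hom C A W \<Longrightarrow> g \<in> hom C B W \<Longrightarrow> f \<bullet> d = g \<bullet> e \<Longrightarrow> \<exists>!h. h \<in> hom C P W \<and> h \<bullet> p = f \<and> h \<bullet> q = g"
  shows "is_pushout C d e p q"
  unfolding is_pushout_def
proof (intro conjI ballI impI)
  fix f g assume "f \<in> ar C" "g \<in> ar C" "tgt C f = tgt C g" "src C f = tgt C d" "src C g = tgt C e" "f \<bullet> d = g \<bullet> e"
  then show "\<exists>!h. h \<in> hom C (tgt C p) (tgt C f) \<and> h \<bullet> p = f \<and> h \<bullet> q = g"
    using assms(6)[of f "tgt C f" g] assms(1-5) by (simp add: hom_def)
qed (use assms(1-5) in \<open>simp_all add: hom_def\<close>)

lemma pushoutD:
  assumes "is_pushout C d e p q" "d \<in> hom C X A"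
  obtains B P where "e \<in> hom C X B" "p \<in> hom C A P" "q \<in> hom C B P" "p \<bullet> d = q \<bullet> e"
    "\<And>W f g. f \<in> hom C A W \<Longrightarrow> g \<in> hom C B W \<Longrightarrow> f \<bullet> d = g \<bullet> e \<Longrightarrow> \<exists>!h. h \<in> hom C P W \<and> h \<bullet> p = f \<and> h \<bullet> q = g"
proof
  show "e \<in> hom C X (tgt C e)" "p \<in> hom C A (tgt C p)" "q \<in> hom C (tgt C e) (tgt C p)" "p \<bullet> d = q \<bullet> e"
    using assms unfolding is_pushout_def hom_def by auto
  have D: "\<forall>f\<in>ar C. \<forall>g\<in>ar C. tgt C f = tgt C g \<longrightarrow> src C f = tgt C d \<longrightarrow> src C g = tgt C e \<longrightarrow>
      f \<bullet> d = g \<bullet> e \<longrightarrow> (\<exists>!h. h \<in> hom C (tgt C p) (tgt C f) \<and> h \<bullet> p = f \<and> h \<bullet> q = g)"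
    using assms(1) unfolding is_pushout_def by (elim conjE) assumption
  fix W f g assume "f \<in> hom C A W" "g \<in> hom C (tgt C e) W" "f \<bullet> d = g \<bullet> e"
  then show "\<exists>!h. h \<in> hom C (tgt C p) W \<and> h \<bullet> p = f \<and> h \<bullet> q = g"
    using D[rule_format, of f g] assms(2) by (simp add: hom_def)
qed

end

section \<open>Closed congruences as kernels, intersections and closures\<close>

context site
begin

definition kernel_of :: "('u \<Rightarrow> 'a set) \<Rightarrow> ('u \<Rightarrow> 'a \<Rightarrow> 'b) \<Rightarrow> ('u \<times> 'a \<times> 'a) set" where
  "kernel_of Q \<phi> = {(c, x, y). c \<in> ob S \<and> x \<in> Q c \<and> y \<in> Q c \<and> \<phi> c x = \<phi> c y}"

lemma closed_congruence_kernel: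
  assumes Q: "presheaf Q r" and Y: "sheaf Y t" and \<phi>: "nmap Q r Y t \<phi>"
  shows "closed_congruence Q r (kernel_of Q \<phi>)"
  unfolding closed_congruence_def
proof (intro conjI allI ballI impI)
  fix c x y f assume "f \<in> into c" "(c, x, y) \<in> kernel_of Q \<phi>"
  then show "(src S f, r f x, r f y) \<in> kernel_of Q \<phi>"
    using presheaf_mem[OF Q] nmap_nat[OF \<phi>] src_ob[of f c] by (simp add: kernel_of_def)
next
  fix c x y assume c: "c \<in> ob S" and x: "x \<in> Q c" and y: "y \<in> Q c"
    and l: "lcov c (\<lambda>h. (src S h, r h x, r h y) \<in> kernel_of Q \<phi>)"
  have "\<phi> c x = \<phi> c y"
  proof (rule sheaf_sep[OF Y c])
    show "\<phi> c x \<in> Y c" "\<phi> c y \<in> Y c" using nmap_mem[OF \<phi> c] x y by auto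
    show "lcov c (\<lambda>h. t h (\<phi> c x) = t h (\<phi> c y))"
      by (rule lcov_mono[OF c l]) (simp add: kernel_of_def nmap_nat[OF \<phi> _ x] nmap_nat[OF \<phi> _ y])
  qed
  then show "(c, x, y) \<in> kernel_of Q \<phi>" using c x y by (simp add: kernel_of_def)
qed (auto simp: kernel_of_def)

text \<open>A nonempty family is required so that the intersection consists of pairs of sections of
  \<open>Q\<close>; the empty intersection would contain all triples of the type.\<close>

lemma closed_congruence_Inter:
  assumes ne: "\<E> \<noteq> {}" and E: "\<And>E. E \<in> \<E> \<Longrightarrow> closed_congruence Q r E"
  shows "closed_congruence Q r (\<Inter>\<E>)"
  unfolding closed_congruence_def
proof (intro conjI allI ballI impI)
  fix c x y assume "(c, x, y) \<in> \<Inter>\<E>"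
  then obtain E where "E \<in> \<E>" "(c, x, y) \<in> E" using ne by blast
  then show "c \<in> ob S" "x \<in> Q c" "y \<in> Q c" using cc_mem[OF E] by blast+
next
  fix c x y assume c: "c \<in> ob S" and x: "x \<in> Q c" and y: "y \<in> Q c"
    and l: "lcov c (\<lambda>h. (src S h, r h x, r h y) \<in> \<Inter>\<E>)"
  show "(c, x, y) \<in> \<Inter>\<E>"
  proof
    fix A assume A: "A \<in> \<E>"
    show "(c, x, y) \<in> A"
      by (rule cc_local[OF E[OF A] c x y], rule lcov_mono[OF c l]) (use A in blast)
  qed
qed (use E[THEN cc_refl] E[THEN cc_sym] E[THEN cc_trans] E[THEN cc_res] in blast)+

lemma closed_congruence_Int:
  "closed_congruence Q r A \<Longrightarrow> closed_congruence Q r B \<Longrightarrow> closed_congruence Q r (A \<inter> B)"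
  using closed_congruence_Inter[of "{A, B}"] by auto

lemma closed_congruence_full:
  assumes "presheaf Q r"
  shows "closed_congruence Q r {(c, x, y). c \<in> ob S \<and> x \<in> Q c \<and> y \<in> Q c}"
  unfolding closed_congruence_def using presheaf_mem[OF assms] src_ob by blast

definition generated :: "('u \<Rightarrow> 'a set) \<Rightarrow> ('u \<Rightarrow> 'a \<Rightarrow> 'a) \<Rightarrow> ('u \<times> 'a \<times> 'a) set \<Rightarrow> ('u \<times> 'a \<times> 'a) set" where
  "generated Q r A = \<Inter>{E. closed_congruence Q r E \<and> A \<subseteq> E}"

lemma generated_closed:
  assumes "presheaf Q r" "\<And>c x y. (c, x, y) \<in> A \<Longrightarrow> c \<in> ob S \<and> x \<in> Q c \<and> y \<in> Q c"
  shows "closed_congruence Q r (generated Q r A)"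
  unfolding generated_def
proof (rule closed_congruence_Inter)
  have "{(c, x, y). c \<in> ob S \<and> x \<in> Q c \<and> y \<in> Q c} \<in> {E. closed_congruence Q r E \<and> A \<subseteq> E}"
    using closed_congruence_full[OF assms(1)] assms(2) by auto
  then show "{E. closed_congruence Q r E \<and> A \<subseteq> E} \<noteq> {}" by blast
qed simp

lemma generated_upper: "A \<subseteq> generated Q r A"
  by (auto simp: generated_def)

lemma generated_least: "closed_congruence Q r E \<Longrightarrow> A \<subseteq> E \<Longrightarrow> generated Q r A \<subseteq> E"
  by (auto simp: generated_def)

end


section \<open>The category of sheaves\<close>

text \<open>
  A topos is handled through its equivalence with sheaves: \<open>el X c\<close> and \<open>res X\<close> are the sections
  and restrictions of the sheaf of an object \<open>X\<close>, and \<open>ap f c\<close> is the component of an arrow \<open>f\<close>.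
\<close>

locale sheaf_topos = site U S J + category_locale T
  for U :: "'u \<Rightarrow> 'u set" and S J and T :: "('o, 'm) cat" +
  fixes el :: "'o \<Rightarrow> 'u \<Rightarrow> 'u set" and res :: "'o \<Rightarrow> 'u \<Rightarrow> 'u \<Rightarrow> 'u" and ap :: "'m \<Rightarrow> 'u \<Rightarrow> 'u \<Rightarrow> 'u"
  assumes el_sheaf: "X \<in> ob T \<Longrightarrow> sheaf (el X) (res X)"
    and el_small: "X \<in> ob T \<Longrightarrow> c \<in> ob S \<Longrightarrow> sm (el X c)"
    and ap_nmap: "f \<in> hom T X Y \<Longrightarrow> nmap (el X) (res X) (el Y) (res Y) (ap f)"
    and ap_cmp: "f \<in> hom T X Y \<Longrightarrow> g \<in> hom T Y Z \<Longrightarrow> c \<in> ob S \<Longrightarrow> x \<in> el X c \<Longrightarrow>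
      ap (g \<cdot>\<^bsub>T\<^esub> f) c x = ap g c (ap f c x)"
    and ap_ide: "X \<in> ob T \<Longrightarrow> c \<in> ob S \<Longrightarrow> x \<in> el X c \<Longrightarrow> ap (ide T X) c x = x"
    and ap_eqI: "f \<in> hom T X Y \<Longrightarrow> g \<in> hom T X Y \<Longrightarrow>
      (\<And>c x. c \<in> ob S \<Longrightarrow> x \<in> el X c \<Longrightarrow> ap f c x = ap g c x) \<Longrightarrow> f = g"
    and ap_full: "X \<in> ob T \<Longrightarrow> Y \<in> ob T \<Longrightarrow> nmap (el X) (res X) (el Y) (res Y) \<phi> \<Longrightarrow>
      \<exists>f\<in>hom T X Y. \<forall>c\<in>ob S. \<forall>x\<in>el X c. ap f c x = \<phi> c x"
    and el_full: "sheaf (Q :: 'u \<Rightarrow> 'u set) r \<Longrightarrow> (\<And>c. c \<in> ob S \<Longrightarrow> sm (Q c)) \<Longrightarrow>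
      \<exists>X\<in>ob T. \<exists>\<beta>. nmap Q r (el X) (res X) \<beta> \<and> (\<forall>c\<in>ob S. bij_betw (\<beta> c) (Q c) (el X c))"
begin

abbreviation cmpT (infixl \<open>\<bullet>\<close> 70) where "f \<bullet> g \<equiv> f \<cdot>\<^bsub>T\<^esub> g"

lemma el_presheaf: "X \<in> ob T \<Longrightarrow> presheaf (el X) (res X)"
  using el_sheaf sheaf_presheaf by blast

lemma ap_mem: "f \<in> hom T X Y \<Longrightarrow> c \<in> ob S \<Longrightarrow> x \<in> el X c \<Longrightarrow> ap f c x \<in> el Y c"
  using ap_nmap nmap_mem by metis

lemma ap_nat: "f \<in> hom T X Y \<Longrightarrow> h \<in> into c \<Longrightarrow> x \<in> el X c \<Longrightarrow> ap f (src S h) (res X h x) = res Y h (ap f c x)"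
  using ap_nmap nmap_nat by metis

abbreviation epic :: "'m \<Rightarrow> bool" where
  "epic f \<equiv> lsurj (el (src T f)) (el (tgt T f)) (res (tgt T f)) (ap f)"

abbreviation monic :: "'m \<Rightarrow> bool" where
  "monic f \<equiv> \<forall>c\<in>ob S. inj_on (ap f c) (el (src T f) c)"

text \<open>Sections of the quotient sheaf are sets of pairs over an arbitrary type. Smallness
  allows each set of sections to be recoded in \<open>'u\<close>, the sheaf structure is transported
  along the coding, and \<open>el_full\<close> turns the result into an object of
  \<open>T\<close>.\<close>

lemma quotient_object:
  fixes Q :: "'u \<Rightarrow> 'a set"
  assumes Q: "presheaf Q r" and E: "closed_congruence Q r E" and Qs: "\<And>c. c \<in> ob S \<Longrightarrow> sm (Q c)"
  obtains X \<phi> where "X \<in> ob T" "nmap Q r (el X) (res X) \<phi>" "lsurj Q (el X) (res X) \<phi>"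
    "\<And>c x y. c \<in> ob S \<Longrightarrow> x \<in> Q c \<Longrightarrow> y \<in> Q c \<Longrightarrow> \<phi> c x = \<phi> c y \<longleftrightarrow> (c, x, y) \<in> E"
proof -
  note small = small_quo[OF Q E Qs] and sh = sheaf_quo[OF Q E]
  note psh = sheaf_presheaf[OF sh]
  have "\<forall>c. \<exists>f. inj_on f (quo Q r E c) \<and> (\<exists>a. bij_betw f (quo Q r E c) (U a))"
    using small_bij[OF small] by (meson bij_betw_def)
  then obtain enc :: "'u \<Rightarrow> ('u \<times> 'a) set \<Rightarrow> 'u" and a where enc: "\<And>c. bij_betw (enc c) (quo Q r E c) (U (a c))" by metis
  define dec where "dec c = inv_into (quo Q r E c) (enc c)" for c
  define Q' where "Q' c = U (a c)" for c
  \<comment> \<open>A restriction map receives only the arrow, so the fibre in which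
    \<open>x\<close> lives is recovered as the target of \<open>f\<close>.\<close>
  define r' where "r' f x = enc (src S f) (quo_res Q f (dec (tgt S f) x))" for f x
  have dec: "dec c x \<in> quo Q r E c" "enc c (dec c x) = x" if "x \<in> Q' c" for c x
    using that enc[of c] unfolding dec_def Q'_def by (auto simp: bij_betw_def inv_into_into f_inv_into_f)
  have enc': "enc c A \<in> Q' c" "dec c (enc c A) = A" if "A \<in> quo Q r E c" for c A
    using that enc[of c] unfolding dec_def Q'_def by (auto simp: bij_betw_def)
  have tg: "tgt S f = c" if "f \<in> into c" for f c using that by (simp add: into_def)
  have r': "r' f x \<in> Q' (src S f)" "dec (src S f) (r' f x) = quo_res Q f (dec c x)" if "f \<in> into c" "x \<in> Q' c" for f c x
    unfolding r'_def tg[OF that(1)] using enc' presheaf_mem[OF psh that(1)] dec that by auto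
  have dinj: "x = y" if "x \<in> Q' c" "y \<in> Q' c" "dec c x = dec c y" for c x y
    using dec that by metis
  have psh': "presheaf Q' r'"
    unfolding presheaf_def
  proof (intro conjI allI ballI)
    fix c x assume c: "c \<in> ob S" and x: "x \<in> Q' c"
    show "r' (ide S c) x = x"
      unfolding r'_def using c dec[OF x] presheaf_ide[OF psh c] tg[OF ide_into[OF c]] by simp
  next
    fix c f g x assume f: "f \<in> into c" and g: "g \<in> into (src S f)" and x: "x \<in> Q' c"
    show "r' (f \<odot> g) x = r' g (r' f x)"
    proof (rule dinj[of _ "src S g"])
      show "r' (f \<odot> g) x \<in> Q' (src S g)" using r'(1)[OF cmp_into[OF f g] x] src_cmp[OF f g] by simp
      show "r' g (r' f x) \<in> Q' (src S g)" using r'(1)[OF g r'(1)[OF f x]] .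
      show "dec (src S g) (r' (f \<odot> g) x) = dec (src S g) (r' g (r' f x))"
        using r'(2)[OF cmp_into[OF f g] x] r'(2)[OF g r'(1)[OF f x]] r'(2)[OF f x]
          src_cmp[OF f g] presheaf_cmp[OF psh f g dec(1)[OF x]] by simp
    qed
  qed (use r' in auto)
  have sh': "sheaf Q' r'"
    unfolding sheaf_def
  proof (intro conjI psh' ballI allI impI)
    fix c R x assume c: "c \<in> ob S" and R: "R \<in> J c" and x: "\<forall>f\<in>R. x f \<in> Q' (src S f)"
      and m: "\<forall>f\<in>R. \<forall>g\<in>into (src S f). r' g (x f) = x (f \<odot> g)"
    note Ri = J_into[OF c R]
    have "\<exists>!A. A \<in> quo Q r E c \<and> (\<forall>f\<in>R. quo_res Q f A = dec (src S f) (x f))"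
    proof (rule sh[unfolded sheaf_def, THEN conjunct2, rule_format, OF c R])
      show "dec (src S f) (x f) \<in> quo Q r E (src S f)" if "f \<in> R" for f using x dec that by auto
      show "quo_res Q g (dec (src S f) (x f)) = dec (src S (f \<odot> g)) (x (f \<odot> g))"
        if f: "f \<in> R" and g: "g \<in> into (src S f)" for f g
        using r'(2)[OF g] x m f g src_cmp[OF Ri[OF f] g] by metis
    qed
    then obtain A where A': "A \<in> quo Q r E c \<and> (\<forall>f\<in>R. quo_res Q f A = dec (src S f) (x f))"
      and uA: "\<forall>B. B \<in> quo Q r E c \<and> (\<forall>f\<in>R. quo_res Q f B = dec (src S f) (x f)) \<longrightarrow> B = A"
      by (rule ex1E)
    have A: "A \<in> quo Q r E c" "\<And>f. f \<in> R \<Longrightarrow> quo_res Q f A = dec (src S f) (x f)" using A' by simp_all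
    show "\<exists>!y. y \<in> Q' c \<and> (\<forall>f\<in>R. r' f y = x f)"
    proof (rule ex1I[of _ "enc c A"])
      have "r' f (enc c A) = x f" if f: "f \<in> R" for f
      proof (rule dinj[of _ "src S f"])
        show "r' f (enc c A) \<in> Q' (src S f)" using r'(1)[OF Ri[OF f] enc'(1)[OF A(1)]] .
        show "x f \<in> Q' (src S f)" using x f by blast
        show "dec (src S f) (r' f (enc c A)) = dec (src S f) (x f)"
          using r'(2)[OF Ri[OF f] enc'(1)[OF A(1)]] enc'(2)[OF A(1)] A(2)[OF f] by simp
      qed
      then show "enc c A \<in> Q' c \<and> (\<forall>f\<in>R. r' f (enc c A) = x f)" using enc' A by auto
      fix y assume y: "y \<in> Q' c \<and> (\<forall>f\<in>R. r' f y = x f)"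
      have "dec c y = A"
        by (rule uA[rule_format], intro conjI ballI)
          (use dec(1) y in blast, use y r'(2)[OF Ri, of _ y] in metis)
      then show "y = enc c A" using dec(2) y by auto
    qed
  qed
  obtain X \<beta> where X: "X \<in> ob T" and \<beta>: "nmap Q' r' (el X) (res X) \<beta>" "\<And>c. c \<in> ob S \<Longrightarrow> bij_betw (\<beta> c) (Q' c) (el X c)"
    using el_full[OF sh'] Q'_def small_U by metis
  define \<phi> where "\<phi> c q = enc c (quo_map Q r E c q)" for c q
  note qm = quo_map_mem[OF Q E]
  have \<phi>: "nmap Q r Q' r' \<phi>"
    unfolding nmap_def
  proof (intro conjI allI ballI)
    fix c f q assume f: "f \<in> into c" and q: "q \<in> Q c"
    show "\<phi> (src S f) (r f q) = r' f (\<phi> c q)"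
      unfolding \<phi>_def r'_def tg[OF f] using enc'(2)[OF qm[OF into_ob[OF f] q]] nmap_nat[OF nmap_quo[OF Q E] f q] by simp
  qed (use enc' qm in \<open>auto simp: \<phi>_def\<close>)
  show ?thesis
  proof (rule that[OF X nmap_comp[OF \<phi> \<beta>(1)]])
    show "lsurj Q (el X) (res X) (\<lambda>c x. \<beta> c (\<phi> c x))"
      unfolding lsurj_def
    proof (intro ballI)
      fix c x assume c: "c \<in> ob S" and x: "x \<in> el X c"
      have "x \<in> \<beta> c ` Q' c" using bij_betw_imp_surj_on[OF \<beta>(2)[OF c]] x by simp
      then obtain y where y: "y \<in> Q' c" "\<beta> c y = x" by blast
      show "lcov c (\<lambda>h. \<exists>q\<in>Q (src S h). \<beta> (src S h) (\<phi> (src S h) q) = res X h x)"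
      proof (rule lcov_mono[OF c lsurjD[OF lsurj_quo[OF Q E] c dec(1)[OF y(1)]]])
        fix h assume h: "h \<in> into c" and "\<exists>q\<in>Q (src S h). quo_map Q r E (src S h) q = quo_res Q h (dec c y)"
        then obtain q where q: "q \<in> Q (src S h)" "quo_map Q r E (src S h) q = quo_res Q h (dec c y)" by blast
        then have "\<phi> (src S h) q = r' h y" unfolding \<phi>_def r'_def tg[OF h] by simp
        then have "\<beta> (src S h) (\<phi> (src S h) q) = res X h x" using nmap_nat[OF \<beta>(1) h y(1)] y(2) by simp
        then show "\<exists>q\<in>Q (src S h). \<beta> (src S h) (\<phi> (src S h) q) = res X h x" using q(1) by blast
      qed
    qed
    fix c x y assume c: "c \<in> ob S" and x: "x \<in> Q c" and y: "y \<in> Q c"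
    have "\<beta> c (\<phi> c x) = \<beta> c (\<phi> c y) \<longleftrightarrow> \<phi> c x = \<phi> c y"
      using inj_on_eq_iff[OF bij_betw_imp_inj_on[OF \<beta>(2)[OF c]]] nmap_mem[OF \<phi> c] x y by blast
    also have "\<dots> \<longleftrightarrow> quo_map Q r E c x = quo_map Q r E c y"
      unfolding \<phi>_def using enc'(2)[OF qm[OF c x]] enc'(2)[OF qm[OF c y]] by metis
    also have "\<dots> \<longleftrightarrow> (c, x, y) \<in> E" by (rule quo_map_eq_iff[OF Q E c x y])
    finally show "\<beta> c (\<phi> c x) = \<beta> c (\<phi> c y) \<longleftrightarrow> (c, x, y) \<in> E" .
  qed
qed

text \<open>For building arrows out of objects obtained from \<open>quotient_object\<close>: the
  factorization through \<open>\<phi>\<close> is a map of sheaves, and fullness makes it an arrow of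
  \<open>T\<close>.\<close>

lemma arrow_from_presheaf:
  assumes "presheaf Q r" "X \<in> ob T" "Y \<in> ob T" "nmap Q r (el X) (res X) \<phi>" "lsurj Q (el X) (res X) \<phi>"
    "nmap Q r (el Y) (res Y) \<psi>"
    "\<And>c q q'. c \<in> ob S \<Longrightarrow> q \<in> Q c \<Longrightarrow> q' \<in> Q c \<Longrightarrow> \<phi> c q = \<phi> c q' \<Longrightarrow> \<psi> c q = \<psi> c q'"
  obtains f where "f \<in> hom T X Y" "\<And>c q. c \<in> ob S \<Longrightarrow> q \<in> Q c \<Longrightarrow> ap f c (\<phi> c q) = \<psi> c q"
proof -
  obtain \<theta> where \<theta>: "nmap (el X) (res X) (el Y) (res Y) \<theta>" "\<And>c q. c \<in> ob S \<Longrightarrow> q \<in> Q c \<Longrightarrow> \<theta> c (\<phi> c q) = \<psi> c q"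
    using factor_through_lsurj[OF assms(1) el_presheaf[OF assms(2)] el_sheaf[OF assms(3)] assms(4-7)] by blast
  obtain f where f: "f \<in> hom T X Y" "\<And>c x. c \<in> ob S \<Longrightarrow> x \<in> el X c \<Longrightarrow> ap f c x = \<theta> c x"
    using ap_full[OF assms(2,3) \<theta>(1)] by blast
  show ?thesis
    by (rule that[OF f(1)]) (simp add: f(2) \<theta>(2) nmap_mem[OF assms(4)])
qed

lemma arrow_ext_lsurj:
  assumes "presheaf Q r" "lsurj Q (el X) (res X) \<phi>" "f \<in> hom T X Y" "g \<in> hom T X Y"
    "\<And>c q. c \<in> ob S \<Longrightarrow> q \<in> Q c \<Longrightarrow> ap f c (\<phi> c q) = ap g c (\<phi> c q)"
  shows "f = g"
  using ap_eqI[OF assms(3,4)] lsurj_unique[OF assms(1) el_presheaf el_sheaf assms(2) ap_nmap[OF assms(3)] ap_nmap[OF assms(4)] assms(5)]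
    homD[OF assms(3)] by blast

section \<open>Isomorphisms, monomorphisms and epimorphisms in terms of sections\<close>

lemma bijective_iso:
  assumes f: "f \<in> hom T X Y" and b: "\<And>c. c \<in> ob S \<Longrightarrow> bij_betw (ap f c) (el X c) (el Y c)"
  shows "iso T f"
proof -
  have X: "X \<in> ob T" and Y: "Y \<in> ob T" using homD[OF f] by auto
  have "nmap (el Y) (res Y) (el X) (res X) (\<lambda>c. inv_into (el X c) (ap f c))"
    unfolding nmap_def
  proof (intro conjI allI ballI)
    fix c y assume "c \<in> ob S" "y \<in> el Y c"
    then show "inv_into (el X c) (ap f c) y \<in> el X c" using b by (metis bij_betw_def inv_into_into)
  next
    fix c h y assume h: "h \<in> into c" and y: "y \<in> el Y c"
    obtain x where x: "x \<in> el X c" "y = ap f c x" using b[OF into_ob[OF h]] y by (auto simp: bij_betw_def)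
    have "res Y h y = ap f (src S h) (res X h x)" using ap_nat[OF f h] x by simp
    then show "inv_into (el X (src S h)) (ap f (src S h)) (res Y h y) = res X h (inv_into (el X c) (ap f c) y)"
      using b[OF into_ob[OF h]] b[OF src_ob[OF h]] x presheaf_mem[OF el_presheaf[OF X] h]
      by (simp add: bij_betw_def)
  qed
  then obtain g where g: "g \<in> hom T Y X" "\<And>c y. c \<in> ob S \<Longrightarrow> y \<in> el Y c \<Longrightarrow> ap g c y = inv_into (el X c) (ap f c) y"
    using ap_full[OF Y X] by blast
  show ?thesis
  proof (rule isoI[OF f g(1)])
    show "g \<bullet> f = ide T X"
      by (rule ap_eqI[OF cmp_hom[OF f g(1)] ide_hom[OF X]])
        (use b in \<open>simp add: ap_cmp[OF f g(1)] ap_ide[OF X] g(2) ap_mem[OF f] bij_betw_def\<close>)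
    show "f \<bullet> g = ide T Y"
      by (rule ap_eqI[OF cmp_hom[OF g(1) f] ide_hom[OF Y]])
        (use b in \<open>simp add: ap_cmp[OF g(1) f] ap_ide[OF Y] g(2) bij_betw_def f_inv_into_f\<close>)
  qed
qed

lemma iso_bijective:
  assumes i: "iso T f" and f: "f \<in> hom T X Y" and c: "c \<in> ob S"
  shows "bij_betw (ap f c) (el X c) (el Y c)"
proof -
  obtain g where g: "g \<in> hom T Y X" "g \<bullet> f = ide T X" "f \<bullet> g = ide T Y" using isoE[OF i f] .
  have X: "X \<in> ob T" and Y: "Y \<in> ob T" using homD[OF f] by auto
  show ?thesis
  proof (rule bij_betw_byWitness[of _ "ap g c"])
    show "\<forall>a\<in>el X c. ap g c (ap f c a) = a" using ap_cmp[OF f g(1) c] ap_ide[OF X c] g(2) by simp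
    show "\<forall>a\<in>el Y c. ap f c (ap g c a) = a" using ap_cmp[OF g(1) f c] ap_ide[OF Y c] g(3) by simp
  qed (use ap_mem[OF f c] ap_mem[OF g(1) c] in auto)
qed

text \<open>The kernel pair of \<open>f\<close> is presented by the presheaf of pairs of sections
  with equal images. A monomorphism cannot distinguish its two projections, so the components of
  every such pair coincide.\<close>

lemma mono_iff: "f \<in> mono_arrows T \<longleftrightarrow> f \<in> ar T \<and> monic f"
proof (intro iffI conjI ballI)
  assume m: "f \<in> mono_arrows T"
  then show "f \<in> ar T" by (simp add: mono_arrows_def)
  then have f: "f \<in> hom T (src T f) (tgt T f)" by (rule ar_hom)
  let ?X = "src T f" and ?Y = "tgt T f"
  have X: "?X \<in> ob T" and Y: "?Y \<in> ob T" using homD[OF f] by auto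
  define Q where "Q c = {(x, x'). x \<in> el ?X c \<and> x' \<in> el ?X c \<and> ap f c x = ap f c x'}" for c
  define r where "r h = map_prod (res ?X h) (res ?X h)" for h
  note pX = el_presheaf[OF X]
  have Q: "presheaf Q r"
    unfolding presheaf_def Q_def r_def
    by (auto simp: presheaf_mem[OF pX] presheaf_ide[OF pX] presheaf_cmp[OF pX] ap_nat[OF f])
  have n1: "nmap Q r (el ?X) (res ?X) (\<lambda>c. fst)" and n2: "nmap Q r (el ?X) (res ?X) (\<lambda>c. snd)"
    by (auto simp: nmap_def Q_def r_def)
  have sQ: "sm (Q c)" if "c \<in> ob S" for c
    by (rule small_subset[OF small_Times[OF el_small[OF X that] el_small[OF X that]]]) (auto simp: Q_def)
  \<comment> \<open>This intersection is the diagonal. It is written with kernels of maps into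
    sheaves so that closedness is automatic.\<close>
  have cc: "closed_congruence Q r (kernel_of Q (\<lambda>c. fst) \<inter> kernel_of Q (\<lambda>c. snd))"
    by (intro closed_congruence_Int closed_congruence_kernel[OF Q el_sheaf[OF X]] n1 n2)
  obtain Z \<phi> where Z: "Z \<in> ob T" and \<phi>: "nmap Q r (el Z) (res Z) \<phi>" "lsurj Q (el Z) (res Z) \<phi>"
    "\<And>c x y. c \<in> ob S \<Longrightarrow> x \<in> Q c \<Longrightarrow> y \<in> Q c \<Longrightarrow> \<phi> c x = \<phi> c y \<longleftrightarrow> (c, x, y) \<in> kernel_of Q (\<lambda>c. fst) \<inter> kernel_of Q (\<lambda>c. snd)"
    by (rule quotient_object[OF Q cc]) (rule sQ, assumption, rule that)
  obtain u where u: "u \<in> hom T Z ?X" "\<And>c q. c \<in> ob S \<Longrightarrow> q \<in> Q c \<Longrightarrow> ap u c (\<phi> c q) = fst q"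
    by (rule arrow_from_presheaf[OF Q Z X \<phi>(1,2) n1]) (use \<phi>(3) in \<open>auto simp: kernel_of_def\<close>)
  obtain v where v: "v \<in> hom T Z ?X" "\<And>c q. c \<in> ob S \<Longrightarrow> q \<in> Q c \<Longrightarrow> ap v c (\<phi> c q) = snd q"
    by (rule arrow_from_presheaf[OF Q Z X \<phi>(1,2) n2]) (use \<phi>(3) in \<open>auto simp: kernel_of_def\<close>)
  have "f \<bullet> u = f \<bullet> v"
    by (rule arrow_ext_lsurj[OF Q \<phi>(2) cmp_hom[OF u(1) f] cmp_hom[OF v(1) f]])
      (use u(2) v(2) nmap_mem[OF \<phi>(1)] in \<open>simp add: ap_cmp[OF u(1) f] ap_cmp[OF v(1) f] Q_def split_beta\<close>)
  then have uv: "u = v" using monoD[OF m f u(1) v(1)] by blast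
  fix c assume c: "c \<in> ob S"
  show "inj_on (ap f c) (el ?X c)"
  proof (rule inj_onI)
    fix x x' assume "x \<in> el ?X c" "x' \<in> el ?X c" "ap f c x = ap f c x'"
    then have "(x, x') \<in> Q c" by (simp add: Q_def)
    then show "x = x'" using u(2)[OF c] v(2)[OF c] uv by fastforce
  qed
next
  assume *: "f \<in> ar T \<and> monic f"
  then have f: "f \<in> hom T (src T f) (tgt T f)" by (simp add: ar_hom)
  show "f \<in> mono_arrows T"
  proof (rule monoI[OF f])
    fix W u v assume u: "u \<in> hom T W (src T f)" and v: "v \<in> hom T W (src T f)" and e: "f \<bullet> u = f \<bullet> v"
    show "u = v"
    proof (rule ap_eqI[OF u v])
      fix c x assume c: "c \<in> ob S" and x: "x \<in> el W c"
      have "ap f c (ap u c x) = ap f c (ap v c x)" using ap_cmp[OF u f c x] ap_cmp[OF v f c x] e by simp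
      then show "ap u c x = ap v c x" using * c ap_mem[OF u c x] ap_mem[OF v c x] by (meson inj_onD)
    qed
  qed
qed

text \<open>
  That epimorphisms are locally surjective is read off two copies of the codomain glued along the
  local image.
\<close>

lemma epi_iff: "f \<in> epi_arrows T \<longleftrightarrow> f \<in> ar T \<and> epic f"
proof (intro iffI conjI)
  assume e: "f \<in> epi_arrows T"
  then show "f \<in> ar T" by (simp add: epi_arrows_def)
  then have f: "f \<in> hom T (src T f) (tgt T f)" by (rule ar_hom)
  let ?X = "src T f" and ?Y = "tgt T f"
  have X: "?X \<in> ob T" and Y: "?Y \<in> ob T" using homD[OF f] by auto
  note pY = el_presheaf[OF Y] and pX = el_presheaf[OF X]
  \<comment> \<open>\<open>y\<close> belongs to the local image of \<open>f\<close>. This predicate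
    is stable under restriction and itself local, which is what makes \<open>E\<close> a closed
    congruence.\<close>
  define L where "L c y = lcov c (\<lambda>h. \<exists>x\<in>el ?X (src S h). ap f (src S h) x = res ?Y h y)" for c y
  define Q where "Q c = el ?Y c \<times> (UNIV :: bool set)" for c
  define r where "r h = map_prod (res ?Y h) (\<lambda>b :: bool. b)" for h
  define E where "E = {(c, q, q'). c \<in> ob S \<and> q \<in> Q c \<and> q' \<in> Q c \<and> fst q = fst q' \<and> (snd q = snd q' \<or> L c (fst q))}"
  have Q: "presheaf Q r"
    unfolding presheaf_def Q_def r_def
    by (auto simp: presheaf_mem[OF pY] presheaf_ide[OF pY] presheaf_cmp[OF pY])
  have L_res: "L (src S h) (res ?Y h y)" if h: "h \<in> into c" and y: "y \<in> el ?Y c" and l: "L c y" for h c y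
    unfolding L_def
    by (rule lcov_mono[OF src_ob[OF h] lcov_pull[OF h l[unfolded L_def]]]) (use h y presheaf_cmp[OF pY h _ y] in auto)
  have L_loc: "L c y" if c: "c \<in> ob S" and y: "y \<in> el ?Y c" and l: "lcov c (\<lambda>h. L (src S h) (res ?Y h y))" for c y
    unfolding L_def
  proof (rule lcov_trans[OF c], rule lcov_mono[OF c l])
    fix h assume h: "h \<in> into c" and "L (src S h) (res ?Y h y)"
    then have l: "lcov (src S h) (\<lambda>g. \<exists>x\<in>el ?X (src S g). ap f (src S g) x = res ?Y g (res ?Y h y))"
      by (simp add: L_def)
    show "lcov (src S h) (\<lambda>g. \<exists>x\<in>el ?X (src S (h \<odot> g)). ap f (src S (h \<odot> g)) x = res ?Y (h \<odot> g) y)"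
      by (rule lcov_mono[OF src_ob[OF h] l]) (use h y presheaf_cmp[OF pY h _ y] in auto)
  qed
  have cc: "closed_congruence Q r E"
    unfolding closed_congruence_def
  proof (intro conjI allI ballI impI)
    fix c x y h assume h: "h \<in> into c" and "(c, x, y) \<in> E"
    then show "(src S h, r h x, r h y) \<in> E"
      using presheaf_mem[OF Q h] src_ob[OF h] L_res[OF h] by (auto simp: E_def r_def Q_def)
  next
    fix c x y assume c: "c \<in> ob S" and x: "x \<in> Q c" and y: "y \<in> Q c" and l: "lcov c (\<lambda>h. (src S h, r h x, r h y) \<in> E)"
    have xy: "fst x \<in> el ?Y c" "fst y \<in> el ?Y c" using x y by (auto simp: Q_def)
    have xy1: "fst x = fst y"
      by (rule sheaf_sep[OF el_sheaf[OF Y] c xy], rule lcov_mono[OF c l]) (simp add: E_def r_def)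
    have "L c (fst x)" if "snd x \<noteq> snd y"
      by (rule L_loc[OF c xy(1)], rule lcov_mono[OF c l]) (use that xy1 in \<open>simp add: E_def r_def\<close>)
    then show "(c, x, y) \<in> E" using c x y xy1 unfolding E_def by blast
  qed (auto simp: E_def)
  have sQ: "sm (Q c)" if "c \<in> ob S" for c
    unfolding Q_def by (rule small_Times[OF el_small[OF Y that] small_bool])
  obtain Z \<phi> where Z: "Z \<in> ob T" and \<phi>: "nmap Q r (el Z) (res Z) \<phi>" "lsurj Q (el Z) (res Z) \<phi>"
    "\<And>c x y. c \<in> ob S \<Longrightarrow> x \<in> Q c \<Longrightarrow> y \<in> Q c \<Longrightarrow> \<phi> c x = \<phi> c y \<longleftrightarrow> (c, x, y) \<in> E"
    by (rule quotient_object[OF Q cc]) (rule sQ, assumption, rule that)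
  have nb: "nmap (el ?Y) (res ?Y) (el Z) (res Z) (\<lambda>c y. \<phi> c (y, b))" for b
    using \<phi>(1) unfolding nmap_def Q_def r_def by force
  obtain u where u: "u \<in> hom T ?Y Z" "\<And>c y. c \<in> ob S \<Longrightarrow> y \<in> el ?Y c \<Longrightarrow> ap u c y = \<phi> c (y, True)"
    using ap_full[OF Y Z nb] by blast
  obtain v where v: "v \<in> hom T ?Y Z" "\<And>c y. c \<in> ob S \<Longrightarrow> y \<in> el ?Y c \<Longrightarrow> ap v c y = \<phi> c (y, False)"
    using ap_full[OF Y Z nb] by blast
  have Lf: "L c (ap f c x)" if c: "c \<in> ob S" and x: "x \<in> el ?X c" for c x
    unfolding L_def
  proof (rule lcov_top[OF c])
    fix h assume h: "h \<in> into c"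
    show "\<exists>x'\<in>el ?X (src S h). ap f (src S h) x' = res ?Y h (ap f c x)"
      using ap_nat[OF f h x] presheaf_mem[OF pX h x] by blast
  qed
  have "u \<bullet> f = v \<bullet> f"
  proof (rule ap_eqI[OF cmp_hom[OF f u(1)] cmp_hom[OF f v(1)]])
    fix c x assume c: "c \<in> ob S" and x: "x \<in> el ?X c"
    have y: "ap f c x \<in> el ?Y c" using ap_mem[OF f c x] .
    then have "\<phi> c (ap f c x, True) = \<phi> c (ap f c x, False)"
      using \<phi>(3)[OF c] Lf[OF c x] c by (simp add: Q_def E_def)
    then show "ap (u \<bullet> f) c x = ap (v \<bullet> f) c x"
      using ap_cmp[OF f u(1) c x] ap_cmp[OF f v(1) c x] u(2)[OF c y] v(2)[OF c y] by simp
  qed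
  then have uv: "u = v" using epiD[OF e f u(1) v(1)] by blast
  show "epic f"
    unfolding lsurj_def
  proof (intro ballI)
    fix c y assume c: "c \<in> ob S" and y: "y \<in> el ?Y c"
    \<comment> \<open>Equality of the two inclusions forces both copies of \<open>y\<close> to be
      identified, which \<open>E\<close> allows only on the local image.\<close>
    have "(c, (y, True), (y, False)) \<in> E" 
      using \<phi>(3)[OF c, of "(y, True)" "(y, False)"] u(2)[OF c y] v(2)[OF c y] uv y by (simp add: Q_def)
    then show "lcov c (\<lambda>h. \<exists>q\<in>el ?X (src S h). ap f (src S h) q = res ?Y h y)"
      by (simp add: E_def L_def)
  qed
next
  assume *: "f \<in> ar T \<and> epic f"
  then have f: "f \<in> hom T (src T f) (tgt T f)" by (simp add: ar_hom)
  note X = homD[OF f]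
  show "f \<in> epi_arrows T"
  proof (rule epiI[OF f])
    fix W u v assume u: "u \<in> hom T (tgt T f) W" and v: "v \<in> hom T (tgt T f) W" and e: "u \<bullet> f = v \<bullet> f"
    show "u = v"
    proof (rule arrow_ext_lsurj[OF el_presheaf _ u v])
      show "lsurj (el (src T f)) (el (tgt T f)) (res (tgt T f)) (ap f)" using * by blast
      fix c q assume "c \<in> ob S" "q \<in> el (src T f) c"
      then show "ap u c (ap f c q) = ap v c (ap f c q)" using ap_cmp[OF f u] ap_cmp[OF f v] e by metis
    qed (use X in blast)
  qed
qed

end

section \<open>Factorizations, pullbacks and pushouts of sheaves\<close>

context sheaf_topos
begin

lemma mono_inj: "m \<in> mono_arrows T \<Longrightarrow> m \<in> hom T X Y \<Longrightarrow> c \<in> ob S \<Longrightarrow> x \<in> el X c \<Longrightarrow> x' \<in> el X c \<Longrightarrow>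
    ap m c x = ap m c x' \<Longrightarrow> x = x'"
  using mono_iff homD by (metis inj_onD)

lemma epi_lsurj: "e \<in> epi_arrows T \<Longrightarrow> e \<in> hom T X Y \<Longrightarrow> lsurj (el X) (el Y) (res Y) (ap e)"
  using epi_iff homD by metis

lemma monoI_inj:
  assumes "m \<in> hom T X Y" "\<And>c x x'. c \<in> ob S \<Longrightarrow> x \<in> el X c \<Longrightarrow> x' \<in> el X c \<Longrightarrow> ap m c x = ap m c x' \<Longrightarrow> x = x'"
  shows "m \<in> mono_arrows T"
  using assms homD[OF assms(1)] by (auto simp: mono_iff intro!: inj_onI)

lemma epiI_lsurj: "e \<in> hom T X Y \<Longrightarrow> lsurj (el X) (el Y) (res Y) (ap e) \<Longrightarrow> e \<in> epi_arrows T"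
  using homD by (auto simp: epi_iff)

lemma factor_through_epi:
  assumes f: "f \<in> hom T X Y" "f \<in> epi_arrows T" and g: "g \<in> hom T X Z"
    and ker: "\<And>c x x'. c \<in> ob S \<Longrightarrow> x \<in> el X c \<Longrightarrow> x' \<in> el X c \<Longrightarrow> ap f c x = ap f c x' \<Longrightarrow> ap g c x = ap g c x'"
  obtains h where "h \<in> hom T Y Z" "h \<bullet> f = g"
proof -
  have ob: "X \<in> ob T" "Y \<in> ob T" "Z \<in> ob T" using homD[OF f(1)] homD[OF g] by auto
  obtain h where h: "h \<in> hom T Y Z" "\<And>c x. c \<in> ob S \<Longrightarrow> x \<in> el X c \<Longrightarrow> ap h c (ap f c x) = ap g c x"
    by (rule arrow_from_presheaf[OF el_presheaf[OF ob(1)] ob(2,3) ap_nmap[OF f(1)] epi_lsurj[OF f(2,1)] ap_nmap[OF g]])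
      (rule ker, assumption+, rule that)
  have "h \<bullet> f = g"
    by (rule ap_eqI[OF cmp_hom[OF f(1) h(1)] g]) (simp add: ap_cmp[OF f(1) h(1)] h(2))
  with h(1) show ?thesis by (rule that)
qed

lemma kernel_closed: "f \<in> hom T X Y \<Longrightarrow> closed_congruence (el X) (res X) (kernel_of (el X) (ap f))"
  using closed_congruence_kernel[OF el_presheaf el_sheaf ap_nmap] homD by blast

text \<open>Together with \<open>kernel_closed\<close> this makes epimorphisms out of
  \<open>X\<close> a matter of closed congruences on its sections; images and pushouts are then
  computed on \<open>X\<close>.\<close>

lemma quotient_arrow:
  assumes X: "X \<in> ob T" and E: "closed_congruence (el X) (res X) E"
  obtains Y f where "f \<in> hom T X Y" "f \<in> epi_arrows T" 
    "\<And>c x y. c \<in> ob S \<Longrightarrow> x \<in> el X c \<Longrightarrow> y \<in> el X c \<Longrightarrow> ap f c x = ap f c y \<longleftrightarrow> (c, x, y) \<in> E"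
proof -
  obtain Y \<phi> where Y: "Y \<in> ob T" and \<phi>: "nmap (el X) (res X) (el Y) (res Y) \<phi>" "lsurj (el X) (el Y) (res Y) \<phi>"
    "\<And>c x y. c \<in> ob S \<Longrightarrow> x \<in> el X c \<Longrightarrow> y \<in> el X c \<Longrightarrow> \<phi> c x = \<phi> c y \<longleftrightarrow> (c, x, y) \<in> E"
    by (rule quotient_object[OF el_presheaf[OF X] E]) (rule el_small[OF X], assumption, rule that)
  obtain f where f: "f \<in> hom T X Y" "\<And>c x. c \<in> ob S \<Longrightarrow> x \<in> el X c \<Longrightarrow> ap f c x = \<phi> c x"
    using ap_full[OF X Y \<phi>(1)] by blast
  have "lsurj (el X) (el Y) (res Y) (ap f)"
    unfolding lsurj_def
  proof (intro ballI)
    fix c y assume c: "c \<in> ob S" and y: "y \<in> el Y c"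
    show "lcov c (\<lambda>h. \<exists>q\<in>el X (src S h). ap f (src S h) q = res Y h y)"
      by (rule lcov_mono[OF c lsurjD[OF \<phi>(2) c y]]) (simp add: f(2) src_ob)
  qed
  then have "f \<in> epi_arrows T" by (rule epiI_lsurj[OF f(1)])
  moreover have "ap f c x = ap f c y \<longleftrightarrow> (c, x, y) \<in> E" if "c \<in> ob S" "x \<in> el X c" "y \<in> el X c" for c x y
    using that by (simp add: f(2) \<phi>(3))
  ultimately show ?thesis using that f(1) by blast
qed

text \<open>The epimorphism is the quotient by the kernel of \<open>f\<close>. The remaining factor
  is injective because two sections of the quotient lift locally to \<open>X\<close>, where equal
  values under \<open>f\<close> mean equal classes.\<close>

lemma image_factorization:
  assumes f: "f \<in> hom T X Y"
  obtains I e m where "e \<in> hom T X I" "m \<in> hom T I Y" "e \<in> epi_arrows T" "m \<in> mono_arrows T" "m \<bullet> e = f"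
proof -
  have X: "X \<in> ob T" and Y: "Y \<in> ob T" using homD[OF f] by auto
  obtain I e where e: "e \<in> hom T X I" "e \<in> epi_arrows T"
    "\<And>c x y. c \<in> ob S \<Longrightarrow> x \<in> el X c \<Longrightarrow> y \<in> el X c \<Longrightarrow> ap e c x = ap e c y \<longleftrightarrow> (c, x, y) \<in> kernel_of (el X) (ap f)"
    by (rule quotient_arrow[OF X kernel_closed[OF f]]) (rule that)
  obtain m where m: "m \<in> hom T I Y" "m \<bullet> e = f"
    by (rule factor_through_epi[OF e(1,2) f]) (use e(3) in \<open>auto simp: kernel_of_def\<close>)
  have I: "I \<in> ob T" using homD[OF m(1)] by auto
  have "m \<in> mono_arrows T"
  proof (rule monoI_inj[OF m(1)])
    fix c z z' assume c: "c \<in> ob S" and z: "z \<in> el I c" "z' \<in> el I c" and eq: "ap m c z = ap m c z'"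
    note l = lsurjD[OF epi_lsurj[OF e(2,1)] c]
    show "z = z'"
    proof (rule sheaf_sep[OF el_sheaf[OF I] c z], rule lcov_mp[OF c l[OF z(1)] l[OF z(2)]])
      fix h assume h: "h \<in> into c"
        and "\<exists>q\<in>el X (src S h). ap e (src S h) q = res I h z" "\<exists>q\<in>el X (src S h). ap e (src S h) q = res I h z'"
      then obtain q q' where q: "q \<in> el X (src S h)" "ap e (src S h) q = res I h z"
        "q' \<in> el X (src S h)" "ap e (src S h) q' = res I h z'" by blast
      have d: "src S h \<in> ob S" using src_ob[OF h] .
      have "ap f (src S h) q = ap f (src S h) q'"
        using ap_cmp[OF e(1) m(1) d q(1)] ap_cmp[OF e(1) m(1) d q(3)] ap_nat[OF m(1) h z(1)] ap_nat[OF m(1) h z(2)]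
          q m(2) eq by simp
      then show "res I h z = res I h z'" using e(3)[OF d q(1,3)] q d by (simp add: kernel_of_def)
    qed
  qed
  then show ?thesis using that e m by blast
qed

text \<open>Sections identified by \<open>e\<close> have equal images under
  \<open>m \<bullet> u\<close>, and \<open>m\<close> is injective, so \<open>u\<close> factors
  through \<open>e\<close>.\<close>

lemma diagonal_fill:
  assumes e: "e \<in> epi_arrows T" "e \<in> hom T A B" and m: "m \<in> mono_arrows T" "m \<in> hom T X Y"
    and u: "u \<in> hom T A X" and v: "v \<in> hom T B Y" and eq: "m \<bullet> u = v \<bullet> e"
  shows "\<exists>!d. d \<in> hom T B X \<and> d \<bullet> e = u \<and> m \<bullet> d = v"
proof -
  obtain d where d: "d \<in> hom T B X" "d \<bullet> e = u"
  proof (rule factor_through_epi[OF e(2,1) u])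
    fix c x x' assume c: "c \<in> ob S" and x: "x \<in> el A c" "x' \<in> el A c" "ap e c x = ap e c x'"
    have "ap m c (ap u c x) = ap m c (ap u c x')"
      using ap_cmp[OF u m(2) c] ap_cmp[OF e(2) v c] x eq by metis
    then show "ap u c x = ap u c x'" using mono_inj[OF m c] ap_mem[OF u c] x by blast
  qed
  have "(m \<bullet> d) \<bullet> e = v \<bullet> e" using assoc[OF e(2) d(1) m(2)] d(2) eq by simp
  then have "m \<bullet> d = v" using epiD[OF e] cmp_hom[OF d(1) m(2)] v by blast
  then show ?thesis using d epiD[OF e] by blast
qed

text \<open>The pullback is presented by the presheaf of compatible pairs. The last conclusion
  records that such a pair is realized by a section of this particular pullback;
  \<open>pullback_el\<close> carries it over to all others.\<close>

lemma mono_pullback: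
  assumes m: "m \<in> mono_arrows T" "m \<in> hom T A Z" and n: "n \<in> mono_arrows T" "n \<in> hom T B Z"
  obtains P p q where "is_pullback T m n p q" "p \<in> hom T P A" "q \<in> hom T P B"
    "\<And>c a b. c \<in> ob S \<Longrightarrow> a \<in> el A c \<Longrightarrow> b \<in> el B c \<Longrightarrow> ap m c a = ap n c b \<Longrightarrow> \<exists>z\<in>el P c. ap p c z = a \<and> ap q c z = b"
proof -
  have A: "A \<in> ob T" and B: "B \<in> ob T" and Z: "Z \<in> ob T" using homD[OF m(2)] homD[OF n(2)] by auto
  define Q where "Q c = {(a, b). a \<in> el A c \<and> b \<in> el B c \<and> ap m c a = ap n c b}" for c
  define r where "r h = map_prod (res A h) (res B h)" for h
  note pA = el_presheaf[OF A] and pB = el_presheaf[OF B]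
  have Q: "presheaf Q r"
    unfolding presheaf_def Q_def r_def
    by (auto simp: presheaf_mem[OF pA] presheaf_ide[OF pA] presheaf_cmp[OF pA] ap_nat[OF m(2)]
        presheaf_mem[OF pB] presheaf_ide[OF pB] presheaf_cmp[OF pB] ap_nat[OF n(2)])
  have n1: "nmap Q r (el A) (res A) (\<lambda>c. fst)" and n2: "nmap Q r (el B) (res B) (\<lambda>c. snd)"
    by (auto simp: nmap_def Q_def r_def)
  have sQ: "sm (Q c)" if "c \<in> ob S" for c
    by (rule small_subset[OF small_Times[OF el_small[OF A that] el_small[OF B that]]]) (auto simp: Q_def)
  have cc: "closed_congruence Q r (kernel_of Q (\<lambda>c. fst) \<inter> kernel_of Q (\<lambda>c. snd))"
    by (intro closed_congruence_Int closed_congruence_kernel[OF Q el_sheaf[OF A] n1] closed_congruence_kernel[OF Q el_sheaf[OF B] n2])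
  obtain P \<phi> where P: "P \<in> ob T" and \<phi>: "nmap Q r (el P) (res P) \<phi>" "lsurj Q (el P) (res P) \<phi>"
    "\<And>c x y. c \<in> ob S \<Longrightarrow> x \<in> Q c \<Longrightarrow> y \<in> Q c \<Longrightarrow> \<phi> c x = \<phi> c y \<longleftrightarrow> (c, x, y) \<in> kernel_of Q (\<lambda>c. fst) \<inter> kernel_of Q (\<lambda>c. snd)"
    by (rule quotient_object[OF Q cc]) (rule sQ, assumption, rule that)
  obtain p where p: "p \<in> hom T P A" "\<And>c q. c \<in> ob S \<Longrightarrow> q \<in> Q c \<Longrightarrow> ap p c (\<phi> c q) = fst q"
    by (rule arrow_from_presheaf[OF Q P A \<phi>(1,2) n1]) (use \<phi>(3) in \<open>auto simp: kernel_of_def\<close>)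
  obtain q where q: "q \<in> hom T P B" "\<And>c x. c \<in> ob S \<Longrightarrow> x \<in> Q c \<Longrightarrow> ap q c (\<phi> c x) = snd x"
    by (rule arrow_from_presheaf[OF Q P B \<phi>(1,2) n2]) (use \<phi>(3) in \<open>auto simp: kernel_of_def\<close>)
  have mp: "m \<bullet> p = n \<bullet> q"
    by (rule arrow_ext_lsurj[OF Q \<phi>(2) cmp_hom[OF p(1) m(2)] cmp_hom[OF q(1) n(2)]])
      (use p(2) q(2) nmap_mem[OF \<phi>(1)] in \<open>simp add: ap_cmp[OF p(1) m(2)] ap_cmp[OF q(1) n(2)] Q_def split_beta\<close>)
  \<comment> \<open>Since \<open>n\<close> is mono, the second component of a pair is determined by
    the first. Uniqueness of mediating arrows then follows from \<open>p\<close> alone.\<close>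
  have pm: "p \<in> mono_arrows T"
  proof (rule monoI_inj[OF p(1)])
    fix c z z' assume c: "c \<in> ob S" and z: "z \<in> el P c" "z' \<in> el P c" and eq: "ap p c z = ap p c z'"
    note l = lsurjD[OF \<phi>(2) c]
    show "z = z'"
    proof (rule sheaf_sep[OF el_sheaf[OF P] c z], rule lcov_mp[OF c l[OF z(1)] l[OF z(2)]])
      fix h assume h: "h \<in> into c"
        and "\<exists>q\<in>Q (src S h). \<phi> (src S h) q = res P h z" "\<exists>q\<in>Q (src S h). \<phi> (src S h) q = res P h z'"
      then obtain x x' where x: "x \<in> Q (src S h)" "\<phi> (src S h) x = res P h z"
        "x' \<in> Q (src S h)" "\<phi> (src S h) x' = res P h z'" by blast
      have d: "src S h \<in> ob S" using src_ob[OF h] .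
      have "fst x = fst x'"
        using p(2)[OF d x(1)] p(2)[OF d x(3)] x ap_nat[OF p(1) h z(1)] ap_nat[OF p(1) h z(2)] eq by simp
      moreover from this have "snd x = snd x'"
        using x(1,3) mono_inj[OF n d, of "snd x" "snd x'"] by (auto simp: Q_def)
      ultimately have "x = x'" by (rule prod_eqI)
      then show "res P h z = res P h z'" using x by simp
    qed
  qed
  have "is_pullback T m n p q"
  proof (rule pullbackI[OF m(2) n(2) p(1) q(1) mp])
    fix W f g assume f: "f \<in> hom T W A" and g: "g \<in> hom T W B" and eq: "m \<bullet> f = n \<bullet> g"
    have W: "W \<in> ob T" using homD[OF f] by auto
    have fgQ: "(ap f c w, ap g c w) \<in> Q c" if "c \<in> ob S" "w \<in> el W c" for c w
      using that ap_mem[OF f] ap_mem[OF g] ap_cmp[OF f m(2)] ap_cmp[OF g n(2)] eq unfolding Q_def by fastforce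
    have "nmap (el W) (res W) Q r (\<lambda>c w. (ap f c w, ap g c w))"
      unfolding nmap_def using fgQ by (auto simp: r_def ap_nat[OF f] ap_nat[OF g])
    then obtain h where h: "h \<in> hom T W P" "\<And>c w. c \<in> ob S \<Longrightarrow> w \<in> el W c \<Longrightarrow> ap h c w = \<phi> c (ap f c w, ap g c w)"
      using ap_full[OF W P nmap_comp[OF _ \<phi>(1)]] by blast
    have ph: "p \<bullet> h = f"
      by (rule ap_eqI[OF cmp_hom[OF h(1) p(1)] f]) (simp add: ap_cmp[OF h(1) p(1)] h(2) p(2) fgQ)
    have qh: "q \<bullet> h = g"
      by (rule ap_eqI[OF cmp_hom[OF h(1) q(1)] g]) (simp add: ap_cmp[OF h(1) q(1)] h(2) q(2) fgQ)
    show "\<exists>!h. h \<in> hom T W P \<and> p \<bullet> h = f \<and> q \<bullet> h = g"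
      using h(1) ph qh monoD[OF pm p(1)] by blast
  qed
  moreover have "\<exists>z\<in>el P c. ap p c z = a \<and> ap q c z = b"
    if c: "c \<in> ob S" and ab: "a \<in> el A c" "b \<in> el B c" "ap m c a = ap n c b" for c a b
  proof -
    have "(a, b) \<in> Q c" using ab by (simp add: Q_def)
    then show ?thesis using p(2)[OF c] q(2)[OF c] nmap_mem[OF \<phi>(1) c] by fastforce
  qed
  ultimately show ?thesis using that p(1) q(1) by blast
qed

text \<open>The mediating arrow from the constructed pullback carries its sections to those of the
  given one.\<close>

lemma pullback_el:
  assumes pb: "is_pullback T m n p q" and m: "m \<in> mono_arrows T" "m \<in> hom T A Z" and n: "n \<in> mono_arrows T" "n \<in> hom T B Z"
    and p: "p \<in> hom T P A" and c: "c \<in> ob S" and ab: "a \<in> el A c" "b \<in> el B c" "ap m c a = ap n c b"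
  shows "\<exists>z\<in>el P c. ap p c z = a \<and> ap q c z = b"
proof -
  obtain P' p' q' where P': "is_pullback T m n p' q'" "p' \<in> hom T P' A" "q' \<in> hom T P' B"
    "\<And>c a b. c \<in> ob S \<Longrightarrow> a \<in> el A c \<Longrightarrow> b \<in> el B c \<Longrightarrow> ap m c a = ap n c b \<Longrightarrow> \<exists>z\<in>el P' c. ap p' c z = a \<and> ap q' c z = b"
    by (rule mono_pullback[OF m n]) (rule that)
  have q: "q \<in> hom T P B" using pb p n(2) unfolding is_pullback_def hom_def by auto
  obtain B' P0 where "n \<in> hom T B' Z" "p \<in> hom T P0 A"
    "\<And>W f g. f \<in> hom T W A \<Longrightarrow> g \<in> hom T W B' \<Longrightarrow> m \<bullet> f = n \<bullet> g \<Longrightarrow> \<exists>!h. h \<in> hom T W P0 \<and> p \<bullet> h = f \<and> q \<bullet> h = g"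
    by (rule pullbackD[OF pb m(2)]) (rule that)
  moreover have "B' = B" "P0 = P" using calculation(1,2) n(2) p by (auto simp: hom_def)
  moreover have "m \<bullet> p' = n \<bullet> q'" using P'(1) by (simp add: is_pullback_def)
  ultimately obtain h where h: "h \<in> hom T P' P" "p \<bullet> h = p'" "q \<bullet> h = q'" using P'(2,3) by metis
  obtain z where z: "z \<in> el P' c" "ap p' c z = a" "ap q' c z = b" using P'(4)[OF c ab] by blast
  have "ap p c (ap h c z) = a" "ap q c (ap h c z) = b"
    using ap_cmp[OF h(1) p c z(1)] ap_cmp[OF h(1) q c z(1)] h z by auto
  then show ?thesis using ap_mem[OF h(1) c z(1)] by blast
qed

text \<open>A sectionwise test for being a pullback. As \<open>p\<close> is injective on sections,
  the chosen preimages are unique and hence natural without further work.\<close>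

lemma pullbackI_el:
  assumes m: "m \<in> mono_arrows T" "m \<in> hom T A Z" and n: "n \<in> mono_arrows T" "n \<in> hom T B Z"
    and p: "p \<in> hom T P A" "p \<in> mono_arrows T" and q: "q \<in> hom T P B" and eq: "m \<bullet> p = n \<bullet> q"
    and ex: "\<And>c a b. c \<in> ob S \<Longrightarrow> a \<in> el A c \<Longrightarrow> b \<in> el B c \<Longrightarrow> ap m c a = ap n c b \<Longrightarrow> \<exists>z\<in>el P c. ap p c z = a"
  shows "is_pullback T m n p q"
proof (rule pullbackI[OF m(2) n(2) p(1) q eq])
  fix W f g assume f: "f \<in> hom T W A" and g: "g \<in> hom T W B" and eq': "m \<bullet> f = n \<bullet> g"
  have W: "W \<in> ob T" and P: "P \<in> ob T" using homD[OF f] homD[OF p(1)] by auto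
  have "\<exists>z\<in>el P c. ap p c z = ap f c w" if c: "c \<in> ob S" and w: "w \<in> el W c" for c w
    using ex[OF c ap_mem[OF f c w] ap_mem[OF g c w]] ap_cmp[OF f m(2) c w] ap_cmp[OF g n(2) c w] eq' by simp
  then obtain k where k: "\<And>c w. c \<in> ob S \<Longrightarrow> w \<in> el W c \<Longrightarrow> k c w \<in> el P c"
    "\<And>c w. c \<in> ob S \<Longrightarrow> w \<in> el W c \<Longrightarrow> ap p c (k c w) = ap f c w" by metis
  have "nmap (el W) (res W) (el P) (res P) k"
    unfolding nmap_def
  proof (intro conjI allI ballI)
    fix c h w assume h: "h \<in> into c" and w: "w \<in> el W c"
    have w': "res W h w \<in> el W (src S h)" using presheaf_mem[OF el_presheaf[OF W] h w] .
    note c = into_ob[OF h] and d = src_ob[OF h]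
    show "k (src S h) (res W h w) = res P h (k c w)"
      by (rule mono_inj[OF p(2,1) d k(1)[OF d w'] presheaf_mem[OF el_presheaf[OF P] h k(1)[OF c w]]])
        (use k(2)[OF d w'] k(2)[OF c w] ap_nat[OF f h w] ap_nat[OF p(1) h k(1)[OF c w]] in simp)
  qed (use k in auto)
  then obtain h where h: "h \<in> hom T W P" "\<And>c w. c \<in> ob S \<Longrightarrow> w \<in> el W c \<Longrightarrow> ap h c w = k c w"
    using ap_full[OF W P] by blast
  have ph: "p \<bullet> h = f"
    by (rule ap_eqI[OF cmp_hom[OF h(1) p(1)] f]) (simp add: ap_cmp[OF h(1) p(1)] h(2) k(2))
  have "n \<bullet> (q \<bullet> h) = n \<bullet> g"
    using assoc[OF h(1) q n(2)] assoc[OF h(1) p(1) m(2)] eq ph eq' by simp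
  then have "q \<bullet> h = g" using monoD[OF n cmp_hom[OF h(1) q] g] by blast
  then show "\<exists>!h. h \<in> hom T W P \<and> p \<bullet> h = f \<and> q \<bullet> h = g"
    using h(1) ph monoD[OF p(2,1)] by blast
qed

section \<open>Pushouts of epimorphisms\<close>

lemma kernel_le_iff:
  "kernel_of (el X) (ap f) \<subseteq> E \<longleftrightarrow>
    (\<forall>c\<in>ob S. \<forall>x\<in>el X c. \<forall>y\<in>el X c. ap f c x = ap f c y \<longrightarrow> (c, x, y) \<in> E)"
  by (auto simp: kernel_of_def)

text \<open>Both arrows are quotients of the same \<open>X\<close>, so no coproduct is formed: the
  pushout is the quotient of \<open>X\<close> by the congruence generated by the two
  kernels.\<close>

lemma pushout_exists:
  assumes d: "d \<in> epi_arrows T" "d \<in> hom T X A" and e: "e \<in> epi_arrows T" "e \<in> hom T X B"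
  shows "\<exists>p q. is_pushout T d e p q"
proof -
  have X: "X \<in> ob T" using homD[OF d(2)] by auto
  let ?K = "kernel_of (el X) (ap d) \<union> kernel_of (el X) (ap e)"
  define E where "E = generated (el X) (res X) ?K"
  have E: "closed_congruence (el X) (res X) E"
    unfolding E_def by (rule generated_closed[OF el_presheaf[OF X]]) (auto simp: kernel_of_def)
  obtain P f where f: "f \<in> hom T X P" "f \<in> epi_arrows T" 
    "\<And>c x y. c \<in> ob S \<Longrightarrow> x \<in> el X c \<Longrightarrow> y \<in> el X c \<Longrightarrow> ap f c x = ap f c y \<longleftrightarrow> (c, x, y) \<in> E"
    by (rule quotient_arrow[OF X E]) (rule that)
  have KE: "?K \<subseteq> E" unfolding E_def by (rule generated_upper)
  obtain p where p: "p \<in> hom T A P" "p \<bullet> d = f"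
    by (rule factor_through_epi[OF d(2,1) f(1)]) (use KE f(3) in \<open>auto simp: kernel_of_def\<close>)
  obtain q where q: "q \<in> hom T B P" "q \<bullet> e = f"
    by (rule factor_through_epi[OF e(2,1) f(1)]) (use KE f(3) in \<open>auto simp: kernel_of_def\<close>)
  have "is_pushout T d e p q"
  proof (rule pushoutI[OF d(2) e(2) p(1) q(1)])
    show "p \<bullet> d = q \<bullet> e" using p q by simp
    fix W u v assume u: "u \<in> hom T A W" and v: "v \<in> hom T B W" and eq: "u \<bullet> d = v \<bullet> e"
    note ud = cmp_hom[OF d(2) u]
    have "E \<subseteq> kernel_of (el X) (ap (u \<bullet> d))"
      unfolding E_def
    proof (rule generated_least[OF kernel_closed[OF ud]], rule Un_least)
      show "kernel_of (el X) (ap d) \<subseteq> kernel_of (el X) (ap (u \<bullet> d))"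
        by (auto simp: kernel_of_def ap_cmp[OF d(2) u])
      show "kernel_of (el X) (ap e) \<subseteq> kernel_of (el X) (ap (u \<bullet> d))"
        unfolding eq by (auto simp: kernel_of_def ap_cmp[OF e(2) v])
    qed
    then obtain h where h: "h \<in> hom T P W" "h \<bullet> f = u \<bullet> d"
      by (elim factor_through_epi[OF f(1,2) ud, rotated]) (use f(3) in \<open>auto simp: kernel_of_def\<close>)
    have "(h \<bullet> p) \<bullet> d = u \<bullet> d" using assoc[OF d(2) p(1) h(1)] p(2) h(2) by simp
    then have hp: "h \<bullet> p = u" using epiD[OF d cmp_hom[OF p(1) h(1)] u] by blast
    have "(h \<bullet> q) \<bullet> e = v \<bullet> e" using assoc[OF e(2) q(1) h(1)] q(2) h(2) eq by simp
    then have hq: "h \<bullet> q = v" using epiD[OF e cmp_hom[OF q(1) h(1)] v] by blast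
    have "k = h" if k: "k \<in> hom T P W" "k \<bullet> p = u" for k
      using epiD[OF f(2,1) k(1) h(1)] assoc[OF d(2) p(1) k(1)] k(2) p(2) h(2) by simp
    then show "\<exists>!h. h \<in> hom T P W \<and> h \<bullet> p = u \<and> h \<bullet> q = v" using h(1) hp hq by blast
  qed
  then show ?thesis by blast
qed

text \<open>The quotient of \<open>X\<close> by \<open>E\<close> completes \<open>d\<close> and
  \<open>e\<close> to a commuting square, hence it factors through the pushout and
  \<open>p \<bullet> d\<close> identifies no more than \<open>E\<close> does.\<close>

lemma pushout_kernel_least:
  assumes po: "is_pushout T d e p q" and d: "d \<in> epi_arrows T" "d \<in> hom T X A" and e: "e \<in> epi_arrows T" "e \<in> hom T X B"
    and E: "closed_congruence (el X) (res X) E" "kernel_of (el X) (ap d) \<subseteq> E" "kernel_of (el X) (ap e) \<subseteq> E"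
  shows "kernel_of (el X) (ap (p \<bullet> d)) \<subseteq> E"
proof -
  have X: "X \<in> ob T" using homD[OF d(2)] by auto
  obtain P f where f: "f \<in> hom T X P" "f \<in> epi_arrows T" 
    "\<And>c x y. c \<in> ob S \<Longrightarrow> x \<in> el X c \<Longrightarrow> y \<in> el X c \<Longrightarrow> ap f c x = ap f c y \<longleftrightarrow> (c, x, y) \<in> E"
    by (rule quotient_arrow[OF X E(1)]) (rule that)
  obtain u where u: "u \<in> hom T A P" "u \<bullet> d = f"
    by (rule factor_through_epi[OF d(2,1) f(1)]) (use E(2) f(3) in \<open>auto simp: kernel_of_def\<close>)
  obtain v where v: "v \<in> hom T B P" "v \<bullet> e = f"
    by (rule factor_through_epi[OF e(2,1) f(1)]) (use E(3) f(3) in \<open>auto simp: kernel_of_def\<close>)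
  obtain B' P' where *: "e \<in> hom T X B'" "p \<in> hom T A P'"
    "\<And>W f g. f \<in> hom T A W \<Longrightarrow> g \<in> hom T B' W \<Longrightarrow> f \<bullet> d = g \<bullet> e \<Longrightarrow> \<exists>!h. h \<in> hom T P' W \<and> h \<bullet> p = f \<and> h \<bullet> q = g"
    by (rule pushoutD[OF po d(2)]) (rule that)
  have "B' = B" using *(1) e(2) by (auto simp: hom_def)
  then obtain h where h: "h \<in> hom T P' P" "h \<bullet> p = u" using *(3)[of u P v] u v by auto
  have hf: "h \<bullet> (p \<bullet> d) = f" using assoc[OF d(2) *(2) h(1)] h(2) u(2) by simp
  show ?thesis
  proof (unfold kernel_le_iff, intro ballI impI)
    fix c x y assume c: "c \<in> ob S" and x: "x \<in> el X c" and y: "y \<in> el X c" and eq: "ap (p \<bullet> d) c x = ap (p \<bullet> d) c y"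
    have "ap f c x = ap f c y"
      using ap_cmp[OF cmp_hom[OF d(2) *(2)] h(1) c x] ap_cmp[OF cmp_hom[OF d(2) *(2)] h(1) c y] eq hf by simp
    then show "(c, x, y) \<in> E" using f(3)[OF c x y] by simp
  qed
qed

section \<open>The topos as a transfer setting\<close>

lemma locally_small_T: "locally_small U T"
  unfolding locally_small_def
proof (intro ballI)
  fix X Y assume X: "X \<in> ob T" and Y: "Y \<in> ob T"
  \<comment> \<open>An arrow is determined by the graph of its components, a subset of a small
    set.\<close>
  define G where "G f = {(c, x, ap f c x) | c x. c \<in> ob S \<and> x \<in> el X c}" for f
  have "inj_on G (hom T X Y)"
  proof (rule inj_onI)
    fix f g assume f: "f \<in> hom T X Y" and g: "g \<in> hom T X Y" and eq: "G f = G g"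
    show "f = g"
    proof (rule ap_eqI[OF f g])
      fix c x assume "c \<in> ob S" "x \<in> el X c"
      then have "(c, x, ap f c x) \<in> G g" unfolding eq[symmetric] by (auto simp: G_def)
      then show "ap f c x = ap g c x" by (auto simp: G_def)
    qed
  qed
  moreover have "G ` hom T X Y \<subseteq> Pow (SIGMA c:ob S. el X c \<times> el Y c)"
    using ap_mem by (fastforce simp: G_def)
  moreover have "sm (Pow (SIGMA c:ob S. el X c \<times> el Y c))"
    by (intro small_Pow small_Sigma small_ob small_Times el_small X Y)
  ultimately show "sm (hom T X Y)" by (rule small_inj)
qed

lemma proper_factorization_system_T: "proper_factorization_system T (epi_arrows T) (mono_arrows T)"
  unfolding proper_factorization_system_def orthogonal_factorization_system_def
proof (intro conjI ballI impI)
  fix f g assume "f \<in> epi_arrows T" "g \<in> epi_arrows T" "src T g = tgt T f"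
  then show "g \<bullet> f \<in> epi_arrows T"
    by (intro epi_cmp[of f "src T f" "tgt T f" g "tgt T g"]) (auto simp: epi_arrows_def hom_def)
next
  fix f g assume "f \<in> mono_arrows T" "g \<in> mono_arrows T" "src T g = tgt T f"
  then show "g \<bullet> f \<in> mono_arrows T"
    by (intro mono_cmp[of f "src T f" "tgt T f" g "tgt T g"]) (auto simp: mono_arrows_def hom_def)
next
  fix f assume "f \<in> ar T"
  then obtain I e m where "e \<in> hom T (src T f) I" "m \<in> hom T I (tgt T f)" "e \<in> epi_arrows T" "m \<in> mono_arrows T" "m \<bullet> e = f"
    using image_factorization[OF ar_hom] by metis
  then show "\<exists>e\<in>epi_arrows T. \<exists>m\<in>mono_arrows T. src T m = tgt T e \<and> f = m \<bullet> e" by (auto simp: hom_def)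
next
  fix e m u v assume "e \<in> epi_arrows T" "m \<in> mono_arrows T" "u \<in> hom T (src T e) (src T m)" "v \<in> hom T (tgt T e) (tgt T m)"
    "m \<bullet> u = v \<bullet> e"
  then show "\<exists>!d. d \<in> hom T (tgt T e) (src T m) \<and> d \<bullet> e = u \<and> m \<bullet> d = v"
    by (intro diagonal_fill) (auto simp: epi_arrows_def mono_arrows_def hom_def)
next
  show "{f. iso T f} \<subseteq> epi_arrows T" "{f. iso T f} \<subseteq> mono_arrows T" using iso_epi iso_mono by auto
qed (auto simp: epi_arrows_def mono_arrows_def)

lemma transfer_setting_T: "transfer_setting U T (epi_arrows T) (mono_arrows T)"
  unfolding transfer_setting_def
proof (intro conjI category locally_small_T proper_factorization_system_T ballI impI)
  fix m n assume "m \<in> mono_arrows T" "n \<in> mono_arrows T" "tgt T m = tgt T n"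
  moreover from this have "m \<in> hom T (src T m) (tgt T m)" "n \<in> hom T (src T n) (tgt T m)"
    by (auto simp: mono_arrows_def hom_def)
  ultimately show "\<exists>p q. is_pullback T m n p q" using mono_pullback by metis
next
  fix d e assume "d \<in> epi_arrows T" "e \<in> epi_arrows T" "src T d = src T e"
  moreover from this have "d \<in> hom T (src T d) (tgt T d)" "e \<in> hom T (src T d) (tgt T e)"
    by (auto simp: epi_arrows_def hom_def)
  ultimately show "\<exists>p q. is_pushout T d e p q" using pushout_exists by metis
qed

end

section \<open>The category of small sets as a topos\<close>

lemma set_homD:
  assumes "f \<in> hom (set_cat U) X Y"
  shows "f = (X, app f, Y)" "app f \<in> U X \<rightarrow>\<^sub>E U Y"
  using assms by (auto simp: hom_def set_cat_def app_def)

lemma app_mem: "f \<in> hom (set_cat U) X Y \<Longrightarrow> x \<in> U X \<Longrightarrow> app f x \<in> U Y"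
  using set_homD(2) by (metis PiE_mem)

lemma set_eqI_app:
  assumes "f \<in> hom (set_cat U) X Y" "g \<in> hom (set_cat U) X Y" "\<And>x. x \<in> U X \<Longrightarrow> app f x = app g x"
  shows "f = g"
  using set_homD[OF assms(1)] set_homD[OF assms(2)] assms(3) by (metis PiE_ext)

definition set_fn :: "('u \<Rightarrow> 'u set) \<Rightarrow> 'u \<Rightarrow> ('u \<Rightarrow> 'u) \<Rightarrow> 'u \<Rightarrow> 'u fn" where
  "set_fn U X \<phi> Y = (X, restrict \<phi> (U X), Y)"

lemma set_fn_hom: "(\<And>x. x \<in> U X \<Longrightarrow> \<phi> x \<in> U Y) \<Longrightarrow> set_fn U X \<phi> Y \<in> hom (set_cat U) X Y"
  by (auto simp: set_fn_def hom_def set_cat_def)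

lemma app_set_fn [simp]: "x \<in> U X \<Longrightarrow> app (set_fn U X \<phi> Y) x = \<phi> x"
  by (simp add: app_def set_fn_def)

lemma ob_set_cat [simp]: "X \<in> ob (set_cat U)"
  by (simp add: set_cat_def)

lemma category_set_cat: "category (set_cat U)"
  unfolding category_def hom_def set_cat_def
  by (auto simp: compose_def restrict_def PiE_iff extensional_def fun_eq_iff)

lemma app_cmp: "f \<in> hom (set_cat U) X Y \<Longrightarrow> x \<in> U X \<Longrightarrow> app (g \<cdot>\<^bsub>set_cat U\<^esub> f) x = app g (app f x)"
  by (cases g; cases f) (auto simp: set_cat_def app_def hom_def compose_def)

lemma app_ide: "x \<in> U X \<Longrightarrow> app (ide (set_cat U) X) x = x"
  by (auto simp: set_cat_def app_def)

section \<open>Sets as sheaves on a point\<close>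

context small_universe
begin

definition point_site :: "('u, 'u) cat" where
  "point_site = \<lparr>ob = {undefined}, ar = {undefined}, src = (\<lambda>_. undefined), tgt = (\<lambda>_. undefined),
     ide = (\<lambda>_. undefined), cmp = (\<lambda>_ _. undefined)\<rparr>"

lemma point_site_simps [simp]: "ob point_site = {undefined}" "ar point_site = {undefined}"
    "src point_site f = undefined" "tgt point_site f = undefined" "ide point_site x = undefined"
    "g \<cdot>\<^bsub>point_site\<^esub> f = undefined"
  by (simp_all add: point_site_def)

text \<open>Only the maximal sieve covers. The empty sieve is left out, as it would force every
  sheaf to have a single section; with this choice local truth is truth.\<close>

definition point_topology :: "'u \<Rightarrow> 'u set set" where
  "point_topology = (\<lambda>_. {{undefined}})"

lemma site_point: "site U point_site point_topology"
proof
  show "category point_site" by (auto simp: category_def hom_def)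
  show "sm (ob point_site)" "sm (ar point_site)" by auto
  show "grothendieck_topology point_site point_topology"
    unfolding grothendieck_topology_def
  proof (intro conjI ballI allI impI)
    fix c R Q assume "c \<in> ob point_site" and R: "R \<in> point_topology c" and Q: "sieve point_site c Q"
      and *: "\<forall>h\<in>R. pull_sieve point_site h Q \<in> point_topology (src point_site h)"
    then have "pull_sieve point_site undefined Q = {undefined}" by (simp add: point_topology_def)
    then have "undefined \<in> Q" by (auto simp: pull_sieve_def)
    then show "Q \<in> point_topology c" using Q by (auto simp: sieve_def point_topology_def)
  qed (auto simp: point_topology_def sieve_def pull_sieve_def)
qed

lemma sheaf_topos_set:
  "sheaf_topos U point_site point_topology (set_cat U) (\<lambda>X c. U X) (\<lambda>X f x. x) (\<lambda>f c. app f)"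
proof -
  interpret site U point_site point_topology by (rule site_point)
  interpret category_locale "set_cat U" by unfold_locales (rule category_set_cat)
  have into: "into c = (if c = undefined then {undefined} else {})" for c
    by (auto simp: into_def)
  show ?thesis
  proof
    fix X
    show "sheaf (\<lambda>c. U X) (\<lambda>f x. x)"
      unfolding sheaf_def presheaf_def
      by (auto simp: point_topology_def into)
    show "sm (U X)" by simp
  next
    fix f X Y assume f: "f \<in> hom (set_cat U) X Y"
    show "nmap (\<lambda>c. U X) (\<lambda>f x. x) (\<lambda>c. U Y) (\<lambda>f x. x) (\<lambda>c. app f)"
      by (auto simp: nmap_def app_mem[OF f])
  next
    fix X Y \<phi> assume n: "nmap (\<lambda>c. U X) (\<lambda>f x. x) (\<lambda>c. U Y) (\<lambda>f x. x) \<phi>"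
    have u: "undefined \<in> ob point_site" by simp
    show "\<exists>f\<in>hom (set_cat U) X Y. \<forall>c\<in>ob point_site. \<forall>x\<in>U X. app f x = \<phi> c x"
      by (rule bexI[OF _ set_fn_hom[of U X "\<phi> undefined" Y]]) (use nmap_mem[OF n u] in auto)
  next
    fix Q :: "'u \<Rightarrow> 'u set" and r assume Q: "sheaf Q r" and s: "\<And>c. c \<in> ob point_site \<Longrightarrow> sm (Q c)"
    obtain X where X: "U X = Q undefined" using small_code s[of undefined] by auto
    have "r undefined x = x" if "x \<in> Q undefined" for x
      using presheaf_ide[OF sheaf_presheaf[OF Q], of undefined x] that by simp
    then have "nmap Q r (\<lambda>c. U X) (\<lambda>f x. x) (\<lambda>c x. x)"
      by (auto simp: nmap_def X into)
    moreover have "\<forall>c\<in>ob point_site. bij_betw (\<lambda>x. x) (Q c) (U X)" by (auto simp: X bij_betw_def)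
    ultimately show "\<exists>X\<in>ob (set_cat U). \<exists>\<beta>. nmap Q r (\<lambda>c. U X) (\<lambda>f x. x) \<beta> \<and> (\<forall>c\<in>ob point_site. bij_betw (\<beta> c) (Q c) (U X))"
      by (intro bexI[of _ X] exI[of _ "\<lambda>c x. x"]) auto
  next
    fix f g X Y assume "f \<in> hom (set_cat U) X Y" "g \<in> hom (set_cat U) X Y"
      and "\<And>c x. c \<in> ob point_site \<Longrightarrow> x \<in> U X \<Longrightarrow> app f x = app g x"
    then show "f = g" by (intro set_eqI_app[of f U X Y g]) simp_all
  qed (simp_all add: app_cmp app_ide)
qed

lemma mono_set_cat: "mono_arrows (set_cat U) = injections U"
proof -
  interpret P: sheaf_topos U point_site point_topology "set_cat U" "\<lambda>X c. U X" "\<lambda>X f x. x" "\<lambda>f c. app f"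
    by (rule sheaf_topos_set)
  show ?thesis by (auto simp: P.mono_iff injections_def)
qed

lemma epi_set_cat: "epi_arrows (set_cat U) = surjections U"
proof -
  interpret P: sheaf_topos U point_site point_topology "set_cat U" "\<lambda>X c. U X" "\<lambda>X f x. x" "\<lambda>f c. app f"
    by (rule sheaf_topos_set)
  \<comment> \<open>With the maximal sieve as only cover, local surjectivity is
    surjectivity.\<close>
  have "P.epic f \<longleftrightarrow> U (tgt (set_cat U) f) \<subseteq> app f ` U (src (set_cat U) f)" for f
    unfolding P.lsurj_def P.lcov_def by (auto simp: point_topology_def)
  moreover have "app f ` U (src (set_cat U) f) \<subseteq> U (tgt (set_cat U) f)" if "f \<in> ar (set_cat U)" for f
    using that app_mem[of f U] by (auto simp: hom_def)
  ultimately have "f \<in> epi_arrows (set_cat U) \<longleftrightarrow> f \<in> surjections U" for f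
    unfolding P.epi_iff surjections_def mem_Collect_eq by (metis subset_antisym subset_refl)
  then show ?thesis by blast
qed

lemma transfer_setting_set: "transfer_setting U (set_cat U) (surjections U) (injections U)"
  using sheaf_topos.transfer_setting_T[OF sheaf_topos_set] by (simp add: mono_set_cat epi_set_cat)

end


section \<open>Grothendieck toposes as categories of sheaves\<close>

lemma functor_mem: "is_functor C D F \<Longrightarrow> X \<in> ob C \<Longrightarrow> on_ob F X \<in> ob D"
  and functor_hom: "is_functor C D F \<Longrightarrow> f \<in> hom C X Y \<Longrightarrow> on_ar F f \<in> hom D (on_ob F X) (on_ob F Y)"
  and functor_ide: "is_functor C D F \<Longrightarrow> X \<in> ob C \<Longrightarrow> on_ar F (ide C X) = ide D (on_ob F X)"
  and functor_cmp: "is_functor C D F \<Longrightarrow> f \<in> hom C X Y \<Longrightarrow> g \<in> hom C Y Z \<Longrightarrow>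
     on_ar F (g \<cdot>\<^bsub>C\<^esub> f) = on_ar F g \<cdot>\<^bsub>D\<^esub> on_ar F f"
  unfolding is_functor_def hom_def by auto

section \<open>Full and faithful functors from an equivalence\<close>

lemma faithful_if_nat_iso:
  assumes C: "category C" and F: "is_functor C D F" and G: "is_functor D C G"
    and \<eta>: "nat_iso C C id_ftr (comp_ftr G F) \<eta>"
    and f: "f \<in> hom C X Y" and g: "g \<in> hom C X Y" and eq: "on_ar F f = on_ar F g"
  shows "f = g"
proof -
  interpret category_locale C by unfold_locales fact
  have Y: "Y \<in> ob C" and X: "X \<in> ob C" using homD[OF f] by auto
  have \<eta>Y: "\<eta> Y \<in> hom C Y (on_ob G (on_ob F Y))" "iso C (\<eta> Y)"
    using \<eta> Y by (auto simp: nat_iso_def nat_trans_def id_ftr_def comp_ftr_def)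
  have n: "\<eta> Y \<bullet> k = on_ar G (on_ar F k) \<bullet> \<eta> X" if "k \<in> hom C X Y" for k
    using \<eta> that by (auto simp: nat_iso_def nat_trans_def id_ftr_def comp_ftr_def hom_def)
  show ?thesis using monoD[OF iso_mono[OF \<eta>Y(2)] \<eta>Y(1) f g] n[OF f] n[OF g] eq by simp
qed

text \<open>The counit of an equivalence points from the composite to the identity, so here the
  isomorphism is cancelled as an epimorphism instead of as a monomorphism. This version serves for
  the inverse functor.\<close>

lemma faithful_if_nat_iso':
  assumes C: "category C" and F: "is_functor C D F" and G: "is_functor D C G"
    and \<eta>: "nat_iso C C (comp_ftr G F) id_ftr \<eta>"
    and f: "f \<in> hom C X Y" and g: "g \<in> hom C X Y" and eq: "on_ar F f = on_ar F g"
  shows "f = g"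
proof -
  interpret category_locale C by unfold_locales fact
  have Y: "Y \<in> ob C" and X: "X \<in> ob C" using homD[OF f] by auto
  have \<eta>X: "\<eta> X \<in> hom C (on_ob G (on_ob F X)) X" "iso C (\<eta> X)"
    using \<eta> X by (auto simp: nat_iso_def nat_trans_def id_ftr_def comp_ftr_def)
  have n: "\<eta> Y \<bullet> on_ar G (on_ar F k) = k \<bullet> \<eta> X" if "k \<in> hom C X Y" for k
    using \<eta> that by (auto simp: nat_iso_def nat_trans_def id_ftr_def comp_ftr_def hom_def)
  show ?thesis using epiD[OF iso_epi[OF \<eta>X(2)] \<eta>X(1) f g] n[OF f] n[OF g] eq by simp
qed

text \<open>The preimage is the conjugate of \<open>on_ar G \<theta>\<close> by the unit. Naturality
  shows that \<open>G\<close> sends \<open>on_ar F f\<close> and \<open>\<theta>\<close> to the same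
  arrow, and \<open>G\<close> is faithful through \<open>\<epsilon>\<close>.\<close>

lemma full_if_nat_iso:
  assumes C: "category C" and D: "category D" and F: "is_functor C D F" and G: "is_functor D C G"
    and \<eta>: "nat_iso C C id_ftr (comp_ftr G F) \<eta>" and \<epsilon>: "nat_iso D D (comp_ftr F G) id_ftr \<epsilon>"
    and X: "X \<in> ob C" and Y: "Y \<in> ob C" and \<theta>: "\<theta> \<in> hom D (on_ob F X) (on_ob F Y)"
  obtains f where "f \<in> hom C X Y" "on_ar F f = \<theta>"
proof -
  interpret C: category_locale C by unfold_locales fact
  have \<eta>h: "\<eta> Z \<in> hom C Z (on_ob G (on_ob F Z))" "iso C (\<eta> Z)" if "Z \<in> ob C" for Z
    using \<eta> that by (auto simp: nat_iso_def nat_trans_def id_ftr_def comp_ftr_def)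
  have n: "\<eta> Y \<cdot>\<^bsub>C\<^esub> k = on_ar G (on_ar F k) \<cdot>\<^bsub>C\<^esub> \<eta> X" if "k \<in> hom C X Y" for k
    using \<eta> that by (auto simp: nat_iso_def nat_trans_def id_ftr_def comp_ftr_def hom_def)
  obtain i where i: "i \<in> hom C (on_ob G (on_ob F Y)) Y" "\<eta> Y \<cdot>\<^bsub>C\<^esub> i = ide C (on_ob G (on_ob F Y))"
    using C.isoE[OF \<eta>h(2)[OF Y] \<eta>h(1)[OF Y]] by blast
  note G\<theta> = functor_hom[OF G \<theta>]
  let ?g = "on_ar G \<theta> \<cdot>\<^bsub>C\<^esub> \<eta> X"
  have g: "?g \<in> hom C X (on_ob G (on_ob F Y))" by (rule C.cmp_hom[OF \<eta>h(1)[OF X] G\<theta>])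
  define f where "f = i \<cdot>\<^bsub>C\<^esub> ?g"
  have f: "f \<in> hom C X Y" unfolding f_def by (rule C.cmp_hom[OF g i(1)])
  have "\<eta> Y \<cdot>\<^bsub>C\<^esub> f = ?g"
    unfolding f_def using C.assoc[OF g i(1) \<eta>h(1)[OF Y]] i(2) C.ide_left[OF g] by simp
  then have "on_ar G (on_ar F f) \<cdot>\<^bsub>C\<^esub> \<eta> X = on_ar G \<theta> \<cdot>\<^bsub>C\<^esub> \<eta> X" using n[OF f] by simp
  then have "on_ar G (on_ar F f) = on_ar G \<theta>"
    using C.epiD[OF C.iso_epi[OF \<eta>h(2)[OF X]] \<eta>h(1)[OF X] functor_hom[OF G functor_hom[OF F f]] G\<theta>] by blast
  then have "on_ar F f = \<theta>"
    using faithful_if_nat_iso'[OF D G F \<epsilon> functor_hom[OF F f] \<theta>] by blast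
  with f show ?thesis by (rule that)
qed

section \<open>Functor categories and full subcategories\<close>

lemma functor_cat_hom:
  "t \<in> hom (functor_cat C D) P Q \<longleftrightarrow> (\<exists>\<eta>. t = (P, \<eta>, Q) \<and> is_functor C D P \<and> is_functor C D Q \<and> nat_trans C D P Q \<eta> \<and>
     \<eta> \<in> extensional (ob C))"
  by (auto simp: functor_cat_def hom_def)

lemma category_functor_cat:
  assumes C: "category C" and D: "category D" shows "category (functor_cat C D)"
proof -
  interpret C: category_locale C by unfold_locales fact
  interpret D: category_locale D by unfold_locales fact
  have nt_cmp: "nat_trans C D P R (restrict (\<lambda>X. \<theta> X \<cdot>\<^bsub>D\<^esub> \<eta> X) (ob C))"
    if P: "is_functor C D P" and Q: "is_functor C D Q" and R: "is_functor C D R"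
      and \<eta>: "nat_trans C D P Q \<eta>" and \<theta>: "nat_trans C D Q R \<theta>" for P Q R \<eta> \<theta>
    unfolding nat_trans_def
  proof (intro conjI ballI)
    fix X assume "X \<in> ob C"
    then show "restrict (\<lambda>X. \<theta> X \<cdot>\<^bsub>D\<^esub> \<eta> X) (ob C) X \<in> hom D (on_ob P X) (on_ob R X)"
      using \<eta> \<theta> D.cmp_hom by (fastforce simp: nat_trans_def)
  next
    fix f assume f: "f \<in> ar C"
    let ?X = "src C f" and ?Y = "tgt C f"
    have fh: "f \<in> hom C ?X ?Y" using f by (rule C.ar_hom)
    have X: "?X \<in> ob C" and Y: "?Y \<in> ob C" using C.homD[OF fh] by auto
    have h: "\<eta> ?X \<in> hom D (on_ob P ?X) (on_ob Q ?X)" "\<eta> ?Y \<in> hom D (on_ob P ?Y) (on_ob Q ?Y)"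
      "\<theta> ?X \<in> hom D (on_ob Q ?X) (on_ob R ?X)" "\<theta> ?Y \<in> hom D (on_ob Q ?Y) (on_ob R ?Y)"
      using \<eta> \<theta> X Y by (auto simp: nat_trans_def)
    note a = functor_hom[OF P fh] functor_hom[OF Q fh] functor_hom[OF R fh]
    have "(\<theta> ?Y \<cdot>\<^bsub>D\<^esub> \<eta> ?Y) \<cdot>\<^bsub>D\<^esub> on_ar P f = \<theta> ?Y \<cdot>\<^bsub>D\<^esub> (on_ar Q f \<cdot>\<^bsub>D\<^esub> \<eta> ?X)"
      using D.assoc[OF a(1) h(2,4)] \<eta> f by (simp add: nat_trans_def)
    also have "\<dots> = on_ar R f \<cdot>\<^bsub>D\<^esub> (\<theta> ?X \<cdot>\<^bsub>D\<^esub> \<eta> ?X)"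
      using D.assoc[OF h(1) a(2) h(4)] D.assoc[OF h(1,3) a(3)] \<theta> f by (simp add: nat_trans_def)
    finally show "restrict (\<lambda>X. \<theta> X \<cdot>\<^bsub>D\<^esub> \<eta> X) (ob C) ?Y \<cdot>\<^bsub>D\<^esub> on_ar P f = on_ar R f \<cdot>\<^bsub>D\<^esub> restrict (\<lambda>X. \<theta> X \<cdot>\<^bsub>D\<^esub> \<eta> X) (ob C) ?X"
      using X Y by simp
  qed
  have nt_ide: "nat_trans C D P P (restrict (\<lambda>X. ide D (on_ob P X)) (ob C))" if P: "is_functor C D P" for P
    unfolding nat_trans_def
  proof (intro conjI ballI)
    fix f assume f: "f \<in> ar C"
    have fh: "f \<in> hom C (src C f) (tgt C f)" using f by (rule C.ar_hom)
    show "restrict (\<lambda>X. ide D (on_ob P X)) (ob C) (tgt C f) \<cdot>\<^bsub>D\<^esub> on_ar P f = on_ar P f \<cdot>\<^bsub>D\<^esub> restrict (\<lambda>X. ide D (on_ob P X)) (ob C) (src C f)"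
      using C.homD[OF fh] D.ide_left[OF functor_hom[OF P fh]] D.ide_right[OF functor_hom[OF P fh]] by simp
  qed (use functor_mem[OF P] D.ide_hom in auto)
  show ?thesis
    unfolding category_def
  proof (intro conjI ballI impI)
    fix f assume "f \<in> ar (functor_cat C D)"
    then obtain P \<eta> Q where f: "f = (P, \<eta>, Q)" "is_functor C D P" "is_functor C D Q" "nat_trans C D P Q \<eta>" "\<eta> \<in> extensional (ob C)"
      by (auto simp: functor_cat_def)
    then show "src (functor_cat C D) f \<in> ob (functor_cat C D)" "tgt (functor_cat C D) f \<in> ob (functor_cat C D)"
      by (auto simp: functor_cat_def)
    have h: "\<eta> X \<in> hom D (on_ob P X) (on_ob Q X)" if "X \<in> ob C" for X using f(4) that by (simp add: nat_trans_def)
    have "restrict (\<lambda>X. \<eta> X \<cdot>\<^bsub>D\<^esub> restrict (\<lambda>X. ide D (on_ob P X)) (ob C) X) (ob C) = \<eta>"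
      "restrict (\<lambda>X. restrict (\<lambda>X. ide D (on_ob Q X)) (ob C) X \<cdot>\<^bsub>D\<^esub> \<eta> X) (ob C) = \<eta>"
      using f(5) D.ide_left[OF h] D.ide_right[OF h] by (auto simp: fun_eq_iff extensional_def)
    then show "f \<cdot>\<^bsub>functor_cat C D\<^esub> ide (functor_cat C D) (src (functor_cat C D) f) = f"
      "ide (functor_cat C D) (tgt (functor_cat C D) f) \<cdot>\<^bsub>functor_cat C D\<^esub> f = f"
      using f(1) by (auto simp: functor_cat_def)
  next
    fix P assume "P \<in> ob (functor_cat C D)"
    then show "ide (functor_cat C D) P \<in> hom (functor_cat C D) P P"
      unfolding functor_cat_hom using nt_ide by (auto simp: functor_cat_def)
  next
    fix f g assume "f \<in> ar (functor_cat C D)" "g \<in> ar (functor_cat C D)" "src (functor_cat C D) g = tgt (functor_cat C D) f"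
    then show "g \<cdot>\<^bsub>functor_cat C D\<^esub> f \<in> hom (functor_cat C D) (src (functor_cat C D) f) (tgt (functor_cat C D) g)"
      unfolding functor_cat_hom using nt_cmp by (auto simp: functor_cat_def)
  next
    fix f g h assume "f \<in> ar (functor_cat C D)" "g \<in> ar (functor_cat C D)" "h \<in> ar (functor_cat C D)"
      "src (functor_cat C D) g = tgt (functor_cat C D) f" "src (functor_cat C D) h = tgt (functor_cat C D) g"
    then obtain P \<eta> Q \<theta> R \<zeta> V where *: "f = (P, \<eta>, Q)" "g = (Q, \<theta>, R)" "h = (R, \<zeta>, V)"
      "nat_trans C D P Q \<eta>" "nat_trans C D Q R \<theta>" "nat_trans C D R V \<zeta>"
      by (auto simp: functor_cat_def)
    have "\<zeta> X \<cdot>\<^bsub>D\<^esub> (\<theta> X \<cdot>\<^bsub>D\<^esub> \<eta> X) = (\<zeta> X \<cdot>\<^bsub>D\<^esub> \<theta> X) \<cdot>\<^bsub>D\<^esub> \<eta> X" if "X \<in> ob C" for X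
      using *(4-6) that D.assoc by (fastforce simp: nat_trans_def)
    then show "h \<cdot>\<^bsub>functor_cat C D\<^esub> (g \<cdot>\<^bsub>functor_cat C D\<^esub> f) = (h \<cdot>\<^bsub>functor_cat C D\<^esub> g) \<cdot>\<^bsub>functor_cat C D\<^esub> f"
      unfolding *(1-3) by (auto simp: functor_cat_def fun_eq_iff)
  qed
qed

lemma category_full_subcat: "category C \<Longrightarrow> category (full_subcat C A)"
  unfolding category_def full_subcat_def hom_def by simp

lemma category_op_cat: "category C \<Longrightarrow> category (op_cat C)"
  unfolding category_def op_cat_def hom_def by simp

section \<open>Sheaves as set-valued functors, and their sections\<close>

context site
begin

definition sections :: "('u, 'u, 'u, 'u fn) ftr \<Rightarrow> 'u \<Rightarrow> 'u set" where
  "sections P c = U (on_ob P c)"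

definition restriction :: "('u, 'u, 'u, 'u fn) ftr \<Rightarrow> 'u \<Rightarrow> 'u \<Rightarrow> 'u" where
  "restriction P f = app (on_ar P f)"

definition component ::
  "('u, 'u, 'u, 'u fn) ftr \<times> ('u \<Rightarrow> 'u fn) \<times> ('u, 'u, 'u, 'u fn) ftr \<Rightarrow> 'u \<Rightarrow> 'u \<Rightarrow> 'u" where
  "component t c = app (fst (snd t) c)"

lemma into_hom_op: "f \<in> into c \<Longrightarrow> f \<in> hom (op_cat S) c (src S f)"
  by (simp add: into_def hom_def op_cat_def)

lemma ob_op [simp]: "ob (op_cat S) = ob S" "ide (op_cat S) = ide S" "g \<cdot>\<^bsub>op_cat S\<^esub> f = f \<odot> g"
  by (simp_all add: op_cat_def)

lemma functor_presheaf:
  assumes P: "is_functor (op_cat S) (set_cat U) P"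
  shows "presheaf (sections P) (restriction P)"
  unfolding presheaf_def sections_def restriction_def
proof (intro conjI allI ballI)
  fix c f x assume f: "f \<in> into c" and x: "x \<in> U (on_ob P c)"
  note h = functor_hom[OF P into_hom_op[OF f]]
  show "app (on_ar P f) x \<in> U (on_ob P (src S f))" by (rule app_mem[OF h x])
  fix g assume g: "g \<in> into (src S f)"
  show "app (on_ar P (f \<odot> g)) x = app (on_ar P g) (app (on_ar P f) x)"
    using functor_cmp[OF P into_hom_op[OF f] into_hom_op[OF g]] app_cmp[OF h x] by simp
next
  fix c x assume "c \<in> ob S" "x \<in> U (on_ob P c)"
  then show "app (on_ar P (ide S c)) x = x" using functor_ide[OF P, of c] app_ide by simp
qed

lemma is_sheaf_iff:
  "is_sheaf U S J P \<longleftrightarrow> is_functor (op_cat S) (set_cat U) P \<and> sheaf (sections P) (restriction P)"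
proof -
  have eq: "(\<forall>g\<in>into c. A g) \<longleftrightarrow> (\<forall>g\<in>ar S. tgt S g = c \<longrightarrow> A g)" for c A
    by (auto simp: into_def)
  show ?thesis
    using functor_presheaf unfolding is_sheaf_def sheaf_def eq unfolding sections_def restriction_def
    by blast
qed

abbreviation "Sh \<equiv> sheaf_cat U S J"

lemma category_Sh: "category Sh"
  unfolding sheaf_cat_def
  by (intro category_full_subcat category_functor_cat category_op_cat category_S category_set_cat)

lemma ob_Sh: "P \<in> ob Sh \<longleftrightarrow> is_sheaf U S J P"
  by (auto simp: sheaf_cat_def full_subcat_def functor_cat_def is_sheaf_def)

lemma hom_Sh: "t \<in> hom Sh P Q \<longleftrightarrow> (\<exists>\<eta>. t = (P, \<eta>, Q) \<and> is_sheaf U S J P \<and> is_sheaf U S J Q \<and>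
     nat_trans (op_cat S) (set_cat U) P Q \<eta> \<and> \<eta> \<in> extensional (ob S))"
  by (auto simp: sheaf_cat_def full_subcat_def functor_cat_def hom_def is_sheaf_def)

lemma hom_Sh_component:
  assumes t: "t \<in> hom Sh P Q" and c: "c \<in> ob S"
  shows "fst (snd t) c \<in> hom (set_cat U) (on_ob P c) (on_ob Q c)"
  using assms by (auto simp: hom_Sh nat_trans_def)

lemma component_nmap:
  assumes t: "t \<in> hom Sh P Q"
  shows "nmap (sections P) (restriction P) (sections Q) (restriction Q) (component t)"
proof -
  note h = hom_Sh_component[OF t]
  have P: "is_functor (op_cat S) (set_cat U) P" and Q: "is_functor (op_cat S) (set_cat U) Q"
    and n: "nat_trans (op_cat S) (set_cat U) P Q (fst (snd t))"
    using t by (auto simp: hom_Sh is_sheaf_def)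
  show ?thesis
    unfolding nmap_def sections_def restriction_def component_def
  proof (intro conjI allI ballI)
    fix c f x assume f: "f \<in> into c" and x: "x \<in> U (on_ob P c)"
    have "fst (snd t) (src S f) \<cdot>\<^bsub>set_cat U\<^esub> on_ar P f = on_ar Q f \<cdot>\<^bsub>set_cat U\<^esub> fst (snd t) c"
      using n f by (auto simp: nat_trans_def op_cat_def into_def)
    then show "app (fst (snd t) (src S f)) (app (on_ar P f) x) = app (on_ar Q f) (app (fst (snd t) c) x)"
      using app_cmp[OF functor_hom[OF P into_hom_op[OF f]] x, of "fst (snd t) (src S f)"]
        app_cmp[OF h[OF into_ob[OF f]] x, of "on_ar Q f"] by simp
  qed (use app_mem[OF h] in auto)
qed

lemma component_cmp:
  assumes t: "t \<in> hom Sh P Q" and s: "s \<in> hom Sh Q R" and c: "c \<in> ob S" and x: "x \<in> sections P c"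
  shows "component (s \<cdot>\<^bsub>Sh\<^esub> t) c x = component s c (component t c x)"
proof -
  have "fst (snd (s \<cdot>\<^bsub>Sh\<^esub> t)) c = fst (snd s) c \<cdot>\<^bsub>set_cat U\<^esub> fst (snd t) c"
  proof -
    obtain \<eta> \<theta> where "t = (P, \<eta>, Q)" "s = (Q, \<theta>, R)" using t s by (auto simp: hom_Sh)
    then show ?thesis using c by (simp add: sheaf_cat_def full_subcat_def functor_cat_def)
  qed
  then show ?thesis
    unfolding component_def using app_cmp[OF hom_Sh_component[OF t c]] x by (simp add: sections_def)
qed

lemma component_ide:
  assumes "c \<in> ob S" and "x \<in> sections P c"
  shows "component (ide Sh P) c x = x"
  using assms app_ide by (simp add: component_def sections_def sheaf_cat_def full_subcat_def functor_cat_def)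

lemma component_eqI:
  assumes t: "t \<in> hom Sh P Q" and s: "s \<in> hom Sh P Q"
    and eq: "\<And>c x. c \<in> ob S \<Longrightarrow> x \<in> sections P c \<Longrightarrow> component t c x = component s c x"
  shows "t = s"
proof -
  obtain \<eta> \<theta> where e: "t = (P, \<eta>, Q)" "s = (P, \<theta>, Q)" "\<eta> \<in> extensional (ob S)" "\<theta> \<in> extensional (ob S)"
    using t s by (auto simp: hom_Sh)
  have "\<eta> c = \<theta> c" if c: "c \<in> ob S" for c
    by (rule set_eqI_app[where U = U and X = "on_ob P c" and Y = "on_ob Q c"])
      (use hom_Sh_component[OF t c] hom_Sh_component[OF s c] eq[OF c] e in \<open>auto simp: component_def sections_def\<close>)
  then have "\<eta> = \<theta>" using e(3,4) by (metis extensionalityI)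
  then show ?thesis using e by simp
qed

lemma component_full:
  assumes P: "is_sheaf U S J P" and Q: "is_sheaf U S J Q"
    and n: "nmap (sections P) (restriction P) (sections Q) (restriction Q) \<phi>"
  obtains t where "t \<in> hom Sh P Q" "\<And>c x. c \<in> ob S \<Longrightarrow> x \<in> sections P c \<Longrightarrow> component t c x = \<phi> c x"
proof -
  define \<eta> where "\<eta> = restrict (\<lambda>c. set_fn U (on_ob P c) (\<phi> c) (on_ob Q c)) (ob S)"
  have h: "\<eta> c \<in> hom (set_cat U) (on_ob P c) (on_ob Q c)" if "c \<in> ob S" for c
    unfolding \<eta>_def restrict_apply'[OF that] by (rule set_fn_hom) (use nmap_mem[OF n that] in \<open>simp add: sections_def\<close>)
  have a: "app (\<eta> c) x = \<phi> c x" if "c \<in> ob S" "x \<in> U (on_ob P c)" for c x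
    using that by (simp add: \<eta>_def)
  have fP: "is_functor (op_cat S) (set_cat U) P" and fQ: "is_functor (op_cat S) (set_cat U) Q"
    using P Q by (auto simp: is_sheaf_def)
  interpret set: category_locale "set_cat U" by unfold_locales (rule category_set_cat)
  have "nat_trans (op_cat S) (set_cat U) P Q \<eta>"
    unfolding nat_trans_def
  proof (intro conjI ballI)
    fix f assume "f \<in> ar (op_cat S)"
    then have f: "f \<in> into (tgt S f)" and st: "src (op_cat S) f = tgt S f" "tgt (op_cat S) f = src S f"
      by (simp_all add: into_def op_cat_def)
    let ?c = "tgt S f" and ?d = "src S f"
    note c = into_ob[OF f] and d = src_ob[OF f]
    note p = functor_hom[OF fP into_hom_op[OF f]] and q = functor_hom[OF fQ into_hom_op[OF f]]
    show "\<eta> (tgt (op_cat S) f) \<cdot>\<^bsub>set_cat U\<^esub> on_ar P f = on_ar Q f \<cdot>\<^bsub>set_cat U\<^esub> \<eta> (src (op_cat S) f)"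
      unfolding st
    proof (rule set_eqI_app[OF set.cmp_hom[OF p h[OF d]] set.cmp_hom[OF h[OF c] q]])
      fix x assume x: "x \<in> U (on_ob P ?c)"
      show "app (\<eta> ?d \<cdot>\<^bsub>set_cat U\<^esub> on_ar P f) x = app (on_ar Q f \<cdot>\<^bsub>set_cat U\<^esub> \<eta> ?c) x"
        using app_cmp[OF p x] app_cmp[OF h[OF c] x] a[OF d app_mem[OF p x]] a[OF c x] nmap_nat[OF n f] x
        by (simp add: sections_def restriction_def)
    qed
  qed (use h in auto)
  then have "(P, \<eta>, Q) \<in> hom Sh P Q"
    using P Q by (auto simp: hom_Sh \<eta>_def)
  moreover have "component (P, \<eta>, Q) c x = \<phi> c x" if "c \<in> ob S" "x \<in> sections P c" for c x
    using a that by (simp add: component_def sections_def)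
  ultimately show ?thesis using that by blast
qed

text \<open>A small set of elements of \<open>'u\<close> is itself of the form \<open>U a\<close>.
  The functor \<open>P\<close> therefore has literally the sections of \<open>Q\<close>, not merely
  a bijective copy of them.\<close>

lemma sheaf_code:
  assumes Q: "sheaf Q r" and s: "\<And>c. c \<in> ob S \<Longrightarrow> sm (Q c)"
  obtains P where "is_sheaf U S J P" "\<And>c. c \<in> ob S \<Longrightarrow> sections P c = Q c"
    "\<And>f c x. f \<in> into c \<Longrightarrow> x \<in> Q c \<Longrightarrow> restriction P f x = r f x"
proof -
  note p = sheaf_presheaf[OF Q]
  have "\<forall>c. \<exists>a. c \<in> ob S \<longrightarrow> U a = Q c" using small_code s by blast
  then obtain k where k: "\<And>c. c \<in> ob S \<Longrightarrow> U (k c) = Q c" by metis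
  define P where "P = \<lparr>on_ob = k, on_ar = (\<lambda>f. set_fn U (k (tgt S f)) (r f) (k (src S f)))\<rparr>"
  have oP: "on_ob P c = k c" for c by (simp add: P_def)
  have aP: "on_ar P f = set_fn U (k c) (r f) (k (src S f))" if "f \<in> into c" for f c
    using that by (simp add: P_def into_def)
  have hP: "on_ar P f \<in> hom (set_cat U) (k c) (k (src S f))" if "f \<in> into c" for f c
    unfolding aP[OF that] using presheaf_mem[OF p that] k[OF into_ob[OF that]] k[OF src_ob[OF that]] by (auto intro: set_fn_hom)
  have rP: "app (on_ar P f) x = r f x" if "f \<in> into c" "x \<in> Q c" for f c x
    using that k[OF into_ob[OF that(1)]] by (simp add: aP)
  interpret set: category_locale "set_cat U" by unfold_locales (rule category_set_cat)
  have fP: "is_functor (op_cat S) (set_cat U) P"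
    unfolding is_functor_def
  proof (intro conjI ballI impI)
    fix f assume "f \<in> ar (op_cat S)"
    then have f: "f \<in> into (tgt S f)" by (simp add: into_def op_cat_def)
    then show "on_ar P f \<in> hom (set_cat U) (on_ob P (src (op_cat S) f)) (on_ob P (tgt (op_cat S) f))"
      using hP by (simp add: oP op_cat_def)
    fix g assume "g \<in> ar (op_cat S)" "src (op_cat S) g = tgt (op_cat S) f"
    then have g: "g \<in> into (src S f)" by (simp add: into_def op_cat_def)
    note fg = cmp_into[OF f g]
    have "on_ar P (f \<odot> g) = on_ar P g \<cdot>\<^bsub>set_cat U\<^esub> on_ar P f"
    proof (rule set_eqI_app[OF hP[OF fg, unfolded src_cmp[OF f g]] set.cmp_hom[OF hP[OF f] hP[OF g]]])
      fix x assume x: "x \<in> U (k (tgt S f))"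
      then have x': "x \<in> Q (tgt S f)" using k[OF into_ob[OF f]] by simp
      show "app (on_ar P (f \<odot> g)) x = app (on_ar P g \<cdot>\<^bsub>set_cat U\<^esub> on_ar P f) x"
        using app_cmp[OF hP[OF f] x] rP[OF fg x'] rP[OF f x'] rP[OF g presheaf_mem[OF p f x']] presheaf_cmp[OF p f g x'] by simp
    qed
    then show "on_ar P (g \<cdot>\<^bsub>op_cat S\<^esub> f) = on_ar P g \<cdot>\<^bsub>set_cat U\<^esub> on_ar P f" by simp
  next
    fix c assume "c \<in> ob (op_cat S)"
    then have c: "c \<in> ob S" by simp
    have "on_ar P (ide S c) = ide (set_cat U) (k c)"
    proof (rule set_eqI_app[OF hP[OF ide_into[OF c], unfolded src_ide[OF c]] set.ide_hom])
      fix x assume x: "x \<in> U (k c)"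
      then show "app (on_ar P (ide S c)) x = app (ide (set_cat U) (k c)) x"
        using rP[OF ide_into[OF c]] presheaf_ide[OF p c] app_ide[where U = U, OF x] k[OF c] by simp
    qed simp
    then show "on_ar P (ide (op_cat S) c) = ide (set_cat U) (on_ob P c)" by (simp add: oP)
  qed simp
  have sP: "sections P c = Q c" if "c \<in> ob S" for c using k[OF that] by (simp add: sections_def oP)
  have rP': "restriction P f x = r f x" if "f \<in> into c" "x \<in> Q c" for f c x
    using rP[OF that] by (simp add: restriction_def)
  have "sheaf (sections P) (restriction P)"
    unfolding sheaf_def
  proof (intro conjI functor_presheaf fP ballI allI impI)
    fix c R x assume c: "c \<in> ob S" and R: "R \<in> J c" and x: "\<forall>f\<in>R. x f \<in> sections P (src S f)"
      and m: "\<forall>f\<in>R. \<forall>g\<in>into (src S f). restriction P g (x f) = x (f \<odot> g)"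
    note Ri = J_into[OF c R]
    have x': "x f \<in> Q (src S f)" if "f \<in> R" for f using x sP[OF src_ob[OF Ri]] that by blast
    have "\<exists>!y. y \<in> Q c \<and> (\<forall>f\<in>R. r f y = x f)"
    proof (rule Q[unfolded sheaf_def, THEN conjunct2, rule_format, OF c R])
      show "r g (x f) = x (f \<odot> g)" if "f \<in> R" "g \<in> into (src S f)" for f g
        using m rP'[OF that(2) x'] that by simp
    qed (rule x')
    moreover have "y \<in> sections P c \<and> (\<forall>f\<in>R. restriction P f y = x f) \<longleftrightarrow> y \<in> Q c \<and> (\<forall>f\<in>R. r f y = x f)" for y
      using sP[OF c] rP'[OF Ri, of _ y] by auto
    ultimately show "\<exists>!y. y \<in> sections P c \<and> (\<forall>f\<in>R. restriction P f y = x f)" by simp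
  qed
  then have "is_sheaf U S J P" using fP by (simp add: is_sheaf_iff)
  then show ?thesis using that sP rP' by blast
qed

text \<open>The sections of \<open>X\<close> are those of its image under the equivalence
  \<open>F\<close>. Faithfulness of \<open>F\<close> gives extensionality of arrows, fullness gives
  \<open>ap_full\<close>, and the inverse of the counit at a sheaf gives
  \<open>el_full\<close>.\<close>

lemma sheaf_topos_if_equivalent:
  fixes T :: "('o, 'm) cat"
  assumes T: "category T" and eq: "equivalent_cats T Sh"
  shows "\<exists>el res ap. sheaf_topos U S J T el res ap"
proof -
  obtain F G \<eta> \<epsilon> where F: "is_functor T Sh F" and G: "is_functor Sh T G"
    and \<eta>: "nat_iso T T id_ftr (comp_ftr G F) \<eta>" and \<epsilon>: "nat_iso Sh Sh (comp_ftr F G) id_ftr \<epsilon>"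
    using eq unfolding equivalent_cats_def by blast
  interpret T: category_locale T by unfold_locales fact
  interpret Sh: category_locale Sh by unfold_locales (rule category_Sh)
  have FX: "is_sheaf U S J (on_ob F X)" if "X \<in> ob T" for X using functor_mem[OF F that] ob_Sh by blast
  have "sheaf_topos U S J T (\<lambda>X. sections (on_ob F X)) (\<lambda>X. restriction (on_ob F X)) (\<lambda>f. component (on_ar F f))"
  proof
    fix X assume X: "X \<in> ob T"
    show "sheaf (sections (on_ob F X)) (restriction (on_ob F X))" using FX[OF X] is_sheaf_iff by blast
    show "sm (sections (on_ob F X) c)" for c by (simp add: sections_def)
    fix c x assume c: "c \<in> ob S" and x: "x \<in> sections (on_ob F X) c"
    show "component (on_ar F (ide T X)) c x = x" using functor_ide[OF F X] component_ide[OF c x] by simp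
  next
    fix f X Y assume f: "f \<in> hom T X Y"
    show "nmap (sections (on_ob F X)) (restriction (on_ob F X)) (sections (on_ob F Y)) (restriction (on_ob F Y)) (component (on_ar F f))"
      by (rule component_nmap[OF functor_hom[OF F f]])
  next
    fix f g X Y Z c x assume f: "f \<in> hom T X Y" and g: "g \<in> hom T Y Z" and c: "c \<in> ob S" and x: "x \<in> sections (on_ob F X) c"
    show "component (on_ar F (g \<cdot>\<^bsub>T\<^esub> f)) c x = component (on_ar F g) c (component (on_ar F f) c x)"
      using component_cmp[OF functor_hom[OF F f] functor_hom[OF F g] c x] functor_cmp[OF F f g] by simp
  next
    fix f g X Y assume f: "f \<in> hom T X Y" and g: "g \<in> hom T X Y"
      and "\<And>c x. c \<in> ob S \<Longrightarrow> x \<in> sections (on_ob F X) c \<Longrightarrow> component (on_ar F f) c x = component (on_ar F g) c x"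
    then have "on_ar F f = on_ar F g" using component_eqI[OF functor_hom[OF F f] functor_hom[OF F g]] by blast
    then show "f = g" by (rule faithful_if_nat_iso[OF T F G \<eta> f g])
  next
    fix X Y \<phi> assume X: "X \<in> ob T" and Y: "Y \<in> ob T"
      and n: "nmap (sections (on_ob F X)) (restriction (on_ob F X)) (sections (on_ob F Y)) (restriction (on_ob F Y)) \<phi>"
    obtain t where t: "t \<in> hom Sh (on_ob F X) (on_ob F Y)"
      "\<And>c x. c \<in> ob S \<Longrightarrow> x \<in> sections (on_ob F X) c \<Longrightarrow> component t c x = \<phi> c x"
      by (rule component_full[OF FX[OF X] FX[OF Y] n]) (rule that)
    obtain f where "f \<in> hom T X Y" "on_ar F f = t"
      by (rule full_if_nat_iso[OF T category_Sh F G \<eta> \<epsilon> X Y t(1)]) (rule that)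
    then show "\<exists>f\<in>hom T X Y. \<forall>c\<in>ob S. \<forall>x\<in>sections (on_ob F X) c. component (on_ar F f) c x = \<phi> c x"
      using t(2) by blast
  next
    fix Q :: "'u \<Rightarrow> 'u set" and r assume Q: "sheaf Q r" and s: "\<And>c. c \<in> ob S \<Longrightarrow> sm (Q c)"
    obtain P where P: "is_sheaf U S J P" and sP: "\<And>c. c \<in> ob S \<Longrightarrow> sections P c = Q c"
      and rP: "\<And>f c x. f \<in> into c \<Longrightarrow> x \<in> Q c \<Longrightarrow> restriction P f x = r f x"
      by (rule sheaf_code[OF Q s]) (assumption, rule that)
    have Po: "P \<in> ob Sh" using P ob_Sh by blast
    define X where "X = on_ob G P"
    have X: "X \<in> ob T" unfolding X_def by (rule functor_mem[OF G Po])
    have e: "\<epsilon> P \<in> hom Sh (on_ob F X) P" "iso Sh (\<epsilon> P)"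
      using \<epsilon> Po by (auto simp: nat_iso_def nat_trans_def comp_ftr_def id_ftr_def X_def)
    obtain i where i: "i \<in> hom Sh P (on_ob F X)" "i \<cdot>\<^bsub>Sh\<^esub> \<epsilon> P = ide Sh (on_ob F X)" "\<epsilon> P \<cdot>\<^bsub>Sh\<^esub> i = ide Sh P"
      using Sh.isoE[OF e(2,1)] by blast
    note n = component_nmap[OF i(1)] and n' = component_nmap[OF e(1)]
    have "nmap Q r (sections (on_ob F X)) (restriction (on_ob F X)) (component i)"
      unfolding nmap_def
    proof (intro conjI allI ballI)
      fix c x assume c: "c \<in> ob S" and "x \<in> Q c"
      then show "component i c x \<in> sections (on_ob F X) c" using nmap_mem[OF n c] sP[OF c] by simp
    next
      fix c f x assume f: "f \<in> into c" and x: "x \<in> Q c"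
      then show "component i (src S f) (r f x) = restriction (on_ob F X) f (component i c x)"
        using nmap_nat[OF n f, of x] sP[OF into_ob[OF f]] rP[OF f x] by simp
    qed
    moreover have "bij_betw (component i c) (Q c) (sections (on_ob F X) c)" if c: "c \<in> ob S" for c
    proof (rule bij_betw_byWitness[of _ "component (\<epsilon> P) c"])
      show "\<forall>a\<in>Q c. component (\<epsilon> P) c (component i c a) = a"
        using component_cmp[OF i(1) e(1) c] component_ide[OF c] i(3) sP[OF c] by simp
      show "\<forall>a\<in>sections (on_ob F X) c. component i c (component (\<epsilon> P) c a) = a"
        using component_cmp[OF e(1) i(1) c] component_ide[OF c] i(2) by simp
    qed (use nmap_mem[OF n c] nmap_mem[OF n' c] sP[OF c] in auto)
    ultimately show "\<exists>X\<in>ob T. \<exists>\<beta>. nmap Q r (sections (on_ob F X)) (restriction (on_ob F X)) \<beta> \<and>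
        (\<forall>c\<in>ob S. bij_betw (\<beta> c) (Q c) (sections (on_ob F X) c))"
      using X by blast
  qed
  then show ?thesis by blast
qed

end

lemma grothendieck_topos_sheaf_topos:
  assumes U: "grothendieck_universe U" and T: "grothendieck_topos U T"
  shows "\<exists>S J el res ap. sheaf_topos U S J T el res ap"
proof -
  obtain S :: "('a, 'a) cat" and J where S: "category S" "small U (ob S)" "small U (ar S)" "grothendieck_topology S J"
    "equivalent_cats T (sheaf_cat U S J)"
    using T unfolding grothendieck_topos_def by auto
  interpret site U S J
    by unfold_locales (use U S in auto)
  show ?thesis using sheaf_topos_if_equivalent[OF _ S(5)] T unfolding grothendieck_topos_def by blast
qed

section \<open>Constant objects\<close>

lemma coproductD:
  assumes "is_coproduct C I A D \<iota>"
  shows "D \<in> ob C" and "x \<in> I \<Longrightarrow> \<iota> x \<in> hom C (A x) D"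
    and "Y \<in> ob C \<Longrightarrow> (\<And>x. x \<in> I \<Longrightarrow> j x \<in> hom C (A x) Y) \<Longrightarrow> \<exists>h\<in>hom C D Y. \<forall>x\<in>I. h \<cdot>\<^bsub>C\<^esub> \<iota> x = j x"
proof -
  assume "Y \<in> ob C" and "\<And>x. x \<in> I \<Longrightarrow> j x \<in> hom C (A x) Y"
  then have "\<exists>!h. h \<in> hom C D Y \<and> (\<forall>x\<in>I. h \<cdot>\<^bsub>C\<^esub> \<iota> x = j x)"
    using assms unfolding is_coproduct_def by simp
  then show "\<exists>h\<in>hom C D Y. \<forall>x\<in>I. h \<cdot>\<^bsub>C\<^esub> \<iota> x = j x" by (elim ex1E) auto
qed (use assms in \<open>simp_all add: is_coproduct_def\<close>)

context category_locale
begin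

lemma coproduct_ext:
  assumes D: "is_coproduct C I A D \<iota>" and f: "f \<in> hom C D Y" and g: "g \<in> hom C D Y"
    and eq: "\<And>x. x \<in> I \<Longrightarrow> f \<bullet> \<iota> x = g \<bullet> \<iota> x"
  shows "f = g"
proof -
  have Y: "Y \<in> ob C" using homD[OF f] by simp
  have "\<exists>!h. h \<in> hom C D Y \<and> (\<forall>x\<in>I. h \<bullet> \<iota> x = g \<bullet> \<iota> x)"
    by (rule D[unfolded is_coproduct_def, THEN conjunct2, THEN conjunct2, rule_format, OF Y])
      (rule cmp_hom[OF coproductD(2)[OF D] g])
  then show ?thesis using f g eq by (elim ex1E) auto
qed

lemma pullback_mono:
  assumes pb: "is_pullback C m n p q" and m: "m \<in> hom C A Z" and n: "n \<in> mono_arrows C"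
  shows "p \<in> mono_arrows C"
proof -
  obtain B P where *: "n \<in> hom C B Z" "p \<in> hom C P A" "q \<in> hom C P B" "m \<bullet> p = n \<bullet> q"
    "\<And>W f g. f \<in> hom C W A \<Longrightarrow> g \<in> hom C W B \<Longrightarrow> m \<bullet> f = n \<bullet> g \<Longrightarrow> \<exists>!h. h \<in> hom C W P \<and> p \<bullet> h = f \<and> q \<bullet> h = g"
    by (rule pullbackD[OF pb m]) (rule that)
  show ?thesis
  proof (rule monoI[OF *(2)])
    fix W f g assume f: "f \<in> hom C W P" and g: "g \<in> hom C W P" and eq: "p \<bullet> f = p \<bullet> g"
    have "n \<bullet> (q \<bullet> f) = n \<bullet> (q \<bullet> g)"
      using assoc[OF f *(3,1)] assoc[OF g *(3,1)] assoc[OF f *(2) m] assoc[OF g *(2) m] *(4) eq by simp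
    then have q: "q \<bullet> f = q \<bullet> g" using monoD[OF n *(1)] cmp_hom[OF f *(3)] cmp_hom[OF g *(3)] by blast
    have "m \<bullet> (p \<bullet> f) = n \<bullet> (q \<bullet> f)" using assoc[OF f *(2) m] assoc[OF f *(3,1)] *(4) by simp
    from *(5)[OF cmp_hom[OF f *(2)] cmp_hom[OF f *(3)] this] show "f = g" using f g eq q by metis
  qed
qed

end

section \<open>Objects covered by the empty sieve\<close>

context site
begin

text \<open>That is, the empty sieve covers \<open>c\<close>. If this happened at every object, the
  topos would be degenerate.\<close>

abbreviation null :: "'u \<Rightarrow> bool" where
  "null c \<equiv> lcov c (\<lambda>h. False)"

text \<open>Over such an object every local statement holds vacuously: the empty family glues to a
  section, and any two sections agree locally.\<close>

lemma null_sheaf: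
  assumes Q: "sheaf Q r" and c: "c \<in> ob S" and n: "null c"
  shows "\<exists>z. Q c = {z}"
proof -
  have "lcov c A" for A by (rule lcov_mono[OF c n]) simp
  then obtain z where z: "z \<in> Q c"
    using sheaf_glue[OF Q c, of "\<lambda>_ _. False"] by blast
  have "y = z" if "y \<in> Q c" for y
    by (rule sheaf_sep[OF Q c that z]) (rule lcov_mono[OF c n], simp)
  then show ?thesis using z by blast
qed

text \<open>If all arrows of the cover that satisfy \<open>P\<close> started at null objects,
  transitivity would make \<open>c\<close> null. This extracts an actual witness from a local
  existence statement.\<close>

lemma lcov_not_null:
  assumes c: "c \<in> ob S" and P: "lcov c P" and n: "\<not> null c"
  obtains h where "h \<in> into c" "P h" "\<not> null (src S h)"
proof -
  have "\<not> (\<forall>h\<in>into c. P h \<longrightarrow> null (src S h))"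
  proof
    assume *: "\<forall>h\<in>into c. P h \<longrightarrow> null (src S h)"
    have "null c" by (rule lcov_trans[OF c], rule lcov_mono[OF c P]) (use * in blast)
    with n show False by simp
  qed
  then show ?thesis using that by blast
qed

lemma presheaf_const: "presheaf (\<lambda>c. I) (\<lambda>h x. x)"
  by (simp add: presheaf_def)

text \<open>Sections over an object covered by the empty sieve are all equal, hence the second case.\<close>

definition const_congruence :: "'i set \<Rightarrow> ('u \<times> 'i \<times> 'i) set" where
  "const_congruence I = {(c, x, y). c \<in> ob S \<and> x \<in> I \<and> y \<in> I \<and> (x = y \<or> null c)}"

lemma closed_const_congruence: "closed_congruence (\<lambda>c. I) (\<lambda>h x. x) (const_congruence I)"
  unfolding closed_congruence_def
proof (intro conjI allI ballI impI)
  fix c x y f assume f: "f \<in> into c" and "(c, x, y) \<in> const_congruence I"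
  then show "(src S f, x, y) \<in> const_congruence I"
    using src_ob[OF f] lcov_pull[OF f] by (auto simp: const_congruence_def)
next
  fix c x y assume c: "c \<in> ob S" and xy: "x \<in> I" "y \<in> I" and l: "lcov c (\<lambda>h. (src S h, x, y) \<in> const_congruence I)"
  have "null c" if "x \<noteq> y"
    by (rule lcov_trans[OF c], rule lcov_mono[OF c l]) (use that in \<open>simp add: const_congruence_def\<close>)
  then show "(c, x, y) \<in> const_congruence I" using c xy by (auto simp: const_congruence_def)
qed (auto simp: const_congruence_def)

end

context sheaf_topos
begin

text \<open>Preimages under a monomorphism are unique, so local ones match and glue.\<close>

lemma mono_image_local:
  assumes m: "m \<in> mono_arrows T" "m \<in> hom T P A" and c: "c \<in> ob S" and a: "a \<in> el A c"
    and l: "lcov c (\<lambda>h. \<exists>z\<in>el P (src S h). ap m (src S h) z = res A h a)"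
  shows "\<exists>z\<in>el P c. ap m c z = a"
proof -
  have A: "A \<in> ob T" and P: "P \<in> ob T" using homD[OF m(2)] by auto
  obtain z where z: "z \<in> el P c"
    "\<And>h y. h \<in> into c \<Longrightarrow> y \<in> el P (src S h) \<Longrightarrow> ap m (src S h) y = res A h a \<Longrightarrow> res P h z = y"
  proof (rule sheaf_glue[OF el_sheaf[OF P] c, of "\<lambda>h y. ap m (src S h) y = res A h a"])
    fix h g y assume h: "h \<in> into c" and g: "g \<in> into (src S h)" and y: "y \<in> el P (src S h)" "ap m (src S h) y = res A h a"
    then show "ap m (src S (h \<odot> g)) (res P g y) = res A (h \<odot> g) a"
      using ap_nat[OF m(2) g y(1)] presheaf_cmp[OF el_presheaf[OF A] h g a] by simp
  next
    fix h y y' assume h: "h \<in> into c" and "y \<in> el P (src S h)" "y' \<in> el P (src S h)"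
      "ap m (src S h) y = res A h a" "ap m (src S h) y' = res A h a"
    then show "y = y'" using mono_inj[OF m src_ob[OF h]] by simp
  qed (rule l, rule that)
  have "ap m c z = a"
  proof (rule sheaf_sep[OF el_sheaf[OF A] c ap_mem[OF m(2) c z(1)] a], rule lcov_mono[OF c l])
    fix h assume h: "h \<in> into c" and "\<exists>z\<in>el P (src S h). ap m (src S h) z = res A h a"
    then obtain y where y: "y \<in> el P (src S h)" "ap m (src S h) y = res A h a" by blast
    then show "res A h (ap m c z) = res A h a" using z(2)[OF h y] ap_nat[OF m(2) h z(1)] by simp
  qed
  then show ?thesis using z(1) by blast
qed

section \<open>The terminal object and its copowers\<close>

context
  fixes one :: 'o
  assumes terminal: "terminal T one"
begin

lemma one_ob: "one \<in> ob T"
  using terminal by (simp add: terminal_def)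

lemma one_unique: "f \<in> hom T X one \<Longrightarrow> g \<in> hom T X one \<Longrightarrow> f = g"
  using terminal homD unfolding terminal_def by metis

text \<open>The one-element presheaf presents an object \<open>X\<close>. By terminality the
  composite from \<open>one\<close> to \<open>X\<close> and back is the identity, so every section
  of \<open>one\<close> is the image of the single section of \<open>X\<close> named by
  \<open>()\<close>.\<close>

lemma one_el: "c \<in> ob S \<Longrightarrow> \<exists>z. el one c = {z}"
proof -
  assume c: "c \<in> ob S"
  have sQ: "sm {()}" by simp
  obtain X \<phi> where X: "X \<in> ob T" and \<phi>: "nmap (\<lambda>c. {()}) (\<lambda>h x. x) (el X) (res X) \<phi>"
    "lsurj (\<lambda>c. {()}) (el X) (res X) \<phi>"
    "\<And>c x y. c \<in> ob S \<Longrightarrow> x \<in> {()} \<Longrightarrow> y \<in> {()} \<Longrightarrow> \<phi> c x = \<phi> c y \<longleftrightarrow> (c, x, y) \<in> {(c, x, y). c \<in> ob S \<and> x \<in> {()} \<and> y \<in> {()}}"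
    by (rule quotient_object[OF presheaf_const closed_congruence_full[OF presheaf_const, of "{()}"]])
      (rule sQ, rule that)
  obtain f where f: "f \<in> hom T X one" using terminal X by (auto simp: terminal_def)
  have "nmap (el one) (res one) (el X) (res X) (\<lambda>c x. \<phi> c ())"
    using nmap_mem[OF \<phi>(1)] nmap_nat[OF \<phi>(1)] by (simp add: nmap_def)
  then obtain g where g: "g \<in> hom T one X" "\<And>c x. c \<in> ob S \<Longrightarrow> x \<in> el one c \<Longrightarrow> ap g c x = \<phi> c ()"
    using ap_full[OF one_ob X] by blast
  have "f \<bullet> g = ide T one" by (rule one_unique[OF cmp_hom[OF g(1) f] ide_hom[OF one_ob]])
  then have "x = ap f c (\<phi> c ())" if "x \<in> el one c" for x
    using ap_cmp[OF g(1) f c that] ap_ide[OF one_ob c that] g(2)[OF c that] by simp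
  moreover have "ap f c (\<phi> c ()) \<in> el one c" using ap_mem[OF f c nmap_mem[OF \<phi>(1) c]] by simp
  ultimately show ?thesis by blast
qed

definition pt :: "'u \<Rightarrow> 'u" where
  "pt c = (THE z. el one c = {z})"

lemma el_one: "c \<in> ob S \<Longrightarrow> el one c = {pt c}"
  unfolding pt_def using one_el[of c] by (metis (mono_tags, lifting) singleton_inject theI)

lemma res_pt: "h \<in> into c \<Longrightarrow> res one h (pt c) = pt (src S h)"
  using presheaf_mem[OF el_presheaf[OF one_ob], of h c "pt c"] el_one[OF into_ob] el_one[OF src_ob] by auto

lemma point_eqI: "f \<in> hom T one Y \<Longrightarrow> g \<in> hom T one Y \<Longrightarrow> (\<And>c. c \<in> ob S \<Longrightarrow> ap f c (pt c) = ap g c (pt c)) \<Longrightarrow> f = g"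
  by (rule ap_eqI) (auto simp: el_one)

lemma points_nmap:
  assumes "\<And>x. x \<in> I \<Longrightarrow> j x \<in> hom T one Y"
  shows "nmap (\<lambda>c. I) (\<lambda>h x. x) (el Y) (res Y) (\<lambda>c x. ap (j x) c (pt c))"
  unfolding nmap_def
proof (intro conjI allI ballI)
  fix c h x assume h: "h \<in> into c" and x: "x \<in> I"
  show "ap (j x) (src S h) (pt (src S h)) = res Y h (ap (j x) c (pt c))"
    using ap_nat[OF assms[OF x] h, of "pt c"] el_one[OF into_ob[OF h]] res_pt[OF h] by simp
qed (use ap_mem[OF assms] el_one in auto)

text \<open>Bundles the universal property with its meaning for sections: every section is locally
  one of the injections, and distinct injections meet only over null objects. In this form both can
  be moved along the isomorphism between two coproducts.\<close>

definition is_copower :: "'i set \<Rightarrow> 'o \<Rightarrow> ('i \<Rightarrow> 'm) \<Rightarrow> bool" where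
  "is_copower I D \<iota> \<longleftrightarrow> is_coproduct T I (\<lambda>x. one) D \<iota> \<and>
     lsurj (\<lambda>c. I) (el D) (res D) (\<lambda>c x. ap (\<iota> x) c (pt c)) \<and>
     (\<forall>c\<in>ob S. \<forall>x\<in>I. \<forall>y\<in>I. ap (\<iota> x) c (pt c) = ap (\<iota> y) c (pt c) \<longleftrightarrow> x = y \<or> null c)"

lemma copower_exists:
  assumes I: "sm I" shows "\<exists>D \<iota>. is_copower I D \<iota>"
proof -
  obtain D \<phi> where D: "D \<in> ob T" and \<phi>: "nmap (\<lambda>c. I) (\<lambda>h x. x) (el D) (res D) \<phi>"
    "lsurj (\<lambda>c. I) (el D) (res D) \<phi>"
    "\<And>c x y. c \<in> ob S \<Longrightarrow> x \<in> I \<Longrightarrow> y \<in> I \<Longrightarrow> \<phi> c x = \<phi> c y \<longleftrightarrow> (c, x, y) \<in> const_congruence I"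
    by (rule quotient_object[OF presheaf_const closed_const_congruence]) (rule I, rule that)
  have "\<forall>x. \<exists>i. x \<in> I \<longrightarrow> i \<in> hom T one D \<and> (\<forall>c\<in>ob S. ap i c (pt c) = \<phi> c x)"
  proof (intro allI)
    fix x
    show "\<exists>i. x \<in> I \<longrightarrow> i \<in> hom T one D \<and> (\<forall>c\<in>ob S. ap i c (pt c) = \<phi> c x)"
    proof (cases "x \<in> I")
      case True
      then have "nmap (el one) (res one) (el D) (res D) (\<lambda>c z. \<phi> c x)"
        using nmap_mem[OF \<phi>(1)] nmap_nat[OF \<phi>(1)] by (simp add: nmap_def)
      then obtain i where "i \<in> hom T one D" "\<And>c z. c \<in> ob S \<Longrightarrow> z \<in> el one c \<Longrightarrow> ap i c z = \<phi> c x"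
        using ap_full[OF one_ob D] by blast
      then show ?thesis using el_one by auto
    qed simp
  qed
  then obtain \<iota> where \<iota>: "\<And>x. x \<in> I \<Longrightarrow> \<iota> x \<in> hom T one D" "\<And>x c. x \<in> I \<Longrightarrow> c \<in> ob S \<Longrightarrow> ap (\<iota> x) c (pt c) = \<phi> c x"
    by metis
  have surj: "lsurj (\<lambda>c. I) (el D) (res D) (\<lambda>c x. ap (\<iota> x) c (pt c))"
    unfolding lsurj_def
  proof (intro ballI)
    fix c z assume c: "c \<in> ob S" and z: "z \<in> el D c"
    show "lcov c (\<lambda>h. \<exists>q\<in>I. ap (\<iota> q) (src S h) (pt (src S h)) = res D h z)"
      by (rule lcov_mono[OF c lsurjD[OF \<phi>(2) c z]]) (simp add: \<iota>(2) src_ob)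
  qed
  have ker: "ap (\<iota> x) c (pt c) = ap (\<iota> y) c (pt c) \<longleftrightarrow> x = y \<or> null c" if "c \<in> ob S" "x \<in> I" "y \<in> I" for c x y
    using that by (simp add: \<iota>(2) \<phi>(3) const_congruence_def)
  have "is_coproduct T I (\<lambda>x. one) D \<iota>"
    unfolding is_coproduct_def
  proof (intro conjI ballI allI impI)
    fix Y and j :: "'a \<Rightarrow> 'm" assume Y: "Y \<in> ob T" and j: "\<forall>x\<in>I. j x \<in> hom T one Y"
    obtain h where h: "h \<in> hom T D Y" "\<And>c x. c \<in> ob S \<Longrightarrow> x \<in> I \<Longrightarrow> ap h c (ap (\<iota> x) c (pt c)) = ap (j x) c (pt c)"
    proof (rule arrow_from_presheaf[OF presheaf_const D Y points_nmap[OF \<iota>(1)] surj points_nmap[of I j Y]])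
      fix c x y assume c: "c \<in> ob S" and x: "x \<in> I" and y: "y \<in> I"
        and eq: "ap (\<iota> x) c (pt c) = ap (\<iota> y) c (pt c)"
      show "ap (j x) c (pt c) = ap (j y) c (pt c)"
      proof (cases "x = y")
        case False
        \<comment> \<open>Distinct indices are identified only over null objects, where
          \<open>Y\<close> has a single section.\<close>
        then have "null c" using ker[OF c x y] eq by simp
        then obtain z where "el Y c = {z}" using null_sheaf[OF el_sheaf[OF Y] c] by blast
        moreover have "ap (j i) c (pt c) \<in> el Y c" if "i \<in> I" for i
          using ap_mem[OF j[rule_format, OF that] c] el_one[OF c] by simp
        ultimately show ?thesis using x y by auto
      qed simp
    qed (use j that in auto)
    have hi: "h \<bullet> \<iota> x = j x" if x: "x \<in> I" for x
      by (rule point_eqI[OF cmp_hom[OF \<iota>(1)[OF x] h(1)] j[rule_format, OF x]])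
        (use ap_cmp[OF \<iota>(1)[OF x] h(1)] h(2) x el_one in simp)
    show "\<exists>!h. h \<in> hom T D Y \<and> (\<forall>x\<in>I. h \<bullet> \<iota> x = j x)"
    proof (rule ex1I[of _ h])
      fix k assume k: "k \<in> hom T D Y \<and> (\<forall>x\<in>I. k \<bullet> \<iota> x = j x)"
      show "k = h"
      proof (rule arrow_ext_lsurj[OF presheaf_const surj _ h(1)])
        fix c x assume c: "c \<in> ob S" and x: "x \<in> I"
        have "ap k c (ap (\<iota> x) c (pt c)) = ap (k \<bullet> \<iota> x) c (pt c)"
          using ap_cmp[OF \<iota>(1)[OF x] conjunct1[OF k] c, of "pt c"] el_one[OF c] by simp
        then show "ap k c (ap (\<iota> x) c (pt c)) = ap h c (ap (\<iota> x) c (pt c))" using k x h(2)[OF c x] by simp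
      qed (use k in simp)
    qed (use h(1) hi in simp)
  qed (use D \<iota> in auto)
  then have "is_copower I D \<iota>" using surj ker by (simp add: is_copower_def)
  then show ?thesis by blast
qed

text \<open>A constant-object functor comes with arbitrary coproducts, so the facts about sections
  are transported from the constructed copower along the canonical isomorphism.\<close>

lemma coproduct_copower:
  assumes I: "sm I" and D': "is_coproduct T I (\<lambda>x. one) D' \<iota>'"
  shows "is_copower I D' \<iota>'"
proof -
  obtain D \<iota> where *: "is_copower I D \<iota>" using copower_exists[OF I] by blast
  then have D: "is_coproduct T I (\<lambda>x. one) D \<iota>" and surj: "lsurj (\<lambda>c. I) (el D) (res D) (\<lambda>c x. ap (\<iota> x) c (pt c))"
    and ker: "\<And>c x y. c \<in> ob S \<Longrightarrow> x \<in> I \<Longrightarrow> y \<in> I \<Longrightarrow> ap (\<iota> x) c (pt c) = ap (\<iota> y) c (pt c) \<longleftrightarrow> x = y \<or> null c"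
    by (auto simp: is_copower_def)
  note i = coproductD(2)[OF D] and i' = coproductD(2)[OF D']
  obtain k where k: "k \<in> hom T D D'" "\<And>x. x \<in> I \<Longrightarrow> k \<bullet> \<iota> x = \<iota>' x"
    using coproductD(3)[OF D coproductD(1)[OF D'], of \<iota>'] i' by auto
  obtain l where l: "l \<in> hom T D' D" "\<And>x. x \<in> I \<Longrightarrow> l \<bullet> \<iota>' x = \<iota> x"
    using coproductD(3)[OF D' coproductD(1)[OF D], of \<iota>] i by auto
  have "l \<bullet> k = ide T D"
    by (rule coproduct_ext[OF D cmp_hom[OF k(1) l(1)] ide_hom[OF coproductD(1)[OF D]]])
      (use assoc[OF i k(1) l(1)] k l ide_left[OF i] in simp)
  moreover have "k \<bullet> l = ide T D'"
    by (rule coproduct_ext[OF D' cmp_hom[OF l(1) k(1)] ide_hom[OF coproductD(1)[OF D']]])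
      (use assoc[OF i' l(1) k(1)] k l ide_left[OF i'] in simp)
  ultimately have "iso T k" by (rule isoI[OF k(1) l(1)])
  note b = iso_bijective[OF this k(1)]
  have a: "ap (\<iota>' x) c (pt c) = ap k c (ap (\<iota> x) c (pt c))" "ap (\<iota> x) c (pt c) \<in> el D c" if "x \<in> I" "c \<in> ob S" for x c
    using ap_cmp[OF i[OF that(1)] k(1) that(2)] ap_mem[OF i[OF that(1)] that(2)] el_one[OF that(2)] k(2)[OF that(1)] by auto
  have "lsurj (\<lambda>c. I) (el D') (res D') (\<lambda>c x. ap (\<iota>' x) c (pt c))"
    unfolding lsurj_def
  proof (intro ballI)
    fix c z' assume c: "c \<in> ob S" and "z' \<in> el D' c"
    then have "z' \<in> ap k c ` el D c" using b[OF c] by (simp add: bij_betw_def)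
    then obtain z where z: "z \<in> el D c" "z' = ap k c z" by blast
    show "lcov c (\<lambda>h. \<exists>q\<in>I. ap (\<iota>' q) (src S h) (pt (src S h)) = res D' h z')"
    proof (rule lcov_mono[OF c lsurjD[OF surj c z(1)]])
      fix h assume h: "h \<in> into c" and "\<exists>q\<in>I. ap (\<iota> q) (src S h) (pt (src S h)) = res D h z"
      then show "\<exists>q\<in>I. ap (\<iota>' q) (src S h) (pt (src S h)) = res D' h z'"
        using a(1)[OF _ src_ob[OF h]] ap_nat[OF k(1) h z(1)] z(2) by metis
    qed
  qed
  moreover have "ap (\<iota>' x) c (pt c) = ap (\<iota>' y) c (pt c) \<longleftrightarrow> x = y \<or> null c" if "c \<in> ob S" "x \<in> I" "y \<in> I" for c x y
    using a[OF that(2,1)] a[OF that(3,1)] ker[OF that] inj_on_eq_iff[OF bij_betw_imp_inj_on[OF b[OF that(1)]]] by simp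
  ultimately show ?thesis using D' by (auto simp: is_copower_def)
qed

lemma constant_object_functor_exists: "\<exists>\<Delta> \<iota>. constant_object_functor U T one \<Delta> \<iota>"
proof -
  have "\<forall>X. \<exists>D \<iota>. is_coproduct T (U X) (\<lambda>x. one) D \<iota>"
    using copower_exists[OF small_U] unfolding is_copower_def by blast
  then obtain D \<iota> where D: "\<And>X. is_coproduct T (U X) (\<lambda>x. one) (D X) (\<iota> X)" by metis
  define P where "P f h \<longleftrightarrow> h \<in> hom T (D (src (set_cat U) f)) (D (tgt (set_cat U) f)) \<and>
    (\<forall>x\<in>U (src (set_cat U) f). h \<bullet> \<iota> (src (set_cat U) f) x = \<iota> (tgt (set_cat U) f) (app f x))" for f h
  have ex: "\<exists>h. P f h" if f: "f \<in> hom (set_cat U) X Y" for f X Y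
  proof -
    have "src (set_cat U) f = X" "tgt (set_cat U) f = Y" using f by (auto simp: hom_def)
    then show ?thesis unfolding P_def
      using coproductD(3)[OF D[of X] coproductD(1)[OF D[of Y]], of "\<lambda>x. \<iota> Y (app f x)"]
        coproductD(2)[OF D[of Y] app_mem[where U = U, OF f]] by auto
  qed
  define \<Delta> where "\<Delta> = \<lparr>on_ob = D, on_ar = (\<lambda>f. SOME h. P f h)\<rparr>"
  have P: "P f (on_ar \<Delta> f)" if "f \<in> hom (set_cat U) X Y" for f X Y
    using someI_ex[OF ex[OF that]] by (simp add: \<Delta>_def)
  have "constant_object_functor U T one \<Delta> \<iota>"
    unfolding constant_object_functor_def
  proof (intro conjI allI impI)
    fix X show "is_coproduct T (U X) (\<lambda>x. one) (on_ob \<Delta> X) (\<iota> X)" using D by (simp add: \<Delta>_def)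
  next
    fix X Y f assume f: "f \<in> hom (set_cat U) X Y"
    have "src (set_cat U) f = X" "tgt (set_cat U) f = Y" using f by (auto simp: hom_def)
    then show "on_ar \<Delta> f \<in> hom T (on_ob \<Delta> X) (on_ob \<Delta> Y)" "\<forall>x\<in>U X. on_ar \<Delta> f \<bullet> \<iota> X x = \<iota> Y (app f x)"
      using P[OF f] unfolding P_def by (simp_all add: \<Delta>_def)
  qed
  then show ?thesis by blast
qed

text \<open>If the empty sieve covered every object of the site, each sheaf would have exactly one
  section everywhere, and the terminal object would be initial.\<close>

lemma nondegenerate_not_null:
  assumes "nondegenerate T" obtains c where "c \<in> ob S" "\<not> null c"
proof (rule ccontr)
  assume "\<not> thesis"
  then have n: "null c" if "c \<in> ob S" for c using that \<open>\<And>c. c \<in> ob S \<Longrightarrow> \<not> null c \<Longrightarrow> thesis\<close> by blast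
  have "initial T one"
    unfolding initial_def
  proof (intro conjI ballI one_ob)
    fix X assume X: "X \<in> ob T"
    have "\<forall>c. \<exists>z. c \<in> ob S \<longrightarrow> el X c = {z}" using null_sheaf[OF el_sheaf[OF X] _ n] by blast
    then obtain z where z: "\<And>c. c \<in> ob S \<Longrightarrow> el X c = {z c}" by metis
    have "nmap (el one) (res one) (el X) (res X) (\<lambda>c x. z c)"
      unfolding nmap_def
    proof (intro conjI allI ballI)
      fix c h assume h: "h \<in> into c"
      show "z (src S h) = res X h (z c)"
        using presheaf_mem[OF el_presheaf[OF X] h, of "z c"] z[OF into_ob[OF h]] z[OF src_ob[OF h]] by simp
    qed (use z in simp)
    then obtain f where f: "f \<in> hom T one X" using ap_full[OF one_ob X] by blast
    moreover have "g = f" if "g \<in> hom T one X" for g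
      by (rule ap_eqI[OF that f]) (use ap_mem[OF that] ap_mem[OF f] z in auto)
    ultimately show "\<exists>!f. f \<in> hom T one X" by blast
  qed
  moreover have "isomorphic T one one"
    unfolding isomorphic_def using iso_ide[OF one_ob] ide_hom[OF one_ob] by blast
  ultimately show False using assms terminal by (auto simp: nondegenerate_def)
qed

section \<open>Preservation properties of the constant-object functor\<close>

context
  fixes \<Delta> \<iota>
  assumes \<Delta>: "constant_object_functor U T one \<Delta> \<iota>"
begin

abbreviation D where "D \<equiv> on_ob \<Delta>"
abbreviation \<phi> where "\<phi> X c x \<equiv> ap (\<iota> X x) c (pt c)"

lemma D_coproduct: "is_coproduct T (U X) (\<lambda>x. one) (D X) (\<iota> X)"
  using \<Delta> by (simp add: constant_object_functor_def)

lemma D_copower: "is_copower (U X) (D X) (\<iota> X)"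
  by (rule coproduct_copower[OF small_U D_coproduct])

lemma D_ob: "D X \<in> ob T"
  using D_coproduct coproductD(1) by metis

lemma iota_hom: "x \<in> U X \<Longrightarrow> \<iota> X x \<in> hom T one (D X)"
  using coproductD(2)[OF D_coproduct[of X]] .

lemma phi_mem: "c \<in> ob S \<Longrightarrow> x \<in> U X \<Longrightarrow> \<phi> X c x \<in> el (D X) c"
  using ap_mem[OF iota_hom] el_one by simp

lemma phi_lsurj: "c \<in> ob S \<Longrightarrow> z \<in> el (D X) c \<Longrightarrow> lcov c (\<lambda>h. \<exists>x\<in>U X. \<phi> X (src S h) x = res (D X) h z)"
  using D_copower[of X] unfolding is_copower_def lsurj_def by blast

lemma phi_eq_iff: "c \<in> ob S \<Longrightarrow> x \<in> U X \<Longrightarrow> y \<in> U X \<Longrightarrow> \<phi> X c x = \<phi> X c y \<longleftrightarrow> x = y \<or> null c"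
  using D_copower unfolding is_copower_def by blast

lemma phi_res: "h \<in> into c \<Longrightarrow> x \<in> U X \<Longrightarrow> res (D X) h (\<phi> X c x) = \<phi> X (src S h) x"
  using ap_nat[OF iota_hom, of x X h c "pt c"] el_one[OF into_ob] res_pt by simp

lemma D_hom: "f \<in> hom (set_cat U) X Y \<Longrightarrow> on_ar \<Delta> f \<in> hom T (D X) (D Y)"
  using \<Delta> unfolding constant_object_functor_def by blast

lemma D_iota: "f \<in> hom (set_cat U) X Y \<Longrightarrow> x \<in> U X \<Longrightarrow> on_ar \<Delta> f \<bullet> \<iota> X x = \<iota> Y (app f x)"
  using \<Delta> unfolding constant_object_functor_def by blast

lemma D_phi: "f \<in> hom (set_cat U) X Y \<Longrightarrow> c \<in> ob S \<Longrightarrow> x \<in> U X \<Longrightarrow> ap (on_ar \<Delta> f) c (\<phi> X c x) = \<phi> Y c (app f x)"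
  using ap_cmp[OF iota_hom D_hom, of x X f Y c "pt c"] D_iota el_one by simp

lemma D_functor: "is_functor (set_cat U) T \<Delta>"
proof -
  interpret set: category_locale "set_cat U" by unfold_locales (rule category_set_cat)
  show ?thesis
    unfolding is_functor_def
  proof (intro conjI ballI impI)
    fix X assume X: "X \<in> ob (set_cat U)"
    show "on_ar \<Delta> (ide (set_cat U) X) = ide T (D X)"
      by (rule coproduct_ext[OF D_coproduct D_hom[OF set.ide_hom[OF X]] ide_hom[OF D_ob]])
        (simp add: D_iota[OF set.ide_hom[OF X]] app_ide ide_left[OF iota_hom])
  next
    fix f g assume f: "f \<in> ar (set_cat U)" and g: "g \<in> ar (set_cat U)" "src (set_cat U) g = tgt (set_cat U) f"
    obtain X Y Z where fh: "f \<in> hom (set_cat U) X Y" and gh: "g \<in> hom (set_cat U) Y Z"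
      using f g by (auto simp: hom_def)
    show "on_ar \<Delta> (g \<cdot>\<^bsub>set_cat U\<^esub> f) = on_ar \<Delta> g \<bullet> on_ar \<Delta> f"
    proof (rule coproduct_ext[OF D_coproduct D_hom[OF set.cmp_hom[OF fh gh]] cmp_hom[OF D_hom[OF fh] D_hom[OF gh]]])
      fix x assume x: "x \<in> U X"
      show "on_ar \<Delta> (g \<cdot>\<^bsub>set_cat U\<^esub> f) \<bullet> \<iota> X x = (on_ar \<Delta> g \<bullet> on_ar \<Delta> f) \<bullet> \<iota> X x"
        using D_iota[OF set.cmp_hom[OF fh gh] x] D_iota[OF fh x] D_iota[OF gh app_mem[where U = U, OF fh x]]
          assoc[OF iota_hom[OF x] D_hom[OF fh] D_hom[OF gh]] app_cmp[where U = U, OF fh x] by simp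
    qed
  qed (use D_ob D_hom in \<open>auto simp: hom_def\<close>)
qed

lemma D_epi:
  assumes f: "f \<in> hom (set_cat U) X Y" "f \<in> surjections U"
  shows "on_ar \<Delta> f \<in> epi_arrows T"
proof (rule epiI_lsurj[OF D_hom[OF f(1)]], unfold lsurj_def, intro ballI)
  fix c z assume c: "c \<in> ob S" and z: "z \<in> el (D Y) c"
  have s: "app f ` U X = U Y" using f by (auto simp: surjections_def hom_def)
  show "lcov c (\<lambda>h. \<exists>q\<in>el (D X) (src S h). ap (on_ar \<Delta> f) (src S h) q = res (D Y) h z)"
  proof (rule lcov_mono[OF c phi_lsurj[OF c z]])
    fix h assume h: "h \<in> into c" and "\<exists>x\<in>U Y. \<phi> Y (src S h) x = res (D Y) h z"
    then obtain y where y: "y \<in> app f ` U X" "\<phi> Y (src S h) y = res (D Y) h z" using s by auto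
    then obtain x where x: "x \<in> U X" "y = app f x" by blast
    then show "\<exists>q\<in>el (D X) (src S h). ap (on_ar \<Delta> f) (src S h) q = res (D Y) h z"
      using D_phi[OF f(1) src_ob[OF h] x(1)] phi_mem[OF src_ob[OF h] x(1)] y(2) by auto
  qed
qed

text \<open>Locally both sections are constants. Their images coincide only if the elements do or
  the object is null, and in either case the sections coincide.\<close>

lemma D_mono:
  assumes f: "f \<in> hom (set_cat U) X Y" "f \<in> injections U"
  shows "on_ar \<Delta> f \<in> mono_arrows T"
proof (rule monoI_inj[OF D_hom[OF f(1)]])
  fix c z z' assume c: "c \<in> ob S" and z: "z \<in> el (D X) c" "z' \<in> el (D X) c"
    and eq: "ap (on_ar \<Delta> f) c z = ap (on_ar \<Delta> f) c z'"
  have i: "inj_on (app f) (U X)" using f by (auto simp: injections_def hom_def)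
  show "z = z'"
  proof (rule sheaf_sep[OF el_sheaf[OF D_ob] c z], rule lcov_mp[OF c phi_lsurj[OF c z(1)] phi_lsurj[OF c z(2)]])
    fix h assume h: "h \<in> into c" and "\<exists>x\<in>U X. \<phi> X (src S h) x = res (D X) h z" "\<exists>x\<in>U X. \<phi> X (src S h) x = res (D X) h z'"
    then obtain x x' where x: "x \<in> U X" "\<phi> X (src S h) x = res (D X) h z" "x' \<in> U X" "\<phi> X (src S h) x' = res (D X) h z'" by blast
    note d = src_ob[OF h]
    have "\<phi> Y (src S h) (app f x) = \<phi> Y (src S h) (app f x')"
      using D_phi[OF f(1) d x(1)] D_phi[OF f(1) d x(3)] x(2,4) ap_nat[OF D_hom[OF f(1)] h z(1)] ap_nat[OF D_hom[OF f(1)] h z(2)] eq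
      by simp
    then have "app f x = app f x' \<or> null (src S h)"
      using phi_eq_iff[OF d app_mem[where U = U, OF f(1) x(1)] app_mem[where U = U, OF f(1) x(3)]] by simp
    then have "\<phi> X (src S h) x = \<phi> X (src S h) x'"
      using phi_eq_iff[OF d x(1,3)] inj_onD[OF i _ x(1,3)] by auto
    then show "res (D X) h z = res (D X) h z'" using x(2,4) by simp
  qed
qed

text \<open>Membership in the image of a monomorphism is local, so the two given sections may be
  taken constant; then the pullback of sets provides the element required.\<close>

lemma D_pullback:
  assumes pb: "is_pullback (set_cat U) m n p q" and m: "m \<in> injections U" and n: "n \<in> injections U"
  shows "is_pullback T (on_ar \<Delta> m) (on_ar \<Delta> n) (on_ar \<Delta> p) (on_ar \<Delta> q)"
proof -
  interpret set: sheaf_topos U point_site point_topology "set_cat U" "\<lambda>X c. U X" "\<lambda>X f x. x" "\<lambda>f c. app f"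
    by (rule sheaf_topos_set)
  obtain A Z where mh: "m \<in> hom (set_cat U) A Z" using pb by (auto simp: is_pullback_def hom_def)
  obtain B P where h: "n \<in> hom (set_cat U) B Z" "p \<in> hom (set_cat U) P A" "q \<in> hom (set_cat U) P B"
    "m \<cdot>\<^bsub>set_cat U\<^esub> p = n \<cdot>\<^bsub>set_cat U\<^esub> q"
    by (rule set.pullbackD[OF pb mh]) (rule that)
  have mn: "m \<in> mono_arrows (set_cat U)" "n \<in> mono_arrows (set_cat U)" using m n mono_set_cat by auto
  have "p \<in> injections U" using set.pullback_mono[OF pb mh mn(2)] mono_set_cat by simp
  then have pm: "on_ar \<Delta> p \<in> mono_arrows T" using D_mono[OF h(2)] by simp
  note Dm = D_hom[OF mh] and Dn = D_hom[OF h(1)] and Dp = D_hom[OF h(2)]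
  show ?thesis
  proof (rule pullbackI_el[OF D_mono[OF mh m] Dm D_mono[OF h(1) n] Dn Dp pm D_hom[OF h(3)]])
    show "on_ar \<Delta> m \<bullet> on_ar \<Delta> p = on_ar \<Delta> n \<bullet> on_ar \<Delta> q"
      using functor_cmp[OF D_functor h(2) mh] functor_cmp[OF D_functor h(3,1)] h(4) by simp
    fix c a b assume c: "c \<in> ob S" and a: "a \<in> el (D A) c" and b: "b \<in> el (D B) c" and eq: "ap (on_ar \<Delta> m) c a = ap (on_ar \<Delta> n) c b"
    show "\<exists>z\<in>el (D P) c. ap (on_ar \<Delta> p) c z = a"
    proof (rule mono_image_local[OF pm Dp c a], rule lcov_mp[OF c phi_lsurj[OF c a] phi_lsurj[OF c b]])
      fix k assume k: "k \<in> into c" and "\<exists>x\<in>U A. \<phi> A (src S k) x = res (D A) k a" "\<exists>x\<in>U B. \<phi> B (src S k) x = res (D B) k b"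
      then obtain x y where x: "x \<in> U A" "\<phi> A (src S k) x = res (D A) k a" and y: "y \<in> U B" "\<phi> B (src S k) y = res (D B) k b" by blast
      note d = src_ob[OF k]
      have "\<phi> Z (src S k) (app m x) = \<phi> Z (src S k) (app n y)"
        using D_phi[OF mh d x(1)] D_phi[OF h(1) d y(1)] x(2) y(2) ap_nat[OF Dm k a] ap_nat[OF Dn k b] eq by simp
      then have "app m x = app n y \<or> null (src S k)"
        using phi_eq_iff[OF d app_mem[where U = U, OF mh x(1)] app_mem[where U = U, OF h(1) y(1)]] by simp
      then show "\<exists>z\<in>el (D P) (src S k). ap (on_ar \<Delta> p) (src S k) z = res (D A) k a"
      proof
        assume "app m x = app n y"
        then obtain w where w: "w \<in> U P" "app p w = x"
          using set.pullback_el[OF pb mn(1) mh mn(2) h(1,2), of undefined x y] x(1) y(1) by auto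
        then show ?thesis using D_phi[OF h(2) d w(1)] phi_mem[OF d w(1)] x(2) by auto
      next
        \<comment> \<open>Here the elements of \<open>A\<close> and \<open>B\<close> need not match
          in \<open>Z\<close>, but \<open>D P\<close> and \<open>D A\<close> have one section
          each.\<close>
        assume nl: "null (src S k)"
        obtain z where z: "el (D P) (src S k) = {z}" using null_sheaf[OF el_sheaf[OF D_ob] d nl] by blast
        obtain z' where z': "el (D A) (src S k) = {z'}" using null_sheaf[OF el_sheaf[OF D_ob] d nl] by blast
        show ?thesis
          using z z' ap_mem[OF Dp d, of z] presheaf_mem[OF el_presheaf[OF D_ob] k a] by auto
      qed
    qed
  qed
qed

text \<open>\<open>\<Delta>\<close> is left adjoint to the functor of points
  \<open>hom T one W\<close>. Local smallness codes the set of points of \<open>W\<close> as an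
  object \<open>w\<close> of sets, and the universal property is carried across the
  adjunction.\<close>

lemma D_pushout:
  assumes po: "is_pushout (set_cat U) d e p q"
  shows "is_pushout T (on_ar \<Delta> d) (on_ar \<Delta> e) (on_ar \<Delta> p) (on_ar \<Delta> q)"
proof -
  interpret set: category_locale "set_cat U" by unfold_locales (rule category_set_cat)
  obtain X A where dh: "d \<in> hom (set_cat U) X A" using po by (auto simp: is_pushout_def hom_def)
  obtain B P where h: "e \<in> hom (set_cat U) X B" "p \<in> hom (set_cat U) A P" "q \<in> hom (set_cat U) B P"
    "p \<cdot>\<^bsub>set_cat U\<^esub> d = q \<cdot>\<^bsub>set_cat U\<^esub> e"
    "\<And>W f g. f \<in> hom (set_cat U) A W \<Longrightarrow> g \<in> hom (set_cat U) B W \<Longrightarrow> f \<cdot>\<^bsub>set_cat U\<^esub> d = g \<cdot>\<^bsub>set_cat U\<^esub> e \<Longrightarrow>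
      \<exists>!h. h \<in> hom (set_cat U) P W \<and> h \<cdot>\<^bsub>set_cat U\<^esub> p = f \<and> h \<cdot>\<^bsub>set_cat U\<^esub> q = g"
    by (rule set.pushoutD[OF po dh]) (rule that)
  note Dd = D_hom[OF dh] and De = D_hom[OF h(1)] and Dp = D_hom[OF h(2)] and Dq = D_hom[OF h(3)]
  show ?thesis
  proof (rule pushoutI[OF Dd De Dp Dq])
    show "on_ar \<Delta> p \<bullet> on_ar \<Delta> d = on_ar \<Delta> q \<bullet> on_ar \<Delta> e"
      using functor_cmp[OF D_functor dh h(2)] functor_cmp[OF D_functor h(1,3)] h(4) by simp
    fix W u v assume u: "u \<in> hom T (D A) W" and v: "v \<in> hom T (D B) W" and eq: "u \<bullet> on_ar \<Delta> d = v \<bullet> on_ar \<Delta> e"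
    have W: "W \<in> ob T" using homD[OF u] by simp
    have "sm (hom T one W)" using locally_small_T one_ob W by (simp add: locally_small_def)
    then obtain g w where g: "bij_betw g (hom T one W) (U w)" using small_bij by blast
    have g_inj: "k = k'" if "k \<in> hom T one W" "k' \<in> hom T one W" "g k = g k'" for k k'
      using that bij_betw_imp_inj_on[OF g] by (meson inj_onD)
    have g_surj: "\<exists>k\<in>hom T one W. g k = x" if "x \<in> U w" for x
      using that unfolding bij_betw_imp_surj_on[OF g, symmetric] by blast
    \<comment> \<open>The adjoint transpose of \<open>k\<close>, sending an element to the code of
      the point of \<open>W\<close> it names. \<open>enc_eq\<close> and \<open>enc_ex\<close> make
      transposition bijective and \<open>enc_cmp\<close> makes it natural.\<close>
    define enc where "enc Y k = set_fn U Y (\<lambda>x. g (k \<bullet> \<iota> Y x)) w" for Y k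
    have enc: "enc Y k \<in> hom (set_cat U) Y w" "\<And>x. x \<in> U Y \<Longrightarrow> app (enc Y k) x = g (k \<bullet> \<iota> Y x)"
      if "k \<in> hom T (D Y) W" for Y k
      using that bij_betwE[OF g] cmp_hom[OF iota_hom that] by (auto simp: enc_def intro!: set_fn_hom)
    have enc_cmp: "enc Y k \<cdot>\<^bsub>set_cat U\<^esub> f = enc X (k \<bullet> on_ar \<Delta> f)"
      if f: "f \<in> hom (set_cat U) X Y" and k: "k \<in> hom T (D Y) W" for X Y f k
    proof (rule set_eqI_app[OF set.cmp_hom[OF f enc(1)[OF k]] enc(1)[OF cmp_hom[OF D_hom[OF f] k]]])
      fix x assume x: "x \<in> U X"
      show "app (enc Y k \<cdot>\<^bsub>set_cat U\<^esub> f) x = app (enc X (k \<bullet> on_ar \<Delta> f)) x"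
        using app_cmp[where U = U, OF f x] enc(2)[OF k app_mem[where U = U, OF f x]] enc(2)[OF cmp_hom[OF D_hom[OF f] k] x]
          assoc[OF iota_hom[OF x] D_hom[OF f] k] D_iota[OF f x] by simp
    qed
    have enc_eq: "k = k'" if k: "k \<in> hom T (D Y) W" "k' \<in> hom T (D Y) W" "enc Y k = enc Y k'" for Y k k'
      by (rule coproduct_ext[OF D_coproduct k(1,2)], rule g_inj)
        (use cmp_hom[OF iota_hom k(1)] cmp_hom[OF iota_hom k(2)] enc(2)[OF k(1)] enc(2)[OF k(2)] k(3) in simp_all)
    have enc_ex: "\<exists>k\<in>hom T (D Y) W. enc Y k = t" if t: "t \<in> hom (set_cat U) Y w" for Y t
    proof -
      have "\<forall>x. \<exists>k. x \<in> U Y \<longrightarrow> k \<in> hom T one W \<and> g k = app t x" using g_surj app_mem[where U = U, OF t] by blast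
      then obtain j where j: "\<And>x. x \<in> U Y \<Longrightarrow> j x \<in> hom T one W \<and> g (j x) = app t x" by metis
      obtain k where k: "k \<in> hom T (D Y) W" "\<And>x. x \<in> U Y \<Longrightarrow> k \<bullet> \<iota> Y x = j x"
        using coproductD(3)[OF D_coproduct[of Y] W, of j] j by blast
      have "enc Y k = t"
        by (rule set_eqI_app[OF enc(1)[OF k(1)] t]) (simp add: enc(2)[OF k(1)] k(2) j)
      then show ?thesis using k(1) by blast
    qed
    have "enc A u \<cdot>\<^bsub>set_cat U\<^esub> d = enc B v \<cdot>\<^bsub>set_cat U\<^esub> e" using enc_cmp[OF dh u] enc_cmp[OF h(1) v] eq by simp
    from h(5)[OF enc(1)[OF u] enc(1)[OF v] this] obtain t where
      t: "t \<in> hom (set_cat U) P w" "t \<cdot>\<^bsub>set_cat U\<^esub> p = enc A u" "t \<cdot>\<^bsub>set_cat U\<^esub> q = enc B v"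
      and ut: "\<And>t'. t' \<in> hom (set_cat U) P w \<Longrightarrow> t' \<cdot>\<^bsub>set_cat U\<^esub> p = enc A u \<Longrightarrow> t' \<cdot>\<^bsub>set_cat U\<^esub> q = enc B v \<Longrightarrow> t' = t"
      by metis
    obtain k where k: "k \<in> hom T (D P) W" "enc P k = t" using enc_ex[OF t(1)] by blast
    show "\<exists>!k. k \<in> hom T (D P) W \<and> k \<bullet> on_ar \<Delta> p = u \<and> k \<bullet> on_ar \<Delta> q = v"
    proof (rule ex1I[of _ k])
      have "k \<bullet> on_ar \<Delta> p = u" by (rule enc_eq[OF cmp_hom[OF Dp k(1)] u]) (use enc_cmp[OF h(2) k(1)] k(2) t(2) in simp)
      moreover have "k \<bullet> on_ar \<Delta> q = v" by (rule enc_eq[OF cmp_hom[OF Dq k(1)] v]) (use enc_cmp[OF h(3) k(1)] k(2) t(3) in simp)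
      ultimately show "k \<in> hom T (D P) W \<and> k \<bullet> on_ar \<Delta> p = u \<and> k \<bullet> on_ar \<Delta> q = v" using k(1) by simp
    next
      fix k' assume k': "k' \<in> hom T (D P) W \<and> k' \<bullet> on_ar \<Delta> p = u \<and> k' \<bullet> on_ar \<Delta> q = v"
      then have "enc P k' = t"
        by (intro ut) (use enc(1) enc_cmp[OF h(2)] enc_cmp[OF h(3)] in auto)
      then show "k' = k" by (intro enc_eq) (use k' k in auto)
    qed
  qed
qed

text \<open>Over an object \<open>c\<close> that is not null the constants separate elements, which
  gives injectivity. For surjectivity the preimage of a constant is only locally constant, so a
  further non-null object is chosen on which it is one.\<close>

lemma D_conservative:
  assumes nd: "nondegenerate T" and f: "f \<in> hom (set_cat U) X Y" and i: "iso T (on_ar \<Delta> f)"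
  shows "iso (set_cat U) f"
proof -
  interpret set: sheaf_topos U point_site point_topology "set_cat U" "\<lambda>X c. U X" "\<lambda>X f x. x" "\<lambda>f c. app f"
    by (rule sheaf_topos_set)
  obtain c where c: "c \<in> ob S" "\<not> null c" by (rule nondegenerate_not_null[OF nd]) (rule that)
  note b = iso_bijective[OF i D_hom[OF f] c(1)]
  have "inj_on (app f) (U X)"
  proof (rule inj_onI)
    fix x y assume x: "x \<in> U X" and y: "y \<in> U X" and eq: "app f x = app f y"
    have "\<phi> X c x = \<phi> X c y"
      using inj_onD[OF bij_betw_imp_inj_on[OF b]] D_phi[OF f c(1) x] D_phi[OF f c(1) y] eq phi_mem[OF c(1)] x y by metis
    then show "x = y" using phi_eq_iff[OF c(1) x y] c(2) by simp
  qed
  moreover have "app f ` U X = U Y"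
  proof
    show "app f ` U X \<subseteq> U Y" using app_mem[where U = U, OF f] by auto
    show "U Y \<subseteq> app f ` U X"
    proof
      fix y assume y: "y \<in> U Y"
      have "\<phi> Y c y \<in> ap (on_ar \<Delta> f) c ` el (D X) c" using phi_mem[OF c(1) y] b by (simp add: bij_betw_def)
      then obtain z where z: "z \<in> el (D X) c" "\<phi> Y c y = ap (on_ar \<Delta> f) c z" by blast
      obtain h where h: "h \<in> into c" "\<exists>x\<in>U X. \<phi> X (src S h) x = res (D X) h z" "\<not> null (src S h)"
        by (rule lcov_not_null[OF c(1) phi_lsurj[OF c(1) z(1)] c(2)]) (rule that)
      then obtain x where x: "x \<in> U X" "\<phi> X (src S h) x = res (D X) h z" by blast
      have "\<phi> Y (src S h) (app f x) = \<phi> Y (src S h) y"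
        using D_phi[OF f src_ob[OF h(1)] x(1)] x(2) ap_nat[OF D_hom[OF f] h(1) z(1)] z(2) phi_res[OF h(1) y] by simp
      then have "app f x = y" using phi_eq_iff[OF src_ob[OF h(1)] app_mem[where U = U, OF f x(1)] y] h(3) by simp
      then show "y \<in> app f ` U X" using x(1) by blast
    qed
  qed
  ultimately have "bij_betw (app f) (U X) (U Y)" by (simp add: bij_betw_def)
  then show ?thesis by (rule set.bijective_iso[OF f])
qed

lemma D_transfer:
  assumes "nondegenerate T"
  shows "transfer_functor U (set_cat U) (surjections U) (injections U) T (epi_arrows T) (mono_arrows T) \<Delta>"
  unfolding transfer_functor_def
proof (intro conjI transfer_setting_set transfer_setting_T D_functor ballI allI impI)
  show "conservative (set_cat U) T \<Delta>"
    unfolding conservative_def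
  proof (intro ballI impI)
    fix f assume "f \<in> ar (set_cat U)" "iso T (on_ar \<Delta> f)"
    then show "iso (set_cat U) f" using D_conservative[OF assms, of f "src (set_cat U) f" "tgt (set_cat U) f"] by (simp add: hom_def)
  qed
  show "on_ar \<Delta> ` surjections U \<subseteq> epi_arrows T"
  proof clarify
    fix f assume f: "f \<in> surjections U"
    then have "f \<in> hom (set_cat U) (src (set_cat U) f) (tgt (set_cat U) f)" by (simp add: surjections_def hom_def)
    then show "on_ar \<Delta> f \<in> epi_arrows T" using D_epi f by blast
  qed
  show "on_ar \<Delta> ` injections U \<subseteq> mono_arrows T"
  proof clarify
    fix f assume f: "f \<in> injections U"
    then have "f \<in> hom (set_cat U) (src (set_cat U) f) (tgt (set_cat U) f)" by (simp add: injections_def hom_def)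
    then show "on_ar \<Delta> f \<in> mono_arrows T" using D_mono f by blast
  qed
qed (auto intro: D_pullback D_pushout)

end

end

end

section \<open>Direct and inverse images of closed congruences\<close>

context site
begin

definition inv_cong :: "('u \<Rightarrow> 'a set) \<Rightarrow> ('u \<Rightarrow> 'a \<Rightarrow> 'b) \<Rightarrow> ('u \<times> 'b \<times> 'b) set \<Rightarrow> ('u \<times> 'a \<times> 'a) set" where
  "inv_cong Q \<phi> E = {(c, x, y). c \<in> ob S \<and> x \<in> Q c \<and> y \<in> Q c \<and> (c, \<phi> c x, \<phi> c y) \<in> E}"

definition dir_cong :: "('u \<Rightarrow> 'b set) \<Rightarrow> ('u \<Rightarrow> 'b \<Rightarrow> 'b) \<Rightarrow> ('u \<Rightarrow> 'a \<Rightarrow> 'b) \<Rightarrow> ('u \<times> 'a \<times> 'a) set \<Rightarrow> ('u \<times> 'b \<times> 'b) set" where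
  "dir_cong Q' r' \<phi> E = generated Q' r' ((\<lambda>(c, x, y). (c, \<phi> c x, \<phi> c y)) ` E)"

definition top_cong :: "('u \<Rightarrow> 'a set) \<Rightarrow> ('u \<times> 'a \<times> 'a) set" where
  "top_cong Q = {(c, x, y). c \<in> ob S \<and> x \<in> Q c \<and> y \<in> Q c}"

text \<open>Plain equality need not be closed: the presheaf of sections with an added element is not
  separated over null objects. The least closed congruence is therefore local equality.\<close>

definition bot_cong :: "('u \<Rightarrow> 'a set) \<Rightarrow> ('u \<Rightarrow> 'a \<Rightarrow> 'a) \<Rightarrow> ('u \<times> 'a \<times> 'a) set" where
  "bot_cong Q r = {(c, x, y). c \<in> ob S \<and> x \<in> Q c \<and> y \<in> Q c \<and> lcov c (\<lambda>h. r h x = r h y)}"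

definition join_cong :: "('u \<Rightarrow> 'a set) \<Rightarrow> ('u \<Rightarrow> 'a \<Rightarrow> 'a) \<Rightarrow> ('u \<times> 'a \<times> 'a) set \<Rightarrow> ('u \<times> 'a \<times> 'a) set \<Rightarrow> ('u \<times> 'a \<times> 'a) set" where
  "join_cong Q r A B = generated Q r (A \<union> B)"

lemma cc_subset: "closed_congruence Q r E \<Longrightarrow> E \<subseteq> top_cong Q"
  using cc_mem unfolding top_cong_def by fast

lemma top_cong_closed: "presheaf Q r \<Longrightarrow> closed_congruence Q r (top_cong Q)"
  unfolding top_cong_def by (rule closed_congruence_full)

lemma join_cong_closed: "presheaf Q r \<Longrightarrow> closed_congruence Q r A \<Longrightarrow> closed_congruence Q r B \<Longrightarrow> closed_congruence Q r (join_cong Q r A B)"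
  unfolding join_cong_def by (rule generated_closed) (use cc_mem[of Q r A] cc_mem[of Q r B] in auto)

lemma join_cong_upper: "A \<subseteq> join_cong Q r A B" "B \<subseteq> join_cong Q r A B"
  unfolding join_cong_def using generated_upper[of "A \<union> B" Q r] by auto

lemma join_cong_least: "closed_congruence Q r E \<Longrightarrow> A \<subseteq> E \<Longrightarrow> B \<subseteq> E \<Longrightarrow> join_cong Q r A B \<subseteq> E"
  unfolding join_cong_def by (rule generated_least) auto

lemma bot_cong_least: 
  assumes "closed_congruence Q r E" shows "bot_cong Q r \<subseteq> E"
proof
  fix t assume "t \<in> bot_cong Q r"
  then obtain c x y where t: "t = (c, x, y)" and *: "c \<in> ob S" "x \<in> Q c" "y \<in> Q c" "lcov c (\<lambda>h. r h x = r h y)"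
    by (auto simp: bot_cong_def)
  have rx: "(src S h, r h x, r h x) \<in> E" if "h \<in> into c" for h
    by (rule cc_res[OF assms that cc_refl[OF assms *(1,2)]])
  have "(c, x, y) \<in> E"
    by (rule cc_local[OF assms *(1-3)], rule lcov_mono[OF *(1,4)]) (use rx in metis)
  then show "t \<in> E" by (simp add: t)
qed

lemma bot_cong_closed:
  assumes Q: "presheaf Q r" shows "closed_congruence Q r (bot_cong Q r)"
  unfolding closed_congruence_def
proof (intro conjI allI ballI impI)
  fix c x y assume "(c, x, y) \<in> bot_cong Q r"
  then have *: "c \<in> ob S" "x \<in> Q c" "y \<in> Q c" "lcov c (\<lambda>h. r h x = r h y)" by (auto simp: bot_cong_def)
  then show "c \<in> ob S" "x \<in> Q c" "y \<in> Q c" by auto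
  show "(c, y, x) \<in> bot_cong Q r" using * by (simp add: bot_cong_def eq_commute)
  fix z assume "(c, y, z) \<in> bot_cong Q r"
  then have **: "z \<in> Q c" "lcov c (\<lambda>h. r h y = r h z)" by (auto simp: bot_cong_def)
  have "lcov c (\<lambda>h. r h x = r h z)" by (rule lcov_mp[OF *(1,4) **(2)]) simp
  then show "(c, x, z) \<in> bot_cong Q r" using * ** by (simp add: bot_cong_def)
next
  fix c x y f assume f: "f \<in> into c" and "(c, x, y) \<in> bot_cong Q r"
  then have *: "x \<in> Q c" "y \<in> Q c" "lcov c (\<lambda>h. r h x = r h y)" by (auto simp: bot_cong_def)
  have "lcov (src S f) (\<lambda>h. r h (r f x) = r h (r f y))"
    by (rule lcov_mono[OF src_ob[OF f] lcov_pull[OF f *(3)]])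
      (use presheaf_cmp[OF Q f _ *(1)] presheaf_cmp[OF Q f _ *(2)] in simp)
  then show "(src S f, r f x, r f y) \<in> bot_cong Q r"
    using presheaf_mem[OF Q f] * src_ob[OF f] by (simp add: bot_cong_def)
next
  fix c x y assume c: "c \<in> ob S" and x: "x \<in> Q c" and y: "y \<in> Q c" and l: "lcov c (\<lambda>h. (src S h, r h x, r h y) \<in> bot_cong Q r)"
  have "lcov c (\<lambda>h. r h x = r h y)"
  proof (rule lcov_trans[OF c], rule lcov_mono[OF c l])
    fix h assume h: "h \<in> into c" and "(src S h, r h x, r h y) \<in> bot_cong Q r"
    then have l: "lcov (src S h) (\<lambda>g. r g (r h x) = r g (r h y))" by (simp add: bot_cong_def)
    show "lcov (src S h) (\<lambda>g. r (h \<odot> g) x = r (h \<odot> g) y)"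
      by (rule lcov_mono[OF src_ob[OF h] l]) (use presheaf_cmp[OF Q h _ x] presheaf_cmp[OF Q h _ y] in simp)
  qed
  then show "(c, x, y) \<in> bot_cong Q r" using c x y by (simp add: bot_cong_def)
qed (auto simp: bot_cong_def intro: lcov_top)

section \<open>Direct and inverse images along a map of presheaves\<close>

context
  fixes Q :: "'u \<Rightarrow> 'a set" and r and Q' :: "'u \<Rightarrow> 'b set" and r' and \<phi>
  assumes Q: "presheaf Q r" and Q': "presheaf Q' r'" and \<phi>: "nmap Q r Q' r' \<phi>"
begin

lemma inv_cong_closed:
  assumes E: "closed_congruence Q' r' E" shows "closed_congruence Q r (inv_cong Q \<phi> E)"
  unfolding closed_congruence_def
proof (intro conjI allI ballI impI)
  fix c x y f assume f: "f \<in> into c" and "(c, x, y) \<in> inv_cong Q \<phi> E"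
  then show "(src S f, r f x, r f y) \<in> inv_cong Q \<phi> E"
    using presheaf_mem[OF Q f] nmap_nat[OF \<phi> f] src_ob[OF f] cc_res[OF E f] by (auto simp: inv_cong_def)
next
  fix c x y assume c: "c \<in> ob S" and x: "x \<in> Q c" and y: "y \<in> Q c" and l: "lcov c (\<lambda>h. (src S h, r h x, r h y) \<in> inv_cong Q \<phi> E)"
  have "(c, \<phi> c x, \<phi> c y) \<in> E"
    by (rule cc_local[OF E c nmap_mem[OF \<phi> c x] nmap_mem[OF \<phi> c y]], rule lcov_mono[OF c l])
      (simp add: inv_cong_def nmap_nat[OF \<phi> _ x] nmap_nat[OF \<phi> _ y])
  then show "(c, x, y) \<in> inv_cong Q \<phi> E" using c x y by (simp add: inv_cong_def)
next
  fix c x y z assume "(c, x, y) \<in> inv_cong Q \<phi> E" "(c, y, z) \<in> inv_cong Q \<phi> E"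
  then show "(c, x, z) \<in> inv_cong Q \<phi> E" using cc_trans[OF E] unfolding inv_cong_def by blast
qed (use cc_refl[OF E] cc_sym[OF E] nmap_mem[OF \<phi>] in \<open>auto simp: inv_cong_def\<close>)

lemma dir_cong_closed:
  assumes E: "E \<subseteq> top_cong Q" shows "closed_congruence Q' r' (dir_cong Q' r' \<phi> E)"
  unfolding dir_cong_def
  by (rule generated_closed[OF Q']) (use E nmap_mem[OF \<phi>] in \<open>auto simp: top_cong_def\<close>)

lemma dir_inv_galois:
  assumes E: "E \<subseteq> top_cong Q" and E': "closed_congruence Q' r' E'"
  shows "dir_cong Q' r' \<phi> E \<subseteq> E' \<longleftrightarrow> E \<subseteq> inv_cong Q \<phi> E'"
proof
  assume "dir_cong Q' r' \<phi> E \<subseteq> E'"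
  then have "(\<lambda>(c, x, y). (c, \<phi> c x, \<phi> c y)) ` E \<subseteq> E'" using generated_upper unfolding dir_cong_def by blast
  then show "E \<subseteq> inv_cong Q \<phi> E'" using E by (auto simp: inv_cong_def top_cong_def)
next
  assume "E \<subseteq> inv_cong Q \<phi> E'"
  then show "dir_cong Q' r' \<phi> E \<subseteq> E'"
    unfolding dir_cong_def by (intro generated_least[OF E']) (auto simp: inv_cong_def)
qed

lemma dir_cong_mono: "A \<subseteq> B \<Longrightarrow> dir_cong Q' r' \<phi> A \<subseteq> dir_cong Q' r' \<phi> B"
  unfolding dir_cong_def generated_def by blast

lemma dir_cong_mem: "(c, x, y) \<in> A \<Longrightarrow> (c, \<phi> c x, \<phi> c y) \<in> dir_cong Q' r' \<phi> A"
  unfolding dir_cong_def by (rule subsetD[OF generated_upper]) force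

lemma inv_cong_mono: "A \<subseteq> B \<Longrightarrow> inv_cong Q \<phi> A \<subseteq> inv_cong Q \<phi> B"
  unfolding inv_cong_def by blast

text \<open>
  Once \<open>W\<close> contains the kernel of \<open>\<phi>\<close>, its image together with the diagonal is already transitive, and
  the direct image is the local closure of that relation.
\<close>

definition img_cong where
  "img_cong W = {(c, y, y'). c \<in> ob S \<and> y \<in> Q' c \<and> y' \<in> Q' c \<and>
     lcov c (\<lambda>h. r' h y = r' h y' \<or> (\<exists>x x'. (src S h, x, x') \<in> W \<and> \<phi> (src S h) x = r' h y \<and> \<phi> (src S h) x' = r' h y'))}"

lemma img_cong_subset:
  assumes E': "closed_congruence Q' r' E'" and W: "\<And>c x x'. (c, x, x') \<in> W \<Longrightarrow> (c, \<phi> c x, \<phi> c x') \<in> E'"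
  shows "img_cong W \<subseteq> E'"
proof
  fix t assume "t \<in> img_cong W"
  then obtain c y y' where t: "t = (c, y, y')" and *: "c \<in> ob S" "y \<in> Q' c" "y' \<in> Q' c"
     "lcov c (\<lambda>h. r' h y = r' h y' \<or> (\<exists>x x'. (src S h, x, x') \<in> W \<and> \<phi> (src S h) x = r' h y \<and> \<phi> (src S h) x' = r' h y'))"
    unfolding img_cong_def by blast
  have "(c, y, y') \<in> E'"
  proof (rule cc_local[OF E' *(1-3)], rule lcov_mono[OF *(1,4)])
    fix h assume h: "h \<in> into c" and
      "r' h y = r' h y' \<or> (\<exists>x x'. (src S h, x, x') \<in> W \<and> \<phi> (src S h) x = r' h y \<and> \<phi> (src S h) x' = r' h y')"
    then show "(src S h, r' h y, r' h y') \<in> E'"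
      using cc_refl[OF E' src_ob[OF h] presheaf_mem[OF Q' h *(2)]] W by metis
  qed
  then show "t \<in> E'" by (simp add: t)
qed

context
  fixes W assumes W: "closed_congruence Q r W" and ker: "inv_cong Q \<phi> (bot_cong Q' r') \<subseteq> W"
begin

lemma ker_W: "c \<in> ob S \<Longrightarrow> x \<in> Q c \<Longrightarrow> x' \<in> Q c \<Longrightarrow> \<phi> c x = \<phi> c x' \<Longrightarrow> (c, x, x') \<in> W"
  using ker nmap_mem[OF \<phi>] cc_refl[OF bot_cong_closed[OF Q']] by (auto simp: inv_cong_def)

lemma img_cong_closed: "closed_congruence Q' r' (img_cong W)"
proof -
  define R where "R c y y' \<longleftrightarrow> y = y' \<or> (\<exists>x x'. (c, x, x') \<in> W \<and> \<phi> c x = y \<and> \<phi> c x' = y')" for c y y'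
  have img: "img_cong W = {(c, y, y'). c \<in> ob S \<and> y \<in> Q' c \<and> y' \<in> Q' c \<and> lcov c (\<lambda>h. R (src S h) (r' h y) (r' h y'))}"
    unfolding img_cong_def R_def ..
  have R_sym: "R c y' y" if "R c y y'" for c y y' using that cc_sym[OF W] unfolding R_def by blast
  have R_trans: "R c y z" if R: "R c y y'" "R c y' z" for c y y' z
  proof (cases "y = y' \<or> y' = z")
    case False
    then obtain x x' w w' where *: "(c, x, x') \<in> W" "\<phi> c x = y" "\<phi> c x' = y'" "(c, w, w') \<in> W" "\<phi> c w = y'" "\<phi> c w' = z"
      using R unfolding R_def by blast
    \<comment> \<open>\<open>x'\<close> and \<open>w\<close> have the same image, and
      \<open>W\<close> contains the kernel, so two consecutive image pairs can be joined
      upstairs.\<close>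
    then have "(c, x', w) \<in> W" using ker_W[of c x' w] cc_mem[OF W] by metis
    then have "(c, x, w') \<in> W" using *(1,4) cc_trans[OF W] by blast
    then show ?thesis using *(2,6) unfolding R_def by blast
  qed (use R in auto)
  show ?thesis
    unfolding closed_congruence_def
  proof (intro conjI allI ballI impI)
    fix c x y assume "(c, x, y) \<in> img_cong W"
    then have *: "c \<in> ob S" "x \<in> Q' c" "y \<in> Q' c" "lcov c (\<lambda>h. R (src S h) (r' h x) (r' h y))" by (auto simp: img)
    then show "c \<in> ob S" "x \<in> Q' c" "y \<in> Q' c" by auto
    have "lcov c (\<lambda>h. R (src S h) (r' h y) (r' h x))" by (rule lcov_mono[OF *(1,4)]) (rule R_sym)
    then show "(c, y, x) \<in> img_cong W" using * by (simp add: img)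
    fix z assume "(c, y, z) \<in> img_cong W"
    then have **: "z \<in> Q' c" "lcov c (\<lambda>h. R (src S h) (r' h y) (r' h z))" by (auto simp: img)
    have "lcov c (\<lambda>h. R (src S h) (r' h x) (r' h z))" by (rule lcov_mp[OF *(1,4) **(2)]) (rule R_trans)
    then show "(c, x, z) \<in> img_cong W" using * ** by (simp add: img)
  next
    fix c x y f assume f: "f \<in> into c" and "(c, x, y) \<in> img_cong W"
    then have *: "x \<in> Q' c" "y \<in> Q' c" "lcov c (\<lambda>h. R (src S h) (r' h x) (r' h y))" by (auto simp: img)
    have "lcov (src S f) (\<lambda>h. R (src S h) (r' h (r' f x)) (r' h (r' f y)))"
    proof (rule lcov_mono[OF src_ob[OF f] lcov_pull[OF f *(3)]])
      fix h assume h: "h \<in> into (src S f)" and "R (src S (f \<odot> h)) (r' (f \<odot> h) x) (r' (f \<odot> h) y)"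
      then show "R (src S h) (r' h (r' f x)) (r' h (r' f y))"
        using presheaf_cmp[OF Q' f h *(1)] presheaf_cmp[OF Q' f h *(2)] src_cmp[OF f h] by simp
    qed
    then show "(src S f, r' f x, r' f y) \<in> img_cong W"
      using presheaf_mem[OF Q' f] * src_ob[OF f] by (simp add: img)
  next
    fix c x y assume c: "c \<in> ob S" and x: "x \<in> Q' c" and y: "y \<in> Q' c" and l: "lcov c (\<lambda>h. (src S h, r' h x, r' h y) \<in> img_cong W)"
    have "lcov c (\<lambda>h. R (src S h) (r' h x) (r' h y))"
    proof (rule lcov_trans[OF c], rule lcov_mono[OF c l])
      fix h assume h: "h \<in> into c" and "(src S h, r' h x, r' h y) \<in> img_cong W"
      then have l: "lcov (src S h) (\<lambda>g. R (src S g) (r' g (r' h x)) (r' g (r' h y)))" by (simp add: img)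
      show "lcov (src S h) (\<lambda>g. R (src S (h \<odot> g)) (r' (h \<odot> g) x) (r' (h \<odot> g) y))"
      proof (rule lcov_mono[OF src_ob[OF h] l])
        fix g assume g: "g \<in> into (src S h)" and "R (src S g) (r' g (r' h x)) (r' g (r' h y))"
        then show "R (src S (h \<odot> g)) (r' (h \<odot> g) x) (r' (h \<odot> g) y)"
          using presheaf_cmp[OF Q' h g x] presheaf_cmp[OF Q' h g y] src_cmp[OF h g] by simp
      qed
    qed
    then show "(c, x, y) \<in> img_cong W" using c x y by (simp add: img)
  next
    fix c x assume "c \<in> ob S" "x \<in> Q' c"
    then show "(c, x, x) \<in> img_cong W" by (auto simp: img R_def intro: lcov_top)
  qed
qed

lemma dir_cong_eq_img: "dir_cong Q' r' \<phi> W = img_cong W"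
proof
  show "dir_cong Q' r' \<phi> W \<subseteq> img_cong W"
    unfolding dir_cong_def
  proof (rule generated_least[OF img_cong_closed], clarify)
    fix c x x' assume xx: "(c, x, x') \<in> W"
    then have *: "c \<in> ob S" "x \<in> Q c" "x' \<in> Q c" using cc_mem[OF W] by blast+
    have "lcov c (\<lambda>h. r' h (\<phi> c x) = r' h (\<phi> c x') \<or> (\<exists>w w'. (src S h, w, w') \<in> W \<and> \<phi> (src S h) w = r' h (\<phi> c x) \<and> \<phi> (src S h) w' = r' h (\<phi> c x')))"
    proof (rule lcov_top[OF *(1)], rule disjI2)
      fix h assume h: "h \<in> into c"
      show "\<exists>w w'. (src S h, w, w') \<in> W \<and> \<phi> (src S h) w = r' h (\<phi> c x) \<and> \<phi> (src S h) w' = r' h (\<phi> c x')"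
        using cc_res[OF W h xx] nmap_nat[OF \<phi> h *(2)] nmap_nat[OF \<phi> h *(3)] by blast
    qed
    then show "(c, \<phi> c x, \<phi> c x') \<in> img_cong W" using * nmap_mem[OF \<phi> *(1)] by (simp add: img_cong_def)
  qed
  have "(c, \<phi> c x, \<phi> c x') \<in> dir_cong Q' r' \<phi> W" if "(c, x, x') \<in> W" for c x x'
    using that by (rule dir_cong_mem)
  then show "img_cong W \<subseteq> dir_cong Q' r' \<phi> W"
    by (rule img_cong_subset[OF dir_cong_closed[OF cc_subset[OF W]]])
qed

text \<open>If the images of \<open>x\<close> and \<open>x'\<close> are joined by images of a pair
  related in \<open>W\<close>, then the kernel, contained in \<open>W\<close>, links
  \<open>x\<close> and \<open>x'\<close> to that pair.\<close>

lemma inv_img_cong: "inv_cong Q \<phi> (img_cong W) \<subseteq> W"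
proof
  fix t assume "t \<in> inv_cong Q \<phi> (img_cong W)"
  then obtain c x x' where t: "t = (c, x, x')" and *: "c \<in> ob S" "x \<in> Q c" "x' \<in> Q c"
    and l: "lcov c (\<lambda>h. r' h (\<phi> c x) = r' h (\<phi> c x') \<or>
      (\<exists>w w'. (src S h, w, w') \<in> W \<and> \<phi> (src S h) w = r' h (\<phi> c x) \<and> \<phi> (src S h) w' = r' h (\<phi> c x')))"
    by (auto simp: inv_cong_def img_cong_def)
  have "(c, x, x') \<in> W"
  proof (rule cc_local[OF W *], rule lcov_mono[OF *(1) l])
    fix h assume h: "h \<in> into c"
    note d = src_ob[OF h] and m = presheaf_mem[OF Q h *(2)] presheaf_mem[OF Q h *(3)]
    note n = nmap_nat[OF \<phi> h *(2)] nmap_nat[OF \<phi> h *(3)]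
    assume "r' h (\<phi> c x) = r' h (\<phi> c x') \<or>
      (\<exists>w w'. (src S h, w, w') \<in> W \<and> \<phi> (src S h) w = r' h (\<phi> c x) \<and> \<phi> (src S h) w' = r' h (\<phi> c x'))"
    then show "(src S h, r h x, r h x') \<in> W"
    proof (elim disjE exE conjE)
      assume "r' h (\<phi> c x) = r' h (\<phi> c x')"
      then show ?thesis using ker_W[OF d m] n by simp
    next
      fix w w' assume w: "(src S h, w, w') \<in> W" "\<phi> (src S h) w = r' h (\<phi> c x)" "\<phi> (src S h) w' = r' h (\<phi> c x')"
      have wm: "w \<in> Q (src S h)" "w' \<in> Q (src S h)" using cc_mem[OF W w(1)] by auto
      have "(src S h, r h x, w) \<in> W" "(src S h, w', r h x') \<in> W"
        using ker_W[OF d m(1) wm(1)] ker_W[OF d wm(2) m(2)] n w(2,3) by auto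
      then show ?thesis using w(1) cc_trans[OF W] by blast
    qed
  qed
  then show "t \<in> W" by (simp add: t)
qed

end

text \<open>\<open>E\<close> is first enlarged by the kernel. The enlargement can only increase the
  left side, and for the enlarged congruence the explicit description of the direct image bounds its
  inverse image.\<close>

lemma inv_dir_cong:
  assumes E: "closed_congruence Q r E"
  shows "inv_cong Q \<phi> (dir_cong Q' r' \<phi> E) = join_cong Q r E (inv_cong Q \<phi> (bot_cong Q' r'))"
    (is "_ = ?W")
proof
  note b = inv_cong_closed[OF bot_cong_closed[OF Q']]
  note W = join_cong_closed[OF Q E b]
  have "inv_cong Q \<phi> (dir_cong Q' r' \<phi> E) \<subseteq> inv_cong Q \<phi> (dir_cong Q' r' \<phi> ?W)"
    by (intro inv_cong_mono dir_cong_mono join_cong_upper)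
  also have "\<dots> \<subseteq> ?W"
    unfolding dir_cong_eq_img[OF W join_cong_upper(2)] by (rule inv_img_cong[OF W join_cong_upper(2)])
  finally show "inv_cong Q \<phi> (dir_cong Q' r' \<phi> E) \<subseteq> ?W" .
  note d = dir_cong_closed[OF cc_subset[OF E]]
  show "?W \<subseteq> inv_cong Q \<phi> (dir_cong Q' r' \<phi> E)"
    by (rule join_cong_least[OF inv_cong_closed[OF d]])
      (use dir_inv_galois[OF cc_subset[OF E] d] inv_cong_mono[OF bot_cong_least[OF d]] in auto)
qed

lemma dir_top_eq_img: "dir_cong Q' r' \<phi> (top_cong Q) = img_cong (top_cong Q)"
  by (rule dir_cong_eq_img[OF top_cong_closed[OF Q] cc_subset[OF inv_cong_closed[OF bot_cong_closed[OF Q']]]])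

text \<open>The total congruence contains the kernel, so its direct image is explicit: a pair in it
  lifts locally to \<open>Q\<close> unless its components agree. If the pair lies in
  \<open>E\<close> as well, the lifted pair lies in the inverse image of \<open>E\<close>.\<close>

lemma dir_inv_cong:
  assumes E: "closed_congruence Q' r' E"
  shows "dir_cong Q' r' \<phi> (inv_cong Q \<phi> E) = E \<inter> dir_cong Q' r' \<phi> (top_cong Q)"
proof
  note i = inv_cong_closed[OF E]
  show "dir_cong Q' r' \<phi> (inv_cong Q \<phi> E) \<subseteq> E \<inter> dir_cong Q' r' \<phi> (top_cong Q)"
    using dir_inv_galois[OF cc_subset[OF i] E] dir_cong_mono[OF cc_subset[OF i]] by auto
  note d = dir_cong_closed[OF cc_subset[OF i]]
  show "E \<inter> dir_cong Q' r' \<phi> (top_cong Q) \<subseteq> dir_cong Q' r' \<phi> (inv_cong Q \<phi> E)"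
    unfolding dir_top_eq_img
  proof clarify
    fix c y y' assume e: "(c, y, y') \<in> E" and "(c, y, y') \<in> img_cong (top_cong Q)"
    then have *: "c \<in> ob S" "y \<in> Q' c" "y' \<in> Q' c" and
      l: "lcov c (\<lambda>h. r' h y = r' h y' \<or> (\<exists>x x'. (src S h, x, x') \<in> top_cong Q \<and> \<phi> (src S h) x = r' h y \<and> \<phi> (src S h) x' = r' h y'))"
      by (auto simp: img_cong_def)
    show "(c, y, y') \<in> dir_cong Q' r' \<phi> (inv_cong Q \<phi> E)"
    proof (rule cc_local[OF d *], rule lcov_mono[OF *(1) l], elim disjE exE conjE)
      fix h assume h: "h \<in> into c" and "r' h y = r' h y'"
      then show "(src S h, r' h y, r' h y') \<in> dir_cong Q' r' \<phi> (inv_cong Q \<phi> E)"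
        using cc_refl[OF d src_ob[OF h] presheaf_mem[OF Q' h *(2)]] by simp
    next
      fix h x x' assume h: "h \<in> into c" and x: "(src S h, x, x') \<in> top_cong Q" "\<phi> (src S h) x = r' h y" "\<phi> (src S h) x' = r' h y'"
      then have "(src S h, x, x') \<in> inv_cong Q \<phi> E"
        using cc_res[OF E h e] by (auto simp: inv_cong_def top_cong_def)
      then have "(src S h, \<phi> (src S h) x, \<phi> (src S h) x') \<in> dir_cong Q' r' \<phi> (inv_cong Q \<phi> E)"
        by (rule dir_cong_mem)
      then show "(src S h, r' h y, r' h y') \<in> dir_cong Q' r' \<phi> (inv_cong Q \<phi> E)" using x by simp
    qed
  qed
qed

end

end


section \<open>Orders of coded sets\<close>

text \<open>Fibres of the form must be carried by \<open>'u\<close>, so the inclusion order on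
  \<open>K\<close> is transported along an injection \<open>e\<close>. Taking genuine equality for
  \<open>eq\<close> makes the setoid-based lattice theory one of ordinary partial orders.\<close>

definition coded_order :: "('a set \<Rightarrow> 'u) \<Rightarrow> 'a set set \<Rightarrow> 'u gorder" where
  "coded_order e K = \<lparr>carrier = e ` K, eq = (=), le = (\<lambda>a b. inv_into K e a \<subseteq> inv_into K e b)\<rparr>"

context
  fixes e :: "'a set \<Rightarrow> 'u" and K
  assumes e: "inj_on e K"
begin

lemma coded_le [simp]: "A \<in> K \<Longrightarrow> B \<in> K \<Longrightarrow> e A \<sqsubseteq>\<^bsub>coded_order e K\<^esub> e B \<longleftrightarrow> A \<subseteq> B"
  by (simp add: coded_order_def e)

lemma coded_carrier [simp]: "carrier (coded_order e K) = e ` K"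
  by (simp add: coded_order_def)

lemma coded_partial_order: "partial_order (coded_order e K)"
  by unfold_locales (auto simp: coded_order_def e)

lemma coded_join:
  assumes "A \<in> K" "B \<in> K" "I \<in> K" "A \<subseteq> I" "B \<subseteq> I" "\<And>Z. Z \<in> K \<Longrightarrow> A \<subseteq> Z \<Longrightarrow> B \<subseteq> Z \<Longrightarrow> I \<subseteq> Z"
  shows "least (coded_order e K) (e I) (Upper (coded_order e K) {e A, e B})"
    and "e A \<squnion>\<^bsub>coded_order e K\<^esub> e B = e I"
proof -
  interpret partial_order "coded_order e K" by (rule coded_partial_order)
  show l: "least (coded_order e K) (e I) (Upper (coded_order e K) {e A, e B})"
    using assms unfolding least_def Upper_def by auto
  show "e A \<squnion>\<^bsub>coded_order e K\<^esub> e B = e I"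
    unfolding join_def sup_def using l least_unique by blast
qed

lemma coded_meet:
  assumes "A \<in> K" "B \<in> K" "A \<inter> B \<in> K"
  shows "greatest (coded_order e K) (e (A \<inter> B)) (Lower (coded_order e K) {e A, e B})"
    and "e A \<sqinter>\<^bsub>coded_order e K\<^esub> e B = e (A \<inter> B)"
proof -
  interpret partial_order "coded_order e K" by (rule coded_partial_order)
  show l: "greatest (coded_order e K) (e (A \<inter> B)) (Lower (coded_order e K) {e A, e B})"
    using assms unfolding greatest_def Lower_def by auto
  show "e A \<sqinter>\<^bsub>coded_order e K\<^esub> e B = e (A \<inter> B)"
    unfolding meet_def inf_def using l greatest_unique by blast
qed

lemma coded_top:
  assumes "A \<in> K" "\<And>B. B \<in> K \<Longrightarrow> B \<subseteq> A"
  shows "greatest (coded_order e K) (e A) (carrier (coded_order e K))" "\<top>\<^bsub>coded_order e K\<^esub> = e A"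
proof -
  interpret partial_order "coded_order e K" by (rule coded_partial_order)
  show l: "greatest (coded_order e K) (e A) (carrier (coded_order e K))"
    using assms unfolding greatest_def by auto
  show "\<top>\<^bsub>coded_order e K\<^esub> = e A"
    unfolding top_def using l greatest_unique by blast
qed

lemma coded_bottom:
  assumes "A \<in> K" "\<And>B. B \<in> K \<Longrightarrow> A \<subseteq> B"
  shows "least (coded_order e K) (e A) (carrier (coded_order e K))" "\<bottom>\<^bsub>coded_order e K\<^esub> = e A"
proof -
  interpret partial_order "coded_order e K" by (rule coded_partial_order)
  show l: "least (coded_order e K) (e A) (carrier (coded_order e K))"
    using assms unfolding least_def by auto
  show "\<bottom>\<^bsub>coded_order e K\<^esub> = e A"
    unfolding bottom_def using l least_unique by blast
qed

lemma coded_bounded_lattice: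
  assumes "\<And>A B. A \<in> K \<Longrightarrow> B \<in> K \<Longrightarrow> I A B \<in> K \<and> A \<subseteq> I A B \<and> B \<subseteq> I A B"
    and "\<And>A B Z. A \<in> K \<Longrightarrow> B \<in> K \<Longrightarrow> Z \<in> K \<Longrightarrow> A \<subseteq> Z \<Longrightarrow> B \<subseteq> Z \<Longrightarrow> I A B \<subseteq> Z"
    and "\<And>A B. A \<in> K \<Longrightarrow> B \<in> K \<Longrightarrow> A \<inter> B \<in> K"
    and t: "t \<in> K" "\<And>B. B \<in> K \<Longrightarrow> B \<subseteq> t" and b: "b \<in> K" "\<And>B. B \<in> K \<Longrightarrow> b \<subseteq> B"
  shows "Lattice.bounded_lattice (coded_order e K)"
proof -
  interpret partial_order "coded_order e K" by (rule coded_partial_order)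
  show ?thesis
  proof
    fix x y assume "x \<in> carrier (coded_order e K)" "y \<in> carrier (coded_order e K)"
    then obtain A B where AB: "A \<in> K" "B \<in> K" "x = e A" "y = e B" by auto
    show "\<exists>s. least (coded_order e K) s (Upper (coded_order e K) {x, y})"
      unfolding AB(3,4)
      by (rule exI, rule coded_join(1)[OF AB(1,2), of "I A B"]) (use assms(1,2)[OF AB(1,2)] in simp_all)
    show "\<exists>s. greatest (coded_order e K) s (Lower (coded_order e K) {x, y})"
      unfolding AB(3,4) by (rule exI, rule coded_meet(1)[OF AB(1,2) assms(3)[OF AB(1,2)]])
  next
    show "\<exists>x. greatest (coded_order e K) x (carrier (coded_order e K))" by (rule exI, rule coded_top(1)[OF t])
    show "\<exists>x. least (coded_order e K) x (carrier (coded_order e K))" by (rule exI, rule coded_bottom(1)[OF b])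
  qed
qed

end

section \<open>Transfer functors\<close>

locale transfer_category = category_locale C for C :: "('c, 'd) cat" +
  fixes U :: "'u \<Rightarrow> 'u set" and E M :: "'d set"
  assumes setting: "transfer_setting U C E M"
begin

lemma proper: "proper_factorization_system C E M"
  using setting by (simp add: transfer_setting_def)

lemma E_epi: "e \<in> E \<Longrightarrow> e \<in> epi_arrows C" and M_mono: "m \<in> M \<Longrightarrow> m \<in> mono_arrows C"
  and E_ar: "e \<in> E \<Longrightarrow> e \<in> ar C" and M_ar: "m \<in> M \<Longrightarrow> m \<in> ar C"
  and iso_E: "iso C f \<Longrightarrow> f \<in> E" and iso_M: "iso C f \<Longrightarrow> f \<in> M"
  using proper unfolding proper_factorization_system_def orthogonal_factorization_system_def by auto

lemma E_cmp: "e \<in> E \<Longrightarrow> e \<in> hom C X Y \<Longrightarrow> e' \<in> E \<Longrightarrow> e' \<in> hom C Y Z \<Longrightarrow> e' \<bullet> e \<in> E"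
  and M_cmp: "m \<in> M \<Longrightarrow> m \<in> hom C X Y \<Longrightarrow> m' \<in> M \<Longrightarrow> m' \<in> hom C Y Z \<Longrightarrow> m' \<bullet> m \<in> M"
  using proper unfolding proper_factorization_system_def orthogonal_factorization_system_def hom_def by auto

lemma factorize:
  assumes f: "f \<in> hom C X Y"
  obtains I e m where "e \<in> hom C X I" "m \<in> hom C I Y" "e \<in> E" "m \<in> M" "f = m \<bullet> e"
proof -
  obtain e m where *: "e \<in> E" "m \<in> M" "src C m = tgt C e" "f = m \<bullet> e"
    using proper homD[OF f] unfolding proper_factorization_system_def orthogonal_factorization_system_def by blast
  have e: "e \<in> hom C (src C e) (tgt C e)" and m: "m \<in> hom C (tgt C e) (tgt C m)"
    using * E_ar M_ar by (auto simp: hom_def)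
  have "f \<in> hom C (src C e) (tgt C m)" unfolding *(4) by (rule cmp_hom[OF e m])
  then have "src C e = X" "tgt C m = Y" using f by (auto simp: hom_def)
  then show ?thesis using that e m * by blast
qed

lemma diagonal:
  assumes "e \<in> E" "m \<in> M" "e \<in> hom C A B" "m \<in> hom C X Y" "u \<in> hom C A X" "v \<in> hom C B Y" "m \<bullet> u = v \<bullet> e"
  obtains d where "d \<in> hom C B X" "d \<bullet> e = u" "m \<bullet> d = v"
proof -
  have "\<forall>e\<in>E. \<forall>m\<in>M. \<forall>u\<in>hom C (src C e) (src C m). \<forall>v\<in>hom C (tgt C e) (tgt C m).
        m \<bullet> u = v \<bullet> e \<longrightarrow> (\<exists>!d. d \<in> hom C (tgt C e) (src C m) \<and> d \<bullet> e = u \<and> m \<bullet> d = v)"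
    using proper unfolding proper_factorization_system_def orthogonal_factorization_system_def by blast
  moreover have "src C e = A" "tgt C e = B" "src C m = X" "tgt C m = Y" using assms by (auto simp: hom_def)
  ultimately show ?thesis using assms that by blast
qed

lemma pullback_ex:
  assumes m: "m \<in> M" "m \<in> hom C A Z" and n: "n \<in> M" "n \<in> hom C B Z"
  obtains P p q where "is_pullback C m n p q" "p \<in> hom C P A" "q \<in> hom C P B" "m \<bullet> p = n \<bullet> q"
proof -
  obtain p q where *: "is_pullback C m n p q" using setting m n unfolding transfer_setting_def hom_def by fastforce
  then have "p \<in> hom C (src C p) A" "q \<in> hom C (src C p) B" "m \<bullet> p = n \<bullet> q"
    using m n unfolding is_pullback_def hom_def by auto
  then show ?thesis using that * by blast
qed

lemma pushout_ex:
  assumes d: "d \<in> E" "d \<in> hom C X A" and e: "e \<in> E" "e \<in> hom C X B"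
  obtains P p q where "is_pushout C d e p q" "p \<in> hom C A P" "q \<in> hom C B P" "p \<bullet> d = q \<bullet> e"
proof -
  obtain p q where *: "is_pushout C d e p q" using setting d e unfolding transfer_setting_def hom_def by fastforce
  then have "p \<in> hom C A (tgt C p)" "q \<in> hom C B (tgt C p)" "p \<bullet> d = q \<bullet> e"
    using d e unfolding is_pushout_def hom_def by auto
  then show ?thesis using that * by blast
qed

end

lemma transfer_category_if_setting: "transfer_setting U C E M \<Longrightarrow> transfer_category C U E M"
  by unfold_locales (simp_all add: transfer_setting_def)

lemma (in category_locale) pushout_epi:
  assumes po: "is_pushout C d e p q" and d: "d \<in> hom C X A" "d \<in> epi_arrows C"
  shows "q \<in> epi_arrows C"
proof -
  obtain B P where *: "e \<in> hom C X B" "p \<in> hom C A P" "q \<in> hom C B P" "p \<bullet> d = q \<bullet> e"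
    "\<And>W f g. f \<in> hom C A W \<Longrightarrow> g \<in> hom C B W \<Longrightarrow> f \<bullet> d = g \<bullet> e \<Longrightarrow> \<exists>!h. h \<in> hom C P W \<and> h \<bullet> p = f \<and> h \<bullet> q = g"
    by (rule pushoutD[OF po d(1)]) (rule that)
  show ?thesis
  proof (rule epiI[OF *(3)])
    fix W f g assume f: "f \<in> hom C P W" and g: "g \<in> hom C P W" and eq: "f \<bullet> q = g \<bullet> q"
    have "(f \<bullet> p) \<bullet> d = (g \<bullet> p) \<bullet> d"
      using assoc[OF d(1) *(2) f] assoc[OF d(1) *(2) g] assoc[OF *(1,3) f] assoc[OF *(1,3) g] *(4) eq by simp
    then have p: "f \<bullet> p = g \<bullet> p" using epiD[OF d(2,1)] cmp_hom[OF *(2) f] cmp_hom[OF *(2) g] by blast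
    have "(f \<bullet> p) \<bullet> d = (f \<bullet> q) \<bullet> e" using assoc[OF d(1) *(2) f] assoc[OF *(1,3) f] *(4) by simp
    from *(5)[OF cmp_hom[OF *(2) f] cmp_hom[OF *(3) f] this] show "f = g" using f g eq p by metis
  qed
qed

lemma (in category_locale) pullback_mono':
  assumes pb: "is_pullback C m n p q" and m: "m \<in> hom C A Z" "m \<in> mono_arrows C"
  shows "q \<in> mono_arrows C"
proof -
  have n: "n \<in> hom C (src C n) Z" using pb m(1) unfolding is_pullback_def hom_def by auto
  have "is_pullback C n m q p"
    using pb unfolding is_pullback_def
    apply (elim conjE)
    apply (intro conjI ballI impI)
    subgoal by simp subgoal by simp subgoal by simp subgoal by simp subgoal by simp
    subgoal by simp subgoal by simp subgoal by simp subgoal by simp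
    subgoal for f g
      by (drule bspec[where x = g], assumption, drule bspec[where x = f], assumption) (simp add: conj_commute)
    done
  then show ?thesis by (rule pullback_mono[OF _ n m(2)])
qed

section \<open>Factorizations reflected by a transfer functor\<close>

context
  fixes U :: "'u \<Rightarrow> 'u set" and C :: "('c, 'd) cat" and E M and D :: "('p, 'n) cat" and E' M' and G
  assumes tf: "transfer_functor U C E M D E' M' G"
begin

text \<open>\<open>k\<close> and the identity of \<open>on_ob G B\<close> form a cocone under the
  preserved pushout, so \<open>on_ar G q\<close> has a left inverse. It is also epi, being a pushout
  of the epimorphism \<open>on_ar G e\<close>, hence invertible; the inverse of \<open>q\<close> in
  \<open>C\<close> composed with \<open>p\<close> is the factorization.\<close>

lemma transfer_factor_epi:
  assumes e: "e \<in> E" "e \<in> hom C X A" and e': "e' \<in> E" "e' \<in> hom C X B"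
    and k: "k \<in> hom D (on_ob G A) (on_ob G B)" "k \<cdot>\<^bsub>D\<^esub> on_ar G e = on_ar G e'"
  obtains h where "h \<in> hom C A B" "h \<cdot>\<^bsub>C\<^esub> e = e'"
proof -
  interpret C: transfer_category C U E M using tf by (intro transfer_category_if_setting) (simp add: transfer_functor_def)
  interpret D: transfer_category D U E' M' using tf by (intro transfer_category_if_setting) (simp add: transfer_functor_def)
  have G: "is_functor C D G" using tf by (simp add: transfer_functor_def)
  obtain P p q where po: "is_pushout C e e' p q" and p: "p \<in> hom C A P" and q: "q \<in> hom C B P"
    and pq: "p \<cdot>\<^bsub>C\<^esub> e = q \<cdot>\<^bsub>C\<^esub> e'"
    by (rule C.pushout_ex[OF e e']) (rule that)
  have po': "is_pushout D (on_ar G e) (on_ar G e') (on_ar G p) (on_ar G q)"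
    using tf po e(1) e'(1) unfolding transfer_functor_def by blast
  note Ge = functor_hom[OF G e(2)] and Ge' = functor_hom[OF G e'(2)] and Gp = functor_hom[OF G p] and Gq = functor_hom[OF G q]
  have "on_ar G e \<in> E'" using tf e(1) unfolding transfer_functor_def by blast
  then have Gq_epi: "on_ar G q \<in> epi_arrows D" using D.pushout_epi[OF po' Ge] D.E_epi by blast
  obtain B' P' where *: "on_ar G e' \<in> hom D (on_ob G X) B'" "on_ar G p \<in> hom D (on_ob G A) P'"
    "\<And>W f g. f \<in> hom D (on_ob G A) W \<Longrightarrow> g \<in> hom D B' W \<Longrightarrow> f \<cdot>\<^bsub>D\<^esub> on_ar G e = g \<cdot>\<^bsub>D\<^esub> on_ar G e' \<Longrightarrow>
      \<exists>!h. h \<in> hom D P' W \<and> h \<cdot>\<^bsub>D\<^esub> on_ar G p = f \<and> h \<cdot>\<^bsub>D\<^esub> on_ar G q = g"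
    by (rule D.pushoutD[OF po' Ge]) (rule that)
  have eqs: "B' = on_ob G B" "P' = on_ob G P" using *(1,2) Ge' Gp by (auto simp: hom_def)
  have GB: "on_ob G B \<in> ob D" using D.homD[OF Gq] by simp
  obtain u where u: "u \<in> hom D (on_ob G P) (on_ob G B)" "u \<cdot>\<^bsub>D\<^esub> on_ar G q = ide D (on_ob G B)"
    using *(3)[unfolded eqs, OF k(1) D.ide_hom[OF GB]] k(2) D.ide_left[OF Ge'] by metis
  have "iso D (on_ar G q)" by (rule D.iso_if_split_mono_epi[OF Gq Gq_epi u])
  then have "iso C q" using tf C.homD[OF q] by (simp add: transfer_functor_def conservative_def)
  then obtain r where r: "r \<in> hom C P B" "r \<cdot>\<^bsub>C\<^esub> q = ide C B" by (rule C.isoE[OF _ q])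
  have "(r \<cdot>\<^bsub>C\<^esub> p) \<cdot>\<^bsub>C\<^esub> e = e'"
    using C.assoc[OF e(2) p r(1)] C.assoc[OF e'(2) q r(1)] pq r(2) C.ide_left[OF e'(2)] by simp
  then show ?thesis using that C.cmp_hom[OF p r(1)] by blast
qed

text \<open>Dually, \<open>k\<close> and the identity form a cone over the preserved pullback and
  give \<open>on_ar G q\<close> a right inverse, while as a pullback of the monomorphism
  \<open>on_ar G m\<close> it is mono.\<close>

lemma transfer_factor_mono:
  assumes m: "m \<in> M" "m \<in> hom C A X" and m': "m' \<in> M" "m' \<in> hom C B X"
    and k: "k \<in> hom D (on_ob G B) (on_ob G A)" "on_ar G m \<cdot>\<^bsub>D\<^esub> k = on_ar G m'"
  obtains h where "h \<in> hom C B A" "m \<cdot>\<^bsub>C\<^esub> h = m'"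
proof -
  interpret C: transfer_category C U E M using tf by (intro transfer_category_if_setting) (simp add: transfer_functor_def)
  interpret D: transfer_category D U E' M' using tf by (intro transfer_category_if_setting) (simp add: transfer_functor_def)
  have G: "is_functor C D G" using tf by (simp add: transfer_functor_def)
  obtain P p q where pb: "is_pullback C m m' p q" and p: "p \<in> hom C P A" and q: "q \<in> hom C P B"
    and pq: "m \<cdot>\<^bsub>C\<^esub> p = m' \<cdot>\<^bsub>C\<^esub> q"
    by (rule C.pullback_ex[OF m m']) (rule that)
  have pb': "is_pullback D (on_ar G m) (on_ar G m') (on_ar G p) (on_ar G q)"
    using tf pb m(1) m'(1) unfolding transfer_functor_def by blast
  note Gm = functor_hom[OF G m(2)] and Gm' = functor_hom[OF G m'(2)] and Gp = functor_hom[OF G p] and Gq = functor_hom[OF G q]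
  have "on_ar G m \<in> M'" using tf m(1) unfolding transfer_functor_def by blast
  then have Gq_mono: "on_ar G q \<in> mono_arrows D" using D.pullback_mono'[OF pb' Gm] D.M_mono by blast
  obtain B' P' where *: "on_ar G m' \<in> hom D B' (on_ob G X)" "on_ar G p \<in> hom D P' (on_ob G A)"
    "\<And>W f g. f \<in> hom D W (on_ob G A) \<Longrightarrow> g \<in> hom D W B' \<Longrightarrow> on_ar G m \<cdot>\<^bsub>D\<^esub> f = on_ar G m' \<cdot>\<^bsub>D\<^esub> g \<Longrightarrow>
      \<exists>!h. h \<in> hom D W P' \<and> on_ar G p \<cdot>\<^bsub>D\<^esub> h = f \<and> on_ar G q \<cdot>\<^bsub>D\<^esub> h = g"
    by (rule D.pullbackD[OF pb' Gm]) (rule that)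
  have eqs: "B' = on_ob G B" "P' = on_ob G P" using *(1,2) Gm' Gp by (auto simp: hom_def)
  have GB: "on_ob G B \<in> ob D" using D.homD[OF Gq] by simp
  obtain u where u: "u \<in> hom D (on_ob G B) (on_ob G P)" "on_ar G q \<cdot>\<^bsub>D\<^esub> u = ide D (on_ob G B)"
    using *(3)[unfolded eqs, OF k(1) D.ide_hom[OF GB]] k(2) D.ide_right[OF Gm'] by metis
  have "iso D (on_ar G q)" by (rule D.iso_if_split_epi_mono[OF Gq Gq_mono u])
  then have "iso C q" using tf C.homD[OF q] by (simp add: transfer_functor_def conservative_def)
  then obtain r where r: "r \<in> hom C B P" "q \<cdot>\<^bsub>C\<^esub> r = ide C B" by (rule C.isoE[OF _ q])
  have "m \<cdot>\<^bsub>C\<^esub> (p \<cdot>\<^bsub>C\<^esub> r) = m'"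
    using C.assoc[OF r(1) p m(2)] C.assoc[OF r(1) q m'(2)] pq r(2) C.ide_right[OF m'(2)] by simp
  then show ?thesis using that C.cmp_hom[OF r(1) p] by blast
qed

end


section \<open>The form of closed congruences on pointed objects\<close>

context sheaf_topos
begin

text \<open>
  The clusters of \<open>X\<close> are the internal equivalence relations on \<open>X + 1\<close>, with \<open>None\<close> for the added
  point. Kernels are the relations that leave the added point alone, so they are the equivalence
  relations on \<open>X\<close>; images are those whose only nontrivial class is that of the added point, so they
  are the subobjects of \<open>X\<close>. The coproduct need not be formed: closed congruences on the presheaf of
  sections with one added element are the same thing.
\<close>

definition pel :: "'o \<Rightarrow> 'u \<Rightarrow> 'u option set" where
  "pel X c = insert None (Some ` el X c)"

definition pres :: "'o \<Rightarrow> 'u \<Rightarrow> 'u option \<Rightarrow> 'u option" where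
  "pres X h = map_option (res X h)"

definition pap :: "'m \<Rightarrow> 'u \<Rightarrow> 'u option \<Rightarrow> 'u option" where
  "pap f c = map_option (ap f c)"

lemma pel_cases: "x \<in> pel X c \<Longrightarrow> (x = None \<Longrightarrow> P) \<Longrightarrow> (\<And>y. x = Some y \<Longrightarrow> y \<in> el X c \<Longrightarrow> P) \<Longrightarrow> P"
  by (auto simp: pel_def)

lemma pel_simps [simp]: "None \<in> pel X c" "Some x \<in> pel X c \<longleftrightarrow> x \<in> el X c" 
  "pres X h None = None" "pres X h (Some x) = Some (res X h x)" "pap f c None = None" "pap f c (Some x) = Some (ap f c x)"
  by (auto simp: pel_def pres_def pap_def)

lemma presheaf_pel: "X \<in> ob T \<Longrightarrow> presheaf (pel X) (pres X)"
  unfolding presheaf_def using presheaf_mem[OF el_presheaf] presheaf_ide[OF el_presheaf] presheaf_cmp[OF el_presheaf]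
  by (auto simp: pel_def)

lemma nmap_pap: "f \<in> hom T X Y \<Longrightarrow> nmap (pel X) (pres X) (pel Y) (pres Y) (pap f)"
  unfolding nmap_def by (auto simp: pel_def ap_mem ap_nat)

section \<open>The lattice of closed congruences of an object\<close>

definition CL :: "'o \<Rightarrow> ('u \<times> 'u option \<times> 'u option) set set" where
  "CL X = {E. closed_congruence (pel X) (pres X) E}"

abbreviation topc where "topc X \<equiv> top_cong (pel X)"
abbreviation botc where "botc X \<equiv> bot_cong (pel X) (pres X)"
abbreviation joinc where "joinc X \<equiv> join_cong (pel X) (pres X)"
abbreviation dirc where "dirc f \<equiv> dir_cong (pel (tgt T f)) (pres (tgt T f)) (pap f)"
abbreviation invc where "invc f \<equiv> inv_cong (pel (src T f)) (pap f)"
abbreviation imc where "imc f \<equiv> dirc f (topc (src T f))"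
abbreviation kerc where "kerc f \<equiv> invc f (botc (tgt T f))"

lemma CL_D: "A \<in> CL X \<Longrightarrow> closed_congruence (pel X) (pres X) A"
  by (simp add: CL_def)

lemma CL_top: "X \<in> ob T \<Longrightarrow> topc X \<in> CL X"
  by (simp add: CL_def top_cong_closed presheaf_pel)

lemma CL_bot: "X \<in> ob T \<Longrightarrow> botc X \<in> CL X"
  by (simp add: CL_def bot_cong_closed presheaf_pel)

lemma CL_join: "X \<in> ob T \<Longrightarrow> A \<in> CL X \<Longrightarrow> B \<in> CL X \<Longrightarrow> joinc X A B \<in> CL X"
  by (simp add: CL_def join_cong_closed presheaf_pel)

lemma CL_Int: "A \<in> CL X \<Longrightarrow> B \<in> CL X \<Longrightarrow> A \<inter> B \<in> CL X"
  by (simp add: CL_def closed_congruence_Int)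

lemma CL_le_top: "A \<in> CL X \<Longrightarrow> A \<subseteq> topc X"
  using cc_subset CL_D by blast

lemma CL_bot_le: "A \<in> CL X \<Longrightarrow> botc X \<subseteq> A"
  using bot_cong_least CL_D by blast

lemma CL_dir: "f \<in> hom T X Y \<Longrightarrow> A \<in> CL X \<Longrightarrow> dirc f A \<in> CL Y"
  using dir_cong_closed[OF presheaf_pel presheaf_pel nmap_pap, of X Y f A] CL_le_top homD[of f X Y] by (auto simp: CL_def)

lemma CL_inv: "f \<in> hom T X Y \<Longrightarrow> A \<in> CL Y \<Longrightarrow> invc f A \<in> CL X"
  using inv_cong_closed[OF presheaf_pel presheaf_pel nmap_pap, of X Y f A] homD[of f X Y] by (auto simp: CL_def)

lemma galois: "f \<in> hom T X Y \<Longrightarrow> A \<in> CL X \<Longrightarrow> B \<in> CL Y \<Longrightarrow> dirc f A \<subseteq> B \<longleftrightarrow> A \<subseteq> invc f B"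
  using dir_inv_galois[OF presheaf_pel presheaf_pel nmap_pap, of X Y f A B] CL_le_top homD[of f X Y] by (auto simp: CL_def)

lemma inv_dirc: "f \<in> hom T X Y \<Longrightarrow> A \<in> CL X \<Longrightarrow> invc f (dirc f A) = joinc X A (kerc f)"
  using inv_dir_cong[OF presheaf_pel presheaf_pel nmap_pap, of X Y f A] homD[of f X Y] by (auto simp: CL_def)

lemma dir_invc: "f \<in> hom T X Y \<Longrightarrow> A \<in> CL Y \<Longrightarrow> dirc f (invc f A) = A \<inter> imc f"
  using dir_inv_cong[OF presheaf_pel presheaf_pel nmap_pap, of X Y f A] homD[of f X Y] by (auto simp: CL_def)

lemma invc_cmp:
  assumes f: "f \<in> hom T X Y" and g: "g \<in> hom T Y Z"
  shows "invc (g \<bullet> f) A = invc f (invc g A)"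
proof -
  have "pap (g \<bullet> f) c x = pap g c (pap f c x) \<and> pap f c x \<in> pel Y c" if "c \<in> ob S" "x \<in> pel X c" for c x
    using that ap_cmp[OF f g] ap_mem[OF f] by (auto elim: pel_cases)
  then show ?thesis using homD[OF f] homD[OF g] homD[OF cmp_hom[OF f g]] by (auto simp: inv_cong_def)
qed

lemma invc_ide: "X \<in> ob T \<Longrightarrow> A \<in> CL X \<Longrightarrow> invc (ide T X) A = A"
proof -
  assume X: "X \<in> ob T" and A: "A \<in> CL X"
  have "pap (ide T X) c x = x" if "c \<in> ob S" "x \<in> pel X c" for c x
    using that ap_ide[OF X] by (auto elim: pel_cases)
  then show ?thesis using homD[OF ide_hom[OF X]] CL_le_top[OF A] by (auto simp: inv_cong_def top_cong_def)
qed

text \<open>Inverse images compose on the nose, and left adjoints of equal maps are equal: both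
  sides lie below the same congruences.\<close>

lemma dirc_cmp:
  assumes f: "f \<in> hom T X Y" and g: "g \<in> hom T Y Z" and A: "A \<in> CL X"
  shows "dirc (g \<bullet> f) A = dirc g (dirc f A)"
proof -
  note gf = cmp_hom[OF f g]
  have "dirc (g \<bullet> f) A \<subseteq> B \<longleftrightarrow> dirc g (dirc f A) \<subseteq> B" if B: "B \<in> CL Z" for B
    using galois[OF gf A B] galois[OF g CL_dir[OF f A] B] galois[OF f A CL_inv[OF g B]] invc_cmp[OF f g] by simp
  then show ?thesis using CL_dir[OF gf A] CL_dir[OF g CL_dir[OF f A]] by blast
qed

lemma dirc_ide: "X \<in> ob T \<Longrightarrow> A \<in> CL X \<Longrightarrow> dirc (ide T X) A = A"
  using galois[OF ide_hom[of X], of A A] galois[OF ide_hom[of X], of A "dirc (ide T X) A"] CL_dir[OF ide_hom] invc_ide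
  by (metis subset_antisym subset_refl)

lemma small_CL: assumes X: "X \<in> ob T" shows "sm (CL X)"
proof -
  have "sm (pel X c)" if "c \<in> ob S" for c
    unfolding pel_def using small_Un[OF small_singleton[of None] small_image[OF el_small[OF X that], of Some]] by simp
  then have "sm (SIGMA c:ob S. pel X c \<times> pel X c)" by (intro small_Sigma small_ob small_Times)
  then show ?thesis
    by (rule small_subset[OF small_Pow]) (use CL_le_top in \<open>auto simp: top_cong_def\<close>)
qed

section \<open>Images and kernels as congruences\<close>

lemma CL_im: "f \<in> hom T X Y \<Longrightarrow> imc f \<in> CL Y"
  using CL_dir[of f X Y "topc X"] CL_top homD[of f X Y] by auto

lemma CL_ker: "f \<in> hom T X Y \<Longrightarrow> kerc f \<in> CL X"
  using CL_inv[of f X Y "botc Y"] CL_bot homD[of f X Y] by auto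

text \<open>Apart from null objects, where local equality relates everything, the added point is
  equivalent only to itself. On proper sections local equality is equality because the codomain is a
  sheaf.\<close>

lemma kerc_mem:
  assumes f: "f \<in> hom T X Y" and c: "c \<in> ob S"
  shows "x \<in> el X c \<Longrightarrow> y \<in> el X c \<Longrightarrow> (c, Some x, Some y) \<in> kerc f \<longleftrightarrow> ap f c x = ap f c y"
    and "x \<in> el X c \<Longrightarrow> (c, Some x, None) \<in> kerc f \<longleftrightarrow> null c"
    and "x \<in> el X c \<Longrightarrow> (c, None, Some x) \<in> kerc f \<longleftrightarrow> null c"
    and "(c, None, None) \<in> kerc f"
proof -
  note st = homD[OF f]
  note m = ap_mem[OF f c]
  have Y: "sheaf (el Y) (res Y)" using st el_sheaf by simp
  show "(c, Some x, Some y) \<in> kerc f \<longleftrightarrow> ap f c x = ap f c y" if "x \<in> el X c" "y \<in> el X c"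
    using st c that m sheaf_sep[OF Y c m m] lcov_top[OF c] by (auto simp: inv_cong_def bot_cong_def)
  show "(c, Some x, None) \<in> kerc f \<longleftrightarrow> null c" "(c, None, Some x) \<in> kerc f \<longleftrightarrow> null c" if "x \<in> el X c"
    using st c that m by (auto simp: inv_cong_def bot_cong_def)
  show "(c, None, None) \<in> kerc f" using st c lcov_top[OF c] by (auto simp: inv_cong_def bot_cong_def)
qed

text \<open>Pairs that involve the added point are either trivial or lie over null objects, where
  every closed congruence is total. So inclusion of a kernel is decided on the sections of
  \<open>X\<close>.\<close>

lemma kerc_le:
  assumes f: "f \<in> hom T X Y" and A: "A \<in> CL X"
    and *: "\<And>c x y. c \<in> ob S \<Longrightarrow> x \<in> el X c \<Longrightarrow> y \<in> el X c \<Longrightarrow> ap f c x = ap f c y \<Longrightarrow> (c, Some x, Some y) \<in> A"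
  shows "kerc f \<subseteq> A"
proof clarify
  fix c x y assume xy: "(c, x, y) \<in> kerc f"
  have "src T f = X" using homD[OF f] by simp
  then have c: "c \<in> ob S" and x: "x \<in> pel X c" and y: "y \<in> pel X c" using xy by (auto simp: inv_cong_def)
  \<comment> \<open>The empty cover makes any two sections related.\<close>
  have nl: "(c, x, y) \<in> A" if "null c"
    by (rule cc_local[OF CL_D[OF A] c x y], rule lcov_mono[OF c that]) simp
  from x y show "(c, x, y) \<in> A"
    by (elim pel_cases) (use xy nl kerc_mem[OF f c] * c cc_refl[OF CL_D[OF A] c] in auto)
qed

lemma kerc_le_iff:
  assumes f: "f \<in> hom T X Y" and g: "g \<in> hom T X Z"
  shows "kerc f \<subseteq> kerc g \<longleftrightarrow> (\<forall>c\<in>ob S. \<forall>x\<in>el X c. \<forall>y\<in>el X c. ap f c x = ap f c y \<longrightarrow> ap g c x = ap g c y)"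
proof
  assume "kerc f \<subseteq> kerc g"
  then show "\<forall>c\<in>ob S. \<forall>x\<in>el X c. \<forall>y\<in>el X c. ap f c x = ap f c y \<longrightarrow> ap g c x = ap g c y"
    using kerc_mem(1)[OF f] kerc_mem(1)[OF g] by blast
next
  assume *: "\<forall>c\<in>ob S. \<forall>x\<in>el X c. \<forall>y\<in>el X c. ap f c x = ap f c y \<longrightarrow> ap g c x = ap g c y"
  show "kerc f \<subseteq> kerc g"
    by (rule kerc_le[OF f CL_ker[OF g]]) (use * kerc_mem(1)[OF g] in blast)
qed

lemma kerc_cmp_mono:
  assumes f: "f \<in> hom T X Y" and m: "m \<in> hom T Y Z" "m \<in> mono_arrows T"
  shows "kerc (m \<bullet> f) = kerc f"
proof -
  note mf = cmp_hom[OF f m(1)]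
  have "ap (m \<bullet> f) c x = ap (m \<bullet> f) c y \<longleftrightarrow> ap f c x = ap f c y" if "c \<in> ob S" "x \<in> el X c" "y \<in> el X c" for c x y
    using that ap_cmp[OF f m(1)] mono_inj[OF m(2,1)] ap_mem[OF f] by metis
  then show ?thesis using kerc_le_iff[OF mf f] kerc_le_iff[OF f mf] by blast
qed

definition in_image :: "'m \<Rightarrow> 'u \<Rightarrow> 'u \<Rightarrow> bool" where
  "in_image f c y \<longleftrightarrow> lcov c (\<lambda>h. \<exists>x\<in>el (src T f) (src S h). ap f (src S h) x = res (tgt T f) h y)"

text \<open>In the explicit description of the direct image, \<open>None\<close> never equals a
  proper section and is hit only by \<open>None\<close>. What remains says that \<open>y\<close> is
  locally in the image of \<open>f\<close>, so the class of the added point is the image as a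
  subobject.\<close>

lemma imc_mem_iff:
  assumes f: "f \<in> hom T X Y" and c: "c \<in> ob S" and y: "y \<in> el Y c"
  shows "(c, None, Some y) \<in> imc f \<longleftrightarrow> in_image f c y"
proof -
  have st: "src T f = X" "tgt T f = Y" "X \<in> ob T" "Y \<in> ob T" using homD[OF f] by auto
  note img = dir_top_eq_img[OF presheaf_pel[OF st(3)] presheaf_pel[OF st(4)] nmap_pap[OF f]]
    img_cong_def[OF presheaf_pel[OF st(3)] presheaf_pel[OF st(4)] nmap_pap[OF f]]
  have eq: "(\<exists>x x'. (src S h, x, x') \<in> topc X \<and> pap f (src S h) x = None \<and> pap f (src S h) x' = Some (res Y h y)) \<longleftrightarrow>
      (\<exists>x\<in>el X (src S h). ap f (src S h) x = res Y h y)" if h: "h \<in> into c" for h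
    using src_ob[OF h] by (auto simp: top_cong_def pap_def pel_def)
  have "lcov c (\<lambda>h. \<exists>x x'. (src S h, x, x') \<in> topc X \<and> pap f (src S h) x = None \<and> pap f (src S h) x' = Some (res Y h y)) \<longleftrightarrow>
      lcov c (\<lambda>h. \<exists>x\<in>el X (src S h). ap f (src S h) x = res Y h y)"
    by (intro iffI; erule lcov_mono[OF c]) (simp_all add: eq)
  then have "(c, None, Some y) \<in> imc f \<longleftrightarrow> lcov c (\<lambda>h. \<exists>x\<in>el X (src S h). ap f (src S h) x = res Y h y)"
    unfolding st img using c y by simp
  then show ?thesis by (simp add: in_image_def st)
qed

text \<open>An image is the relation with a single class around the added point, and transitivity
  through that point produces all other pairs.\<close>

lemma imc_le:
  assumes f: "f \<in> hom T X Y" and A: "A \<in> CL Y"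
    and *: "\<And>c x. c \<in> ob S \<Longrightarrow> x \<in> el X c \<Longrightarrow> (c, None, Some (ap f c x)) \<in> A"
  shows "imc f \<subseteq> A"
proof -
  have st: "src T f = X" "X \<in> ob T" "Y \<in> ob T" using homD[OF f] by auto
  note A' = CL_D[OF A]
  have n: "(c, None, pap f c x) \<in> A" if "c \<in> ob S" "x \<in> pel X c" for c x
    using that * cc_refl[OF A'] by (auto elim: pel_cases)
  have "topc X \<subseteq> invc f A"
    using n cc_trans[OF A' cc_sym[OF A' n] n] st by (auto simp: top_cong_def inv_cong_def)
  then show ?thesis using galois[OF f CL_top[OF st(2)] A] st by simp
qed

lemma imc_le_iff:
  assumes f: "f \<in> hom T X Y" and g: "g \<in> hom T Z Y"
  shows "imc f \<subseteq> imc g \<longleftrightarrow> (\<forall>c\<in>ob S. \<forall>x\<in>el X c. in_image g c (ap f c x))"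
proof
  assume le: "imc f \<subseteq> imc g"
  have st: "src T f = X" "tgt T f = Y" using homD[OF f] by auto
  show "\<forall>c\<in>ob S. \<forall>x\<in>el X c. in_image g c (ap f c x)"
  proof (intro ballI)
    fix c x assume c: "c \<in> ob S" and x: "x \<in> el X c"
    have "in_image f c (ap f c x)"
      unfolding in_image_def st
    proof (rule lcov_top[OF c])
      fix h assume h: "h \<in> into c"
      show "\<exists>x'\<in>el X (src S h). ap f (src S h) x' = res Y h (ap f c x)"
        using ap_nat[OF f h x] presheaf_mem[OF el_presheaf h x] homD[OF f] by blast
    qed
    then show "in_image g c (ap f c x)" using le imc_mem_iff[OF f c ap_mem[OF f c x]] imc_mem_iff[OF g c ap_mem[OF f c x]] by blast
  qed
next
  assume "\<forall>c\<in>ob S. \<forall>x\<in>el X c. in_image g c (ap f c x)"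
  then show "imc f \<subseteq> imc g" using imc_le[OF f CL_im[OF g]] imc_mem_iff[OF g _ ap_mem[OF f]] by blast
qed

lemma imc_cmp_epi:
  assumes e: "e \<in> hom T X Y" "e \<in> epi_arrows T" and f: "f \<in> hom T Y Z"
  shows "imc (f \<bullet> e) = imc f"
proof
  note fe = cmp_hom[OF e(1) f]
  have st: "src T f = Y" "tgt T f = Z" "src T (f \<bullet> e) = X" "tgt T (f \<bullet> e) = Z" "X \<in> ob T" "Y \<in> ob T"
    using homD[OF f] homD[OF fe] by auto
  show "imc (f \<bullet> e) \<subseteq> imc f"
    unfolding imc_le_iff[OF fe f]
  proof (intro ballI)
    fix c x assume c: "c \<in> ob S" and x: "x \<in> el X c"
    show "in_image f c (ap (f \<bullet> e) c x)"
      unfolding in_image_def st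
    proof (rule lcov_top[OF c])
      fix h assume h: "h \<in> into c"
      show "\<exists>z\<in>el Y (src S h). ap f (src S h) z = res Z h (ap (f \<bullet> e) c x)"
        using ap_nat[OF f h ap_mem[OF e(1) c x]] ap_cmp[OF e(1) f c x] presheaf_mem[OF el_presheaf[OF st(6)] h ap_mem[OF e(1) c x]] by metis
    qed
  qed
  show "imc f \<subseteq> imc (f \<bullet> e)"
    unfolding imc_le_iff[OF f fe]
  proof (intro ballI)
    fix c y assume c: "c \<in> ob S" and y: "y \<in> el Y c"
    show "in_image (f \<bullet> e) c (ap f c y)"
      unfolding in_image_def st
    proof (rule lcov_mono[OF c lsurjD[OF epi_lsurj[OF e(2,1)] c y]])
      fix h assume h: "h \<in> into c" and "\<exists>q\<in>el X (src S h). ap e (src S h) q = res Y h y"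
      then show "\<exists>x\<in>el X (src S h). ap (f \<bullet> e) (src S h) x = res Z h (ap f c y)"
        using ap_nat[OF f h y] ap_cmp[OF e(1) f src_ob[OF h]] by metis
    qed
  qed
qed

text \<open>Inclusion of images gives local preimages under \<open>m\<close>; being unique, they
  glue to sections and these form a natural family.\<close>

lemma factor_through_mono:
  assumes m: "m \<in> hom T A Y" "m \<in> mono_arrows T" and g: "g \<in> hom T W Y"
    and im: "imc g \<subseteq> imc m"
  obtains h where "h \<in> hom T W A" "m \<bullet> h = g"
proof -
  have ob: "W \<in> ob T" "A \<in> ob T" "src T m = A" "tgt T m = Y" using homD[OF g] homD[OF m(1)] by auto
  have "\<exists>z\<in>el A c. ap m c z = ap g c w" if c: "c \<in> ob S" and w: "w \<in> el W c" for c w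
    by (rule mono_image_local[OF m(2,1) c ap_mem[OF g c w]])
      (use imc_le_iff[OF g m(1)] im c w in \<open>auto simp: in_image_def ob\<close>)
  then obtain k where k: "\<And>c w. c \<in> ob S \<Longrightarrow> w \<in> el W c \<Longrightarrow> k c w \<in> el A c"
    "\<And>c w. c \<in> ob S \<Longrightarrow> w \<in> el W c \<Longrightarrow> ap m c (k c w) = ap g c w" by metis
  have "nmap (el W) (res W) (el A) (res A) k"
    unfolding nmap_def
  proof (intro conjI allI ballI)
    fix c h w assume h: "h \<in> into c" and w: "w \<in> el W c"
    have w': "res W h w \<in> el W (src S h)" using presheaf_mem[OF el_presheaf[OF ob(1)] h w] .
    note c = into_ob[OF h] and d = src_ob[OF h]
    show "k (src S h) (res W h w) = res A h (k c w)"
      by (rule mono_inj[OF m(2,1) d k(1)[OF d w'] presheaf_mem[OF el_presheaf[OF ob(2)] h k(1)[OF c w]]])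
        (use k(2)[OF d w'] k(2)[OF c w] ap_nat[OF g h w] ap_nat[OF m(1) h k(1)[OF c w]] in simp)
  qed (use k in auto)
  then obtain h where h: "h \<in> hom T W A" "\<And>c w. c \<in> ob S \<Longrightarrow> w \<in> el W c \<Longrightarrow> ap h c w = k c w"
    using ap_full[OF ob(1,2)] by blast
  have "m \<bullet> h = g"
    by (rule ap_eqI[OF cmp_hom[OF h(1) m(1)] g]) (simp add: ap_cmp[OF h(1) m(1)] h(2) k(2))
  with h(1) show ?thesis by (rule that)
qed

lemma kernel_le_if_kerc_le:
  assumes f: "f \<in> hom T X Y" and W: "kerc f \<subseteq> W"
  shows "kernel_of (el X) (ap f) \<subseteq> inv_cong (el X) (\<lambda>c. Some) W"
proof (unfold kernel_le_iff, intro ballI impI)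
  fix c x y assume *: "c \<in> ob S" "x \<in> el X c" "y \<in> el X c" "ap f c x = ap f c y"
  then have "(c, Some x, Some y) \<in> kerc f" using kerc_mem(1)[OF f] by simp
  with W have "(c, Some x, Some y) \<in> W" by (rule subsetD)
  then show "(c, x, y) \<in> inv_cong (el X) (\<lambda>c. Some) W" using * by (simp add: inv_cong_def)
qed

text \<open>The join is formed on sections with an added point, whereas the pushout speaks of
  sections of \<open>X\<close>. Restricting the join along \<open>Some\<close> gives a closed
  congruence on \<open>X\<close> that contains both kernels, hence the kernel of the
  pushout.\<close>

lemma kerc_pushout:
  assumes po: "is_pushout T d e p q" and d: "d \<in> epi_arrows T" "d \<in> hom T X A" and e: "e \<in> epi_arrows T" "e \<in> hom T X B"
    and p: "p \<in> hom T A P"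
  shows "kerc (p \<bullet> d) = joinc X (kerc d) (kerc e)"
proof
  have X: "X \<in> ob T" using homD[OF d(2)] by simp
  have q: "q \<in> hom T B P" and pq: "p \<bullet> d = q \<bullet> e" using po p e(2) unfolding is_pushout_def hom_def by auto
  note pd = cmp_hom[OF d(2) p] 
  define W where "W = joinc X (kerc d) (kerc e)"
  have W: "W \<in> CL X" unfolding W_def by (rule CL_join[OF X CL_ker[OF d(2)] CL_ker[OF e(2)]])
  have n: "nmap (el X) (res X) (pel X) (pres X) (\<lambda>c. Some)" by (auto simp: nmap_def)
  note cl = inv_cong_closed[OF el_presheaf[OF X] presheaf_pel[OF X] n CL_D[OF W]]
  have "kerc d \<subseteq> W" "kerc e \<subseteq> W" unfolding W_def by (rule join_cong_upper)+
  then have "kernel_of (el X) (ap d) \<subseteq> inv_cong (el X) (\<lambda>c. Some) W" "kernel_of (el X) (ap e) \<subseteq> inv_cong (el X) (\<lambda>c. Some) W"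
    using kernel_le_if_kerc_le[OF d(2)] kernel_le_if_kerc_le[OF e(2)] by simp_all
  from pushout_kernel_least[OF po d e cl this]
  have "(c, Some x, Some y) \<in> W" if "c \<in> ob S" "x \<in> el X c" "y \<in> el X c" "ap (p \<bullet> d) c x = ap (p \<bullet> d) c y" for c x y
    using that unfolding kernel_le_iff by (auto simp: inv_cong_def)
  then show "kerc (p \<bullet> d) \<subseteq> joinc X (kerc d) (kerc e)" using kerc_le[OF pd W] unfolding W_def by blast
  show "joinc X (kerc d) (kerc e) \<subseteq> kerc (p \<bullet> d)"
  proof (rule join_cong_least[OF CL_D[OF CL_ker[OF pd]]])
    show "kerc d \<subseteq> kerc (p \<bullet> d)" unfolding kerc_le_iff[OF d(2) pd] by (auto simp: ap_cmp[OF d(2) p])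
    show "kerc e \<subseteq> kerc (p \<bullet> d)" unfolding kerc_le_iff[OF e(2) pd] by (auto simp: pq ap_cmp[OF e(2) q])
  qed
qed

text \<open>Precomposition can only shrink images, which settles one inclusion. For the other, a
  pair reached through both \<open>m\<close> and \<open>n\<close> is lifted to the pullback one
  component at a time.\<close>

lemma imc_pullback:
  assumes pb: "is_pullback T m n p q" and m: "m \<in> mono_arrows T" "m \<in> hom T A Z" and n: "n \<in> mono_arrows T" "n \<in> hom T B Z"
    and p: "p \<in> hom T P A"
  shows "imc (m \<bullet> p) = imc m \<inter> imc n"
proof
  have q: "q \<in> hom T P B" and pq: "m \<bullet> p = n \<bullet> q" using pb p n(2) unfolding is_pullback_def hom_def by auto
  note mp = cmp_hom[OF p m(2)]
  have st: "src T m = A" "tgt T m = Z" "src T n = B" "tgt T n = Z" "src T (m \<bullet> p) = P" "tgt T (m \<bullet> p) = Z" and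
    ob: "A \<in> ob T" "B \<in> ob T" "Z \<in> ob T" "P \<in> ob T"
    using homD[OF m(2)] homD[OF n(2)] homD[OF mp] by auto
  have img: "imc f = {(c, y, y'). c \<in> ob S \<and> y \<in> pel Z c \<and> y' \<in> pel Z c \<and>
     lcov c (\<lambda>h. pres Z h y = pres Z h y' \<or> (\<exists>x x'. (src S h, x, x') \<in> topc X \<and> pap f (src S h) x = pres Z h y \<and> pap f (src S h) x' = pres Z h y'))}"
    if f: "f \<in> hom T X Z" for f X
    using homD[OF f] dir_top_eq_img[OF presheaf_pel presheaf_pel nmap_pap[OF f]] img_cong_def[OF presheaf_pel presheaf_pel nmap_pap[OF f]] by simp
  show "imc (m \<bullet> p) \<subseteq> imc m \<inter> imc n"
  proof -
    have "imc (g \<bullet> r) \<subseteq> imc g" if r: "r \<in> hom T P K" and g: "g \<in> hom T K Z" for g r K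
    proof -
      have "imc (g \<bullet> r) = dirc g (imc r)"
        using dirc_cmp[OF r g CL_top[OF ob(4)]] homD[OF cmp_hom[OF r g]] homD[OF r] by simp
      also have "\<dots> \<subseteq> imc g"
        using CL_le_top[OF CL_im[OF r]] homD[OF g] homD[OF r] dir_cong_mono[OF presheaf_pel presheaf_pel nmap_pap[OF g]] by simp
      finally show ?thesis .
    qed
    from this[OF p m(2)] this[OF q n(2)] show ?thesis using pq by simp
  qed
  show "imc m \<inter> imc n \<subseteq> imc (m \<bullet> p)"
  proof clarify
    fix c y y' assume "(c, y, y') \<in> imc m" "(c, y, y') \<in> imc n"
    then have c: "c \<in> ob S" and y: "y \<in> pel Z c" "y' \<in> pel Z c"
      and l: "lcov c (\<lambda>h. pres Z h y = pres Z h y' \<or> (\<exists>x x'. (src S h, x, x') \<in> topc A \<and> pap m (src S h) x = pres Z h y \<and> pap m (src S h) x' = pres Z h y'))"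
        "lcov c (\<lambda>h. pres Z h y = pres Z h y' \<or> (\<exists>x x'. (src S h, x, x') \<in> topc B \<and> pap n (src S h) x = pres Z h y \<and> pap n (src S h) x' = pres Z h y'))"
      unfolding img[OF m(2)] img[OF n(2)] by auto
    \<comment> \<open>A value reached from both sides comes from the pullback, the added point
      included; since \<open>pap\<close> preserves \<open>None\<close> and \<open>Some\<close>, the
      two cases do not mix.\<close>
    have P: "\<exists>z\<in>pel P d. pap (m \<bullet> p) d z = w"
      if d: "d \<in> ob S" and a: "a \<in> pel A d" "pap m d a = w" and b: "b \<in> pel B d" "pap n d b = w" for d a b w
      using a(1)
    proof (rule pel_cases)
      assume "a = None" then show ?thesis using a(2) by (intro bexI[of _ None]) auto
    next
      fix a' assume a': "a = Some a'" "a' \<in> el A d"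
      then obtain b' where b': "b = Some b'" "b' \<in> el B d" using a(2) b by (auto elim: pel_cases)
      have "ap m d a' = ap n d b'" using a' b' a(2) b(2) by auto
      then obtain z where "z \<in> el P d" "ap p d z = a'" using pullback_el[OF pb m n p d a'(2) b'(2)] by blast
      then show ?thesis using ap_cmp[OF p m(2) d] a(2) a' by (intro bexI[of _ "Some z"]) auto
    qed
    have "lcov c (\<lambda>h. pres Z h y = pres Z h y' \<or>
        (\<exists>x x'. (src S h, x, x') \<in> topc P \<and> pap (m \<bullet> p) (src S h) x = pres Z h y \<and> pap (m \<bullet> p) (src S h) x' = pres Z h y'))"
    proof (rule lcov_mp[OF c l])
      fix h assume h: "h \<in> into c"
        and 1: "pres Z h y = pres Z h y' \<or> (\<exists>x x'. (src S h, x, x') \<in> topc A \<and> pap m (src S h) x = pres Z h y \<and> pap m (src S h) x' = pres Z h y')"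
        and 2: "pres Z h y = pres Z h y' \<or> (\<exists>x x'. (src S h, x, x') \<in> topc B \<and> pap n (src S h) x = pres Z h y \<and> pap n (src S h) x' = pres Z h y')"
      note d = src_ob[OF h]
      show "pres Z h y = pres Z h y' \<or>
        (\<exists>x x'. (src S h, x, x') \<in> topc P \<and> pap (m \<bullet> p) (src S h) x = pres Z h y \<and> pap (m \<bullet> p) (src S h) x' = pres Z h y')"
      proof (cases "pres Z h y = pres Z h y'")
        case False
        then obtain a a' b b' where a: "a \<in> pel A (src S h)" "a' \<in> pel A (src S h)" "pap m (src S h) a = pres Z h y" "pap m (src S h) a' = pres Z h y'"
          and b: "b \<in> pel B (src S h)" "b' \<in> pel B (src S h)" "pap n (src S h) b = pres Z h y" "pap n (src S h) b' = pres Z h y'"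
          using 1 2 by (auto simp: top_cong_def)
        obtain z where "z \<in> pel P (src S h)" "pap (m \<bullet> p) (src S h) z = pres Z h y" using P[OF d a(1,3) b(1,3)] by blast
        moreover obtain z' where "z' \<in> pel P (src S h)" "pap (m \<bullet> p) (src S h) z' = pres Z h y'" using P[OF d a(2,4) b(2,4)] by blast
        ultimately show ?thesis using d unfolding top_cong_def by blast
      qed simp
    qed
    then show "(c, y, y') \<in> imc (m \<bullet> p)" unfolding img[OF mp] using c y by simp
  qed
qed

end

section \<open>The form given by a transfer functor to a topos\<close>

locale transfer_to_topos = sheaf_topos U S J T el res ap + C: transfer_category C U E M
  for U :: "'u \<Rightarrow> 'u set" and S J and T :: "('o, 'm) cat" and el res ap
    and C :: "('c, 'd) cat" and E M +
  fixes G :: "('c, 'd, 'o, 'm) ftr"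
  assumes transfer: "transfer_functor U C E M T (epi_arrows T) (mono_arrows T) G"
begin

abbreviation GO where "GO \<equiv> on_ob G"
abbreviation GA where "GA \<equiv> on_ar G"

lemma functor_G: "is_functor C T G"
  using transfer by (simp add: transfer_functor_def)

lemma GA_epi: "e \<in> E \<Longrightarrow> GA e \<in> epi_arrows T" and GA_mono: "m \<in> M \<Longrightarrow> GA m \<in> mono_arrows T"
  using transfer unfolding transfer_functor_def by blast+

lemma GA_pullback: "is_pullback C m n p q \<Longrightarrow> m \<in> M \<Longrightarrow> n \<in> M \<Longrightarrow> is_pullback T (GA m) (GA n) (GA p) (GA q)"
  and GA_pushout: "is_pushout C d e p q \<Longrightarrow> d \<in> E \<Longrightarrow> e \<in> E \<Longrightarrow> is_pushout T (GA d) (GA e) (GA p) (GA q)"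
  using transfer unfolding transfer_functor_def by blast+

lemma GO_ob: "X \<in> ob C \<Longrightarrow> GO X \<in> ob T"
  using functor_mem[OF functor_G] .

lemma GA_hom: "f \<in> hom C X Y \<Longrightarrow> GA f \<in> hom T (GO X) (GO Y)"
  using functor_hom[OF functor_G] .

lemma GA_st: "f \<in> hom C X Y \<Longrightarrow> src T (GA f) = GO X \<and> tgt T (GA f) = GO Y"
  using homD[OF GA_hom] by blast

lemma GA_cmp: "f \<in> hom C X Y \<Longrightarrow> g \<in> hom C Y Z \<Longrightarrow> GA (g \<cdot>\<^bsub>C\<^esub> f) = GA g \<bullet> GA f"
  using functor_cmp[OF functor_G] .

text \<open>Any injection into the universe type serves; one exists because \<open>CL X\<close> is
  small.\<close>

definition enc :: "'o \<Rightarrow> ('u \<times> 'u option \<times> 'u option) set \<Rightarrow> 'u" where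
  "enc X = (SOME e. inj_on e (CL X))"

definition dec :: "'o \<Rightarrow> 'u \<Rightarrow> ('u \<times> 'u option \<times> 'u option) set" where
  "dec X = inv_into (CL X) (enc X)"

lemma enc_inj: "X \<in> ob T \<Longrightarrow> inj_on (enc X) (CL X)"
  unfolding enc_def using small_CL[of X] by (metis (mono_tags, lifting) small_iff_inj someI_ex)

lemma dec_enc [simp]: "X \<in> ob T \<Longrightarrow> A \<in> CL X \<Longrightarrow> dec X (enc X A) = A"
  unfolding dec_def by (rule inv_into_f_f[OF enc_inj])

text \<open>The congruence lattices of the topos pulled back along \<open>G\<close>; decoding and
  encoding only carry them into \<open>'u\<close>.\<close>

definition cong_form :: "('c, 'd, 'u) form" where
  "cong_form = \<lparr>fib = (\<lambda>X. coded_order (enc (GO X)) (CL (GO X))),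
     push = (\<lambda>f a. enc (GO (tgt C f)) (dirc (GA f) (dec (GO (src C f)) a))),
     pull = (\<lambda>f a. enc (GO (src C f)) (invc (GA f) (dec (GO (tgt C f)) a)))\<rparr>"

abbreviation F where "F \<equiv> cong_form"

lemma fib_F: "fib F X = coded_order (enc (GO X)) (CL (GO X))"
  by (simp add: cong_form_def)

lemma carrier_F [simp]: "X \<in> ob C \<Longrightarrow> clusters F X = enc (GO X) ` CL (GO X)"
  by (simp add: fib_F enc_inj GO_ob)

lemma le_F [simp]: "X \<in> ob C \<Longrightarrow> A \<in> CL (GO X) \<Longrightarrow> B \<in> CL (GO X) \<Longrightarrow>
    enc (GO X) A \<sqsubseteq>\<^bsub>fib F X\<^esub> enc (GO X) B \<longleftrightarrow> A \<subseteq> B"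
  unfolding fib_F by (rule coded_le[OF enc_inj[OF GO_ob]])

lemma push_F: "f \<in> hom C X Y \<Longrightarrow> A \<in> CL (GO X) \<Longrightarrow> push F f (enc (GO X) A) = enc (GO Y) (dirc (GA f) A)"
  using C.homD[of f X Y] by (simp add: cong_form_def GO_ob)

lemma pull_F: "f \<in> hom C X Y \<Longrightarrow> A \<in> CL (GO Y) \<Longrightarrow> pull F f (enc (GO Y) A) = enc (GO X) (invc (GA f) A)"
  using C.homD[of f X Y] by (simp add: cong_form_def GO_ob)

lemma join_F:
  assumes X: "X \<in> ob C" and A: "A \<in> CL (GO X)" and B: "B \<in> CL (GO X)"
  shows "enc (GO X) A \<squnion>\<^bsub>fib F X\<^esub> enc (GO X) B = enc (GO X) (joinc (GO X) A B)"
  unfolding fib_F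
  by (rule coded_join(2)[OF enc_inj[OF GO_ob[OF X]] A B CL_join[OF GO_ob[OF X] A B] join_cong_upper])
    (rule join_cong_least[OF CL_D])

lemma meet_F:
  assumes X: "X \<in> ob C" and A: "A \<in> CL (GO X)" and B: "B \<in> CL (GO X)"
  shows "enc (GO X) A \<sqinter>\<^bsub>fib F X\<^esub> enc (GO X) B = enc (GO X) (A \<inter> B)"
  unfolding fib_F by (rule coded_meet(2)[OF enc_inj[OF GO_ob[OF X]] A B CL_Int[OF A B]])

lemma top_F: "X \<in> ob C \<Longrightarrow> \<top>\<^bsub>fib F X\<^esub> = enc (GO X) (topc (GO X))"
  unfolding fib_F by (rule coded_top(2)[OF enc_inj CL_top]) (use GO_ob CL_le_top in auto)

lemma bottom_F: "X \<in> ob C \<Longrightarrow> \<bottom>\<^bsub>fib F X\<^esub> = enc (GO X) (botc (GO X))"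
  unfolding fib_F by (rule coded_bottom(2)[OF enc_inj CL_bot]) (use GO_ob CL_bot_le in auto)

lemma lattice_F: "X \<in> ob C \<Longrightarrow> Lattice.bounded_lattice (fib F X)"
  unfolding fib_F
  by (rule coded_bounded_lattice[OF enc_inj, where I = "joinc (GO X)" and t = "topc (GO X)" and b = "botc (GO X)"])
    (simp_all add: GO_ob CL_join join_cong_upper join_cong_least[OF CL_D] CL_Int CL_top CL_bot CL_le_top CL_bot_le)

lemma CL_GA:
  assumes f: "f \<in> hom C X Y"
  shows "A \<in> CL (GO X) \<Longrightarrow> dirc (GA f) A \<in> CL (GO Y)" "B \<in> CL (GO Y) \<Longrightarrow> invc (GA f) B \<in> CL (GO X)"
    "imc (GA f) \<in> CL (GO Y)" "kerc (GA f) \<in> CL (GO X)"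
  using CL_dir[OF GA_hom[OF f]] CL_inv[OF GA_hom[OF f]] CL_im[OF GA_hom[OF f]] CL_ker[OF GA_hom[OF f]] by auto

lemma Im_F: "f \<in> hom C X Y \<Longrightarrow> Im C F f = enc (GO Y) (imc (GA f))"
  using C.homD[of f X Y] push_F[of f X Y] CL_top[OF GO_ob] GA_st[of f X Y] by (simp add: Im_def top_F)

lemma Ker_F: "f \<in> hom C X Y \<Longrightarrow> Ker C F f = enc (GO X) (kerc (GA f))"
  using C.homD[of f X Y] pull_F[of f X Y] CL_bot[OF GO_ob] GA_st[of f X Y] by (simp add: Ker_def bottom_F)

lemma enc_eq: "X \<in> ob C \<Longrightarrow> A \<in> CL (GO X) \<Longrightarrow> B \<in> CL (GO X) \<Longrightarrow> enc (GO X) A = enc (GO X) B \<longleftrightarrow> A = B"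
  using inj_on_eq_iff[OF enc_inj[OF GO_ob]] by blast

lemma conormal_F: "X \<in> ob C \<Longrightarrow> conormal C F X S' \<longleftrightarrow> (\<exists>Z. \<exists>f\<in>hom C Z X. S' = enc (GO X) (imc (GA f)))"
  unfolding conormal_def using Im_F C.homD C.ar_hom by metis

lemma normal_F: "X \<in> ob C \<Longrightarrow> normal C F X K \<longleftrightarrow> (\<exists>Z. \<exists>f\<in>hom C X Z. K = enc (GO X) (kerc (GA f)))"
  unfolding normal_def using Ker_F C.homD C.ar_hom by metis

lemma is_form_F: "is_form U C F"
  unfolding is_form_def
proof (intro conjI ballI impI)
  fix X assume X: "X \<in> ob C"
  show "Lattice.bounded_lattice (fib F X)" by (rule lattice_F[OF X])
  show "sm (clusters F X)" using small_image[OF small_CL[OF GO_ob[OF X]]] X by simp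
  fix A assume "A \<in> clusters F X"
  then obtain A' where A: "A = enc (GO X) A'" "A' \<in> CL (GO X)" using X by auto
  have "GA (ide C X) = ide T (GO X)" using functor_ide[OF functor_G X] .
  then show "push F (ide C X) A = A" "pull F (ide C X) A = A"
    using push_F[OF C.ide_hom[OF X] A(2)] pull_F[OF C.ide_hom[OF X] A(2)] A dirc_ide[OF GO_ob[OF X] A(2)] invc_ide[OF GO_ob[OF X] A(2)]
    by simp_all
next
  fix f assume "f \<in> ar C"
  then obtain X Y where f: "f \<in> hom C X Y" by (auto simp: hom_def)
  have st: "src C f = X" "tgt C f = Y" "X \<in> ob C" "Y \<in> ob C" using C.homD[OF f] by auto
  note h = GA_hom[OF f]
  have gst: "src T (GA f) = GO X" "tgt T (GA f) = GO Y" using GA_st[OF f] by auto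
  show "push F f \<in> clusters F (src C f) \<rightarrow> clusters F (tgt C f)" "pull F f \<in> clusters F (tgt C f) \<rightarrow> clusters F (src C f)"
    unfolding st using st(3,4) push_F[OF f] pull_F[OF f] CL_GA(1,2)[OF f] by auto
  interpret LX: bounded_lattice "fib F X" by (rule lattice_F[OF st(3)])
  interpret LY: bounded_lattice "fib F Y" by (rule lattice_F[OF st(4)])
  show "isotone (fib F (src C f)) (fib F (tgt C f)) (push F f)"
    unfolding st isotone_def
  proof (intro conjI ballI impI)
    fix a b assume "a \<in> clusters F X" "b \<in> clusters F X" and le: "a \<sqsubseteq>\<^bsub>fib F X\<^esub> b"
    then obtain A B where *: "a = enc (GO X) A" "A \<in> CL (GO X)" "b = enc (GO X) B" "B \<in> CL (GO X)" using st by auto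
    have "A \<subseteq> B" using le * st by simp
    then have "dirc (GA f) A \<subseteq> dirc (GA f) B"
      using dir_cong_mono[OF presheaf_pel presheaf_pel nmap_pap[OF h] \<open>A \<subseteq> B\<close>] GO_ob st gst by simp
    then show "push F f a \<sqsubseteq>\<^bsub>fib F Y\<^esub> push F f b"
      using push_F[OF f] * CL_GA(1)[OF f] st by simp
  qed (rule LX.weak_partial_order_axioms LY.weak_partial_order_axioms)+
  show "isotone (fib F (tgt C f)) (fib F (src C f)) (pull F f)"
    unfolding st isotone_def
  proof (intro conjI ballI impI)
    fix a b assume "a \<in> clusters F Y" "b \<in> clusters F Y" and le: "a \<sqsubseteq>\<^bsub>fib F Y\<^esub> b"
    then obtain A B where *: "a = enc (GO Y) A" "A \<in> CL (GO Y)" "b = enc (GO Y) B" "B \<in> CL (GO Y)" using st by auto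
    have "A \<subseteq> B" using le * st by simp
    then have "invc (GA f) A \<subseteq> invc (GA f) B" by (auto simp: inv_cong_def)
    then show "pull F f a \<sqsubseteq>\<^bsub>fib F X\<^esub> pull F f b"
      using pull_F[OF f] * CL_GA(2)[OF f] st by simp
  qed (rule LX.weak_partial_order_axioms LY.weak_partial_order_axioms)+
  fix a b assume "a \<in> clusters F (src C f)" "b \<in> clusters F (tgt C f)"
  then obtain A B where *: "a = enc (GO X) A" "A \<in> CL (GO X)" "b = enc (GO Y) B" "B \<in> CL (GO Y)" using st by auto
  show "push F f a \<sqsubseteq>\<^bsub>fib F (tgt C f)\<^esub> b \<longleftrightarrow> a \<sqsubseteq>\<^bsub>fib F (src C f)\<^esub> pull F f b"
    unfolding st using * push_F[OF f *(2)] pull_F[OF f *(4)] CL_GA(1,2)[OF f] st(3,4) galois[OF h *(2,4)] by simp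
next
  fix f g assume "f \<in> ar C" "g \<in> ar C" "src C g = tgt C f"
  then obtain X Y Z where f: "f \<in> hom C X Y" and g: "g \<in> hom C Y Z" by (auto simp: hom_def)
  have st: "src C f = X" "tgt C g = Z" "X \<in> ob C" "Z \<in> ob C" using C.homD[OF f] C.homD[OF g] by auto
  show "push F (g \<cdot>\<^bsub>C\<^esub> f) a = push F g (push F f a)" if a: "a \<in> clusters F (src C f)" for a
  proof -
    obtain A where *: "a = enc (GO X) A" "A \<in> CL (GO X)" using st a by auto
    show ?thesis using push_F[OF C.cmp_hom[OF f g] *(2)] push_F[OF f *(2)] push_F[OF g CL_GA(1)[OF f *(2)]]
      dirc_cmp[OF GA_hom[OF f] GA_hom[OF g] *(2)] GA_cmp[OF f g] *(1) by simp
  qed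
  show "pull F (g \<cdot>\<^bsub>C\<^esub> f) b = pull F f (pull F g b)" if b: "b \<in> clusters F (tgt C g)" for b
  proof -
    obtain B where *: "b = enc (GO Z) B" "B \<in> CL (GO Z)" using st b by auto
    show ?thesis using pull_F[OF C.cmp_hom[OF f g] *(2)] pull_F[OF g *(2)] pull_F[OF f CL_GA(2)[OF g *(2)]]
      invc_cmp[OF GA_hom[OF f] GA_hom[OF g]] GA_cmp[OF f g] *(1) by simp
  qed
qed

lemma kerc_factor:
  assumes e: "e \<in> hom C X I" and m: "m \<in> hom C I Y" "m \<in> M"
  shows "kerc (GA (m \<cdot>\<^bsub>C\<^esub> e)) = kerc (GA e)"
  using kerc_cmp_mono[OF GA_hom[OF e] GA_hom[OF m(1)] GA_mono[OF m(2)]] GA_cmp[OF e m(1)] by simp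

lemma imc_factor:
  assumes e: "e \<in> hom C X I" "e \<in> E" and m: "m \<in> hom C I Y"
  shows "imc (GA (m \<cdot>\<^bsub>C\<^esub> e)) = imc (GA m)"
  using imc_cmp_epi[OF GA_hom[OF e(1)] GA_epi[OF e(2)] GA_hom[OF m]] GA_cmp[OF e(1) m] by simp

text \<open>\<open>transfer_factor_epi\<close> compares only arrows of \<open>E\<close>, so
  \<open>g\<close> is first factorized. Its left part has the same kernel as \<open>g\<close>,
  because the image of the right part in \<open>T\<close> is mono. In \<open>T\<close> inclusion of
  kernels gives a factorization, and this is reflected to \<open>C\<close>.\<close>

lemma quotient_F:
  assumes e: "e \<in> E" "e \<in> hom C X I"
  shows "is_quotient C F X (Ker C F e) e"
  unfolding is_quotient_def
proof (intro conjI ballI impI)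
  have X: "X \<in> ob C" using C.homD[OF e(2)] by simp
  show "normal C F X (Ker C F e)" unfolding normal_F[OF X] Ker_F[OF e(2)] using e(2) by blast
  show "e \<in> ar C" "src C e = X" "Ker C F e = Ker C F e" using C.homD[OF e(2)] by auto
  fix g assume "g \<in> ar C" "src C g = X" and le: "Ker C F e \<sqsubseteq>\<^bsub>fib F X\<^esub> Ker C F g"
  then obtain Z where g: "g \<in> hom C X Z" by (auto simp: hom_def)
  have le': "kerc (GA e) \<subseteq> kerc (GA g)" using le Ker_F[OF e(2)] Ker_F[OF g] CL_GA(4)[OF e(2)] CL_GA(4)[OF g] X by simp
  obtain I' e' m' where e': "e' \<in> hom C X I'" "m' \<in> hom C I' Z" "e' \<in> E" "m' \<in> M" "g = m' \<cdot>\<^bsub>C\<^esub> e'"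
    by (rule C.factorize[OF g]) (rule that)
  have "kerc (GA e) \<subseteq> kerc (GA e')" using le' kerc_factor[OF e'(1,2,4)] e'(5) by simp
  then have ker_e: "\<forall>c\<in>ob S. \<forall>x\<in>el (GO X) c. \<forall>y\<in>el (GO X) c. ap (GA e) c x = ap (GA e) c y \<longrightarrow> ap (GA e') c x = ap (GA e') c y"
    by (rule iffD1[OF kerc_le_iff[OF GA_hom[OF e(2)] GA_hom[OF e'(1)]]])
  obtain k where k: "k \<in> hom T (GO I) (GO I')" "k \<bullet> GA e = GA e'"
  proof (rule factor_through_epi[OF GA_hom[OF e(2)] GA_epi[OF e(1)] GA_hom[OF e'(1)]])
    fix c x x' assume "c \<in> ob S" "x \<in> el (GO X) c" "x' \<in> el (GO X) c" "ap (GA e) c x = ap (GA e) c x'"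
    then show "ap (GA e') c x = ap (GA e') c x'" by (rule ker_e[rule_format])
  qed (rule that)
  obtain h where h: "h \<in> hom C I I'" "h \<cdot>\<^bsub>C\<^esub> e = e'"
    by (rule transfer_factor_epi[OF transfer e e'(3,1) k]) (rule that)
  have "g = (m' \<cdot>\<^bsub>C\<^esub> h) \<cdot>\<^bsub>C\<^esub> e" using C.assoc[OF e(2) h(1) e'(2)] h(2) e'(5) by simp
  moreover have "m' \<cdot>\<^bsub>C\<^esub> h \<in> hom C I Z" by (rule C.cmp_hom[OF h(1) e'(2)])
  moreover have "k = k'" if "k \<in> hom C I Z \<and> g = k \<cdot>\<^bsub>C\<^esub> e" "k' \<in> hom C I Z \<and> g = k' \<cdot>\<^bsub>C\<^esub> e" for k k'
    by (rule C.epiD[OF C.E_epi[OF e(1)] e(2), where W = Z]) (use that in simp_all)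
  ultimately have "\<exists>!h. h \<in> hom C I Z \<and> g = h \<cdot>\<^bsub>C\<^esub> e"
    by (intro ex_ex1I) blast+
  then show "\<exists>!h. h \<in> hom C (tgt C e) (tgt C g) \<and> g = h \<cdot>\<^bsub>C\<^esub> e"
    using C.homD[OF e(2)] C.homD[OF g] by simp
qed

text \<open>The dual argument: the right part of \<open>g\<close> has the same image as
  \<open>g\<close>, since the left part becomes epi in \<open>T\<close>, and inclusion of images
  yields the factorization to be reflected.\<close>

lemma embedding_F:
  assumes m: "m \<in> M" "m \<in> hom C I X"
  shows "is_embedding C F X (Im C F m) m"
  unfolding is_embedding_def
proof (intro conjI ballI impI)
  have X: "X \<in> ob C" using C.homD[OF m(2)] by simp
  show "conormal C F X (Im C F m)" unfolding conormal_F[OF X] Im_F[OF m(2)] using m(2) by blast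
  show "m \<in> ar C" "tgt C m = X" "Im C F m = Im C F m" using C.homD[OF m(2)] by auto
  fix g assume "g \<in> ar C" "tgt C g = X" and le: "Im C F g \<sqsubseteq>\<^bsub>fib F X\<^esub> Im C F m"
  then obtain Z where g: "g \<in> hom C Z X" by (auto simp: hom_def)
  have le': "imc (GA g) \<subseteq> imc (GA m)" using le Im_F[OF m(2)] Im_F[OF g] CL_GA(3)[OF m(2)] CL_GA(3)[OF g] X by simp
  obtain I' e' m' where e': "e' \<in> hom C Z I'" "m' \<in> hom C I' X" "e' \<in> E" "m' \<in> M" "g = m' \<cdot>\<^bsub>C\<^esub> e'"
    by (rule C.factorize[OF g]) (rule that)
  have "imc (GA m') \<subseteq> imc (GA m)" using le' imc_factor[OF e'(1,3,2)] e'(5) by simp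
  then obtain k where k: "k \<in> hom T (GO I') (GO I)" "GA m \<bullet> k = GA m'"
    by (rule factor_through_mono[OF GA_hom[OF m(2)] GA_mono[OF m(1)] GA_hom[OF e'(2)]])
  obtain h where h: "h \<in> hom C I' I" "m \<cdot>\<^bsub>C\<^esub> h = m'"
    by (rule transfer_factor_mono[OF transfer m e'(4,2) k]) (rule that)
  have "g = m \<cdot>\<^bsub>C\<^esub> (h \<cdot>\<^bsub>C\<^esub> e')" using C.assoc[OF e'(1) h(1) m(2)] h(2) e'(5) by simp
  moreover have "h \<cdot>\<^bsub>C\<^esub> e' \<in> hom C Z I" by (rule C.cmp_hom[OF e'(1) h(1)])
  moreover have "k = k'" if "k \<in> hom C Z I \<and> g = m \<cdot>\<^bsub>C\<^esub> k" "k' \<in> hom C Z I \<and> g = m \<cdot>\<^bsub>C\<^esub> k'" for k k'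
    by (rule C.monoD[OF C.M_mono[OF m(1)] m(2), where W = Z]) (use that in simp_all)
  ultimately have "\<exists>!h. h \<in> hom C Z I \<and> g = m \<cdot>\<^bsub>C\<^esub> h"
    by (intro ex_ex1I) blast+
  then show "\<exists>!h. h \<in> hom C (src C g) (src C m) \<and> g = m \<cdot>\<^bsub>C\<^esub> h"
    using C.homD[OF m(2)] C.homD[OF g] by simp
qed

lemma noetherian_F: "noetherian_form U C F"
  unfolding noetherian_form_def
proof (intro conjI ballI allI impI is_form_F)
  fix f a assume "f \<in> ar C" and a: "a \<in> clusters F (src C f)"
  then obtain X Y where f: "f \<in> hom C X Y" by (auto simp: hom_def)
  have st: "src C f = X" "X \<in> ob C" using C.homD[OF f] by auto
  obtain A where *: "a = enc (GO X) A" "A \<in> CL (GO X)" using st a by auto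
  show "pull F f (push F f a) = a \<squnion>\<^bsub>fib F (src C f)\<^esub> Ker C F f"
    using push_F[OF f *(2)] pull_F[OF f CL_GA(1)[OF f *(2)]] inv_dirc[OF GA_hom[OF f] *(2)] Ker_F[OF f]
      join_F[OF st(2) *(2) CL_GA(4)[OF f]] st *(1) by simp
next
  fix f a assume "f \<in> ar C" and a: "a \<in> clusters F (tgt C f)"
  then obtain X Y where f: "f \<in> hom C X Y" by (auto simp: hom_def)
  have st: "tgt C f = Y" "Y \<in> ob C" using C.homD[OF f] by auto
  obtain A where *: "a = enc (GO Y) A" "A \<in> CL (GO Y)" using st a by auto
  show "push F f (pull F f a) = a \<sqinter>\<^bsub>fib F (tgt C f)\<^esub> Im C F f"
    using pull_F[OF f *(2)] push_F[OF f CL_GA(2)[OF f *(2)]] dir_invc[OF GA_hom[OF f] *(2)] Im_F[OF f]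
      meet_F[OF st(2) *(2) CL_GA(3)[OF f]] st *(1) by simp
next
  fix f assume "f \<in> ar C"
  then obtain X Y where f: "f \<in> hom C X Y" by (auto simp: hom_def)
  obtain I e m where e: "e \<in> hom C X I" "m \<in> hom C I Y" "e \<in> E" "m \<in> M" "f = m \<cdot>\<^bsub>C\<^esub> e"
    by (rule C.factorize[OF f]) (rule that)
  have "Ker C F f = Ker C F e" "Im C F f = Im C F m"
    using Ker_F[OF f] Ker_F[OF e(1)] Im_F[OF f] Im_F[OF e(2)] kerc_factor[OF e(1,2,4)] imc_factor[OF e(1,3,2)] e(5) by simp_all
  then show "\<exists>e m. is_quotient C F (src C f) (Ker C F f) e \<and> is_embedding C F (tgt C f) (Im C F f) m \<and> src C m = tgt C e \<and> f = m \<cdot>\<^bsub>C\<^esub> e"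
    using quotient_F[OF e(3,1)] embedding_F[OF e(4,2)] e(5) C.homD[OF f] C.homD[OF e(1)] C.homD[OF e(2)] by metis
next
  fix X K L assume X: "X \<in> ob C" and "normal C F X K" "normal C F X L"
  then obtain Z f Z' g where f: "f \<in> hom C X Z" "K = enc (GO X) (kerc (GA f))" and g: "g \<in> hom C X Z'" "L = enc (GO X) (kerc (GA g))"
    unfolding normal_F[OF X] by blast
  obtain I e m where e: "e \<in> hom C X I" "m \<in> hom C I Z" "e \<in> E" "m \<in> M" "f = m \<cdot>\<^bsub>C\<^esub> e"
    by (rule C.factorize[OF f(1)]) (rule that)
  obtain I' e' m' where e': "e' \<in> hom C X I'" "m' \<in> hom C I' Z'" "e' \<in> E" "m' \<in> M" "g = m' \<cdot>\<^bsub>C\<^esub> e'"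
    by (rule C.factorize[OF g(1)]) (rule that)
  obtain P p q where po: "is_pushout C e e' p q" "p \<in> hom C I P"
    by (rule C.pushout_ex[OF e(3,1) e'(3,1)]) (rule that)
  \<comment> \<open>\<open>G\<close> preserves this pushout, and in \<open>T\<close> the kernel of
    the composite into a pushout of epimorphisms is the join of the kernels.\<close>
  have "kerc (GA (p \<cdot>\<^bsub>C\<^esub> e)) = joinc (GO X) (kerc (GA e)) (kerc (GA e'))"
    using kerc_pushout[OF GA_pushout[OF po(1) e(3) e'(3)] GA_epi[OF e(3)] GA_hom[OF e(1)] GA_epi[OF e'(3)] GA_hom[OF e'(1)] GA_hom[OF po(2)]]
      GA_cmp[OF e(1) po(2)] by simp
  then have "K \<squnion>\<^bsub>fib F X\<^esub> L = enc (GO X) (kerc (GA (p \<cdot>\<^bsub>C\<^esub> e)))"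
    using join_F[OF X CL_GA(4)[OF e(1)] CL_GA(4)[OF e'(1)]] f(2) g(2) kerc_factor[OF e(1,2,4)] kerc_factor[OF e'(1,2,4)] e(5) e'(5) by simp
  then show "normal C F X (K \<squnion>\<^bsub>fib F X\<^esub> L)" unfolding normal_F[OF X] using C.cmp_hom[OF e(1) po(2)] by blast
next
  fix X K L assume X: "X \<in> ob C" and "conormal C F X K" "conormal C F X L"
  then obtain Z f Z' g where f: "f \<in> hom C Z X" "K = enc (GO X) (imc (GA f))" and g: "g \<in> hom C Z' X" "L = enc (GO X) (imc (GA g))"
    unfolding conormal_F[OF X] by blast
  obtain I e m where e: "e \<in> hom C Z I" "m \<in> hom C I X" "e \<in> E" "m \<in> M" "f = m \<cdot>\<^bsub>C\<^esub> e"
    by (rule C.factorize[OF f(1)]) (rule that)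
  obtain I' e' m' where e': "e' \<in> hom C Z' I'" "m' \<in> hom C I' X" "e' \<in> E" "m' \<in> M" "g = m' \<cdot>\<^bsub>C\<^esub> e'"
    by (rule C.factorize[OF g(1)]) (rule that)
  obtain P p q where pb: "is_pullback C m m' p q" "p \<in> hom C P I"
    by (rule C.pullback_ex[OF e(4,2) e'(4,2)]) (rule that)
  \<comment> \<open>\<open>G\<close> preserves this pullback, and in \<open>T\<close> the image of
    the composite out of a pullback of monomorphisms is the meet of the images.\<close>
  have "imc (GA (m \<cdot>\<^bsub>C\<^esub> p)) = imc (GA m) \<inter> imc (GA m')"
    using imc_pullback[OF GA_pullback[OF pb(1) e(4) e'(4)] GA_mono[OF e(4)] GA_hom[OF e(2)] GA_mono[OF e'(4)] GA_hom[OF e'(2)] GA_hom[OF pb(2)]]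
      GA_cmp[OF pb(2) e(2)] by simp
  then have "K \<sqinter>\<^bsub>fib F X\<^esub> L = enc (GO X) (imc (GA (m \<cdot>\<^bsub>C\<^esub> p)))"
    using meet_F[OF X CL_GA(3)[OF e(2)] CL_GA(3)[OF e'(2)]] f(2) g(2) imc_factor[OF e(1,3,2)] imc_factor[OF e'(1,3,2)] e(5) e'(5) by simp
  then show "conormal C F X (K \<sqinter>\<^bsub>fib F X\<^esub> L)" unfolding conormal_F[OF X] using C.cmp_hom[OF pb(2) e(2)] by blast
qed

text \<open>A quotient \<open>e0\<close> and its left part \<open>e\<close> have the same kernel, so
  \<open>e\<close> factors through \<open>e0\<close>. This splits the right part of
  \<open>e0\<close>, which is mono and therefore invertible.\<close>

lemma quotients_F: "quotients C F = E"
proof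
  show "E \<subseteq> quotients C F"
    unfolding quotients_def using quotient_F C.E_ar C.ar_hom by blast
  show "quotients C F \<subseteq> E"
  proof
    fix e0 assume "e0 \<in> quotients C F"
    then obtain X K where e0: "is_quotient C F X K e0" by (auto simp: quotients_def)
    then have h0: "e0 \<in> hom C X (tgt C e0)" and K: "K = Ker C F e0"
      by (simp_all add: is_quotient_def hom_def)
    from e0 have u: "\<And>g. g \<in> ar C \<Longrightarrow> src C g = X \<Longrightarrow> K \<sqsubseteq>\<^bsub>fib F X\<^esub> Ker C F g \<Longrightarrow> \<exists>!h. h \<in> hom C (tgt C e0) (tgt C g) \<and> g = h \<cdot>\<^bsub>C\<^esub> e0"
      by (simp add: is_quotient_def)
    let ?Y = "tgt C e0"
    have X: "X \<in> ob C" and Y: "?Y \<in> ob C" using C.homD[OF h0] by auto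
    obtain I e m where e: "e \<in> hom C X I" "m \<in> hom C I ?Y" "e \<in> E" "m \<in> M" "e0 = m \<cdot>\<^bsub>C\<^esub> e"
      by (rule C.factorize[OF h0]) (rule that)
    have K': "K = Ker C F e" using K Ker_F[OF h0] Ker_F[OF e(1)] kerc_factor[OF e(1,2,4)] e(5) by simp
    have refl: "K \<sqsubseteq>\<^bsub>fib F X\<^esub> K" using K' Ker_F[OF e(1)] CL_GA(4)[OF e(1)] X by simp
    have "\<exists>!h. h \<in> hom C ?Y I \<and> e = h \<cdot>\<^bsub>C\<^esub> e0"
      using u[of e] C.homD[OF e(1)] refl K' by simp
    from ex1_implies_ex[OF this] obtain h where h: "h \<in> hom C ?Y I" "e = h \<cdot>\<^bsub>C\<^esub> e0"
      by (elim exE conjE) (rule that)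
    have 1: "(m \<cdot>\<^bsub>C\<^esub> h) \<cdot>\<^bsub>C\<^esub> e0 = e0" 
      by (simp only: C.assoc[OF h0 h(1) e(2), symmetric] h(2)[symmetric] e(5)[symmetric])
    have 2: "ide C ?Y \<cdot>\<^bsub>C\<^esub> e0 = e0" using C.ide_left[OF h0] .
    have "\<exists>!k. k \<in> hom C ?Y ?Y \<and> e0 = k \<cdot>\<^bsub>C\<^esub> e0"
      by (rule u) (use C.homD[OF h0] refl K in simp_all)
    then have mh: "m \<cdot>\<^bsub>C\<^esub> h = ide C ?Y"
      by (rule ex1_eq[rotated -1]) (use 1 2 C.cmp_hom[OF h(1) e(2)] C.ide_hom[OF Y] in simp_all)
    have "iso C m" by (rule C.iso_if_split_epi_mono[OF e(2) C.M_mono[OF e(4)] h(1) mh])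
    then show "e0 \<in> E" using C.E_cmp[OF e(3,1) C.iso_E e(2)] e(5) by simp
  qed
qed

text \<open>As for quotients, with the roles exchanged: the right part factors through
  \<open>m0\<close>, which splits the left part, an epimorphism.\<close>

lemma embeddings_F: "embeddings C F = M"
proof
  show "M \<subseteq> embeddings C F"
    unfolding embeddings_def using embedding_F C.M_ar C.ar_hom by blast
  show "embeddings C F \<subseteq> M"
  proof
    fix m0 assume "m0 \<in> embeddings C F"
    then obtain X K where m0: "is_embedding C F X K m0" by (auto simp: embeddings_def)
    then have h0: "m0 \<in> hom C (src C m0) X" and K: "K = Im C F m0"
      by (simp_all add: is_embedding_def hom_def)
    from m0 have u: "\<And>g. g \<in> ar C \<Longrightarrow> tgt C g = X \<Longrightarrow> Im C F g \<sqsubseteq>\<^bsub>fib F X\<^esub> K \<Longrightarrow> \<exists>!h. h \<in> hom C (src C g) (src C m0) \<and> g = m0 \<cdot>\<^bsub>C\<^esub> h"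
      by (simp add: is_embedding_def)
    let ?Y = "src C m0"
    have X: "X \<in> ob C" and Y: "?Y \<in> ob C" using C.homD[OF h0] by auto
    obtain I e m where e: "e \<in> hom C ?Y I" "m \<in> hom C I X" "e \<in> E" "m \<in> M" "m0 = m \<cdot>\<^bsub>C\<^esub> e"
      by (rule C.factorize[OF h0]) (rule that)
    have K': "K = Im C F m" using K Im_F[OF h0] Im_F[OF e(2)] imc_factor[OF e(1,3,2)] e(5) by simp
    have refl: "K \<sqsubseteq>\<^bsub>fib F X\<^esub> K" using K' Im_F[OF e(2)] CL_GA(3)[OF e(2)] X by simp
    have "\<exists>!h. h \<in> hom C I ?Y \<and> m = m0 \<cdot>\<^bsub>C\<^esub> h"
      using u[of m] C.homD[OF e(2)] refl K' by simp
    from ex1_implies_ex[OF this] obtain h where h: "h \<in> hom C I ?Y" "m = m0 \<cdot>\<^bsub>C\<^esub> h"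
      by (elim exE conjE) (rule that)
    have 1: "m0 \<cdot>\<^bsub>C\<^esub> (h \<cdot>\<^bsub>C\<^esub> e) = m0" 
      by (simp only: C.assoc[OF e(1) h(1) h0] h(2)[symmetric] e(5)[symmetric])
    have 2: "m0 \<cdot>\<^bsub>C\<^esub> ide C ?Y = m0" using C.ide_right[OF h0] .
    have "\<exists>!k. k \<in> hom C ?Y ?Y \<and> m0 = m0 \<cdot>\<^bsub>C\<^esub> k"
      by (rule u) (use C.homD[OF h0] refl K in simp_all)
    then have he: "h \<cdot>\<^bsub>C\<^esub> e = ide C ?Y"
      by (rule ex1_eq[rotated -1]) (use 1 2 C.cmp_hom[OF e(1) h(1)] C.ide_hom[OF Y] in simp_all)
    have "iso C e" by (rule C.iso_if_split_mono_epi[OF e(1) C.E_epi[OF e(3)] h(1) he])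
    then show "m0 \<in> M" using C.M_cmp[OF C.iso_M e(1) e(4,2)] e(5) by simp
  qed
qed

lemma has_form: "has_noetherian_form_inducing U C E M"
  unfolding has_noetherian_form_inducing_def
  using noetherian_F quotients_F embeddings_F by blast

end

section \<open>The transfer functor of a noetherian form\<close>

context transfer_category
begin

text \<open>The diagonal fill turns the right part of \<open>p\<close> into one leg of a cone over
  the pullback. The mediating arrow is a left inverse of the left part of \<open>p\<close>, which is
  epi and therefore invertible. Needed to know that the direct image along a leg of the pullback is
  injective.\<close>

lemma pullback_M:
  assumes pb: "is_pullback C m n p q" and m: "m \<in> hom C A Z" and n: "n \<in> M"
  shows "p \<in> M"
proof -
  obtain B P where *: "n \<in> hom C B Z" "p \<in> hom C P A" "q \<in> hom C P B" "m \<bullet> p = n \<bullet> q"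
    "\<And>W f g. f \<in> hom C W A \<Longrightarrow> g \<in> hom C W B \<Longrightarrow> m \<bullet> f = n \<bullet> g \<Longrightarrow> \<exists>!h. h \<in> hom C W P \<and> p \<bullet> h = f \<and> q \<bullet> h = g"
    by (rule pullbackD[OF pb m]) (rule that)
  obtain I e' m' where e: "e' \<in> hom C P I" "m' \<in> hom C I A" "e' \<in> E" "m' \<in> M" and pf: "p = m' \<bullet> e'"
    by (rule factorize[OF *(2)]) (rule that)
  have "n \<bullet> q = (m \<bullet> m') \<bullet> e'" using assoc[OF e(1,2) m] *(4) pf by simp
  then obtain d where d: "d \<in> hom C I B" "d \<bullet> e' = q" "n \<bullet> d = m \<bullet> m'"
    by (rule diagonal[OF e(3) n e(1) *(1,3) cmp_hom[OF e(2) m]])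
  obtain h where h: "h \<in> hom C I P" "p \<bullet> h = m'" "q \<bullet> h = d" using *(5)[OF e(2) d(1)] d(3) by metis
  have P: "P \<in> ob C" using homD[OF *(2)] by simp
  have "\<exists>!k. k \<in> hom C P P \<and> p \<bullet> k = p \<and> q \<bullet> k = q" by (rule *(5)[OF *(2,3,4)])
  then have "h \<bullet> e' = ide C P"
    by (rule ex1_eq[rotated -1])
      (use assoc[OF e(1) h(1) *(2)] assoc[OF e(1) h(1) *(3)] h(2,3) d(2) pf[symmetric] cmp_hom[OF e(1) h(1)]
        ide_hom[OF P] ide_right[OF *(2)] ide_right[OF *(3)] in simp_all)
  then have "iso C e'" by (rule iso_if_split_mono_epi[OF e(1) E_epi[OF e(3)] h(1)])
  then show ?thesis unfolding pf by (intro M_cmp[OF iso_M e(1) e(4,2)])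
qed

text \<open>Dually, the diagonal fill gives a cocone with the left part of \<open>p\<close>, and the
  mediating arrow splits the right part. Needed to know that the direct image along a leg of the
  pushout is surjective.\<close>

lemma pushout_E:
  assumes po: "is_pushout C d e p q" and d: "d \<in> hom C X A" and e: "e \<in> E"
  shows "p \<in> E"
proof -
  obtain B P where *: "e \<in> hom C X B" "p \<in> hom C A P" "q \<in> hom C B P" "p \<bullet> d = q \<bullet> e"
    "\<And>W f g. f \<in> hom C A W \<Longrightarrow> g \<in> hom C B W \<Longrightarrow> f \<bullet> d = g \<bullet> e \<Longrightarrow> \<exists>!h. h \<in> hom C P W \<and> h \<bullet> p = f \<and> h \<bullet> q = g"
    by (rule pushoutD[OF po d]) (rule that)
  obtain I e' m' where m: "e' \<in> hom C A I" "m' \<in> hom C I P" "e' \<in> E" "m' \<in> M" and pf: "p = m' \<bullet> e'"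
    by (rule factorize[OF *(2)]) (rule that)
  have "m' \<bullet> (e' \<bullet> d) = q \<bullet> e" using assoc[OF d m(1,2)] *(4) pf by simp
  then obtain t where t: "t \<in> hom C B I" "t \<bullet> e = e' \<bullet> d" "m' \<bullet> t = q"
    by (rule diagonal[OF e m(4) *(1) m(2) cmp_hom[OF d m(1)] *(3)])
  obtain h where h: "h \<in> hom C P I" "h \<bullet> p = e'" "h \<bullet> q = t" using *(5)[OF m(1) t(1)] t(2) by metis
  have P: "P \<in> ob C" using homD[OF *(2)] by simp
  have "\<exists>!k. k \<in> hom C P P \<and> k \<bullet> p = p \<and> k \<bullet> q = q" by (rule *(5)[OF *(2,3,4)])
  then have "m' \<bullet> h = ide C P"
    by (rule ex1_eq[rotated -1])
      (use assoc[OF *(2) h(1) m(2)] assoc[OF *(3) h(1) m(2)] h(2,3) t(3) pf[symmetric] cmp_hom[OF h(1) m(2)]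
        ide_hom[OF P] ide_left[OF *(2)] ide_left[OF *(3)] in simp_all)
  then have "iso C m'" by (rule iso_if_split_epi_mono[OF m(2) M_mono[OF m(4)] h(1)])
  then show ?thesis unfolding pf by (intro E_cmp[OF m(3,1) iso_E m(2)])
qed

end

section \<open>Clusters of a noetherian form\<close>

locale noetherian_category = transfer_category C U E M + small_universe U
  for C :: "('c, 'd) cat" and U :: "'u \<Rightarrow> 'u set" and E M +
  fixes F :: "('c, 'd, 'u) form"
  assumes noetherian: "noetherian_form U C F" and quotients: "quotients C F = E" and embeddings: "embeddings C F = M"
begin

lemma form: "is_form U C F"
  using noetherian by (simp add: noetherian_form_def)

lemma lattice: "X \<in> ob C \<Longrightarrow> Lattice.bounded_lattice (fib F X)"
  and clusters_small: "X \<in> ob C \<Longrightarrow> sm (clusters F X)"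
  and push_ide: "X \<in> ob C \<Longrightarrow> A \<in> clusters F X \<Longrightarrow> push F (ide C X) A = A"
  and pull_ide: "X \<in> ob C \<Longrightarrow> A \<in> clusters F X \<Longrightarrow> pull F (ide C X) A = A"
  using form unfolding is_form_def by blast+

lemma push_mem: "f \<in> hom C X Y \<Longrightarrow> A \<in> clusters F X \<Longrightarrow> push F f A \<in> clusters F Y"
  and pull_mem: "f \<in> hom C X Y \<Longrightarrow> B \<in> clusters F Y \<Longrightarrow> pull F f B \<in> clusters F X"
  and push_isotone: "f \<in> hom C X Y \<Longrightarrow> isotone (fib F X) (fib F Y) (push F f)"
  and pull_isotone: "f \<in> hom C X Y \<Longrightarrow> isotone (fib F Y) (fib F X) (pull F f)"
  and galois: "f \<in> hom C X Y \<Longrightarrow> A \<in> clusters F X \<Longrightarrow> B \<in> clusters F Y \<Longrightarrow>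
     push F f A \<sqsubseteq>\<^bsub>fib F Y\<^esub> B \<longleftrightarrow> A \<sqsubseteq>\<^bsub>fib F X\<^esub> pull F f B"
  using form unfolding is_form_def hom_def by (auto simp: Pi_iff)

lemma push_cmp: "f \<in> hom C X Y \<Longrightarrow> g \<in> hom C Y Z \<Longrightarrow> A \<in> clusters F X \<Longrightarrow> push F (g \<bullet> f) A = push F g (push F f A)"
  and pull_cmp: "f \<in> hom C X Y \<Longrightarrow> g \<in> hom C Y Z \<Longrightarrow> B \<in> clusters F Z \<Longrightarrow> pull F (g \<bullet> f) B = pull F f (pull F g B)"
  using form unfolding is_form_def hom_def by auto

lemma pull_push: "f \<in> hom C X Y \<Longrightarrow> A \<in> clusters F X \<Longrightarrow> pull F f (push F f A) = A \<squnion>\<^bsub>fib F X\<^esub> Ker C F f"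
  and push_pull: "f \<in> hom C X Y \<Longrightarrow> B \<in> clusters F Y \<Longrightarrow> push F f (pull F f B) = B \<sqinter>\<^bsub>fib F Y\<^esub> Im C F f"
  using noetherian unfolding noetherian_form_def hom_def by auto

abbreviation le_at where "le_at X a b \<equiv> a \<sqsubseteq>\<^bsub>fib F X\<^esub> b"

lemma le_trans: "X \<in> ob C \<Longrightarrow> le_at X a b \<Longrightarrow> le_at X b c \<Longrightarrow> a \<in> clusters F X \<Longrightarrow> b \<in> clusters F X \<Longrightarrow> c \<in> clusters F X \<Longrightarrow> le_at X a c"
  and le_antisym: "X \<in> ob C \<Longrightarrow> le_at X a b \<Longrightarrow> le_at X b a \<Longrightarrow> a \<in> clusters F X \<Longrightarrow> b \<in> clusters F X \<Longrightarrow> a = b"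
  and le_refl: "X \<in> ob C \<Longrightarrow> a \<in> clusters F X \<Longrightarrow> le_at X a a"
  and top_mem: "X \<in> ob C \<Longrightarrow> \<top>\<^bsub>fib F X\<^esub> \<in> clusters F X"
  and bot_mem: "X \<in> ob C \<Longrightarrow> \<bottom>\<^bsub>fib F X\<^esub> \<in> clusters F X"
  and le_top: "X \<in> ob C \<Longrightarrow> a \<in> clusters F X \<Longrightarrow> le_at X a \<top>\<^bsub>fib F X\<^esub>"
  and bot_le: "X \<in> ob C \<Longrightarrow> a \<in> clusters F X \<Longrightarrow> le_at X \<bottom>\<^bsub>fib F X\<^esub> a"
  and join_bot: "X \<in> ob C \<Longrightarrow> a \<in> clusters F X \<Longrightarrow> a \<squnion>\<^bsub>fib F X\<^esub> \<bottom>\<^bsub>fib F X\<^esub> = a"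
  and meet_absorb: "X \<in> ob C \<Longrightarrow> a \<in> clusters F X \<Longrightarrow> b \<in> clusters F X \<Longrightarrow> le_at X a b \<Longrightarrow> a \<sqinter>\<^bsub>fib F X\<^esub> b = a"
  and join_mem: "X \<in> ob C \<Longrightarrow> a \<in> clusters F X \<Longrightarrow> b \<in> clusters F X \<Longrightarrow> a \<squnion>\<^bsub>fib F X\<^esub> b \<in> clusters F X"
  and join_assoc: "X \<in> ob C \<Longrightarrow> a \<in> clusters F X \<Longrightarrow> b \<in> clusters F X \<Longrightarrow> c \<in> clusters F X \<Longrightarrow>
     (a \<squnion>\<^bsub>fib F X\<^esub> b) \<squnion>\<^bsub>fib F X\<^esub> c = a \<squnion>\<^bsub>fib F X\<^esub> (b \<squnion>\<^bsub>fib F X\<^esub> c)"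
  and join_least: "X \<in> ob C \<Longrightarrow> a \<in> clusters F X \<Longrightarrow> b \<in> clusters F X \<Longrightarrow> c \<in> clusters F X \<Longrightarrow> le_at X a c \<Longrightarrow> le_at X b c \<Longrightarrow>
     le_at X (a \<squnion>\<^bsub>fib F X\<^esub> b) c"
  and join_left: "X \<in> ob C \<Longrightarrow> a \<in> clusters F X \<Longrightarrow> b \<in> clusters F X \<Longrightarrow> le_at X a (a \<squnion>\<^bsub>fib F X\<^esub> b)"
  and join_right: "X \<in> ob C \<Longrightarrow> a \<in> clusters F X \<Longrightarrow> b \<in> clusters F X \<Longrightarrow> le_at X b (a \<squnion>\<^bsub>fib F X\<^esub> b)"
  and meet_greatest: "X \<in> ob C \<Longrightarrow> a \<in> clusters F X \<Longrightarrow> b \<in> clusters F X \<Longrightarrow> c \<in> clusters F X \<Longrightarrow> le_at X c a \<Longrightarrow> le_at X c b \<Longrightarrow>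
     le_at X c (a \<sqinter>\<^bsub>fib F X\<^esub> b)"
  and meet_left: "X \<in> ob C \<Longrightarrow> a \<in> clusters F X \<Longrightarrow> b \<in> clusters F X \<Longrightarrow> le_at X (a \<sqinter>\<^bsub>fib F X\<^esub> b) a"
  and meet_right: "X \<in> ob C \<Longrightarrow> a \<in> clusters F X \<Longrightarrow> b \<in> clusters F X \<Longrightarrow> le_at X (a \<sqinter>\<^bsub>fib F X\<^esub> b) b"
  and meet_mem: "X \<in> ob C \<Longrightarrow> a \<in> clusters F X \<Longrightarrow> b \<in> clusters F X \<Longrightarrow> a \<sqinter>\<^bsub>fib F X\<^esub> b \<in> clusters F X"
proof -
  assume X: "X \<in> ob C"
  interpret L: bounded_lattice "fib F X" by (rule lattice[OF X])
  show "le_at X a b \<Longrightarrow> le_at X b c \<Longrightarrow> a \<in> clusters F X \<Longrightarrow> b \<in> clusters F X \<Longrightarrow> c \<in> clusters F X \<Longrightarrow> le_at X a c"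
    by (rule L.le_trans)
  show "le_at X a b \<Longrightarrow> le_at X b a \<Longrightarrow> a \<in> clusters F X \<Longrightarrow> b \<in> clusters F X \<Longrightarrow> a = b" by (rule L.le_antisym)
  show "a \<in> clusters F X \<Longrightarrow> le_at X a a" "\<top>\<^bsub>fib F X\<^esub> \<in> clusters F X" "\<bottom>\<^bsub>fib F X\<^esub> \<in> clusters F X"
    "a \<in> clusters F X \<Longrightarrow> le_at X a \<top>\<^bsub>fib F X\<^esub>" "a \<in> clusters F X \<Longrightarrow> le_at X \<bottom>\<^bsub>fib F X\<^esub> a" by simp_all
  show "a \<squnion>\<^bsub>fib F X\<^esub> \<bottom>\<^bsub>fib F X\<^esub> = a" if "a \<in> clusters F X"
    using that by (intro L.le_antisym L.join_le L.join_left) simp_all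
  show "a \<sqinter>\<^bsub>fib F X\<^esub> b = a" if "a \<in> clusters F X" "b \<in> clusters F X" "le_at X a b"
    using that by (intro L.le_antisym L.meet_le L.meet_left) simp_all
  show "a \<squnion>\<^bsub>fib F X\<^esub> b \<in> clusters F X" "a \<sqinter>\<^bsub>fib F X\<^esub> b \<in> clusters F X" if "a \<in> clusters F X" "b \<in> clusters F X"
    using that by simp_all
  show "(a \<squnion>\<^bsub>fib F X\<^esub> b) \<squnion>\<^bsub>fib F X\<^esub> c = a \<squnion>\<^bsub>fib F X\<^esub> (b \<squnion>\<^bsub>fib F X\<^esub> c)"
    if "a \<in> clusters F X" "b \<in> clusters F X" "c \<in> clusters F X"
    using L.weak_join_assoc[OF that] by (simp add: L.eq_is_equal)
  show "a \<in> clusters F X \<Longrightarrow> b \<in> clusters F X \<Longrightarrow> c \<in> clusters F X \<Longrightarrow> le_at X a c \<Longrightarrow> le_at X b c \<Longrightarrow> le_at X (a \<squnion>\<^bsub>fib F X\<^esub> b) c"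
    by (rule L.join_le)
  show "a \<in> clusters F X \<Longrightarrow> b \<in> clusters F X \<Longrightarrow> c \<in> clusters F X \<Longrightarrow> le_at X c a \<Longrightarrow> le_at X c b \<Longrightarrow> le_at X c (a \<sqinter>\<^bsub>fib F X\<^esub> b)"
    by (rule L.meet_le)
  show "a \<in> clusters F X \<Longrightarrow> b \<in> clusters F X \<Longrightarrow> le_at X a (a \<squnion>\<^bsub>fib F X\<^esub> b)" by (rule L.join_left)
  show "a \<in> clusters F X \<Longrightarrow> b \<in> clusters F X \<Longrightarrow> le_at X b (a \<squnion>\<^bsub>fib F X\<^esub> b)" by (rule L.join_right)
  show "a \<in> clusters F X \<Longrightarrow> b \<in> clusters F X \<Longrightarrow> le_at X (a \<sqinter>\<^bsub>fib F X\<^esub> b) a" by (rule L.meet_left)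
  show "a \<in> clusters F X \<Longrightarrow> b \<in> clusters F X \<Longrightarrow> le_at X (a \<sqinter>\<^bsub>fib F X\<^esub> b) b" by (rule L.meet_right)
qed

lemma push_mono: "f \<in> hom C X Y \<Longrightarrow> a \<in> clusters F X \<Longrightarrow> b \<in> clusters F X \<Longrightarrow> le_at X a b \<Longrightarrow> le_at Y (push F f a) (push F f b)"
  using use_iso2[OF push_isotone] by blast

lemma pull_mono: "f \<in> hom C X Y \<Longrightarrow> a \<in> clusters F Y \<Longrightarrow> b \<in> clusters F Y \<Longrightarrow> le_at Y a b \<Longrightarrow> le_at X (pull F f a) (pull F f b)"
  using use_iso2[OF pull_isotone] by blast

lemma Im_push: "f \<in> hom C X Y \<Longrightarrow> Im C F f = push F f \<top>\<^bsub>fib F X\<^esub>"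
  and Ker_pull: "f \<in> hom C X Y \<Longrightarrow> Ker C F f = pull F f \<bottom>\<^bsub>fib F Y\<^esub>"
  using homD[of f X Y] by (auto simp: Im_def Ker_def)

lemma Im_mem: "f \<in> hom C X Y \<Longrightarrow> Im C F f \<in> clusters F Y"
  using Im_push push_mem top_mem homD by metis

lemma Ker_mem: "f \<in> hom C X Y \<Longrightarrow> Ker C F f \<in> clusters F X"
  using Ker_pull pull_mem bot_mem homD by metis

lemma push_le_Im: "f \<in> hom C X Y \<Longrightarrow> a \<in> clusters F X \<Longrightarrow> le_at Y (push F f a) (Im C F f)"
  using push_mono[of f X Y a "\<top>\<^bsub>fib F X\<^esub>"] top_mem le_top homD[of f X Y] Im_push[of f X Y] by simp

lemma Ker_le_pull: "f \<in> hom C X Y \<Longrightarrow> b \<in> clusters F Y \<Longrightarrow> le_at X (Ker C F f) (pull F f b)"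
  using pull_mono[of f X Y "\<bottom>\<^bsub>fib F Y\<^esub>" b] bot_mem bot_le homD[of f X Y] Ker_pull[of f X Y] by simp

lemma Im_cmp_le: "f \<in> hom C X Y \<Longrightarrow> g \<in> hom C Y Z \<Longrightarrow> le_at Z (Im C F (g \<bullet> f)) (Im C F g)"
  using push_le_Im[of g Y Z "Im C F f"] Im_mem[of f X Y] push_cmp[of f X Y g Z "\<top>\<^bsub>fib F X\<^esub>"] top_mem homD[of f X Y]
    Im_push[of f X Y] Im_push[OF cmp_hom[of f X Y g Z]] by simp

lemma Ker_cmp_le: "f \<in> hom C X Y \<Longrightarrow> g \<in> hom C Y Z \<Longrightarrow> le_at X (Ker C F f) (Ker C F (g \<bullet> f))"
  using Ker_le_pull[of f X Y "Ker C F g"] Ker_mem[of g Y Z] pull_cmp[of f X Y g Z "\<bottom>\<^bsub>fib F Z\<^esub>"] bot_mem homD[of g Y Z]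
    Ker_pull[of g Y Z] Ker_pull[OF cmp_hom[of f X Y g Z]] by simp

lemma quotient_E:
  assumes e: "e \<in> E" "e \<in> hom C X Y" and g: "g \<in> hom C X Z" and le: "le_at X (Ker C F e) (Ker C F g)"
  obtains h where "h \<in> hom C Y Z" "g = h \<bullet> e"
proof -
  obtain X' K where q: "is_quotient C F X' K e" using e(1) quotients by (auto simp: quotients_def)
  have "X' = X" "K = Ker C F e" "tgt C e = Y" using q homD[OF e(2)] by (auto simp: is_quotient_def)
  then have "\<forall>g\<in>ar C. src C g = X \<longrightarrow> le_at X (Ker C F e) (Ker C F g) \<longrightarrow> (\<exists>!h. h \<in> hom C Y (tgt C g) \<and> g = h \<bullet> e)"
    using q by (simp add: is_quotient_def)
  from this[rule_format, of g] have "\<exists>!h. h \<in> hom C Y Z \<and> g = h \<bullet> e"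
    using le homD[OF g] by simp
  from ex1_implies_ex[OF this] show ?thesis by (elim exE conjE) (rule that)
qed

lemma embedding_M:
  assumes m: "m \<in> M" "m \<in> hom C Y X" and g: "g \<in> hom C Z X" and le: "le_at X (Im C F g) (Im C F m)"
  obtains h where "h \<in> hom C Z Y" "g = m \<bullet> h"
proof -
  obtain X' K where q: "is_embedding C F X' K m" using m(1) embeddings by (auto simp: embeddings_def)
  have "X' = X" "K = Im C F m" "src C m = Y" using q homD[OF m(2)] by (auto simp: is_embedding_def)
  then have "\<forall>g\<in>ar C. tgt C g = X \<longrightarrow> le_at X (Im C F g) (Im C F m) \<longrightarrow> (\<exists>!h. h \<in> hom C (src C g) Y \<and> g = m \<bullet> h)"
    using q by (simp add: is_embedding_def)
  from this[rule_format, of g] have "\<exists>!h. h \<in> hom C Z Y \<and> g = m \<bullet> h"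
    using le homD[OF g] by simp
  from ex1_implies_ex[OF this] show ?thesis by (elim exE conjE) (rule that)
qed

lemma noetherian_factorize:
  assumes f: "f \<in> hom C X Y"
  obtains I e m where "e \<in> hom C X I" "m \<in> hom C I Y" "e \<in> E" "m \<in> M" "f = m \<bullet> e" "Ker C F e = Ker C F f" "Im C F m = Im C F f"
proof -
  have "\<exists>e m. is_quotient C F (src C f) (Ker C F f) e \<and> is_embedding C F (tgt C f) (Im C F f) m \<and> src C m = tgt C e \<and> f = m \<bullet> e"
    using noetherian homD[OF f] unfolding noetherian_form_def by blast
  then obtain e m where *: "is_quotient C F X (Ker C F f) e" "is_embedding C F Y (Im C F f) m" "src C m = tgt C e" "f = m \<bullet> e"
    using homD[OF f] by auto
  have "e \<in> E" "m \<in> M" using *(1,2) quotients embeddings by (auto simp: quotients_def embeddings_def)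
  moreover have "e \<in> hom C X (tgt C e)" "m \<in> hom C (tgt C e) Y" "Ker C F e = Ker C F f" "Im C F m = Im C F f"
    using * by (auto simp: is_quotient_def is_embedding_def hom_def)
  ultimately show ?thesis using that *(4) by blast
qed

lemma Im_top_if_split:
  assumes m: "m \<in> hom C X Y" and h: "h \<in> hom C Y X" and mh: "m \<bullet> h = ide C Y"
  shows "Im C F m = \<top>\<^bsub>fib F Y\<^esub>"
proof (rule le_antisym[of Y])
  have Y: "Y \<in> ob C" using homD[OF m] by simp
  show "Y \<in> ob C" "Im C F m \<in> clusters F Y" "\<top>\<^bsub>fib F Y\<^esub> \<in> clusters F Y" "le_at Y (Im C F m) \<top>\<^bsub>fib F Y\<^esub>"
    using Y Im_mem[OF m] top_mem le_top by auto
  have "Im C F (m \<bullet> h) = \<top>\<^bsub>fib F Y\<^esub>" using Im_push[OF ide_hom[OF Y]] push_ide[OF Y top_mem[OF Y]] mh by simp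
  then show "le_at Y \<top>\<^bsub>fib F Y\<^esub> (Im C F m)" using Im_cmp_le[OF h m] by simp
qed

lemma Ker_bot_if_split:
  assumes e: "e \<in> hom C X Y" and h: "h \<in> hom C Y X" and he: "h \<bullet> e = ide C X"
  shows "Ker C F e = \<bottom>\<^bsub>fib F X\<^esub>"
proof (rule le_antisym[of X])
  have X: "X \<in> ob C" using homD[OF e] by simp
  show "X \<in> ob C" "Ker C F e \<in> clusters F X" "\<bottom>\<^bsub>fib F X\<^esub> \<in> clusters F X" "le_at X \<bottom>\<^bsub>fib F X\<^esub> (Ker C F e)"
    using X Ker_mem[OF e] bot_mem bot_le by auto
  have "Ker C F (h \<bullet> e) = \<bottom>\<^bsub>fib F X\<^esub>" using Ker_pull[OF ide_hom[OF X]] pull_ide[OF X bot_mem[OF X]] he by simp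
  then show "le_at X (Ker C F e) \<bottom>\<^bsub>fib F X\<^esub>" using Ker_cmp_le[OF e h] by simp
qed

text \<open>Both \<open>e\<close> and the quotient part \<open>e'\<close> in its factorization have
  the same kernel, so \<open>e'\<close> factors through \<open>e\<close>. Then the embedding part is
  split and has full image, which is the image of \<open>e\<close>.\<close>

lemma Im_E:
  assumes e: "e \<in> E" "e \<in> hom C X Y" shows "Im C F e = \<top>\<^bsub>fib F Y\<^esub>"
proof -
  obtain I e' m' where *: "e' \<in> hom C X I" "m' \<in> hom C I Y" "e' \<in> E" "m' \<in> M" and ef: "e = m' \<bullet> e'"
    and k: "Ker C F e' = Ker C F e" "Im C F m' = Im C F e"
    by (rule noetherian_factorize[OF e(2)]) (rule that)
  have X: "X \<in> ob C" and Y: "Y \<in> ob C" using homD[OF e(2)] by auto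
  obtain h where h: "h \<in> hom C Y I" "e' = h \<bullet> e"
    by (rule quotient_E[OF e *(1)]) (use k(1) le_refl[OF X Ker_mem[OF e(2)]] in simp, rule that)
  have "(m' \<bullet> h) \<bullet> e = ide C Y \<bullet> e"
    by (simp only: assoc[OF e(2) h(1) *(2), symmetric] h(2)[symmetric] ef[symmetric] ide_left[OF e(2)])
  then have "m' \<bullet> h = ide C Y" using epiD[OF E_epi[OF e(1)] e(2) cmp_hom[OF h(1) *(2)] ide_hom[OF Y]] by simp
  then show ?thesis using Im_top_if_split[OF *(2) h(1)] k(2) by simp
qed

text \<open>The embedding part of \<open>m\<close> has the same image and factors through
  \<open>m\<close>; this splits the quotient part, whose kernel is that of \<open>m\<close>.\<close>

lemma Ker_M:
  assumes m: "m \<in> M" "m \<in> hom C Y X" shows "Ker C F m = \<bottom>\<^bsub>fib F Y\<^esub>"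
proof -
  obtain I e' m' where *: "e' \<in> hom C Y I" "m' \<in> hom C I X" "e' \<in> E" "m' \<in> M" and mf: "m = m' \<bullet> e'"
    and k: "Ker C F e' = Ker C F m" "Im C F m' = Im C F m"
    by (rule noetherian_factorize[OF m(2)]) (rule that)
  have X: "X \<in> ob C" and Y: "Y \<in> ob C" using homD[OF m(2)] by auto
  obtain h where h: "h \<in> hom C I Y" "m' = m \<bullet> h"
    by (rule embedding_M[OF m *(2)]) (use k(2) le_refl[OF X Im_mem[OF m(2)]] in simp, rule that)
  have "m \<bullet> (h \<bullet> e') = m \<bullet> ide C Y"
    by (simp only: assoc[OF *(1) h(1) m(2)] h(2)[symmetric] mf[symmetric] ide_right[OF m(2)])
  then have "h \<bullet> e' = ide C Y" using monoD[OF M_mono[OF m(1)] m(2) cmp_hom[OF *(1) h(1)] ide_hom[OF Y]] by simp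
  then show ?thesis using Ker_bot_if_split[OF *(1) h(1)] k(1) by simp
qed

lemma push_pull_E: "e \<in> E \<Longrightarrow> e \<in> hom C X Y \<Longrightarrow> b \<in> clusters F Y \<Longrightarrow> push F e (pull F e b) = b"
  using push_pull[of e X Y b] Im_E[of e X Y] meet_absorb[of Y b] top_mem le_top homD[of e X Y] by simp

lemma pull_push_M: "m \<in> M \<Longrightarrow> m \<in> hom C X Y \<Longrightarrow> a \<in> clusters F X \<Longrightarrow> pull F m (push F m a) = a"
  using pull_push[of m X Y a] Ker_M[of m X Y] join_bot[of X a] homD[of m X Y] by simp

text \<open>Bijectivity forces the kernel to be bottom and the image to be top. The identities then
  factor through the quotient part and the embedding part, so both are invertible.\<close>

lemma iso_if_push_bij:
  assumes f: "f \<in> hom C X Y" and b: "bij_betw (push F f) (clusters F X) (clusters F Y)"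
  shows "iso C f"
proof -
  have X: "X \<in> ob C" and Y: "Y \<in> ob C" using homD[OF f] by auto
  note bX = bot_mem[OF X] and bY = bot_mem[OF Y] and tX = top_mem[OF X] and tY = top_mem[OF Y]
  \<comment> \<open>A left adjoint preserves the bottom cluster. The kernel is sent there as well,
    so injectivity identifies it with bottom.\<close>
  have pb: "push F f \<bottom>\<^bsub>fib F X\<^esub> = \<bottom>\<^bsub>fib F Y\<^esub>"
    using le_antisym[OF Y _ bot_le[OF Y push_mem[OF f bX]] push_mem[OF f bX] bY] galois[OF f bX bY] bot_le[OF X pull_mem[OF f bY]] by simp
  have "push F f (Ker C F f) = \<bottom>\<^bsub>fib F Y\<^esub>"
    using le_antisym[OF Y _ bot_le[OF Y push_mem[OF f Ker_mem[OF f]]] push_mem[OF f Ker_mem[OF f]] bY]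
      galois[OF f Ker_mem[OF f] bY] le_refl[OF X Ker_mem[OF f]] Ker_pull[OF f] by simp
  then have k: "Ker C F f = \<bottom>\<^bsub>fib F X\<^esub>"
    using inj_onD[OF bij_betw_imp_inj_on[OF b], of "Ker C F f" "\<bottom>\<^bsub>fib F X\<^esub>"] pb Ker_mem[OF f] bX by simp
  have "\<top>\<^bsub>fib F Y\<^esub> \<in> push F f ` clusters F X" using bij_betw_imp_surj_on[OF b] tY by simp
  then obtain a where a: "a \<in> clusters F X" "\<top>\<^bsub>fib F Y\<^esub> = push F f a" by (elim imageE)
  have i: "Im C F f = \<top>\<^bsub>fib F Y\<^esub>"
    using le_antisym[OF Y le_top[OF Y Im_mem[OF f]] _ Im_mem[OF f] tY] push_le_Im[OF f a(1)] a(2) by simp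
  obtain I e m where *: "e \<in> hom C X I" "m \<in> hom C I Y" "e \<in> E" "m \<in> M" and fe: "f = m \<bullet> e"
    and km: "Ker C F e = Ker C F f" "Im C F m = Im C F f"
    by (rule noetherian_factorize[OF f]) (rule that)
  obtain h where h: "h \<in> hom C I X" "ide C X = h \<bullet> e"
    by (rule quotient_E[OF *(3,1) ide_hom[OF X]]) (use km k bot_le[OF X Ker_mem[OF ide_hom[OF X]]] in simp, rule that)
  have e: "iso C e" by (rule iso_if_split_mono_epi[OF *(1) E_epi[OF *(3)] h(1) h(2)[symmetric]])
  obtain h' where h': "h' \<in> hom C Y I" "ide C Y = m \<bullet> h'"
    by (rule embedding_M[OF *(4,2) ide_hom[OF Y]]) (use km i le_top[OF Y Im_mem[OF ide_hom[OF Y]]] in simp, rule that)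
  have m: "iso C m" by (rule iso_if_split_epi_mono[OF *(2) M_mono[OF *(4)] h'(1) h'(2)[symmetric]])
  obtain e' where e': "e' \<in> hom C I X" "e' \<bullet> e = ide C X" "e \<bullet> e' = ide C I" by (rule isoE[OF e *(1)])
  obtain m' where m': "m' \<in> hom C Y I" "m' \<bullet> m = ide C I" "m \<bullet> m' = ide C Y" by (rule isoE[OF m *(2)])
  show ?thesis
  proof (rule isoI[OF f cmp_hom[OF m'(1) e'(1)]])
    show "(e' \<bullet> m') \<bullet> f = ide C X"
      unfolding fe using assoc[OF cmp_hom[OF *(1,2)] m'(1) e'(1)] assoc[OF *(1,2) m'(1)] m'(2) ide_left[OF *(1)] e'(2) by simp
    show "f \<bullet> (e' \<bullet> m') = ide C Y"
      unfolding fe using assoc[OF cmp_hom[OF m'(1) e'(1)] *(1,2)] assoc[OF m'(1) e'(1) *(1)] e'(3) ide_left[OF m'(1)] m'(3) by simp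
  qed
qed

text \<open>The meet of the two images is conormal, hence the image of some arrow. That arrow
  factors through both embeddings, so through the pullback, which bounds the meet by the image of
  the pullback.\<close>

lemma Im_pullback:
  assumes pb: "is_pullback C m n p q" and m: "m \<in> M" "m \<in> hom C A Z" and n: "n \<in> M" "n \<in> hom C B Z" and p: "p \<in> hom C P A"
  shows "Im C F (m \<bullet> p) = Im C F m \<sqinter>\<^bsub>fib F Z\<^esub> Im C F n"
proof -
  have q: "q \<in> hom C P B" and pq: "m \<bullet> p = n \<bullet> q" using pb p n(2) unfolding is_pullback_def hom_def by auto
  have Z: "Z \<in> ob C" using homD[OF m(2)] by simp
  note mp = cmp_hom[OF p m(2)]
  note im = Im_mem[OF m(2)] and in' = Im_mem[OF n(2)]
  let ?I = "Im C F m \<sqinter>\<^bsub>fib F Z\<^esub> Im C F n"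
  note mm = meet_mem[OF Z im in']
  have "conormal C F Z (Im C F m)" "conormal C F Z (Im C F n)"
    unfolding conormal_def using homD[OF m(2)] homD[OF n(2)] by auto
  then have "conormal C F Z ?I" using noetherian Z unfolding noetherian_form_def by blast
  then obtain f W where f: "f \<in> hom C W Z" and If: "Im C F f = ?I" unfolding conormal_def hom_def by fastforce
  obtain u where u: "u \<in> hom C W A" "f = m \<bullet> u"
    by (rule embedding_M[OF m f]) (use If meet_left[OF Z im in'] in simp, rule that)
  obtain v where v: "v \<in> hom C W B" "f = n \<bullet> v"
    by (rule embedding_M[OF n f]) (use If meet_right[OF Z im in'] in simp, rule that)
  obtain B' P' where *: "n \<in> hom C B' Z" "p \<in> hom C P' A"
    "\<And>W f g. f \<in> hom C W A \<Longrightarrow> g \<in> hom C W B' \<Longrightarrow> m \<bullet> f = n \<bullet> g \<Longrightarrow> \<exists>!h. h \<in> hom C W P' \<and> p \<bullet> h = f \<and> q \<bullet> h = g"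
    by (rule pullbackD[OF pb m(2)]) (rule that)
  have eqs: "B' = B" "P' = P" using *(1,2) n(2) p by (auto simp: hom_def)
  have "m \<bullet> u = n \<bullet> v" using u(2) v(2) by simp
  from ex1_implies_ex[OF *(3)[unfolded eqs, OF u(1) v(1) this]]
  obtain h where h: "h \<in> hom C W P" "p \<bullet> h = u" by blast
  have "f = (m \<bullet> p) \<bullet> h" using assoc[OF h(1) p m(2)] h(2) u(2) by simp
  then have "le_at Z ?I (Im C F (m \<bullet> p))" using Im_cmp_le[OF h(1) mp] If by simp
  moreover have "le_at Z (Im C F (m \<bullet> p)) ?I"
    by (rule meet_greatest[OF Z im in' Im_mem[OF mp] Im_cmp_le[OF p m(2)]]) (use Im_cmp_le[OF q n(2)] pq in simp)
  ultimately show ?thesis using le_antisym[OF Z _ _ Im_mem[OF mp] mm] by simp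
qed

text \<open>The join of the two kernels is normal, hence the kernel of some arrow. That arrow
  factors through both quotients, so through the pushout, whose kernel is therefore below the
  join.\<close>

lemma Ker_pushout:
  assumes po: "is_pushout C d e p q" and d: "d \<in> E" "d \<in> hom C X A" and e: "e \<in> E" "e \<in> hom C X B" and p: "p \<in> hom C A P"
  shows "Ker C F (p \<bullet> d) = Ker C F d \<squnion>\<^bsub>fib F X\<^esub> Ker C F e"
proof -
  have q: "q \<in> hom C B P" and pq: "p \<bullet> d = q \<bullet> e" using po p e(2) unfolding is_pushout_def hom_def by auto
  have X: "X \<in> ob C" using homD[OF d(2)] by simp
  note pd = cmp_hom[OF d(2) p]
  note kd = Ker_mem[OF d(2)] and ke = Ker_mem[OF e(2)]
  let ?I = "Ker C F d \<squnion>\<^bsub>fib F X\<^esub> Ker C F e"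
  note jm = join_mem[OF X kd ke]
  have "normal C F X (Ker C F d)" "normal C F X (Ker C F e)"
    unfolding normal_def using homD[OF d(2)] homD[OF e(2)] by auto
  then have "normal C F X ?I" using noetherian X unfolding noetherian_form_def by blast
  then obtain f W where f: "f \<in> hom C X W" and Kf: "Ker C F f = ?I" unfolding normal_def hom_def by fastforce
  obtain u where u: "u \<in> hom C A W" "f = u \<bullet> d"
    by (rule quotient_E[OF d f]) (use Kf join_left[OF X kd ke] in simp, rule that)
  obtain v where v: "v \<in> hom C B W" "f = v \<bullet> e"
    by (rule quotient_E[OF e f]) (use Kf join_right[OF X kd ke] in simp, rule that)
  obtain B' P' where *: "e \<in> hom C X B'" "p \<in> hom C A P'"
    "\<And>W f g. f \<in> hom C A W \<Longrightarrow> g \<in> hom C B' W \<Longrightarrow> f \<bullet> d = g \<bullet> e \<Longrightarrow> \<exists>!h. h \<in> hom C P' W \<and> h \<bullet> p = f \<and> h \<bullet> q = g"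
    by (rule pushoutD[OF po d(2)]) (rule that)
  have eqs: "B' = B" "P' = P" using *(1,2) e(2) p by (auto simp: hom_def)
  have "u \<bullet> d = v \<bullet> e" using u(2) v(2) by simp
  from ex1_implies_ex[OF *(3)[unfolded eqs, OF u(1) v(1) this]]
  obtain h where h: "h \<in> hom C P W" "h \<bullet> p = u" by blast
  have "f = h \<bullet> (p \<bullet> d)" using assoc[OF d(2) p h(1)] h(2) u(2) by simp
  then have "le_at X (Ker C F (p \<bullet> d)) ?I" using Ker_cmp_le[OF pd h(1)] Kf by simp
  moreover have "le_at X ?I (Ker C F (p \<bullet> d))"
    by (rule join_least[OF X kd ke Ker_mem[OF pd] Ker_cmp_le[OF d(2) p]]) (use Ker_cmp_le[OF e(2) q] pq in simp)
  ultimately show ?thesis using le_antisym[OF X _ _ Ker_mem[OF pd] jm] by simp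
qed

section \<open>The functor of direct images\<close>

definition cluster_code :: "'c \<Rightarrow> 'u" where
  "cluster_code X = (SOME a. U a = clusters F X)"

lemma U_cluster_code: "X \<in> ob C \<Longrightarrow> U (cluster_code X) = clusters F X"
  unfolding cluster_code_def by (rule someI_ex) (rule small_code[OF clusters_small])

definition push_functor :: "('c, 'd, 'u, 'u fn) ftr" where
  "push_functor = \<lparr>on_ob = cluster_code,
     on_ar = (\<lambda>f. set_fn U (cluster_code (src C f)) (push F f) (cluster_code (tgt C f)))\<rparr>"

abbreviation H where "H \<equiv> push_functor"

lemma H_ob: "on_ob H = cluster_code"
  by (simp add: push_functor_def)

lemma H_hom: "f \<in> hom C X Y \<Longrightarrow> on_ar H f \<in> hom (set_cat U) (cluster_code X) (cluster_code Y)"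
  using homD[of f X Y] push_mem[of f X Y] by (auto simp: push_functor_def U_cluster_code intro!: set_fn_hom)

lemma H_app: "f \<in> hom C X Y \<Longrightarrow> a \<in> clusters F X \<Longrightarrow> app (on_ar H f) a = push F f a"
  using homD[of f X Y] by (simp add: push_functor_def U_cluster_code)

lemma H_functor: "is_functor C (set_cat U) H"
proof -
  interpret set: category_locale "set_cat U" by unfold_locales (rule category_set_cat)
  show ?thesis
    unfolding is_functor_def
  proof (intro conjI ballI impI)
    fix f assume "f \<in> ar C"
    then show "on_ar H f \<in> hom (set_cat U) (on_ob H (src C f)) (on_ob H (tgt C f))" using H_hom[OF ar_hom] by (simp add: H_ob)
  next
    fix X assume X: "X \<in> ob C"
    have "on_ar H (ide C X) = ide (set_cat U) (cluster_code X)"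
      by (rule set_eqI_app[OF H_hom[OF ide_hom[OF X]] set.ide_hom])
        (use X in \<open>simp_all add: H_app[OF ide_hom[OF X]] push_ide app_ide[where U = U] U_cluster_code\<close>)
    then show "on_ar H (ide C X) = ide (set_cat U) (on_ob H X)" by (simp add: H_ob)
  next
    fix f g assume "f \<in> ar C" "g \<in> ar C" "src C g = tgt C f"
    then obtain X Y Z where f: "f \<in> hom C X Y" and g: "g \<in> hom C Y Z" by (auto simp: hom_def)
    have X: "X \<in> ob C" using homD[OF f] by simp
    show "on_ar H (g \<bullet> f) = on_ar H g \<cdot>\<^bsub>set_cat U\<^esub> on_ar H f"
    proof (rule set_eqI_app[OF H_hom[OF cmp_hom[OF f g]] set.cmp_hom[OF H_hom[OF f] H_hom[OF g]]])
      fix a assume a: "a \<in> U (cluster_code X)"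
      then have a': "a \<in> clusters F X" using U_cluster_code[OF X] by simp
      show "app (on_ar H (g \<bullet> f)) a = app (on_ar H g \<cdot>\<^bsub>set_cat U\<^esub> on_ar H f) a"
        using app_cmp[where U = U, OF H_hom[OF f] a] H_app[OF cmp_hom[OF f g] a'] H_app[OF f a'] H_app[OF g push_mem[OF f a']]
          push_cmp[OF f g a'] by simp
    qed
  qed simp
qed

lemma H_surj:
  assumes e: "e \<in> E" "e \<in> hom C X Y" shows "on_ar H e \<in> surjections U"
proof -
  note h = H_hom[OF e(2)]
  have X: "X \<in> ob C" and Y: "Y \<in> ob C" using homD[OF e(2)] by auto
  have "app (on_ar H e) ` clusters F X = clusters F Y"
  proof
    show "app (on_ar H e) ` clusters F X \<subseteq> clusters F Y" using H_app[OF e(2)] push_mem[OF e(2)] by auto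
    show "clusters F Y \<subseteq> app (on_ar H e) ` clusters F X"
    proof
      fix b assume b: "b \<in> clusters F Y"
      have "app (on_ar H e) (pull F e b) = b" using H_app[OF e(2) pull_mem[OF e(2) b]] push_pull_E[OF e b] by simp
      then show "b \<in> app (on_ar H e) ` clusters F X" using pull_mem[OF e(2) b] by (metis imageI)
    qed
  qed
  then show ?thesis using h X Y by (simp add: surjections_def hom_def U_cluster_code)
qed

lemma H_inj:
  assumes m: "m \<in> M" "m \<in> hom C X Y" shows "on_ar H m \<in> injections U"
proof -
  note h = H_hom[OF m(2)]
  have X: "X \<in> ob C" using homD[OF m(2)] by auto
  have "inj_on (app (on_ar H m)) (clusters F X)"
    by (rule inj_on_inverseI[of _ "pull F m"]) (simp add: H_app[OF m(2)] pull_push_M[OF m])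
  then show ?thesis using h X by (simp add: injections_def hom_def U_cluster_code)
qed

lemma H_conservative:
  assumes f: "f \<in> hom C X Y" and i: "iso (set_cat U) (on_ar H f)"
  shows "iso C f"
proof -
  interpret set: sheaf_topos U point_site point_topology "set_cat U" "\<lambda>X c. U X" "\<lambda>X f x. x" "\<lambda>f c. app f"
    by (rule sheaf_topos_set)
  have "bij_betw (app (on_ar H f)) (clusters F X) (clusters F Y)"
    using set.iso_bijective[OF i H_hom[OF f], of undefined] homD[OF f] by (simp add: U_cluster_code)
  then have "bij_betw (push F f) (clusters F X) (clusters F Y)"
    using bij_betw_cong[of "clusters F X" "app (on_ar H f)" "push F f"] H_app[OF f] by blast
  then show ?thesis by (rule iso_if_push_bij[OF f])
qed

text \<open>A cluster hit from both sides lies below both images, hence below the image of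
  \<open>m \<bullet> p\<close>, so it is the direct image of its own inverse image along
  \<open>m \<bullet> p\<close>. Injectivity of the direct image along \<open>m\<close> brings this
  down to \<open>A\<close>.\<close>

lemma H_pullback:
  assumes pb: "is_pullback C m n p q" and m: "m \<in> M" and n: "n \<in> M"
  shows "is_pullback (set_cat U) (on_ar H m) (on_ar H n) (on_ar H p) (on_ar H q)"
proof -
  interpret set: sheaf_topos U point_site point_topology "set_cat U" "\<lambda>X c. U X" "\<lambda>X f x. x" "\<lambda>f c. app f"
    by (rule sheaf_topos_set)
  obtain A Z where mh: "m \<in> hom C A Z" using pb by (auto simp: is_pullback_def hom_def)
  obtain B P where h: "n \<in> hom C B Z" "p \<in> hom C P A" "q \<in> hom C P B" "m \<bullet> p = n \<bullet> q"
    by (rule pullbackD[OF pb mh]) (rule that)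
  note mp = cmp_hom[OF h(2) mh]
  have p: "p \<in> M" by (rule pullback_M[OF pb mh n])
  have ob: "A \<in> ob C" "B \<in> ob C" "P \<in> ob C" "Z \<in> ob C" using homD[OF h(2)] homD[OF h(1)] by auto
  note mono = H_inj[unfolded mono_set_cat[symmetric]]
  show ?thesis
  proof (rule set.pullbackI_el[OF mono[OF m mh] H_hom[OF mh] mono[OF n h(1)] H_hom[OF h(1)] H_hom[OF h(2)] mono[OF p h(2)] H_hom[OF h(3)]])
    show "on_ar H m \<cdot>\<^bsub>set_cat U\<^esub> on_ar H p = on_ar H n \<cdot>\<^bsub>set_cat U\<^esub> on_ar H q"
      using functor_cmp[OF H_functor h(2) mh] functor_cmp[OF H_functor h(3,1)] h(4) by simp
    fix c a b assume "a \<in> U (cluster_code A)" "b \<in> U (cluster_code B)" and eq: "app (on_ar H m) a = app (on_ar H n) b"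
    then have a: "a \<in> clusters F A" and b: "b \<in> clusters F B" using ob by (auto simp: U_cluster_code)
    let ?c = "push F m a"
    have c: "?c \<in> clusters F Z" by (rule push_mem[OF mh a])
    have cn: "?c = push F n b" using eq H_app[OF mh a] H_app[OF h(1) b] by simp
    have "le_at Z ?c (Im C F m \<sqinter>\<^bsub>fib F Z\<^esub> Im C F n)"
      by (rule meet_greatest[OF ob(4) Im_mem[OF mh] Im_mem[OF h(1)] c push_le_Im[OF mh a]]) (use push_le_Im[OF h(1) b] cn in simp)
    then have "le_at Z ?c (Im C F (m \<bullet> p))" using Im_pullback[OF pb m mh n h(1,2)] by simp
    then have "push F (m \<bullet> p) (pull F (m \<bullet> p) ?c) = ?c"
      using push_pull[OF mp c] meet_absorb[OF ob(4) c Im_mem[OF mp]] by simp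
    then have "push F m (push F p (pull F (m \<bullet> p) ?c)) = push F m a"
      using push_cmp[OF h(2) mh pull_mem[OF mp c]] by simp
    then have "push F p (pull F (m \<bullet> p) ?c) = a"
      using pull_push_M[OF m mh a] pull_push_M[OF m mh push_mem[OF h(2) pull_mem[OF mp c]]] by simp
    then show "\<exists>z\<in>U (cluster_code P). app (on_ar H p) z = a"
      using H_app[OF h(2) pull_mem[OF mp c]] pull_mem[OF mp c] ob by (intro bexI[of _ "pull F (m \<bullet> p) ?c"]) (simp_all add: U_cluster_code)
  qed
qed

text \<open>Compatible maps on the clusters of \<open>A\<close> and \<open>B\<close> amount to one
  map \<open>\<phi>\<close> on the clusters of \<open>X\<close> that does not change when the kernel
  of \<open>d\<close> or of \<open>e\<close> is joined on. It is then invariant under joining the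
  kernel of \<open>p \<bullet> d\<close>, their join, and so descends to the clusters of
  \<open>P\<close>.\<close>

lemma H_pushout:
  assumes po: "is_pushout C d e p q" and d: "d \<in> E" and e: "e \<in> E"
  shows "is_pushout (set_cat U) (on_ar H d) (on_ar H e) (on_ar H p) (on_ar H q)"
proof -
  interpret set: category_locale "set_cat U" by unfold_locales (rule category_set_cat)
  obtain X A where dh: "d \<in> hom C X A" using po by (auto simp: is_pushout_def hom_def)
  obtain B P where h: "e \<in> hom C X B" "p \<in> hom C A P" "q \<in> hom C B P" "p \<bullet> d = q \<bullet> e"
    by (rule pushoutD[OF po dh]) (rule that)
  note pd = cmp_hom[OF dh h(2)]
  have p: "p \<in> E" by (rule pushout_E[OF po dh e])
  have ob: "X \<in> ob C" "A \<in> ob C" "B \<in> ob C" "P \<in> ob C" using homD[OF dh] homD[OF h(3)] by auto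
  show ?thesis
  proof (rule set.pushoutI[OF H_hom[OF dh] H_hom[OF h(1)] H_hom[OF h(2)] H_hom[OF h(3)]])
    show "on_ar H p \<cdot>\<^bsub>set_cat U\<^esub> on_ar H d = on_ar H q \<cdot>\<^bsub>set_cat U\<^esub> on_ar H e"
      using functor_cmp[OF H_functor dh h(2)] functor_cmp[OF H_functor h(1,3)] h(4) by simp
    fix W f g assume f: "f \<in> hom (set_cat U) (cluster_code A) W" and g: "g \<in> hom (set_cat U) (cluster_code B) W"
      and eq: "f \<cdot>\<^bsub>set_cat U\<^esub> on_ar H d = g \<cdot>\<^bsub>set_cat U\<^esub> on_ar H e"
    define \<phi> where "\<phi> s = app f (push F d s)" for s
    have \<phi>_g: "\<phi> s = app g (push F e s)" if s: "s \<in> clusters F X" for s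
    proof -
      have "s \<in> U (cluster_code X)" using s ob by (simp add: U_cluster_code)
      then show ?thesis
        using app_cmp[where U = U, OF H_hom[OF dh], of s f] app_cmp[where U = U, OF H_hom[OF h(1)], of s g] H_app[OF dh s] H_app[OF h(1) s] eq
        by (simp add: \<phi>_def)
    qed
    \<comment> \<open>Joining the kernel of \<open>d\<close> is pulling the direct image back along
      \<open>d\<close>, and pushing again returns the same cluster since \<open>d\<close> is in
      \<open>E\<close>.\<close>
    have \<phi>_d: "\<phi> (s \<squnion>\<^bsub>fib F X\<^esub> Ker C F d) = \<phi> s" if s: "s \<in> clusters F X" for s
      unfolding \<phi>_def pull_push[OF dh s, symmetric] push_pull_E[OF d dh push_mem[OF dh s]] ..
    have \<phi>_e: "\<phi> (s \<squnion>\<^bsub>fib F X\<^esub> Ker C F e) = \<phi> s" if s: "s \<in> clusters F X" for s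
      unfolding \<phi>_g[OF s] \<phi>_g[OF join_mem[OF ob(1) s Ker_mem[OF h(1)]]]
      unfolding pull_push[OF h(1) s, symmetric] push_pull_E[OF e h(1) push_mem[OF h(1) s]] ..
    have \<phi>_pd: "\<phi> (pull F (p \<bullet> d) (push F (p \<bullet> d) s)) = \<phi> s" if s: "s \<in> clusters F X" for s
      using pull_push[OF pd s] Ker_pushout[OF po d dh e h(1,2)] join_assoc[OF ob(1) s Ker_mem[OF dh] Ker_mem[OF h(1)]]
        \<phi>_e[OF join_mem[OF ob(1) s Ker_mem[OF dh]]] \<phi>_d[OF s] by simp
    \<comment> \<open>A cluster of the pushout is represented in \<open>X\<close> by its inverse
      image; \<open>\<phi>_pd\<close> makes the value independent of that choice.\<close>
    define k where "k = set_fn U (cluster_code P) (\<lambda>t. \<phi> (pull F (p \<bullet> d) t)) W"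
    have \<phi>_W: "\<phi> s \<in> U W" if s: "s \<in> clusters F X" for s
      unfolding \<phi>_def using app_mem[where U = U, OF f] push_mem[OF dh s] ob by (simp add: U_cluster_code)
    have k: "k \<in> hom (set_cat U) (cluster_code P) W"
      unfolding k_def by (rule set_fn_hom) (use \<phi>_W pull_mem[OF pd] ob in \<open>simp add: U_cluster_code\<close>)
    have k_app: "app k t = \<phi> (pull F (p \<bullet> d) t)" if "t \<in> clusters F P" for t
      using that ob by (simp add: k_def U_cluster_code)
    have kp: "k \<cdot>\<^bsub>set_cat U\<^esub> on_ar H p = f"
    proof (rule set_eqI_app[OF set.cmp_hom[OF H_hom[OF h(2)] k] f])
      fix a assume aU: "a \<in> U (cluster_code A)"
      then have a: "a \<in> clusters F A" using ob by (simp add: U_cluster_code)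
      have s: "pull F d a \<in> clusters F X" "push F d (pull F d a) = a" using pull_mem[OF dh a] push_pull_E[OF d dh a] by auto
      have "app (k \<cdot>\<^bsub>set_cat U\<^esub> on_ar H p) a = \<phi> (pull F (p \<bullet> d) (push F p a))"
        using app_cmp[where U = U, OF H_hom[OF h(2)] aU] H_app[OF h(2) a] k_app[OF push_mem[OF h(2) a]] by simp
      also have "push F p a = push F (p \<bullet> d) (pull F d a)" using push_cmp[OF dh h(2) s(1)] s(2) by simp
      also have "\<phi> (pull F (p \<bullet> d) (push F (p \<bullet> d) (pull F d a))) = app f a" unfolding \<phi>_pd[OF s(1)] by (simp add: \<phi>_def s(2))
      finally show "app (k \<cdot>\<^bsub>set_cat U\<^esub> on_ar H p) a = app f a" .
    qed
    have kq: "k \<cdot>\<^bsub>set_cat U\<^esub> on_ar H q = g"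
    proof (rule set_eqI_app[OF set.cmp_hom[OF H_hom[OF h(3)] k] g])
      fix b assume bU: "b \<in> U (cluster_code B)"
      then have b: "b \<in> clusters F B" using ob by (simp add: U_cluster_code)
      have s: "pull F e b \<in> clusters F X" "push F e (pull F e b) = b" using pull_mem[OF h(1) b] push_pull_E[OF e h(1) b] by auto
      have "app (k \<cdot>\<^bsub>set_cat U\<^esub> on_ar H q) b = \<phi> (pull F (p \<bullet> d) (push F q b))"
        using app_cmp[where U = U, OF H_hom[OF h(3)] bU] H_app[OF h(3) b] k_app[OF push_mem[OF h(3) b]] by simp
      also have "push F q b = push F (p \<bullet> d) (pull F e b)" using push_cmp[OF h(1,3) s(1)] s(2) h(4) by simp
      also have "\<phi> (pull F (p \<bullet> d) (push F (p \<bullet> d) (pull F e b))) = app g b" unfolding \<phi>_pd[OF s(1)] \<phi>_g[OF s(1)] by (simp add: s(2))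
      finally show "app (k \<cdot>\<^bsub>set_cat U\<^esub> on_ar H q) b = app g b" .
    qed
    \<comment> \<open>Surjectivity of the direct image along \<open>p\<close> gives uniqueness of
      \<open>k\<close>.\<close>
    have Hp: "on_ar H p \<in> epi_arrows (set_cat U)" using H_surj[OF p h(2)] by (simp add: epi_set_cat)
    show "\<exists>!k. k \<in> hom (set_cat U) (cluster_code P) W \<and> k \<cdot>\<^bsub>set_cat U\<^esub> on_ar H p = f \<and> k \<cdot>\<^bsub>set_cat U\<^esub> on_ar H q = g"
    proof (rule ex1I[of _ k])
      fix k' assume "k' \<in> hom (set_cat U) (cluster_code P) W \<and> k' \<cdot>\<^bsub>set_cat U\<^esub> on_ar H p = f \<and> k' \<cdot>\<^bsub>set_cat U\<^esub> on_ar H q = g"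
      then show "k' = k" using set.epiD[OF Hp H_hom[OF h(2)] _ k] kp by simp
    qed (use k kp kq in simp)
  qed
qed

lemma H_transfer: "transfer_functor U C E M (set_cat U) (surjections U) (injections U) H"
  unfolding transfer_functor_def
proof (intro conjI setting transfer_setting_set H_functor ballI allI impI)
  show "conservative C (set_cat U) H"
    unfolding conservative_def using H_conservative[OF ar_hom] by blast
  show "on_ar H ` E \<subseteq> surjections U" using H_surj[OF _ ar_hom[OF E_ar]] by blast
  show "on_ar H ` M \<subseteq> injections U" using H_inj[OF _ ar_hom[OF M_ar]] by blast
qed (auto intro: H_pullback H_pushout)

end

section \<open>Composition of transfer functors and universality\<close>

lemma transfer_functor_comp:
  assumes F: "transfer_functor U C E M D E' M' F" and G: "transfer_functor U D E' M' B E'' M'' G"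
  shows "transfer_functor U C E M B E'' M'' (comp_ftr G F)"
proof -
  have f: "is_functor C D F" and g: "is_functor D B G" using F G by (auto simp: transfer_functor_def)
  have FE: "\<And>e. e \<in> E \<Longrightarrow> on_ar F e \<in> E'" and FM: "\<And>e. e \<in> M \<Longrightarrow> on_ar F e \<in> M'"
    using F unfolding transfer_functor_def by blast+
  have "is_functor C B (comp_ftr G F)"
    using f g unfolding is_functor_def comp_ftr_def hom_def by simp
  moreover have "conservative C B (comp_ftr G F)"
    using F G f unfolding transfer_functor_def conservative_def comp_ftr_def is_functor_def hom_def by simp
  ultimately show ?thesis
    using F G FE FM unfolding transfer_functor_def comp_ftr_def by (auto simp: image_subset_iff)
qed

theorem proposition3p38:
  fixes U :: "'u \<Rightarrow> 'u set"
    and T :: "('o, 'm) cat"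
    and one :: 'o
  assumes "grothendieck_universe U"
    and "grothendieck_topos U T"
    and "nondegenerate T"
    and "terminal T one"
  shows "(\<exists>\<Delta> \<iota>. constant_object_functor U T one \<Delta> \<iota>) \<and>
         (\<forall>\<Delta> \<iota>. constant_object_functor U T one \<Delta> \<iota> \<longrightarrow>
            transfer_functor U (set_cat U) (surjections U) (injections U)
              T (epi_arrows T) (mono_arrows T) \<Delta>) \<and>
         universal_target U T (epi_arrows T) (mono_arrows T) TYPE(('c, 'd) cat)"
proof -
  obtain S J el res ap where "sheaf_topos U S J T el res ap"
    using grothendieck_topos_sheaf_topos[OF assms(1,2)] by blast
  then interpret sheaf_topos U S J T el res ap .
  obtain \<Delta> \<iota> where \<Delta>: "constant_object_functor U T one \<Delta> \<iota>"
    using constant_object_functor_exists[OF assms(4)] by blast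
  note transfer = D_transfer[OF assms(4) _ assms(3)]
  have "universal_target U T (epi_arrows T) (mono_arrows T) TYPE(('c, 'd) cat)"
    unfolding universal_target_def
  proof (intro conjI transfer_setting_T allI impI iffI)
    fix C :: "('c, 'd) cat" and E M
    assume setting: "transfer_setting U C E M"
    interpret C: transfer_category C U E M by (rule transfer_category_if_setting[OF setting])
    {
      assume "has_noetherian_form_inducing U C E M"
      then obtain F :: "('c, 'd, 'u) form" where F: "noetherian_form U C F" "quotients C F = E" "embeddings C F = M"
        unfolding has_noetherian_form_inducing_def by blast
      interpret noetherian_category C U E M F by unfold_locales (use F in auto)
      show "\<exists>F. transfer_functor U C E M T (epi_arrows T) (mono_arrows T) F"
        using transfer_functor_comp[OF H_transfer transfer[OF \<Delta>]] by blast
    next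
      assume "\<exists>F. transfer_functor U C E M T (epi_arrows T) (mono_arrows T) F"
      then obtain G where G: "transfer_functor U C E M T (epi_arrows T) (mono_arrows T) G" by blast
      interpret transfer_to_topos U S J T el res ap C E M G by unfold_locales (rule G)
      show "has_noetherian_form_inducing U C E M" by (rule has_form)
    }
  qed
  then show ?thesis using \<Delta> transfer by blast
qed

end
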